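(* Let $n\ge 2$ and $N\ge 1$ be integers, let $\mathbb{B}^n$ be the unit ball in $\mathbb{R}^n$ and $\mathbb{S}^{n-1}=\partial\mathbb{B}^n$. Let $f:\mathbb{S}^{n-1}\to\mathbb{R}^N$ be a homeomorphism onto its image. Then for any $s\in(0,1]$ with $s\ge\frac{n}{n+1}$ there exists no map $u\in W^{s,\frac{n}{s}}(\mathbb{B}^n,\mathbb{R}^N)$ (homeomorphism or not) having both of the following properties: \begin{itemize} \item $\operatorname{rank} Du<n$ in distributional sense in $\mathbb{B}^n$; \item $f=u\big|_{\partial\mathbb{B}^n}$ in the sense of traces. \end{itemize}
   Context: Sobolev spaces: for $s\in(0,1)$ and $p\in(1,\infty)$, $W^{s,p}(\Omega)$ is the fractional Sobolev space of $f\in L^p(\Omega)$ with finite Gagliardo seminorm \[ [f]_{W^{s,p}(\Omega)} := \left(\int_{\Omega} \int_{\Omega} \frac{|f(x)-f(y)|^{p}}{|x-y|^{n+sp}}\, dx\, dy\right)^{\frac{1}{p}}, \] with norm $\|f\|_{W^{s,p}}=\|f\|_{L^p}+[f]_{W^{s,p}}$. For $s=1$, $W^{1,p}$ is the usual first-order Sobolev space. Traces on $\partial\mathbb{B}^n$ are well defined for $W^{s,\frac{n}{s}}(\mathbb{B}^n)$ since $s\cdot\frac{n}{s}=n>1$; the trace operator is the continuous extension of restriction to the boundary. Pullback: for a smooth map $g=(g^1,\ldots,g^N)$ from $\mathbb{B}^n$ to $\mathbb{R}^N$ and $1\le i_1<\ldots<i_n\le N$, \[ g^\ast(dp^{i_1}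 \wedge \ldots \wedge dp^{i_n}) = \sum_{\alpha_1,\ldots,\alpha_n=1}^n\partial_{\alpha_1} g^{i_1}\cdots \partial_{\alpha_n} g^{i_n}\ dx^{\alpha_1} \wedge \ldots \wedge dx^{\alpha_n}=\det(\nabla g^{i_1},\ldots,\nabla g^{i_n})\,dx^1\wedge\ldots\wedge dx^n . \] Distributional rank: let $s\in(0,1]$, $p\in(1,\infty)$. A map $v\in W^{s,p}(\mathbb{B}^n,\mathbb{R}^N)$ satisfies $\operatorname{rank}Dv<n$ in ($W^{s,p}$-)distributional sense if for all $1\le i_1<\ldots<i_n\le N$ one has $v^\ast(dp^{i_1}\wedge\ldots\wedge dp^{i_n})=0$ in distributional sense, meaning: for any $\varphi\in C_c^\infty(\mathbb{B}^n)$ and any $v_\varepsilon\in C^\infty(\overline{\mathbb{B}^n},\mathbb{R}^N)$ with $\|v_\varepsilon-v\|_{W^{s,p}}\to0$ as $\varepsilon\to0$, \[ \lim_{\varepsilon\to0}\int_{\mathbb{B}^n} v_\varepsilon^\ast(dp^{i_1}\wedge\ldots\wedge dp^{i_n})\,\varphi=0 . \] In the theorem this is used with $p=\frac{n}{s}$. *)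

theory Defs
  imports "HOL-Analysis.Analysis"
begin

subsection \<open>Smooth functions\<close>

text \<open>Meant for open sets \<open>U\<close>.\<close>

primrec Ck_on :: "nat \<Rightarrow> 'a::euclidean_space set \<Rightarrow> ('a \<Rightarrow> 'b::real_normed_vector) \<Rightarrow> bool" where
  "Ck_on 0 U f \<longleftrightarrow> continuous_on U f"
| "Ck_on (Suc k) U f \<longleftrightarrow>
     f differentiable_on U \<and> (\<forall>h. Ck_on k U (\<lambda>x. frechet_derivative f (at x) h))"

definition smooth_on :: "'a::euclidean_space set \<Rightarrow> ('a \<Rightarrow> 'b::real_normed_vector) \<Rightarrow> bool" where
  "smooth_on U f \<longleftrightarrow> (\<forall>k. Ck_on k U f)"

text \<open>\<open>C\<^sup>\<infinity>\<close> of the closure of \<^term>\<open>\<Omega>\<close>: smooth on an open neighbourhood of the closure.\<close>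

definition smooth_up_to_boundary ::
    "'a::euclidean_space set \<Rightarrow> ('a \<Rightarrow> 'b::real_normed_vector) \<Rightarrow> bool" where
  "smooth_up_to_boundary \<Omega> f \<longleftrightarrow> (\<exists>U. open U \<and> closure \<Omega> \<subseteq> U \<and> smooth_on U f)"

definition test_function :: "'a::euclidean_space set \<Rightarrow> ('a \<Rightarrow> real) \<Rightarrow> bool" where
  "test_function \<Omega> \<phi> \<longleftrightarrow> smooth_on UNIV \<phi> \<and>
     compact (closure {x. \<phi> x \<noteq> 0}) \<and> closure {x. \<phi> x \<noteq> 0} \<subseteq> \<Omega>"


subsection \<open>Lebesgue spaces\<close>

definition ennroot :: "real \<Rightarrow> ennreal \<Rightarrow> ennreal" where
  "ennroot p t = (if t = \<infinity> then \<infinity> else ennreal (enn2real t powr (1 / p)))"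

definition Lp_norm :: "'a measure \<Rightarrow> real \<Rightarrow> ('a \<Rightarrow> 'b::real_normed_vector) \<Rightarrow> ennreal" where
  "Lp_norm M p f = ennroot p (\<integral>\<^sup>+x. ennreal (norm (f x) powr p) \<partial>M)"

definition Lp_space :: "'a measure \<Rightarrow> real \<Rightarrow> ('a \<Rightarrow> 'b::real_normed_vector) set" where
  "Lp_space M p = {f. f \<in> borel_measurable M \<and> Lp_norm M p f < \<infinity>}"


subsection \<open>Sobolev spaces\<close>

text \<open>Functions stand for their almost-everywhere classes; nothing below depends on the
  representative. On the diagonal \<open>x = y\<close>, a null set, the Gagliardo integrand is \<open>0 / 0 = 0\<close>.\<close>

definition gagliardo_seminorm ::
    "real \<Rightarrow> real \<Rightarrow> 'a::euclidean_space set \<Rightarrow> ('a \<Rightarrow> 'b::real_normed_vector) \<Rightarrow> ennreal" where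
  "gagliardo_seminorm s p \<Omega> f = ennroot p
     (\<integral>\<^sup>+x. (\<integral>\<^sup>+y. ennreal (norm (f x - f y) powr p / norm (x - y) powr (real DIM('a) + s * p))
        \<partial>lebesgue_on \<Omega>) \<partial>lebesgue_on \<Omega>)"

text \<open>\<^term>\<open>G x $ i $ j\<close> is the weak partial derivative in direction \<^term>\<open>j\<close> of the component
  \<^term>\<open>i\<close> of \<^term>\<open>f\<close>.\<close>

definition has_weak_gradient ::
    "(real^'n \<Rightarrow> real^'m) \<Rightarrow> (real^'n \<Rightarrow> real^'n^'m) \<Rightarrow> (real^'n) set \<Rightarrow> bool" where
  "has_weak_gradient f G \<Omega> \<longleftrightarrow>
     (\<forall>K. compact K \<and> K \<subseteq> \<Omega> \<longrightarrow> f absolutely_integrable_on K \<and> G absolutely_integrable_on K) \<and>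
     (\<forall>\<phi>. test_function \<Omega> \<phi> \<longrightarrow> (\<forall>i j.
        (LINT x|lebesgue_on \<Omega>. f x $ i * frechet_derivative \<phi> (at x) (axis j 1)) =
        - (LINT x|lebesgue_on \<Omega>. G x $ i $ j * \<phi> x)))"

text \<open>Weak gradients are unique up to null sets, so the choice made here is immaterial wherever
  a weak gradient exists.\<close>

definition weak_gradient ::
    "(real^'n \<Rightarrow> real^'m) \<Rightarrow> (real^'n) set \<Rightarrow> real^'n \<Rightarrow> real^'n^'m" where
  "weak_gradient f \<Omega> = (SOME G. has_weak_gradient f G \<Omega>)"

text \<open>The space \<open>W\<^sup>s\<^sup>,\<^sup>p(\<Omega>)\<close> and its norm, for \<^prop>\<open>0 < s \<and> s \<le> 1\<close> and \<^prop>\<open>1 < p\<close>. The norm is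
  only meaningful on the space itself.\<close>

definition sobolev_space :: "real \<Rightarrow> real \<Rightarrow> (real^'n) set \<Rightarrow> (real^'n \<Rightarrow> real^'m) set" where
  "sobolev_space s p \<Omega> = {f \<in> Lp_space (lebesgue_on \<Omega>) p.
     if s = 1 then \<exists>G \<in> Lp_space (lebesgue_on \<Omega>) p. has_weak_gradient f G \<Omega>
     else gagliardo_seminorm s p \<Omega> f < \<infinity>}"

definition sobolev_norm ::
    "real \<Rightarrow> real \<Rightarrow> (real^'n) set \<Rightarrow> (real^'n \<Rightarrow> real^'m) \<Rightarrow> ennreal" where
  "sobolev_norm s p \<Omega> f = Lp_norm (lebesgue_on \<Omega>) p f +
     (if s = 1 then Lp_norm (lebesgue_on \<Omega>) p (weak_gradient f \<Omega>) else gagliardo_seminorm s p \<Omega> f)"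


subsection \<open>Traces on the unit sphere\<close>

text \<open>Surface measure on the unit sphere, by polar coordinates: the area of \<open>A\<close> is the dimension
  times the volume of the cone \<open>{r x | 0 < r < 1, x \<in> A}\<close>. Note \<^term>\<open>sgn x = x /\<^sub>R norm x\<close>.\<close>

definition sphere_measure :: "'a::euclidean_space measure" where
  "sphere_measure = scale_measure (of_nat DIM('a))
     (distr (lebesgue_on (ball 0 1 - {0})) (restrict_space borel (sphere 0 1)) sgn)"

text \<open>The trace operator is the continuous extension, from \<open>W\<^sup>s\<^sup>,\<^sup>p\<close> of the ball to \<open>L\<^sup>p\<close> of the
  sphere, of the restriction map on functions smooth up to the boundary: \<^term>\<open>g\<close> is the trace of
  \<^term>\<open>u\<close> if \<^term>\<open>g\<close> is the limit of the restrictions along a smooth approximation of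
  \<^term>\<open>u\<close>.\<close>

definition has_trace ::
    "real \<Rightarrow> real \<Rightarrow> (real^'n \<Rightarrow> real^'m) \<Rightarrow> (real^'n \<Rightarrow> real^'m) \<Rightarrow> bool" where
  "has_trace s p u g \<longleftrightarrow> g \<in> Lp_space sphere_measure p \<and>
     (\<exists>v :: nat \<Rightarrow> real^'n \<Rightarrow> real^'m.
        (\<forall>k. smooth_up_to_boundary (ball 0 1) (v k)) \<and>
        (\<lambda>k. sobolev_norm s p (ball 0 1) (\<lambda>x. v k x - u x)) \<longlonglongrightarrow> 0 \<and>
        (\<lambda>k. Lp_norm sphere_measure p (\<lambda>x. v k x - g x)) \<longlonglongrightarrow> 0)"


subsection \<open>Distributional rank\<close>

text \<open>The coefficient of \<open>dx\<^sup>1 \<and> \<dots> \<and> dx\<^sup>n\<close> in the pullback of \<open>dp\<^sup>i\<^sup>1 \<and> \<dots> \<and> dp\<^sup>i\<^sup>n\<close> under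
  \<^term>\<open>g\<close>: the determinant with rows the gradients of the selected components of \<^term>\<open>g\<close>.\<close>

definition pullback_coeff ::
    "(real^'n \<Rightarrow> real^'m) \<Rightarrow> ('n \<Rightarrow> 'm) \<Rightarrow> real^'n \<Rightarrow> real" where
  "pullback_coeff g i x = det (\<chi> k \<alpha>. frechet_derivative g (at x) (axis \<alpha> 1) $ i k)"

text \<open>The multi-indices \<open>i\<^sub>1 < \<dots> < i\<^sub>n\<close> are the strictly increasing maps between the index types.\<close>

definition distributional_rank_less ::
    "real \<Rightarrow> real \<Rightarrow> (real^'n::{finite,linorder} \<Rightarrow> real^'m::{finite,linorder}) \<Rightarrow> bool" where
  "distributional_rank_less s p u \<longleftrightarrow>
     (\<forall>i :: 'n \<Rightarrow> 'm. strict_mono i \<longrightarrow>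
       (\<forall>\<phi> v.
          test_function (ball 0 1) \<phi> \<and>
          (\<forall>\<epsilon>::real. \<epsilon> > 0 \<longrightarrow> smooth_up_to_boundary (ball 0 1) (v \<epsilon>)) \<and>
          ((\<lambda>\<epsilon>. sobolev_norm s p (ball 0 1) (\<lambda>x. v \<epsilon> x - u x)) \<longlongrightarrow> 0) (at_right 0) \<longrightarrow>
          ((\<lambda>\<epsilon>. LINT x|lebesgue_on (ball 0 1). pullback_coeff (v \<epsilon>) i x * \<phi> x) \<longlongrightarrow> 0)
            (at_right 0)))"

end

theory Submission
  imports Defs
begin

text \<open>
  Write \<open>n\<close> for the dimension of the ball and \<open>p = n / s\<close>, so that \<open>n \<le> p \<le> n + 1\<close>. Suppose that
  \<open>u\<close> is a map as excluded by the theorem, and let \<open>v k\<close> be smooth maps that converge to \<open>u\<close> in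
  \<open>W\<^sup>s\<^sup>,\<^sup>p\<close> and whose restrictions to the sphere converge to \<open>f\<close> in \<open>L\<^sup>p\<close>. For maps continuous up to
  the boundary the theorem would be classical degree theory: if \<open>\<Phi>\<close> is close to a left inverse of
  \<open>f\<close> on the sphere, then \<open>\<Phi> \<circ> u\<close> is close to the identity there, so it has degree one and the
  integral of the pullback under \<open>\<Phi> \<circ> u\<close> of a bump form around the origin is positive; but this
  pullback is a combination of the forms \<open>u\<^sup>* (dp\<^sup>i\<^sup>1 \<and> \<dots> \<and> dp\<^sup>i\<^sup>n)\<close>, which vanish. In the critical
  space \<open>u\<close> need not be continuous, and two difficulties have to be overcome.

  Degree. In place of \<open>v k\<close> its averages \<open>F = avg t (v k)\<close> over balls of radius \<open>t\<close> are used. The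
  critical scaling makes \<open>t \<bar>DF\<bar>\<close> uniformly small and makes \<open>F\<close> uniformly close to \<open>f\<close> on the sphere
  (avg_close_to_trace, proved by telescoping over dyadic scales and averaging over spherical caps).
  Hence \<open>\<Phi> \<circ> F\<close> has the right boundary values, and degree_integral_pos gives a lower bound
  \<open>c0 > 0\<close>, independent of \<open>t\<close> and \<open>k\<close>, for the integral of the pulled back bump form.

  Rank. This integral is a sum of terms \<open>\<integral> \<xi> F\<^sup>* dp\<^sup>g\<close>, where the weight \<open>\<xi> = \<psi> \<circ> F\<close> is again built
  from averages, and \<open>F\<close> has to be replaced by \<open>v k\<close> in the form. Jacobian determinants are null
  Lagrangians (integral_jac_zero): they depend on the map only through its distance to the
  competitor, once a derivative is put on the weight (integral_jac_comparison). Applied to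
  consecutive dyadic scales \<open>r \<le> t\<close>, this costs \<open>\<integral> Q (b / t) (Q / r)\<^sup>n\<^sup>-\<^sup>1\<close>, with \<open>Q\<close> the oscillation of \<open>v k\<close>
  at scale \<open>r\<close> and \<open>b\<close> that at scale \<open>t\<close>. Both are controlled in \<open>L\<^sup>p\<close>, and the sum over the scales
  converges (integral_jac_avg_comparison). The bound carries the factor \<open>\<beta>\<^sup>n\<^sup>+\<^sup>1\<^sup>-\<^sup>p\<close> with \<open>\<beta>\<close> the
  small supremum of \<open>b\<close>: this is where \<open>p \<le> n + 1\<close>, that is \<open>s \<ge> n / (n + 1)\<close>, enters. In the
  borderline case the factor is one, and smallness comes from the oscillations themselves, whose
  \<open>L\<^sup>p\<close> norms tend to zero with the scale when \<open>s < 1\<close>. The weight is fixed once the scale and one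
  index \<open>k0\<close> are fixed, so the rank condition applies to it as \<open>k\<close> tends to infinity: it gives
  \<open>\<integral> \<xi> (v k)\<^sup>* dp\<^sup>g \<longlonglongrightarrow> 0\<close>, first for test functions and then for C1 weights
  (integral_jac_tendsto_0). Together these facts contradict \<open>c0 > 0\<close>; this is
  no_rank_deficient_approximation.

  What is used of the Sobolev norms is collected in \<open>osc_decay\<close>, uniform bounds on the
  oscillation integrals \<open>Osc\<close>. They follow because \<open>v k - v l\<close> has small norm
  for large \<open>k\<close> and \<open>l\<close> while a single \<open>v l\<close> is Lipschitz; for \<open>s < 1\<close> the kernel \<open>\<bar>x - y\<bar>\<^sup>-\<^sup>2\<^sup>n\<close> dominates
  the indicator of \<open>\<bar>x - y\<bar> < 6 t\<close> up to the factor \<open>(6 t)\<^sup>2\<^sup>n\<close>, and for \<open>s = 1\<close> increments are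
  integrated along segments.
\<close>

section \<open>Continuously differentiable functions\<close>

definition C1 :: "('a::euclidean_space \<Rightarrow> 'b::real_normed_vector) \<Rightarrow> bool" where
  "C1 f \<longleftrightarrow> (\<forall>x. f differentiable at x) \<and>
     (\<forall>h. continuous_on UNIV (\<lambda>x. frechet_derivative f (at x) h))"

lemma C1I:
  assumes "\<And>x. (f has_derivative f' x) (at x)" "\<And>h. continuous_on UNIV (\<lambda>x. f' x h)"
  shows "C1 f"
proof -
  have "frechet_derivative f (at x) = f' x" for x
    using frechet_derivative_at[OF assms(1)] by simp
  then show ?thesis
    using assms unfolding C1_def differentiable_def by auto
qed

lemma C1_has_derivative: "C1 f ==> (f has_derivative frechet_derivative f (at x)) (at x)"
  unfolding C1_def by (simp add: frechet_derivative_works[symmetric])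

lemma C1_differentiable: "C1 f ==> f differentiable at x"
  unfolding C1_def by simp

lemma C1_deriv_continuous: "C1 f ==> continuous_on A (\<lambda>x. frechet_derivative f (at x) h)"
  unfolding C1_def by (meson continuous_on_subset subset_UNIV)

lemma C1_continuous: "C1 f ==> continuous_on A f"
  by (meson C1_differentiable differentiable_imp_continuous_on differentiable_on_def
      differentiable_at_withinI)

lemma frechet_derivative_eqI:
  "(f has_derivative f') (at x) ==> frechet_derivative f (at x) = f'"
  using frechet_derivative_at by metis

lemma C1_const: "C1 (\<lambda>x. c)"
  by (rule C1I[where f' = "\<lambda>x h. 0"]) (auto intro!: derivative_eq_intros)

lemma C1_linear: "bounded_linear f ==> C1 f"
  by (rule C1I[where f' = "\<lambda>x. f"]) (auto intro: bounded_linear_imp_has_derivative)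

lemma C1_add: assumes "C1 f" "C1 g" shows "C1 (\<lambda>x. f x + g x)"
  by (rule C1I[where f' = "\<lambda>x h. frechet_derivative f (at x) h + frechet_derivative g (at x) h"])
     (auto intro!: has_derivative_add continuous_on_add C1_has_derivative C1_deriv_continuous assms)

lemma C1_diff: assumes "C1 f" "C1 g" shows "C1 (\<lambda>x. f x - g x)"
  by (rule C1I[where f' = "\<lambda>x h. frechet_derivative f (at x) h - frechet_derivative g (at x) h"])
     (auto intro!: has_derivative_diff continuous_on_diff C1_has_derivative C1_deriv_continuous assms)

lemma C1_scaleR:
  fixes f :: "'a::euclidean_space \<Rightarrow> real"
  assumes "C1 f" "C1 g" shows "C1 (\<lambda>x. f x *\<^sub>R g x)"
  by (rule C1I[where f' = "\<lambda>x h. f x *\<^sub>R frechet_derivative g (at x) h + frechet_derivative f (at x) h *\<^sub>R g x"])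
     (intro has_derivative_scaleR C1_has_derivative assms,
      intro continuous_on_add continuous_on_scaleR C1_deriv_continuous C1_continuous assms)

lemma C1_mult:
  fixes f :: "'a::euclidean_space \<Rightarrow> real"
  assumes "C1 f" "C1 g" shows "C1 (\<lambda>x. f x * g x)"
  using C1_scaleR[OF assms] by simp

lemma C1_prod:
  fixes f :: "'i \<Rightarrow> 'a::euclidean_space \<Rightarrow> real"
  assumes "\<And>i. i \<in> I ==> C1 (f i)" shows "C1 (\<lambda>x. \<Prod>i\<in>I. f i x)"
  using assms by (induction I rule: infinite_finite_induct) (auto intro: C1_const C1_mult)

lemma C1_compose:
  fixes f :: "'a::euclidean_space \<Rightarrow> 'b::euclidean_space" and g :: "'b \<Rightarrow> 'c::real_normed_vector"
  assumes "C1 f" "C1 g" shows "C1 (\<lambda>x. g (f x))"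
proof (rule C1I)
  let ?D = "\<lambda>x. frechet_derivative g (at (f x)) \<circ> frechet_derivative f (at x)"
  show "((\<lambda>x. g (f x)) has_derivative ?D x) (at x)" for x
    using diff_chain_at[OF C1_has_derivative[OF assms(1)] C1_has_derivative[OF assms(2)]]
    by (simp add: comp_def)
  fix h
  have "?D x h = (\<Sum>b\<in>Basis. (frechet_derivative f (at x) h \<bullet> b) *\<^sub>R frechet_derivative g (at (f x)) b)" for x
  proof -
    interpret bounded_linear "frechet_derivative g (at (f x))"
      using C1_has_derivative[OF assms(2)] has_derivative_bounded_linear by blast
    show ?thesis
      unfolding comp_def
      by (subst euclidean_representation[symmetric, of "frechet_derivative f (at x) h"])
         (simp only: sum scaleR)
  qed
  moreover have "continuous_on UNIV (\<lambda>x. \<Sum>b\<in>Basis. (frechet_derivative f (at x) h \<bullet> b) *\<^sub>R frechet_derivative g (at (f x)) b)"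
  proof (intro continuous_on_sum continuous_on_scaleR continuous_on_inner continuous_on_const
      C1_deriv_continuous[OF assms(1)])
    show "continuous_on UNIV (\<lambda>x. frechet_derivative g (at (f x)) b)" for b
      by (rule continuous_on_compose2[OF C1_deriv_continuous[OF assms(2), of UNIV] C1_continuous[OF assms(1)]]) auto
  qed
  ultimately show "continuous_on UNIV (\<lambda>x. ?D x h)" by simp
qed

lemma C1_component: "C1 (f :: 'a::euclidean_space \<Rightarrow> real^'m) ==> C1 (\<lambda>x. f x $ i)"
  by (rule C1_compose[of f "\<lambda>y. y $ i"]) (auto intro: C1_linear bounded_linear_vec_nth)

text \<open>In this form the differential depends continuously on the point as an operator, which
  differentiation under the integral sign asks for.\<close>

lemma C1_blinfun:
  fixes f :: "'a::euclidean_space \<Rightarrow> 'b::real_normed_vector"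
  assumes "C1 f"
  shows "continuous_on UNIV (\<lambda>x. Blinfun (frechet_derivative f (at x)))"
    and "blinfun_apply (Blinfun (frechet_derivative f (at x))) = frechet_derivative f (at x)"
proof -
  show *: "blinfun_apply (Blinfun (frechet_derivative f (at x))) = frechet_derivative f (at x)" for x
    by (rule bounded_linear_Blinfun_apply) (use C1_has_derivative[OF assms] has_derivative_bounded_linear in blast)
  show "continuous_on UNIV (\<lambda>x. Blinfun (frechet_derivative f (at x)))"
    by (rule continuous_on_blinfun_componentwise) (simp add: * C1_deriv_continuous[OF assms])
qed


subsection \<open>Partial derivatives\<close>

abbreviation pd :: "'n \<Rightarrow> (real^'n \<Rightarrow> 'b::real_normed_vector) \<Rightarrow> real^'n \<Rightarrow> 'b" where
  "pd \<alpha> f x \<equiv> frechet_derivative f (at x) (axis \<alpha> 1)"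

lemma pd_eqI: "(f has_derivative f') (at x) ==> pd \<alpha> f x = f' (axis \<alpha> 1)"
  by (simp add: frechet_derivative_eqI)

lemma pd_cong_open:
  assumes "open S" "x \<in> S" "\<And>y. y \<in> S ==> f y = g y"
  shows "frechet_derivative f (at x) = frechet_derivative g (at x)"
proof -
  have "(f has_derivative D) (at x) \<longleftrightarrow> (g has_derivative D) (at x)" for D
    using assms has_derivative_transform_within_open[of f D x UNIV S g]
      has_derivative_transform_within_open[of g D x UNIV S f] by auto
  then show ?thesis unfolding frechet_derivative_def by simp
qed

lemma pd_mult:
  fixes f g :: "real^'n \<Rightarrow> real"
  assumes "C1 f" "C1 g"
  shows "pd \<alpha> (\<lambda>x. f x * g x) x = f x * pd \<alpha> g x + pd \<alpha> f x * g x"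
  by (rule pd_eqI[OF has_derivative_mult[OF C1_has_derivative C1_has_derivative]]) (use assms in auto)

lemma pd_diff:
  assumes "C1 f" "C1 g"
  shows "pd \<alpha> (\<lambda>x. f x - g x) x = pd \<alpha> f x - pd \<alpha> g x"
  by (rule pd_eqI[OF has_derivative_diff[OF C1_has_derivative C1_has_derivative]]) (use assms in auto)

lemma pd_component:
  assumes "C1 (f :: real^'n \<Rightarrow> real^'m)"
  shows "pd \<alpha> (\<lambda>x. f x $ i) x = pd \<alpha> f x $ i"
  by (rule pd_eqI[OF bounded_linear.has_derivative[OF bounded_linear_vec_nth C1_has_derivative[OF assms]]])

lemma frechet_derivative_expand:
  assumes "C1 (f :: real^'n \<Rightarrow> 'b::real_normed_vector)"
  shows "frechet_derivative f (at x) h = (\<Sum>\<alpha>\<in>UNIV. h $ \<alpha> *\<^sub>R pd \<alpha> f x)"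
proof -
  interpret bounded_linear "frechet_derivative f (at x)"
    using C1_has_derivative[OF assms] has_derivative_bounded_linear by blast
  have "h = (\<Sum>\<alpha>\<in>UNIV. h $ \<alpha> *\<^sub>R axis \<alpha> 1)"
    by (simp add: vec_eq_iff axis_def if_distrib cong: if_cong)
  then have "frechet_derivative f (at x) h = frechet_derivative f (at x) (\<Sum>\<alpha>\<in>UNIV. h $ \<alpha> *\<^sub>R axis \<alpha> 1)" by simp
  then show ?thesis by (simp only: sum scaleR)
qed

lemma pd_compose:
  fixes f :: "real^'n \<Rightarrow> real^'m" and g :: "real^'m \<Rightarrow> 'c::real_normed_vector"
  assumes "C1 f" "C1 g"
  shows "pd \<alpha> (\<lambda>x. g (f x)) x = (\<Sum>i\<in>UNIV. pd \<alpha> f x $ i *\<^sub>R pd i g (f x))"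
proof -
  have "((\<lambda>x. g (f x)) has_derivative frechet_derivative g (at (f x)) \<circ> frechet_derivative f (at x)) (at x)"
    using diff_chain_at[OF C1_has_derivative[OF assms(1)] C1_has_derivative[OF assms(2)]]
    by (simp add: comp_def)
  from pd_eqI[OF this, of \<alpha>] show ?thesis
    by (simp add: frechet_derivative_expand[OF assms(2), of "f x" "pd \<alpha> f x"])
qed

lemma pd_compose_real:
  fixes f :: "real^'n \<Rightarrow> real"
  assumes "C1 f" "(g has_real_derivative d) (at (f x))"
  shows "pd \<alpha> (\<lambda>x. g (f x)) x = d * pd \<alpha> f x"
  by (rule pd_eqI[OF has_derivative_compose[OF C1_has_derivative[OF assms(1)]
        assms(2)[unfolded has_field_derivative_def]]])

lemma pd_eq_0:
  assumes "open S" "x \<in> S" "\<And>y. y \<in> S ==> f y = (c::'b::real_normed_vector)"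
  shows "pd \<alpha> f x = 0"
  using pd_cong_open[OF assms(1,2), of f "\<lambda>y. c"] assms(3) by (auto simp: frechet_derivative_const)

lemma C1_real:
  assumes "\<And>t. (g has_real_derivative g' t) (at t)" "continuous_on UNIV g'"
  shows "C1 (g :: real \<Rightarrow> real)"
proof (rule C1I[where f' = "\<lambda>x h. g' x * h"])
  show "(g has_derivative (*) (g' x)) (at x)" for x
    using assms(1)[of x] by (simp add: has_field_derivative_def)
qed (intro continuous_intros assms)


subsection \<open>One-dimensional step and bump functions\<close>

lemma has_real_derivative_max_power:
  assumes "n \<ge> 1"
  shows "((\<lambda>s::real. (max 0 s) ^ Suc n) has_real_derivative real (Suc n) * (max 0 t) ^ n) (at t)"
proof -
  consider "t < 0" | "t > 0" | "t = 0" by linarith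
  then show ?thesis
  proof cases
    case 1
    then have "((\<lambda>s::real. (max 0 s) ^ Suc n) has_real_derivative 0) (at t)"
      by (intro has_field_derivative_transform_within_open[OF DERIV_const[of "0::real"], where S = "{..<0}"]) auto
    with 1 assms show ?thesis by (simp add: max_def power_0_left)
  next
    case 2
    have "((\<lambda>s::real. s ^ Suc n) has_real_derivative real (Suc n) * t ^ n) (at t)"
      using DERIV_pow[of "Suc n" t UNIV] by simp
    then have "((\<lambda>s::real. (max 0 s) ^ Suc n) has_real_derivative real (Suc n) * t ^ n) (at t)"
      by (rule has_field_derivative_transform_within_open[where S = "{0<..}"]) (use 2 in auto)
    with 2 show ?thesis by (simp add: max_def)
  next
    case 3
    have "((\<lambda>h. (max 0 h) ^ n) \<longlongrightarrow> (max 0 0)^n) (at (0::real))"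
      by (intro tendsto_intros)
    then have l: "((\<lambda>h. (max 0 h) ^ n) \<longlongrightarrow> 0) (at (0::real))"
      using assms by (simp add: power_0_left)
    have "((\<lambda>h. ((max 0 (0+h)) ^ Suc n - (max 0 0) ^ Suc n) / h) \<longlongrightarrow> 0) (at (0::real))"
      by (rule Lim_null_comparison[OF _ l]) (auto simp: eventually_at max_def intro!: exI[of _ 1])
    with 3 assms show ?thesis by (simp add: has_field_derivative_iff power_0_left)
  qed
qed

text \<open>The quotient of cubes below is a C2 step from 0 to 1, so its derivative is a C1 bump.\<close>

lemma step_bump_exists:
  assumes "0 < (a::real)"
  obtains Y \<eta> \<eta>' :: "real \<Rightarrow> real" where
    "\<And>t. (Y has_real_derivative \<eta> t) (at t)" "\<And>t. (\<eta> has_real_derivative \<eta>' t) (at t)"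
    "continuous_on UNIV \<eta>'" "\<And>t. \<eta> t \<ge> 0" "\<eta> 0 > 0" "\<And>t. \<bar>t\<bar> \<ge> a ==> \<eta> t = 0"
    "\<And>t. t \<le> -a ==> Y t = 0" "\<And>t. t \<ge> a ==> Y t = 1" "\<And>t. 0 \<le> Y t" "\<And>t. Y t \<le> 1"
proof -
  define p where "p k t = (max 0 (t + a)) ^ k" for k and t :: real
  define q where "q k t = (max 0 (a - t)) ^ k" for k and t :: real
  have dp: "(p (Suc n) has_real_derivative real (Suc n) * p n t) (at t)" if "n \<ge> 1" for n t
    unfolding p_def
    by (rule DERIV_cong[OF DERIV_chain2[where f = "\<lambda>s. (max 0 s) ^ Suc n" and g = "\<lambda>t. t + a" and Db = 1,
            OF has_real_derivative_max_power[OF that]]])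
       (auto intro!: derivative_eq_intros)
  have dq: "(q (Suc n) has_real_derivative - real (Suc n) * q n t) (at t)" if "n \<ge> 1" for n t
    unfolding q_def
    by (rule DERIV_cong[OF DERIV_chain2[where f = "\<lambda>s. (max 0 s) ^ Suc n" and g = "\<lambda>t. a - t" and Db = "-1",
            OF has_real_derivative_max_power[OF that]]])
       (auto intro!: derivative_eq_intros simp: algebra_simps)
  have p3: "(p 3 has_real_derivative 3 * p 2 t) (at t)" for t
    using dp[of 2 t] by (simp add: numeral_3_eq_3 numeral_2_eq_2)
  have p2: "(p 2 has_real_derivative 2 * p 1 t) (at t)" for t
    using dp[of 1 t] by (simp add: numeral_2_eq_2)
  have q3: "(q 3 has_real_derivative - 3 * q 2 t) (at t)" for t
    using dq[of 2 t] by (simp add: numeral_3_eq_3 numeral_2_eq_2)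
  have q2: "(q 2 has_real_derivative - 2 * q 1 t) (at t)" for t
    using dq[of 1 t] by (simp add: numeral_2_eq_2)
  define N where "N t = p 3 t + q 3 t" for t
  have N0: "N t > 0" for t
  proof -
    have "p 3 t \<ge> 0" "q 3 t \<ge> 0" by (auto simp: p_def q_def)
    moreover have "p 3 t > 0 \<or> q 3 t > 0"
      using assms by (cases "t \<ge> 0") (auto simp: p_def q_def)
    ultimately show ?thesis unfolding N_def by linarith
  qed
  have N0': "N t \<noteq> 0" for t using N0[of t] by simp
  define D where "D t = 3 * (p 2 t * q 3 t + p 3 t * q 2 t)" for t
  define D' where "D' t = 3 * (p 2 t * (- 3 * q 2 t) + 2 * p 1 t * q 3 t
      + (p 3 t * (- 2 * q 1 t) + 3 * p 2 t * q 2 t))" for t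
  define N' where "N' t = 3 * p 2 t - 3 * q 2 t" for t
  have dN: "(N has_real_derivative N' t) (at t)" for t
    unfolding N_def N'_def by (auto intro!: derivative_eq_intros p3 q3)
  have dD: "(D has_real_derivative D' t) (at t)" for t
    unfolding D_def D'_def by (rule derivative_eq_intros p3 p2 q3 q2 refl)+ (simp add: algebra_simps)
  show thesis
  proof (rule that[where Y = "\<lambda>t. p 3 t / N t" and \<eta> = "\<lambda>t. D t / (N t)^2"
        and \<eta>' = "\<lambda>t. (D' t * (N t)^2 - D t * (2 * N t * N' t)) / ((N t)^2)^2"])
    show "((\<lambda>t. p 3 t / N t) has_real_derivative D t / (N t)^2) (at t)" for t
      by (rule DERIV_cong[OF DERIV_divide[OF p3 dN N0']])
         (simp add: D_def N_def N'_def power2_eq_square algebra_simps)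
    have "((\<lambda>t. (N t)^2) has_real_derivative 2 * N t * N' t) (at t)" for t
      by (rule derivative_eq_intros dN refl)+ simp
    then show "((\<lambda>t. D t / (N t)^2) has_real_derivative
        (D' t * (N t)^2 - D t * (2 * N t * N' t)) / ((N t)^2)^2) (at t)" for t
      by (rule DERIV_cong[OF DERIV_divide[OF dD]]) (simp_all add: N0' power2_eq_square)
    have c: "continuous_on UNIV (p k)" "continuous_on UNIV (q k)" for k
      unfolding p_def q_def by (intro continuous_intros)+
    have c': "continuous_on UNIV N" "continuous_on UNIV D" "continuous_on UNIV D'" "continuous_on UNIV N'"
      unfolding N_def[abs_def] D_def[abs_def] D'_def[abs_def] N'_def[abs_def] by (intro continuous_intros c)+
    show "continuous_on UNIV (\<lambda>t. (D' t * (N t)^2 - D t * (2 * N t * N' t)) / ((N t)^2)^2)"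
      by (intro continuous_intros c') (simp add: N0')
    show "D t / (N t)^2 \<ge> 0" for t
      unfolding D_def by (intro divide_nonneg_nonneg) (auto simp: p_def q_def)
    show "D 0 / (N 0)^2 > 0"
      using assms N0[of 0] unfolding D_def by (intro divide_pos_pos) (auto simp: p_def q_def add_pos_pos)
    show "D t / (N t)^2 = 0" if "\<bar>t\<bar> \<ge> a" for t
      using that assms by (cases "t \<ge> 0") (auto simp: D_def p_def q_def)
    show "p 3 t / N t = 0" if "t \<le> -a" for t using that by (auto simp: p_def)
    show "p 3 t / N t = 1" if "t \<ge> a" for t
    proof -
      have "q 3 t = 0" using that by (auto simp: q_def)
      then show ?thesis using N0'[of t] by (simp add: N_def)
    qed
    show "0 \<le> p 3 t / N t" "p 3 t / N t \<le> 1" for t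
      using N0[of t] by (auto simp: N_def p_def q_def divide_simps)
  qed
qed

lemma cutoff_exists:
  assumes "0 \<le> r" "r < R"
  obtains \<phi> :: "'a::euclidean_space \<Rightarrow> real" where "C1 \<phi>" "\<And>x. 0 \<le> \<phi> x" "\<And>x. \<phi> x \<le> 1"
    "\<And>x. norm x \<le> r ==> \<phi> x = 1" "\<And>x. norm x \<ge> R ==> \<phi> x = 0"
proof -
  define a where "a = (R\<^sup>2 - r\<^sup>2) / 2"
  have "r\<^sup>2 < R\<^sup>2" using assms by (intro power_strict_mono) auto
  then have "a > 0" by (simp add: a_def)
  then obtain Y \<eta> \<eta>' :: "real \<Rightarrow> real" where Y:
    "\<And>t. (Y has_real_derivative \<eta> t) (at t)" "\<And>t. (\<eta> has_real_derivative \<eta>' t) (at t)"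
    "\<And>t. t \<le> -a ==> Y t = 0" "\<And>t. t \<ge> a ==> Y t = 1" "\<And>t. 0 \<le> Y t" "\<And>t. Y t \<le> 1"
    using step_bump_exists[of a] by metis
  have "continuous_on UNIV \<eta>"
    using Y(2) by (meson DERIV_continuous continuous_at_imp_continuous_on)
  then have "C1 Y" using C1_real Y(1) by blast
  moreover have "C1 (\<lambda>x::'a. (R\<^sup>2 + r\<^sup>2) / 2 - x \<bullet> x)"
    by (rule C1I[where f' = "\<lambda>x h. - (2 * (x \<bullet> h))"])
       (auto intro!: derivative_eq_intros continuous_intros simp: inner_commute)
  ultimately have "C1 (\<lambda>x::'a. Y ((R\<^sup>2 + r\<^sup>2) / 2 - x \<bullet> x))" by (rule C1_compose[rotated])
  moreover have "Y ((R\<^sup>2 + r\<^sup>2) / 2 - x \<bullet> x) = 1" if "norm x \<le> r" for x :: 'a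
  proof -
    have "x \<bullet> x \<le> r\<^sup>2" using that by (simp add: dot_square_norm power_mono)
    then show ?thesis by (intro Y) (simp add: a_def field_simps)
  qed
  moreover have "Y ((R\<^sup>2 + r\<^sup>2) / 2 - x \<bullet> x) = 0" if "norm x \<ge> R" for x :: 'a
  proof -
    have "x \<bullet> x \<ge> R\<^sup>2" using that assms by (simp add: dot_square_norm power_mono)
    then show ?thesis by (intro Y) (simp add: a_def field_simps)
  qed
  ultimately show thesis using Y that[of "\<lambda>x. Y ((R\<^sup>2 + r\<^sup>2) / 2 - x \<bullet> x)"] by blast
qed

section \<open>Smooth bump functions and mollification\<close>

lemma Ck_Suc_C1:
  assumes "Ck_on (Suc k) UNIV f" shows "C1 f"
proof -
  have "continuous_on UNIV g" if "Ck_on j UNIV g" for j and g :: "'a \<Rightarrow> 'b"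
    using that by (cases j) (auto intro: differentiable_imp_continuous_on)
  then show ?thesis
    using assms by (auto simp: C1_def differentiable_on_def)
qed

lemma Ck_add:
  assumes "Ck_on k UNIV f" "Ck_on k UNIV g" shows "Ck_on k UNIV (\<lambda>x. f x + g x)"
  using assms
proof (induction k arbitrary: f g)
  case 0 then show ?case by (auto intro: continuous_on_add)
next
  case (Suc k)
  note C = C1_has_derivative[OF Ck_Suc_C1[OF Suc.prems(1)]] C1_has_derivative[OF Ck_Suc_C1[OF Suc.prems(2)]]
  have "frechet_derivative (\<lambda>x. f x + g x) (at x) h
      = frechet_derivative f (at x) h + frechet_derivative g (at x) h" for x h
    by (subst frechet_derivative_eqI[OF has_derivative_add[OF C]]) simp
  with Suc show ?case by (auto intro: differentiable_on_add)
qed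

text \<open>The functions \<open>t\<^sup>-\<^sup>m exp (-1/t)\<close>, extended by zero, are closed under differentiation up to
  linear combinations.\<close>

definition flat_exp :: "nat \<Rightarrow> real \<Rightarrow> real" where
  "flat_exp m t = (if t > 0 then exp (- (1 / t)) / t ^ m else 0)"

lemma flat_exp_tendsto_0: "(flat_exp m \<longlongrightarrow> 0) (at 0)"
proof -
  have "((\<lambda>t::real. inverse t ^ m / exp (inverse t)) \<longlongrightarrow> 0) (at_right 0)"
    using filterlim_compose[OF tendsto_power_div_exp_0 filterlim_inverse_at_top_right] .
  then have "(flat_exp m \<longlongrightarrow> 0) (at_right 0)"
    by (rule Lim_transform_eventually)
       (auto simp: eventually_at_filter flat_exp_def exp_minus field_simps)
  moreover have "(flat_exp m \<longlongrightarrow> 0) (at_left 0)"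
    by (rule Lim_transform_eventually[of "\<lambda>_. 0"])
       (auto simp: eventually_at_filter flat_exp_def)
  ultimately show ?thesis by (simp add: filterlim_at_split)
qed

lemma flat_exp_deriv:
  "(flat_exp m has_real_derivative flat_exp (m + 2) t - real m * flat_exp (Suc m) t) (at t)"
proof -
  consider "t < 0" | "t > 0" | "t = 0" by linarith
  then show ?thesis
  proof cases
    case 1
    then have "(flat_exp m has_real_derivative 0) (at t)"
      by (intro has_field_derivative_transform_within_open[OF DERIV_const[of "0::real"], where S = "{..<0}"])
         (auto simp: flat_exp_def)
    with 1 show ?thesis by (simp add: flat_exp_def)
  next
    case 2
    have "((\<lambda>t. exp (- (1 / t)) / t ^ m) has_real_derivative flat_exp (m + 2) t - real m * flat_exp (Suc m) t) (at t)"
    proof (cases m)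
      case 0
      with 2 show ?thesis
        by (auto intro!: derivative_eq_intros simp: flat_exp_def power2_eq_square)
    next
      case (Suc j)
      have "((\<lambda>t. exp (- (1 / t)) / t ^ m) has_real_derivative
          (exp (- (1 / t)) * (1 / t^2) * t ^ m - exp (- (1 / t)) * (real m * t ^ j)) / (t ^ m * t ^ m)) (at t)"
        using 2 DERIV_pow[of m t UNIV]
        by (intro DERIV_divide) (auto intro!: derivative_eq_intros simp: Suc power2_eq_square)
      with 2 show ?thesis
        by (auto elim!: DERIV_cong simp: Suc flat_exp_def field_simps power2_eq_square)
    qed
    then show ?thesis
      by (rule has_field_derivative_transform_within_open[where S = "{0<..}"])
         (use 2 in \<open>auto simp: flat_exp_def\<close>)
  next
    case 3
    have "((\<lambda>h. (flat_exp m (0 + h) - flat_exp m 0) / h) \<longlongrightarrow> 0) (at 0)"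
      by (rule Lim_transform_eventually[OF flat_exp_tendsto_0[of "Suc m"]])
         (auto simp: eventually_at_filter flat_exp_def)
    with 3 show ?thesis by (simp add: has_field_derivative_iff flat_exp_def)
  qed
qed

lemma real_polynomial_function_derivative:
  fixes p :: "'a::euclidean_space \<Rightarrow> real"
  assumes "real_polynomial_function p"
  shows "\<exists>p'. (\<forall>x. (p has_derivative p' x) (at x)) \<and> (\<forall>h. real_polynomial_function (\<lambda>x. p' x h))"
  using assms
proof (induction p rule: real_polynomial_function.induct)
  case (linear f)
  then show ?case
    by (intro exI[of _ "\<lambda>x. f"]) (auto intro: bounded_linear_imp_has_derivative real_polynomial_function.intros(2))
next
  case (const c)
  then show ?case
    by (intro exI[of _ "\<lambda>x h. 0"]) (auto intro: real_polynomial_function.intros(2))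
next
  case (add f g)
  then obtain f' g' where *: "\<forall>x. (f has_derivative f' x) (at x)" "\<forall>h. real_polynomial_function (\<lambda>x. f' x h)"
    "\<forall>x. (g has_derivative g' x) (at x)" "\<forall>h. real_polynomial_function (\<lambda>x. g' x h)" by blast
  then show ?case
    by (intro exI[of _ "\<lambda>x h. f' x h + g' x h"])
       (auto intro!: has_derivative_add real_polynomial_function.intros(3))
next
  case (mult f g)
  then obtain f' g' where *: "\<forall>x. (f has_derivative f' x) (at x)" "\<forall>h. real_polynomial_function (\<lambda>x. f' x h)"
    "\<forall>x. (g has_derivative g' x) (at x)" "\<forall>h. real_polynomial_function (\<lambda>x. g' x h)" by blast
  with mult show ?case
    by (intro exI[of _ "\<lambda>x h. f x * g' x h + f' x h * g x"])
       (auto intro!: has_derivative_mult real_polynomial_function.intros(3,4))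
qed

text \<open>The class of these products is closed under differentiation, so one induction on the order
  gives smoothness. For \<open>p = 1\<close> it is the standard bump; general \<open>p\<close> lets polynomial
  approximations be cut off smoothly.\<close>

lemma smooth_polynomial_bump:
  fixes p :: "'a::euclidean_space \<Rightarrow> real"
  assumes "real_polynomial_function p"
  shows "smooth_on UNIV (\<lambda>x. p x * flat_exp m (c - x \<bullet> x))"
proof -
  have d: "((\<lambda>x. flat_exp m (c - x \<bullet> x)) has_derivative
      (\<lambda>h. (flat_exp (m + 2) (c - x \<bullet> x) - real m * flat_exp (Suc m) (c - x \<bullet> x)) * (- 2 * (x \<bullet> h)))) (at x)"
    for x :: 'a and m
  proof -
    have "((\<lambda>x. c - x \<bullet> x) has_derivative (\<lambda>h. - 2 * (x \<bullet> h))) (at x)"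
      by (auto intro!: derivative_eq_intros simp: inner_commute)
    from has_derivative_compose[OF this flat_exp_deriv[unfolded has_field_derivative_def]] show ?thesis .
  qed
  have "Ck_on k UNIV (\<lambda>x. p x * flat_exp m (c - x \<bullet> x))" if "real_polynomial_function p"
    for k m and p :: "'a \<Rightarrow> real"
    using that
  proof (induction k arbitrary: p m)
    case 0
    have "continuous_on UNIV (\<lambda>x::'a. flat_exp m (c - x \<bullet> x))"
      by (intro continuous_at_imp_continuous_on ballI has_derivative_continuous[OF d])
    moreover have "continuous_on UNIV p"
      by (intro continuous_at_imp_continuous_on ballI continuous_real_polymonial_function 0)
    ultimately show ?case by (simp add: continuous_on_mult)
  next
    case (Suc k)
    obtain p' where p': "\<And>x. (p has_derivative p' x) (at x)" "\<And>h. real_polynomial_function (\<lambda>x. p' x h)"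
      using real_polynomial_function_derivative[OF Suc.prems] by blast
    define D where "D x h = p x * ((flat_exp (m + 2) (c - x \<bullet> x) - real m * flat_exp (Suc m) (c - x \<bullet> x)) * (- 2 * (x \<bullet> h)))
       + p' x h * flat_exp m (c - x \<bullet> x)" for x h
    have D: "((\<lambda>x. p x * flat_exp m (c - x \<bullet> x)) has_derivative D x) (at x)" for x
      unfolding D_def by (rule has_derivative_mult[OF p'(1) d])
    have D': "D x h = (p x * (- 2 * (x \<bullet> h))) * flat_exp (m + 2) (c - x \<bullet> x)
       + ((p x * (2 * real m * (x \<bullet> h))) * flat_exp (Suc m) (c - x \<bullet> x) + p' x h * flat_exp m (c - x \<bullet> x))" for x h
      unfolding D_def by (simp add: algebra_simps)
    have lin: "real_polynomial_function (\<lambda>x. x \<bullet> h)" for h :: 'a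
      by (intro real_polynomial_function.intros(1) bounded_linear_inner_left)
    have "Ck_on k UNIV (\<lambda>x. D x h)" for h
      unfolding D' by (intro Ck_add Suc.IH real_polynomial_function.intros Suc.prems lin p')
    then show ?case
      using D by (auto simp: frechet_derivative_eqI[OF D] differentiable_on_def differentiable_def
          intro: has_derivative_at_withinI)
  qed
  then show ?thesis using assms by (simp add: smooth_on_def)
qed


subsection \<open>Integrals of compactly supported continuous functions\<close>

lemma integrable_lborel_compact_support:
  fixes f :: "'a::euclidean_space \<Rightarrow> 'b::euclidean_space"
  assumes "continuous_on UNIV f" "\<And>x. norm x > R ==> f x = 0"
  shows "integrable lborel f"
proof -
  have "integrable lborel (\<lambda>x. indicator (cball 0 R) x *\<^sub>R f x)"
    by (intro borel_integrable_compact continuous_on_subset[OF assms(1)]) auto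
  also have "(\<lambda>x. indicator (cball 0 R) x *\<^sub>R f x) = f"
    using assms(2) by (auto simp: indicator_def fun_eq_iff not_le)
  finally show ?thesis .
qed

lemma lborel_integral_eq_cbox:
  fixes f :: "'a::euclidean_space \<Rightarrow> 'b::euclidean_space"
  assumes "continuous_on UNIV f" "\<And>x. norm x > R ==> f x = 0" "cball 0 R \<subseteq> cbox a b"
  shows "(LINT x|lborel. f x) = integral (cbox a b) f"
proof -
  have "(LINT x|lborel. f x) = integral UNIV f"
    using integral_lborel[OF integrable_lborel_compact_support[OF assms(1,2)]] by simp
  also have "\<dots> = integral UNIV (\<lambda>x. if x \<in> cbox a b then f x else 0)"
    using assms(2,3) by (intro arg_cong[where f = "integral UNIV"]) (force simp: not_le fun_eq_iff)
  also have "\<dots> = integral (cbox a b) f" by (rule integral_restrict_UNIV)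
  finally show ?thesis .
qed

lemma lborel_integral_affine:
  fixes f :: "'a::euclidean_space \<Rightarrow> 'b::euclidean_space"
  assumes "c \<noteq> 0" "f \<in> borel_measurable borel"
  shows "(LINT x|lborel. f x) = \<bar>c\<bar> ^ DIM('a) *\<^sub>R (LINT x|lborel. f (t + c *\<^sub>R x))"
  using assms by (subst lborel_affine[OF assms(1), of t]) (simp add: integral_density integral_distr)

lemma nn_integral_affine:
  fixes f :: "'a::euclidean_space \<Rightarrow> ennreal"
  assumes "c \<noteq> 0" "f \<in> borel_measurable borel"
  shows "(\<integral>\<^sup>+x. f x \<partial>lborel) = ennreal (\<bar>c\<bar> ^ DIM('a)) * (\<integral>\<^sup>+x. f (t + c *\<^sub>R x) \<partial>lborel)"
  using assms by (subst lborel_affine[OF assms(1), of t])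
    (simp add: nn_integral_density nn_integral_distr nn_integral_cmult)

text \<open>Both the averages of a function at a fixed scale and convolutions have this form.\<close>

lemma averaging_continuous:
  fixes w :: "'a::euclidean_space \<Rightarrow> real" and g :: "'a \<Rightarrow> 'b::euclidean_space"
  assumes w: "continuous_on UNIV w" "\<forall>z. norm z > R --> w z = 0" and g: "continuous_on UNIV g"
  shows "continuous_on UNIV (\<lambda>x. LINT z|lborel. w z *\<^sub>R g (a *\<^sub>R x + b *\<^sub>R z))"
proof -
  obtain c where c: "cball 0 R \<subseteq> cbox (-c) (c::'a)"
    using bounded_subset_cbox_symmetric[OF bounded_cball] by blast
  have "(LINT z|lborel. w z *\<^sub>R g (a *\<^sub>R x + b *\<^sub>R z)) = integral (cbox (-c) c) (\<lambda>z. w z *\<^sub>R g (a *\<^sub>R x + b *\<^sub>R z))" for x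
    by (rule lborel_integral_eq_cbox[OF _ _ c])
       (use w(2) in \<open>auto intro!: continuous_intros w(1) continuous_on_compose2[OF g]\<close>)
  moreover have "continuous_on UNIV (\<lambda>x. integral (cbox (-c) c) (\<lambda>z. w z *\<^sub>R g (a *\<^sub>R x + b *\<^sub>R z)))"
    by (rule integral_continuous_on_param)
       (auto simp: split_beta intro!: continuous_intros continuous_on_compose2[OF g] continuous_on_compose2[OF w(1)])
  ultimately show ?thesis by simp
qed

lemma averaging_has_derivative:
  fixes w :: "'a::euclidean_space \<Rightarrow> real" and g :: "'a \<Rightarrow> 'b::euclidean_space"
  assumes w: "continuous_on UNIV w" "\<forall>z. norm z > R --> w z = 0" and g: "C1 g"
  shows "((\<lambda>x. LINT z|lborel. w z *\<^sub>R g (a *\<^sub>R x + b *\<^sub>R z)) has_derivative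
     (\<lambda>h. LINT z|lborel. w z *\<^sub>R (a *\<^sub>R frechet_derivative g (at (a *\<^sub>R x + b *\<^sub>R z)) h))) (at x)"
proof -
  note [continuous_intros] = continuous_on_compose2[OF C1_continuous[OF g, of UNIV]]
    continuous_on_compose2[OF w(1)] continuous_on_compose2[OF C1_blinfun(1)[OF g]]
    continuous_on_compose2[OF C1_deriv_continuous[OF g, of UNIV]]
  obtain c where c: "cball 0 R \<subseteq> cbox (-c) (c::'a)"
    using bounded_subset_cbox_symmetric[OF bounded_cball] by blast
  have 1: "(LINT z|lborel. w z *\<^sub>R g (a *\<^sub>R x + b *\<^sub>R z)) = integral (cbox (-c) c) (\<lambda>z. w z *\<^sub>R g (a *\<^sub>R x + b *\<^sub>R z))" for x
    by (rule lborel_integral_eq_cbox[OF _ _ c]) (use w(2) in \<open>auto intro!: continuous_intros\<close>)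
  have 2: "(LINT z|lborel. w z *\<^sub>R (a *\<^sub>R frechet_derivative g (at (a *\<^sub>R x + b *\<^sub>R z)) h))
     = integral (cbox (-c) c) (\<lambda>z. w z *\<^sub>R (a *\<^sub>R frechet_derivative g (at (a *\<^sub>R x + b *\<^sub>R z)) h))" for h
    by (rule lborel_integral_eq_cbox[OF _ _ c]) (use w(2) in \<open>auto intro!: continuous_intros\<close>)
  define fx where "fx x z = (w z * a) *\<^sub>R Blinfun (frechet_derivative g (at (a *\<^sub>R x + b *\<^sub>R z)))" for x z
  have fx: "blinfun_apply (fx x z) = (\<lambda>h. w z *\<^sub>R (a *\<^sub>R frechet_derivative g (at (a *\<^sub>R x + b *\<^sub>R z)) h))" for x z
    by (auto simp: fx_def scaleR_blinfun.rep_eq C1_blinfun(2)[OF g])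
  have cfx: "continuous_on (UNIV \<times> cbox (-c) c) (\<lambda>(x, z). fx x z)"
    unfolding fx_def by (auto simp: split_beta intro!: continuous_intros)
  have "((\<lambda>x. integral (cbox (-c) c) (\<lambda>z. w z *\<^sub>R g (a *\<^sub>R x + b *\<^sub>R z))) has_derivative integral (cbox (-c) c) (fx x)) (at x within UNIV)"
  proof (rule leibniz_rule[OF _ _ cfx])
    fix x z :: 'a
    have "((\<lambda>x. a *\<^sub>R x + b *\<^sub>R z) has_derivative (\<lambda>h. a *\<^sub>R h)) (at x)"
      by (auto intro!: derivative_eq_intros)
    from has_derivative_compose[OF this C1_has_derivative[OF g, of "a *\<^sub>R x + b *\<^sub>R z"]]
    have "((\<lambda>x. g (a *\<^sub>R x + b *\<^sub>R z)) has_derivative (\<lambda>h. frechet_derivative g (at (a *\<^sub>R x + b *\<^sub>R z)) (a *\<^sub>R h))) (at x)" .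
    moreover have "bounded_linear (frechet_derivative g (at y))" for y
      using C1_has_derivative[OF g] has_derivative_bounded_linear by blast
    then have "frechet_derivative g (at y) (a *\<^sub>R h) = a *\<^sub>R frechet_derivative g (at y) h" for y h
      by (simp add: linear_cmul bounded_linear.linear)
    ultimately show "((\<lambda>x. w z *\<^sub>R g (a *\<^sub>R x + b *\<^sub>R z)) has_derivative blinfun_apply (fx x z)) (at x within UNIV)"
      unfolding fx by (auto intro!: derivative_eq_intros)
  next
    show "(\<lambda>z. w z *\<^sub>R g (a *\<^sub>R x + b *\<^sub>R z)) integrable_on cbox (-c) c" for x
      by (intro integrable_continuous continuous_intros) auto
  qed auto
  moreover have "integral (cbox (-c) c) (fx x) h = integral (cbox (-c) c) (\<lambda>z. fx x z h)" for h
  proof (rule integral_linear[OF _ blinfun.bounded_linear_left[of h], unfolded o_def, symmetric])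
    show "fx x integrable_on cbox (-c) c"
      by (rule integrable_continuous) (use continuous_on_compose2[OF cfx, of "cbox (-c) c" "\<lambda>z. (x, z)"] in \<open>auto simp: continuous_on_Pair\<close>)
  qed
  ultimately have "((\<lambda>x. integral (cbox (-c) c) (\<lambda>z. w z *\<^sub>R g (a *\<^sub>R x + b *\<^sub>R z))) has_derivative (\<lambda>h. integral (cbox (-c) c) (\<lambda>z. fx x z h))) (at x)"
    by (auto elim!: has_derivative_eq_rhs)
  then show ?thesis unfolding 1 2 fx .
qed

lemma averaging_C1:
  fixes w :: "'a::euclidean_space \<Rightarrow> real" and g :: "'a \<Rightarrow> 'b::euclidean_space"
  assumes w: "continuous_on UNIV w" "\<forall>z. norm z > R --> w z = 0" and g: "C1 g"
  shows "C1 (\<lambda>x. LINT z|lborel. w z *\<^sub>R g (a *\<^sub>R x + b *\<^sub>R z))"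
proof (rule C1I[OF averaging_has_derivative[OF assms]])
  show "continuous_on UNIV (\<lambda>x. LINT z|lborel. w z *\<^sub>R (a *\<^sub>R frechet_derivative g (at (a *\<^sub>R x + b *\<^sub>R z)) h))" for h
    by (rule averaging_continuous[OF w, where g = "\<lambda>x. a *\<^sub>R frechet_derivative g (at x) h"])
       (auto intro!: continuous_on_scaleR C1_deriv_continuous[OF g])
qed

lemma averaging_Ck:
  fixes w :: "'a::euclidean_space \<Rightarrow> real" and g :: "'a \<Rightarrow> 'b::euclidean_space"
  assumes w: "continuous_on UNIV w" "\<forall>z. norm z > R --> w z = 0" and g: "Ck_on k UNIV g"
  shows "Ck_on k UNIV (\<lambda>x. LINT z|lborel. w z *\<^sub>R g (x + b *\<^sub>R z))"
  using g
proof (induction k arbitrary: g)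
  case 0 then show ?case using averaging_continuous[OF w, where g = g and a = 1 and b = b] by simp
next
  case (Suc k)
  note d = averaging_has_derivative[OF w Ck_Suc_C1[OF Suc.prems], where a = 1 and b = b, unfolded scaleR_one]
  from Suc have "Ck_on k UNIV (\<lambda>x. LINT z|lborel. w z *\<^sub>R frechet_derivative g (at (x + b *\<^sub>R z)) h)" for h
    by (intro Suc.IH) auto
  moreover have "(\<lambda>x. LINT z|lborel. w z *\<^sub>R g (x + b *\<^sub>R z)) differentiable_on UNIV"
    unfolding differentiable_on_def differentiable_def using d has_derivative_at_withinI by blast
  ultimately show ?case by (simp add: frechet_derivative_eqI[OF d])
qed

lemma integral_pos_continuous:
  fixes f :: "'a::euclidean_space \<Rightarrow> real"
  assumes f: "continuous_on UNIV f" "integrable lborel f" "\<And>x. f x \<ge> 0" "f a > 0"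
  shows "(LINT x|lborel. f x) > 0"
proof -
  have "open {x. f x > f a / 2}" by (intro open_Collect_less continuous_on_const f(1))
  moreover have "a \<in> {x. f x > f a / 2}" using f(4) by simp
  ultimately obtain d where d: "d > 0" "ball a d \<subseteq> {x. f x > f a / 2}"
    using open_contains_ball by blast
  have "0 < f a / 2 * measure lborel (ball a d)"
    using f(4) d(1) content_ball_pos[of d a] by simp
  also have "\<dots> = (LINT x|lborel. f a / 2 * indicator (ball a d) x)" by simp
  also have "\<dots> \<le> (LINT x|lborel. f x)"
  proof (rule integral_mono[OF _ f(2)])
    show "integrable lborel (\<lambda>x. f a / 2 * indicator (ball a d) x)"
      using emeasure_lborel_ball_finite[of a d] by (intro integrable_mult_right integrable_real_indicator) auto
    show "f a / 2 * indicator (ball a d) x \<le> f x" for x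
      using d(2) f(3)[of x] by (auto simp: indicator_def subset_iff simp del: mem_ball intro: less_imp_le)
  qed
  finally show ?thesis .
qed

lemma mollifier_exists:
  assumes "d > 0"
  obtains \<rho> :: "'a::euclidean_space \<Rightarrow> real" where "smooth_on UNIV \<rho>" "\<And>x. \<rho> x \<ge> 0"
    "\<And>x. norm x \<ge> d ==> \<rho> x = 0" "(LINT x|lborel. \<rho> x) = 1"
proof -
  define b where "b x = flat_exp 0 (d\<^sup>2 - x \<bullet> x)" for x :: 'a
  have sm: "smooth_on UNIV (\<lambda>x. c * b x)" for c
    unfolding b_def by (rule smooth_polynomial_bump) (rule real_polynomial_function.intros(2))
  have b0: "b x \<ge> 0" for x by (simp add: b_def flat_exp_def)
  have bs: "b x = 0" if "norm x \<ge> d" for x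
  proof -
    have "d\<^sup>2 \<le> x \<bullet> x" using that assms by (simp add: dot_square_norm power_mono)
    then show ?thesis by (simp add: b_def flat_exp_def)
  qed
  have cb: "continuous_on UNIV b"
    using sm[of 1] C1_continuous[OF Ck_Suc_C1[of 0 b]] by (simp add: smooth_on_def del: Ck_on.simps)
  define I where "I = (LINT x|lborel. b x)"
  have "I > 0" unfolding I_def
    by (rule integral_pos_continuous[OF cb integrable_lborel_compact_support[OF cb, of d], of 0])
       (use assms in \<open>auto simp: b0 bs, auto simp: b_def flat_exp_def\<close>)
  then show thesis
    by (intro that[OF sm[of "1 / I"]]) (auto simp: b0 bs I_def)
qed

lemma averaging_close:
  fixes g :: "'a::euclidean_space \<Rightarrow> real"
  assumes g: "continuous_on UNIV g" "\<And>x. norm x \<ge> R ==> g x = 0" and "e > 0"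
  obtains d where "d > 0" "\<And>w x. continuous_on UNIV w ==> (\<And>z. w z \<ge> 0) ==> (\<And>z. norm z \<ge> d ==> w z = 0) ==>
    (LINT z|lborel. w z) = 1 ==> \<bar>(LINT z|lborel. w z * g (x - z)) - g x\<bar> \<le> e"
proof -
  have "uniformly_continuous_on (cball 0 (R + 2)) g"
    by (intro compact_uniformly_continuous continuous_on_subset[OF g(1)]) auto
  then obtain d where d: "d > 0" "\<And>x y. x \<in> cball 0 (R + 2) ==> y \<in> cball 0 (R + 2) ==> dist y x < d ==> dist (g y) (g x) < e"
    unfolding uniformly_continuous_on_def using \<open>e > 0\<close> by metis
  have close: "\<bar>g (x - z) - g x\<bar> \<le> e" if "norm z < min d 1" for x z
  proof (cases "norm x \<le> R + 1")
    case True
    then have "norm (x - z) \<le> R + 2" using norm_triangle_ineq4[of x z] that by simp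
    then have "dist (x - z) x < d" "x - z \<in> cball 0 (R + 2)" "x \<in> cball 0 (R + 2)"
      using True that by (auto simp: dist_norm norm_minus_commute[of z x])
    then have "dist (g (x - z)) (g x) < e" by (intro d(2))
    then show ?thesis by (simp add: dist_norm)
  next
    case False
    then have "norm (x - z) \<ge> R" using norm_triangle_ineq2[of x z] that by linarith
    then show ?thesis using False g(2) \<open>e > 0\<close> by simp
  qed
  show thesis
  proof (rule that)
    show "min d 1 > 0" using d(1) by simp
    fix w :: "'a \<Rightarrow> real" and x
    assume w: "continuous_on UNIV w" "\<And>z. w z \<ge> 0" "\<And>z. norm z \<ge> min d 1 ==> w z = 0" "(LINT z|lborel. w z) = 1"
    have iw: "integrable lborel w"
      by (rule integrable_lborel_compact_support[OF w(1), of "min d 1"]) (use w(3) in auto)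
    have ig: "integrable lborel (\<lambda>z. w z * g (x - z))"
      by (rule integrable_lborel_compact_support[of _ "min d 1"])
         (use w(3) in \<open>auto intro!: continuous_intros w(1) continuous_on_compose2[OF g(1)]\<close>)
    have "(LINT z|lborel. w z * g (x - z)) - g x = (LINT z|lborel. w z * (g (x - z) - g x))"
      using w(4) iw ig by (simp add: algebra_simps)
    also have "\<bar>\<dots>\<bar> \<le> (LINT z|lborel. w z * e)"
    proof -
      have "\<bar>LINT z|lborel. w z * (g (x - z) - g x)\<bar> \<le> (LINT z|lborel. \<bar>w z * (g (x - z) - g x)\<bar>)"
        by (rule integral_abs_bound)
      also have "\<dots> \<le> (LINT z|lborel. w z * e)"
      proof (rule integral_mono)
        show "integrable lborel (\<lambda>z. \<bar>w z * (g (x - z) - g x)\<bar>)"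
          using iw ig by (auto simp: algebra_simps)
        show "integrable lborel (\<lambda>z. w z * e)" using iw by simp
        show "\<bar>w z * (g (x - z) - g x)\<bar> \<le> w z * e" for z
          using close[of z x] w(2)[of z] w(3)[of z]
          by (cases "norm z < min d 1") (auto simp: abs_mult intro: mult_left_mono)
      qed
      finally show ?thesis .
    qed
    finally show "\<bar>(LINT z|lborel. w z * g (x - z)) - g x\<bar> \<le> e" using w(4) by simp
  qed
qed

text \<open>Closeness of the partial derivatives comes for free: convolution commutes with them. The
  explicit support radius keeps mollified weights compactly supported in the open ball.\<close>

lemma mollification_exists:
  fixes \<xi> :: "real^'n \<Rightarrow> real"
  assumes \<xi>: "continuous_on UNIV \<xi>" "\<And>x. norm x \<ge> R ==> \<xi> x = 0" and e: "e > 0"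
  obtains \<phi> where "smooth_on UNIV \<phi>" "\<And>x. norm x \<ge> R + e ==> \<phi> x = 0" "\<And>x. \<bar>\<phi> x - \<xi> x\<bar> \<le> e"
    "\<And>\<alpha> x. C1 \<xi> ==> \<bar>pd \<alpha> \<phi> x - pd \<alpha> \<xi> x\<bar> \<le> e"
proof -
  define P where "P d g \<longleftrightarrow> (\<forall>w x. continuous_on UNIV w --> (\<forall>z. w z \<ge> 0) --> (\<forall>z. norm z \<ge> d --> w z = 0) -->
    (LINT z|lborel. w z) = 1 --> \<bar>(LINT z|lborel. w z * g (x - z)) - g x\<bar> \<le> e)" for d and g :: "real^'n \<Rightarrow> real"
  have Pex: "\<exists>d>0. P d g" if g: "continuous_on UNIV g" "\<And>x. norm x \<ge> r ==> g x = 0" for g r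
  proof -
    obtain d where "d > 0" "\<And>w x. continuous_on UNIV w ==> (\<And>z. w z \<ge> 0) ==> (\<And>z. norm z \<ge> d ==> w z = 0) ==>
        (LINT z|lborel. w z) = 1 ==> \<bar>(LINT z|lborel. w z * g (x - z)) - g x\<bar> \<le> e"
      using averaging_close[where g = g and R = r, OF g e] by blast
    then show ?thesis unfolding P_def by (intro exI[of _ d]) simp
  qed
  have Pmono: "P d g" if "P d' g" "d \<le> d'" for d d' g
    using that unfolding P_def by (auto intro: order_trans)
  obtain d0 where d0: "d0 > 0" "P d0 \<xi>" using Pex[OF \<xi>] by blast
  have "\<exists>d. d > 0 \<and> (C1 \<xi> --> P d (pd \<alpha> \<xi>))" for \<alpha>
  proof (cases "C1 \<xi>")
    case True
    have "pd \<alpha> \<xi> x = 0" if "norm x \<ge> R + 1" for x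
      by (rule pd_eq_0[of "- cball 0 R"]) (use that \<xi>(2) in auto)
    then show ?thesis using Pex[OF C1_deriv_continuous[OF True]] by blast
  qed (auto intro: exI[of _ 1])
  then obtain d1 where d1: "\<And>\<alpha>. d1 \<alpha> > 0" "\<And>\<alpha>. C1 \<xi> ==> P (d1 \<alpha>) (pd \<alpha> \<xi>)" by metis
  define d where "d = min e (min d0 (Min (range d1)))"
  have d: "d > 0" "d \<le> e" "d \<le> d0" "\<And>\<alpha>. d \<le> d1 \<alpha>"
    using d0 d1 e by (auto simp: d_def min.coboundedI2)
  obtain \<rho> :: "real^'n \<Rightarrow> real" where \<rho>: "smooth_on UNIV \<rho>" "\<And>x. \<rho> x \<ge> 0"
    "\<And>x. norm x \<ge> d ==> \<rho> x = 0" "(LINT x|lborel. \<rho> x) = 1" using mollifier_exists[OF d(1)] by metis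
  have C\<rho>: "C1 \<rho>" using \<rho>(1) Ck_Suc_C1[of 0 \<rho>] by (simp add: smooth_on_def del: Ck_on.simps)
  note c\<rho> = C1_continuous[OF C\<rho>, of UNIV]
  have s\<rho>: "\<forall>z. norm z > d --> \<rho> z = 0" using \<rho>(3) by auto
  have s\<xi>: "\<forall>z. norm z > R --> \<xi> z = 0" using \<xi>(2) by auto
  define \<phi> where "\<phi> x = (LINT z|lborel. \<xi> z *\<^sub>R \<rho> (x + (-1) *\<^sub>R z))" for x
  have eq: "\<phi> = (\<lambda>x. LINT z|lborel. \<rho> z *\<^sub>R \<xi> (1 *\<^sub>R x + (-1) *\<^sub>R z))"
  proof
    fix x
    have "(\<lambda>z. \<xi> z *\<^sub>R \<rho> (x + (-1) *\<^sub>R z)) \<in> borel_measurable borel"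
      by (intro borel_measurable_continuous_onI) (auto intro!: continuous_intros \<xi>(1) continuous_on_compose2[OF c\<rho>])
    from lborel_integral_affine[OF _ this, of "-1" x]
    show "\<phi> x = (LINT z|lborel. \<rho> z *\<^sub>R \<xi> (1 *\<^sub>R x + (-1) *\<^sub>R z))" by (simp add: \<phi>_def mult.commute)
  qed
  show thesis
  proof (rule that[of \<phi>])
    show "smooth_on UNIV \<phi>"
      unfolding smooth_on_def \<phi>_def[abs_def] using \<rho>(1)
      by (intro allI averaging_Ck[OF \<xi>(1) s\<xi>]) (simp add: smooth_on_def)
    show "\<phi> x = 0" if x: "norm x \<ge> R + e" for x
    proof -
      have "\<xi> z *\<^sub>R \<rho> (x + (-1) *\<^sub>R z) = 0" for z
      proof (cases "norm z \<ge> R")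
        case False
        then have "norm (x - z) \<ge> d" using norm_triangle_ineq2[of x z] x d(2) by linarith
        then show ?thesis using \<rho>(3) by simp
      qed (simp add: \<xi>(2))
      then show ?thesis unfolding \<phi>_def by (simp only: integral_zero)
    qed
    show "\<bar>\<phi> x - \<xi> x\<bar> \<le> e" for x
      using Pmono[OF d0(2) d(3)] c\<rho> \<rho> unfolding P_def eq by simp
    show "\<bar>pd \<alpha> \<phi> x - pd \<alpha> \<xi> x\<bar> \<le> e" if "C1 \<xi>" for \<alpha> x
    proof -
      have "pd \<alpha> \<phi> x = (LINT z|lborel. \<rho> z * pd \<alpha> \<xi> (x - z))"
        unfolding eq by (subst pd_eqI[OF averaging_has_derivative[OF c\<rho> s\<rho> that]]) auto
      then show ?thesis using Pmono[OF d1(2)[OF that] d(4)] c\<rho> \<rho> unfolding P_def by simp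
    qed
  qed
qed

section \<open>Jacobian determinants\<close>

definition jac :: "('n \<Rightarrow> real^'n \<Rightarrow> real) \<Rightarrow> real^'n \<Rightarrow> real" where
  "jac a x = det (\<chi> k \<alpha>. pd \<alpha> (a k) x)"

lemma jac_alt: "jac a x = (\<Sum>p | p permutes UNIV. of_int (sign p) * (\<Prod>k\<in>UNIV. pd (p k) (a k) x))"
  by (simp add: jac_def det_def)

lemma jac_continuous:
  assumes "\<And>k. C1 (a k)" shows "continuous_on A (jac a)"
  unfolding jac_alt[abs_def]
  by (intro continuous_on_sum continuous_on_mult continuous_on_const continuous_on_prod C1_deriv_continuous assms)

lemma jac_bound:
  fixes a :: "'n::finite \<Rightarrow> real^'n \<Rightarrow> real"
  assumes "\<And>k \<alpha>. \<bar>pd \<alpha> (a k) x\<bar> \<le> d k"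
  shows "\<bar>jac a x\<bar> \<le> fact CARD('n) * (\<Prod>k\<in>UNIV. d k)"
proof -
  have "\<bar>jac a x\<bar> \<le> (\<Sum>p | p permutes (UNIV :: 'n set). \<Prod>k\<in>UNIV. d k)"
    unfolding jac_alt
  proof (rule order_trans[OF sum_abs sum_mono])
    fix p :: "'n \<Rightarrow> 'n"
    have "\<bar>of_int (sign p) * (\<Prod>k\<in>UNIV. pd (p k) (a k) x)\<bar> = (\<Prod>k\<in>UNIV. \<bar>pd (p k) (a k) x\<bar>)"
      by (simp add: abs_mult abs_prod sign_def)
    also have "\<dots> \<le> (\<Prod>k\<in>UNIV. d k)" by (intro prod_mono) (simp add: assms)
    finally show "\<bar>of_int (sign p) * (\<Prod>k\<in>UNIV. pd (p k) (a k) x)\<bar> \<le> (\<Prod>k\<in>UNIV. d k)" .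
  qed
  then show ?thesis by (simp add: card_permutations)
qed

lemma jac_cong:
  assumes "\<And>k \<alpha>. pd \<alpha> (a k) x = pd \<alpha> (b k) x" shows "jac a x = jac b x"
  using assms by (simp add: jac_def)

lemma jac_zero_row:
  assumes "\<And>\<alpha>. pd \<alpha> (a k) x = 0" shows "jac a x = 0"
  unfolding jac_def by (rule det_zero_row[of k]) (simp add: row_def assms vec_eq_iff)

text \<open>Only the gradient of the replaced function enters, so the determinant is linear in it.\<close>

lemma jac_upd:
  "jac (c(k := f)) x = det (\<chi> i. if i = k then (\<chi> \<alpha>. pd \<alpha> f x) else (\<chi> \<alpha>. pd \<alpha> (c i) x))"
  unfolding jac_def by (rule arg_cong[where f = det]) (auto simp: vec_eq_iff)

lemma jac_upd_linear:
  assumes "\<And>\<alpha>. pd \<alpha> f x = s * pd \<alpha> g x + t * pd \<alpha> h x"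
  shows "jac (c(k := f)) x = s * jac (c(k := g)) x + t * jac (c(k := h)) x"
proof -
  have "(\<chi> \<alpha>. pd \<alpha> f x) = s *s (\<chi> \<alpha>. pd \<alpha> g x) + t *s (\<chi> \<alpha>. pd \<alpha> h x)"
    by (simp add: vec_eq_iff assms)
  then show ?thesis
    using det_row_add[of k "\<lambda>_. s *s (\<chi> \<alpha>. pd \<alpha> g x)" "\<lambda>_. t *s (\<chi> \<alpha>. pd \<alpha> h x)" "\<lambda>i. (\<chi> \<alpha>. pd \<alpha> (c i) x)"]
      det_row_mul[of k s "\<lambda>_. (\<chi> \<alpha>. pd \<alpha> g x)" "\<lambda>i. (\<chi> \<alpha>. pd \<alpha> (c i) x)"]
      det_row_mul[of k t "\<lambda>_. (\<chi> \<alpha>. pd \<alpha> h x)" "\<lambda>i. (\<chi> \<alpha>. pd \<alpha> (c i) x)"]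
    unfolding jac_upd by (simp only:)
qed

lemma jac_upd_diff:
  assumes "C1 f" "C1 g"
  shows "jac (c(k := \<lambda>x. f x - g x)) x = jac (c(k := f)) x - jac (c(k := g)) x"
  using jac_upd_linear[of "\<lambda>x. f x - g x" x 1 f "-1" g c k] by (simp add: pd_diff assms)

lemma jac_upd_mult:
  assumes "C1 f" "C1 g"
  shows "jac (c(k := \<lambda>x. f x * g x)) x = f x * jac (c(k := g)) x + g x * jac (c(k := f)) x"
  by (rule jac_upd_linear) (simp add: pd_mult assms)

text \<open>A row of the determinant that is a combination of the others makes it vanish. This disposes
  of the derivatives of the remaining factors when a product is used as an entry.\<close>

lemma jac_upd_dependent:
  assumes "\<And>\<alpha>. pd \<alpha> f x = (\<Sum>l\<in>L. w l * pd \<alpha> (c l) x)" "k \<notin> L" "finite L"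
  shows "jac (c(k := f)) x = 0"
proof -
  have "(\<chi> \<alpha>. pd \<alpha> f x) = (\<Sum>l\<in>L. w l *s (\<chi> \<alpha>. pd \<alpha> (c l) x))"
    by (simp add: vec_eq_iff assms(1))
  then have "jac (c(k := f)) x = (\<Sum>l\<in>L. w l * jac (c(k := c l)) x)"
    using det_linear_row_sum[OF assms(3), of k "\<lambda>_ l. w l *s (\<chi> \<alpha>. pd \<alpha> (c l) x)" "\<lambda>i. (\<chi> \<alpha>. pd \<alpha> (c i) x)"]
      det_row_mul[of k "w l" "\<lambda>_. (\<chi> \<alpha>. pd \<alpha> (c l) x)" "\<lambda>i. (\<chi> \<alpha>. pd \<alpha> (c i) x)" for l]
    unfolding jac_upd by (simp only:)
  also have "\<dots> = 0"
  proof (rule sum.neutral, intro ballI)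
    fix l assume "l \<in> L"
    then have "l \<noteq> k" using assms(2) by auto
    have "jac (c(k := c l)) x = 0"
      unfolding jac_def by (rule det_identical_rows[OF \<open>l \<noteq> k\<close>]) (use \<open>l \<noteq> k\<close> in \<open>simp add: row_def\<close>)
    then show "w l * jac (c(k := c l)) x = 0" by simp
  qed
  finally show ?thesis .
qed


subsection \<open>Integration by parts\<close>

lemma integral_pd_compact_support:
  fixes g :: "real^'n \<Rightarrow> real"
  assumes g: "C1 g" and s: "\<forall>x. norm x > R --> g x = 0"
  shows "(LINT x|lborel. pd \<alpha> g x) = 0"
proof -
  define r where "r = max R 0"
  have sr: "g x = 0" if "norm x > r" for x using s that by (simp add: r_def)
  obtain w :: "real^'n \<Rightarrow> real" where w: "C1 w" "\<And>x. norm x \<le> r + 1 ==> w x = 1" "\<And>x. norm x \<ge> r + 2 ==> w x = 0"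
  proof (rule cutoff_exists[of "r + 1" "r + 2"])
    show "0 \<le> r + 1" by (simp add: r_def)
  qed auto
  have ws: "\<forall>z. norm z > r + 2 --> w z = 0" using w(3) by auto
  \<comment> \<open>For small translations the cutoff is invisible and the integral does not change.\<close>
  have tr: "(LINT z|lborel. w z *\<^sub>R g (1 *\<^sub>R h + 1 *\<^sub>R z)) = (LINT z|lborel. g z)" if "norm h < 1" for h
  proof -
    have "w z * g (h + z) = g (h + z)" for z
    proof (cases "norm z \<le> r + 1")
      case False
      then have "norm (h + z) > r" using norm_triangle_ineq2[of z "-h"] that by (simp add: add.commute)
      then show ?thesis by (simp add: sr)
    qed (simp add: w)
    moreover have "g \<in> borel_measurable borel"
      by (intro borel_measurable_continuous_onI C1_continuous g)
    then have "(LINT z|lborel. g z) = (LINT z|lborel. g (h + z))"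
      using lborel_integral_affine[of 1 g h] by simp
    ultimately show ?thesis by (simp only: real_scaleR_def scaleR_one)
  qed
  note d = averaging_has_derivative[OF C1_continuous[OF w(1)] ws g, of 1 1 0]
  have "((\<lambda>h. LINT z|lborel. w z *\<^sub>R g (1 *\<^sub>R h + 1 *\<^sub>R z)) has_derivative (\<lambda>h. 0)) (at 0)"
    by (rule has_derivative_transform_within_open[OF has_derivative_const[of "LINT z|lborel. g z"], where s = "ball 0 1"])
       (auto simp: tr simp del: scaleR_one real_scaleR_def)
  from has_derivative_unique[OF this d]
  have "(LINT z|lborel. w z *\<^sub>R (1 *\<^sub>R frechet_derivative g (at (1 *\<^sub>R 0 + 1 *\<^sub>R z)) (axis \<alpha> 1))) = 0"
    by metis
  moreover have "w z * pd \<alpha> g z = pd \<alpha> g z" for z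
  proof (cases "norm z \<le> r + 1")
    case False
    then have "pd \<alpha> g z = 0" by (intro pd_eq_0[of "- cball 0 r"]) (auto simp: sr)
    then show ?thesis by simp
  qed (simp add: w)
  ultimately show ?thesis by simp
qed

text \<open>Symmetry of second derivatives: both sides of
  \<open>\<integral>\<^sub>0\<^sup>s \<partial>\<^sub>\<alpha> g (y + \<tau> e\<^sub>\<alpha>) d\<tau> = g (y + s e\<^sub>\<alpha>) - g y\<close> are differentiated in \<open>y\<close>, then in \<open>s\<close>.\<close>

lemma pd_commute:
  fixes g :: "real^'n \<Rightarrow> real"
  assumes g: "C1 g" and g2: "\<And>\<alpha>. C1 (pd \<alpha> g)"
  shows "pd \<alpha> (pd \<beta> g) x = pd \<beta> (pd \<alpha> g) x"
proof -
  let ?e = "axis \<alpha> 1 :: real^'n"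
  have line: "((\<lambda>s. f (y + s *\<^sub>R ?e)) has_real_derivative pd \<alpha> f (y + s *\<^sub>R ?e)) (at s within S)"
    if "C1 f" for f :: "real^'n \<Rightarrow> real" and y s S
  proof -
    have "((\<lambda>s. y + s *\<^sub>R ?e) has_derivative (\<lambda>h. h *\<^sub>R ?e)) (at s)"
      by (auto intro!: derivative_eq_intros)
    from has_derivative_compose[OF this C1_has_derivative[OF that, of "y + s *\<^sub>R ?e"]]
    have "((\<lambda>s. f (y + s *\<^sub>R ?e)) has_derivative (\<lambda>h. frechet_derivative f (at (y + s *\<^sub>R ?e)) (h *\<^sub>R ?e))) (at s)" .
    moreover have "frechet_derivative f (at (y + s *\<^sub>R ?e)) (h *\<^sub>R ?e) = pd \<alpha> f (y + s *\<^sub>R ?e) * h" for h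
      using linear_cmul[OF bounded_linear.linear[OF has_derivative_bounded_linear[OF C1_has_derivative[OF that]]]]
      by simp
    ultimately show ?thesis
      by (simp add: has_field_derivative_def has_derivative_at_withinI mult_commute_abs)
  qed
  let ?q = "\<lambda>\<tau>. pd \<beta> (pd \<alpha> g) (x + \<tau> *\<^sub>R ?e)"
  note ci = continuous_on_compose2[OF C1_continuous[OF g2, of UNIV]]
    continuous_on_compose2[OF C1_blinfun(1)[OF g2]] continuous_on_compose2[OF C1_deriv_continuous[OF g2, of UNIV]]
  have step: "pd \<beta> g (x + s *\<^sub>R ?e) - pd \<beta> g x = integral {0..s} ?q" if "0 \<le> s" for s
  proof -
    have 1: "integral (cbox 0 s) (\<lambda>\<tau>. pd \<alpha> g (y + \<tau> *\<^sub>R ?e)) = g (y + s *\<^sub>R ?e) - g y" for y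
    proof -
      have "((\<lambda>\<tau>. pd \<alpha> g (y + \<tau> *\<^sub>R ?e)) has_integral (g (y + s *\<^sub>R ?e) - g (y + 0 *\<^sub>R ?e))) {0..s}"
        by (rule fundamental_theorem_of_calculus[OF that])
           (use line[OF g, of y] in \<open>simp add: has_real_derivative_iff_has_vector_derivative\<close>)
      then show ?thesis by (simp add: integral_unique)
    qed
    let ?F = "\<lambda>y \<tau>. Blinfun (frechet_derivative (pd \<alpha> g) (at (y + \<tau> *\<^sub>R ?e)))"
    have cF: "continuous_on (UNIV \<times> cbox 0 s) (\<lambda>(y, \<tau>). ?F y \<tau>)"
      by (auto simp: split_beta intro!: ci continuous_intros)
    have "((\<lambda>y. integral (cbox 0 s) (\<lambda>\<tau>. pd \<alpha> g (y + \<tau> *\<^sub>R ?e))) has_derivative integral (cbox 0 s) (?F x)) (at x within UNIV)"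
    proof (rule leibniz_rule[OF _ _ cF])
      fix y :: "real^'n" and \<tau> :: real
      have "((\<lambda>y. y + \<tau> *\<^sub>R ?e) has_derivative (\<lambda>h. h)) (at y)"
        by (auto intro!: derivative_eq_intros)
      from has_derivative_compose[OF this C1_has_derivative[OF g2[of \<alpha>], of "y + \<tau> *\<^sub>R ?e"]]
      show "((\<lambda>y. pd \<alpha> g (y + \<tau> *\<^sub>R ?e)) has_derivative blinfun_apply (?F y \<tau>)) (at y within UNIV)"
        by (simp add: C1_blinfun(2)[OF g2])
      show "(\<lambda>\<tau>. pd \<alpha> g (y + \<tau> *\<^sub>R ?e)) integrable_on cbox 0 s"
        by (intro integrable_continuous ci continuous_intros) auto
    qed auto
    then have "pd \<beta> (\<lambda>y. g (y + s *\<^sub>R ?e) - g y) x = integral (cbox 0 s) (?F x) (axis \<beta> 1)"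
      unfolding 1 by (intro pd_eqI) simp
    also have "\<dots> = integral (cbox 0 s) (\<lambda>\<tau>. ?F x \<tau> (axis \<beta> 1))"
    proof (rule integral_linear[OF _ blinfun.bounded_linear_left[of "axis \<beta> 1"], unfolded o_def, symmetric])
      show "?F x integrable_on cbox 0 s"
        by (intro integrable_continuous ci continuous_intros) auto
    qed
    also have "\<dots> = integral {0..s} ?q" by (simp add: C1_blinfun(2)[OF g2])
    also have "pd \<beta> (\<lambda>y. g (y + s *\<^sub>R ?e) - g y) x = pd \<beta> g (x + s *\<^sub>R ?e) - pd \<beta> g x"
    proof -
      have "((\<lambda>y. y + s *\<^sub>R ?e) has_derivative (\<lambda>h. h)) (at x)"
        by (auto intro!: derivative_eq_intros)
      from has_derivative_compose[OF this C1_has_derivative[OF g, of "x + s *\<^sub>R ?e"]]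
      show ?thesis by (intro pd_eqI has_derivative_diff C1_has_derivative g) simp
    qed
    finally show ?thesis .
  qed
  have "((\<lambda>s. integral {0..s} ?q) has_real_derivative ?q 0) (at 0 within {0..1})"
    by (rule integral_has_real_derivative) (auto intro!: ci continuous_intros)
  then have "((\<lambda>s. pd \<beta> g (x + s *\<^sub>R ?e) - pd \<beta> g x) has_real_derivative ?q 0) (at 0 within {0..1})"
    by (rule has_field_derivative_transform_within[where d = 1]) (auto simp: step)
  moreover have "((\<lambda>s. pd \<beta> g (x + s *\<^sub>R ?e) - pd \<beta> g x) has_real_derivative pd \<alpha> (pd \<beta> g) x) (at 0 within {0..1})"
    using line[OF g2[of \<beta>], of x 0 "{0..1}"] by (auto intro!: derivative_eq_intros)
  ultimately have "?q 0 = pd \<alpha> (pd \<beta> g) x"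
    unfolding has_real_derivative_iff_has_vector_derivative
    by (rule vector_derivative_unique_within[rotated]) (simp add: trivial_limit_within islimpt_Icc)
  then show ?thesis by simp
qed

lemma C1_pd_bounded:
  fixes f :: "real^'n \<Rightarrow> real"
  assumes "C1 f" obtains M where "M > 0" "\<And>\<alpha> x. norm x \<le> R ==> \<bar>pd \<alpha> f x\<bar> \<le> M"
proof -
  have "\<exists>m. \<forall>x. norm x \<le> R --> \<bar>pd \<alpha> f x\<bar> \<le> m" for \<alpha>
  proof -
    have "bounded (pd \<alpha> f ` cball 0 R)"
      by (intro compact_imp_bounded compact_continuous_image C1_deriv_continuous assms compact_cball)
    then obtain m where "\<forall>x\<in>cball 0 R. \<bar>pd \<alpha> f x\<bar> \<le> m" by (auto simp: bounded_iff)
    then show ?thesis by (intro exI[of _ m]) simp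
  qed
  then obtain m where m: "\<And>\<alpha> x. norm x \<le> R ==> \<bar>pd \<alpha> f x\<bar> \<le> m \<alpha>" by metis
  show thesis
  proof (rule that[of "Max (insert 1 (range m))"])
    show "Max (insert 1 (range m)) > 0" by (subst Max_gr_iff) auto
    show "\<bar>pd \<alpha> f x\<bar> \<le> Max (insert 1 (range m))" if "norm x \<le> R" for \<alpha> x
      by (rule order_trans[OF m[OF that]]) (rule Max_ge, auto)
  qed
qed

subsection \<open>Jacobians are null Lagrangians\<close>

text \<open>For twice differentiable entries the determinant is a divergence: the terms with second
  derivatives cancel in pairs, because swapping two values of a permutation flips its sign.\<close>

lemma integral_jac_zero_C2:
  fixes a :: "'n::finite \<Rightarrow> real^'n \<Rightarrow> real"
  assumes a: "\<And>k. C1 (a k)" and a2: "\<And>k \<alpha>. k \<noteq> K ==> C1 (pd \<alpha> (a k))"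
    and s: "\<forall>x. norm x > R --> a K x = 0"
  shows "(LINT x|lborel. jac a x) = 0"
proof -
  \<comment> \<open>The compactly supported entry is split off from each summand of the determinant.\<close>
  define P where "P p x = (\<Prod>k\<in>UNIV - {K}. pd (p k) (a k) x)" for p x
  have CP: "C1 (P p)" for p unfolding P_def[abs_def] by (intro C1_prod a2) auto
  have pdP: "pd \<alpha> (P p) x = (\<Sum>l\<in>UNIV - {K}. pd \<alpha> (pd (p l) (a l)) x * (\<Prod>k\<in>UNIV - {K} - {l}. pd (p k) (a k) x))" for \<alpha> p x
  proof -
    have "((\<lambda>x. \<Prod>k\<in>UNIV - {K}. pd (p k) (a k) x) has_derivative
      (\<lambda>h. \<Sum>l\<in>UNIV - {K}. frechet_derivative (pd (p l) (a l)) (at x) h * (\<Prod>k\<in>UNIV - {K} - {l}. pd (p k) (a k) x))) (at x)"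
      by (intro has_derivative_prod C1_has_derivative a2) auto
    then show ?thesis unfolding P_def[abs_def] by (intro pd_eqI)
  qed
  have zero: "(\<Sum>p | p permutes UNIV. of_int (sign p) * pd (p K) (P p) x) = 0" for x
  proof -
    define T where "T l p = pd (p K) (pd (p l) (a l)) x * (\<Prod>k\<in>UNIV - {K} - {l}. pd (p k) (a k) x)" for l p
    have "(\<Sum>p | p permutes (UNIV::'n set). of_int (sign p) * T l p) = 0" if l: "l \<noteq> K" for l
    proof -
      let ?t = "Transposition.transpose K l"
      have t: "?t permutes UNIV" by (rule permutes_swap_id) auto
      have "(\<Sum>p | p permutes (UNIV::'n set). of_int (sign p) * T l p)
          = (\<Sum>p | p permutes (UNIV::'n set). of_int (sign (p \<circ> ?t)) * T l (p \<circ> ?t))"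
        by (rule sum_permutations_compose_right[OF t])
      also have "\<dots> = (\<Sum>p | p permutes (UNIV::'n set). - (of_int (sign p) * T l p))"
      proof (rule sum.cong)
        fix p :: "'n \<Rightarrow> 'n" assume "p \<in> {p. p permutes UNIV}"
        then have p: "permutation p" unfolding permutation_permutes by (intro exI[of _ UNIV]) simp
        have "sign (p \<circ> ?t) = - sign p"
          using l sign_compose[OF p permutation_swap_id, of K l] by (simp add: sign_swap_id)
        moreover have "T l (p \<circ> ?t) = T l p"
        proof -
          have "(\<Prod>k\<in>UNIV - {K} - {l}. pd ((p \<circ> ?t) k) (a k) x) = (\<Prod>k\<in>UNIV - {K} - {l}. pd (p k) (a k) x)"
            by (rule prod.cong) (auto simp: Transposition.transpose_def)
          moreover have "pd (p l) (pd (p K) (a l)) x = pd (p K) (pd (p l) (a l)) x"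
            by (rule pd_commute) (use l a a2 in auto)
          ultimately show ?thesis unfolding T_def by simp
        qed
        ultimately show "of_int (sign (p \<circ> ?t)) * T l (p \<circ> ?t) = - (of_int (sign p) * T l p)" by simp
      qed simp
      finally show ?thesis by (simp add: sum_negf)
    qed
    then have "(\<Sum>l\<in>UNIV - {K}. \<Sum>p | p permutes (UNIV::'n set). of_int (sign p) * T l p) = 0"
      by (intro sum.neutral) auto
    then show ?thesis
      unfolding pdP T_def[symmetric] by (subst (asm) sum.swap) (simp add: sum_distrib_left)
  qed
  have jac: "jac a x = (\<Sum>p | p permutes UNIV. of_int (sign p) * pd (p K) (\<lambda>x. a K x * P p x) x)" for x
  proof -
    have "(\<Sum>p | p permutes UNIV. of_int (sign p) * pd (p K) (\<lambda>x. a K x * P p x) x)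
      = (\<Sum>p | p permutes UNIV. of_int (sign p) * (a K x * pd (p K) (P p) x + pd (p K) (a K) x * P p x))"
      by (simp add: pd_mult[OF a CP])
    also have "\<dots> = a K x * (\<Sum>p | p permutes UNIV. of_int (sign p) * pd (p K) (P p) x)
      + (\<Sum>p | p permutes UNIV. of_int (sign p) * (pd (p K) (a K) x * P p x))"
      by (simp add: distrib_left sum.distrib sum_distrib_left mult_ac)
    also have "\<dots> = jac a x"
      unfolding zero jac_alt P_def by (simp add: prod.remove[of UNIV K])
    finally show ?thesis by simp
  qed
  have C: "C1 (\<lambda>x. a K x * P p x)" for p by (intro C1_mult a CP)
  have i: "integrable lborel (pd \<alpha> (\<lambda>x. a K x * P p x))" for \<alpha> p
    by (rule integrable_lborel_compact_support[OF C1_deriv_continuous[OF C], of "R"])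
       (rule pd_eq_0[of "- cball 0 R"], use s in auto)
  have "(LINT x|lborel. jac a x)
      = (\<Sum>p | p permutes UNIV. of_int (sign p) * (LINT x|lborel. pd (p K) (\<lambda>x. a K x * P p x) x))"
    unfolding jac using i by (subst Bochner_Integration.integral_sum) auto
  also have "\<dots> = 0"
    by (intro sum.neutral ballI) (simp add: integral_pd_compact_support[OF C, of R] s)
  finally show ?thesis .
qed

lemma jac_tendsto:
  assumes "\<And>k \<alpha>. ((\<lambda>m. pd \<alpha> (b m k) x) \<longlongrightarrow> pd \<alpha> (a k) x) F"
  shows "((\<lambda>m. jac (b m) x) \<longlongrightarrow> jac a x) F"
  unfolding jac_alt by (intro tendsto_intros assms)

text \<open>Mollification carries the identity over to C1 entries.\<close>

theorem integral_jac_zero: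
  fixes a :: "'n::finite \<Rightarrow> real^'n \<Rightarrow> real"
  assumes a: "\<And>k. C1 (a k)" and s: "\<forall>x. norm x \<ge> R --> a K x = 0"
  shows "(LINT x|lborel. jac a x) = 0"
proof -
  define r where "r = max R 0 + 1"
  have r: "r \<ge> 0" "r > R" by (auto simp: r_def)
  obtain w :: "real^'n \<Rightarrow> real" where w: "C1 w" "\<And>x. norm x \<le> r + 1 ==> w x = 1" "\<And>x. norm x \<ge> r + 2 ==> w x = 0"
  proof (rule cutoff_exists[of "r + 1" "r + 2"])
    show "0 \<le> r + 1" using r by simp
  qed auto
  define b where "b k = (if k = K then a K else (\<lambda>x. w x * a k x))" for k
  have Cb: "C1 (b k)" for k by (auto simp: b_def intro!: a C1_mult w)
  have zK: "pd \<alpha> (b K) x = 0" if "norm x > r" for \<alpha> x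
    by (rule pd_eq_0[of "- cball 0 r"]) (use that s r in \<open>auto simp: b_def\<close>)
  have zK': "pd \<alpha> (a K) x = 0" if "norm x > r" for \<alpha> x
    by (rule pd_eq_0[of "- cball 0 r"]) (use that s r in auto)
  have jab: "jac b x = jac a x" for x
  proof (cases "norm x \<le> r")
    case True
    have "frechet_derivative (b k) (at x) = frechet_derivative (a k) (at x)" for k
      by (rule pd_cong_open[of "ball 0 (r + 1)"]) (use True in \<open>auto simp: b_def w(2)\<close>)
    then show ?thesis by (intro jac_cong) simp
  next
    case False
    then show ?thesis using jac_zero_row[of b K x] jac_zero_row[of a K x] zK zK' by auto
  qed
  have "\<exists>\<phi>. smooth_on UNIV \<phi> \<and> (\<forall>\<alpha> x. \<bar>pd \<alpha> \<phi> x - pd \<alpha> (b k) x\<bar> \<le> 1 / real (Suc m))" if "k \<noteq> K" for k m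
  proof -
    have "b k x = 0" if "norm x \<ge> r + 2" for x using that \<open>k \<noteq> K\<close> w(3) by (simp add: b_def)
    from mollification_exists[where \<xi> = "b k" and R = "r + 2", OF C1_continuous[OF Cb] this, of "1 / real (Suc m)"] Cb
    show ?thesis by (metis of_nat_0_less_iff zero_less_Suc zero_less_divide_1_iff)
  qed
  then obtain \<phi> where \<phi>: "\<And>k m. k \<noteq> K ==> smooth_on UNIV (\<phi> k m)"
    "\<And>k m \<alpha> x. k \<noteq> K ==> \<bar>pd \<alpha> (\<phi> k m) x - pd \<alpha> (b k) x\<bar> \<le> 1 / real (Suc m)" by metis
  define c where "c m k = (if k = K then a K else \<phi> k m)" for m k
  have Cc: "C1 (c m k)" "k \<noteq> K ==> C1 (pd \<alpha> (c m k))" for m k \<alpha>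
  proof -
    have *: "Ck_on (Suc (Suc 0)) UNIV (\<phi> k m)" if "k \<noteq> K" using \<phi>(1)[OF that] by (simp only: smooth_on_def)
    show "C1 (c m k)" using a Ck_Suc_C1[OF *] by (auto simp: c_def)
    assume k: "k \<noteq> K"
    have "Ck_on (Suc 0) UNIV (pd \<alpha> (\<phi> k m))" using *[OF k] Ck_on.simps(2)[of "Suc 0"] by blast
    then show "C1 (pd \<alpha> (c m k))" using k by (simp add: c_def Ck_Suc_C1 del: Ck_on.simps)
  qed
  have close: "\<bar>pd \<alpha> (c m k) x - pd \<alpha> (b k) x\<bar> \<le> 1 / real (Suc m)" for k m \<alpha> x
    using \<phi>(2)[where k = k and \<alpha> = \<alpha> and m = m and x = x] by (auto simp: c_def b_def)
  have lim: "(\<lambda>m. jac (c m) x) \<longlonglongrightarrow> jac b x" for x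
  proof (rule jac_tendsto)
    show "(\<lambda>m. pd \<alpha> (c m k) x) \<longlonglongrightarrow> pd \<alpha> (b k) x" for k \<alpha>
    proof (rule metric_tendsto_imp_tendsto[OF LIMSEQ_inverse_real_of_nat])
      show "\<forall>\<^sub>F m in sequentially. dist (pd \<alpha> (c m k) x) (pd \<alpha> (b k) x) \<le> dist (inverse (real (Suc m))) 0"
        using close[where \<alpha> = \<alpha> and k = k and x = x] by (simp add: dist_real_def inverse_eq_divide)
    qed
  qed
  have "\<exists>M. M > 0 \<and> (\<forall>\<alpha> x. norm x \<le> r --> \<bar>pd \<alpha> (b k) x\<bar> \<le> M)" for k
    using C1_pd_bounded[OF Cb] by metis
  then obtain M where M: "\<And>k \<alpha> x. norm x \<le> r ==> \<bar>pd \<alpha> (b k) x\<bar> \<le> M k" by metis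
  define B where "B = fact CARD('n) * (\<Prod>k\<in>UNIV. M k + 1)"
  have bound: "\<bar>jac (c m) x\<bar> \<le> indicator (cball 0 r) x * B" for m x
  proof (cases "norm x \<le> r")
    case True
    have "\<bar>pd \<alpha> (c m k) x\<bar> \<le> M k + 1" for k \<alpha>
    proof -
      have "1 / real (Suc m) \<le> 1" by simp
      then show ?thesis using close[where \<alpha> = \<alpha> and m = m and k = k and x = x] M[OF True, where \<alpha> = \<alpha> and k = k] by linarith
    qed
    then show ?thesis using True jac_bound[of "c m" x "\<lambda>k. M k + 1"] by (simp add: B_def)
  next
    case False
    then have "jac (c m) x = 0" by (intro jac_zero_row[of _ K]) (use zK in \<open>auto simp: c_def b_def\<close>)
    then show ?thesis using False by simp
  qed
  have meas: "jac (c m) \<in> borel_measurable borel" "jac b \<in> borel_measurable borel" for m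
    by (intro borel_measurable_continuous_onI jac_continuous Cc Cb)+
  have "(\<lambda>m. LINT x|lborel. jac (c m) x) \<longlonglongrightarrow> (LINT x|lborel. jac b x)"
  proof (rule integral_dominated_convergence[where w = "\<lambda>x. indicator (cball 0 r) x * B"])
    show "integrable lborel (\<lambda>x. indicator (cball (0::real^'n) r) x * B)"
      using emeasure_lborel_cball_finite[of "0::real^'n" r] by simp
  qed (use meas lim bound in auto)
  moreover have "(LINT x|lborel. jac (c m) x) = 0" for m
    by (rule integral_jac_zero_C2[of "c m" K r]) (use Cc r s in \<open>auto simp: c_def\<close>)
  ultimately have "(LINT x|lborel. jac b x) = 0"
    using LIMSEQ_const_iff[of "0::real" "LINT x|lborel. jac b x"] by simp
  then show ?thesis by (simp add: jab)
qed


subsection \<open>Comparison of Jacobian integrals\<close>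

lemma integrable_mult_jac_upd:
  fixes c :: "'n::finite \<Rightarrow> real^'n \<Rightarrow> real"
  assumes c: "\<And>k. C1 (c k)" and h: "continuous_on UNIV h" and \<xi>: "C1 \<xi>" "\<forall>x. norm x \<ge> r --> \<xi> x = 0"
  shows "integrable lborel (\<lambda>x. h x * jac (c(k := \<xi>)) x)"
proof (rule integrable_lborel_compact_support[of _ r])
  have "C1 ((c(k := \<xi>)) l)" for l using \<xi>(1) c by auto
  then show "continuous_on UNIV (\<lambda>x. h x * jac (c(k := \<xi>)) x)"
    by (intro continuous_on_mult h jac_continuous)
  show "h x * jac (c(k := \<xi>)) x = 0" if "norm x > r" for x
  proof -
    have "jac (c(k := \<xi>)) x = 0"
    proof (rule jac_zero_row[of _ k])
      show "pd \<alpha> ((c(k := \<xi>)) k) x = 0" for \<alpha>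
        using that \<xi>(2) by (auto intro!: pd_eq_0[of "- cball 0 r"])
    qed
    then show ?thesis by simp
  qed
qed

text \<open>The Jacobian with \<open>\<xi> (f - g)\<close> as an entry integrates to zero; expanding that row by the
  product rule moves the derivative from \<open>f - g\<close> to \<open>\<xi>\<close>.\<close>

lemma integral_mult_jac_diff_row:
  fixes c :: "'n::finite \<Rightarrow> real^'n \<Rightarrow> real"
  assumes c: "\<And>k. C1 (c k)" and fg: "C1 f" "C1 g" and \<xi>: "C1 \<xi>" "\<forall>x. norm x \<ge> r --> \<xi> x = 0"
  shows "(LINT x|lborel. \<xi> x * jac (c(k := f)) x) - (LINT x|lborel. \<xi> x * jac (c(k := g)) x)
    = - (LINT x|lborel. (f x - g x) * jac (c(k := \<xi>)) x)"
proof -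
  let ?h = "\<lambda>x. f x - g x"
  have Ch: "C1 ?h" by (intro C1_diff fg)
  have CC: "C1 ((c(k := u)) l)" if "C1 u" for u l using that c by auto
  have int: "integrable lborel (\<lambda>x. \<xi> x * jac (c(k := u)) x)" if "C1 u" for u
    by (rule integrable_lborel_compact_support[of _ r])
       (use \<xi>(2) in \<open>auto intro!: continuous_on_mult C1_continuous[OF \<xi>(1)] jac_continuous CC[OF that] simp del: fun_upd_apply\<close>)
  have int2: "integrable lborel (\<lambda>x. ?h x * jac (c(k := \<xi>)) x)"
    by (rule integrable_mult_jac_upd[OF c C1_continuous[OF Ch] \<xi>])
  have "0 = (LINT x|lborel. jac (c(k := \<lambda>x. \<xi> x * ?h x)) x)"
    by (rule integral_jac_zero[where K = k and R = r, symmetric])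
       (use CC[OF C1_mult[OF \<xi>(1) Ch]] \<xi>(2) in auto)
  also have "\<dots> = (LINT x|lborel. \<xi> x * jac (c(k := ?h)) x) + (LINT x|lborel. ?h x * jac (c(k := \<xi>)) x)"
    unfolding jac_upd_mult[OF \<xi>(1) Ch] by (rule Bochner_Integration.integral_add[OF int[OF Ch] int2])
  also have "(LINT x|lborel. \<xi> x * jac (c(k := ?h)) x)
      = (LINT x|lborel. \<xi> x * jac (c(k := f)) x) - (LINT x|lborel. \<xi> x * jac (c(k := g)) x)"
    unfolding jac_upd_diff[OF fg] right_diff_distrib by (rule Bochner_Integration.integral_diff[OF int int]) (use fg in auto)
  finally show ?thesis by linarith
qed

text \<open>Rows are exchanged one at a time. Integration by parts moves the derivative of each
  difference \<open>a k - b k\<close> to the weight, so only the size of the difference matters.\<close>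

theorem integral_jac_comparison:
  fixes a b :: "'n::finite \<Rightarrow> real^'n \<Rightarrow> real"
  assumes a: "\<And>k. C1 (a k)" and b: "\<And>k. C1 (b k)" and \<xi>: "C1 \<xi>" "\<forall>x. norm x \<ge> r --> \<xi> x = 0" "r < 1"
    and q: "\<And>k x. norm x < 1 ==> \<bar>a k x - b k x\<bar> \<le> q x"
    and e: "\<And>\<alpha> x. norm x < 1 ==> \<bar>pd \<alpha> \<xi> x\<bar> \<le> e x"
    and d: "\<And>k \<alpha> x. norm x < 1 ==> \<bar>pd \<alpha> (a k) x\<bar> \<le> d x" "\<And>k \<alpha> x. norm x < 1 ==> \<bar>pd \<alpha> (b k) x\<bar> \<le> d x"
  shows "ennreal \<bar>(LINT x|lborel. \<xi> x * jac a x) - (LINT x|lborel. \<xi> x * jac b x)\<bar>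
    \<le> of_nat CARD('n) * (\<integral>\<^sup>+x\<in>ball 0 1. ennreal (fact CARD('n) * (q x * e x * d x ^ (CARD('n) - 1))) \<partial>lborel)"
proof -
  let ?I = "\<integral>\<^sup>+x\<in>ball 0 1. ennreal (fact CARD('n) * (q x * e x * d x ^ (CARD('n) - 1))) \<partial>lborel"
  define c where "c S k = (if k \<in> S then a k else b k)" for S k
  have Cc: "C1 (c S k)" for S k using a b by (simp add: c_def)
  have step: "ennreal \<bar>(LINT x|lborel. \<xi> x * jac (c (insert k S)) x) - (LINT x|lborel. \<xi> x * jac (c S) x)\<bar> \<le> ?I"
    if "k \<notin> S" for k S
  proof -
    have eq: "c (insert k S) = (c S)(k := a k)" "c S = (c S)(k := b k)" using that by (auto simp: c_def)
    let ?G = "\<lambda>x. (a k x - b k x) * jac ((c S)(k := \<xi>)) x"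
    have "(LINT x|lborel. \<xi> x * jac (c (insert k S)) x) - (LINT x|lborel. \<xi> x * jac (c S) x) = - (LINT x|lborel. ?G x)"
      unfolding eq(1) by (subst (2) eq(2)) (rule integral_mult_jac_diff_row[OF Cc a b \<xi>(1,2)])
    then have "\<bar>(LINT x|lborel. \<xi> x * jac (c (insert k S)) x) - (LINT x|lborel. \<xi> x * jac (c S) x)\<bar> = norm (LINT x|lborel. ?G x)" by simp
    also have "ennreal (norm (LINT x|lborel. ?G x)) \<le> (\<integral>\<^sup>+x. norm (?G x) \<partial>lborel)"
      by (intro integral_norm_bound_ennreal integrable_mult_jac_upd[OF Cc _ \<xi>(1,2)] continuous_on_diff C1_continuous a b)
    also have "\<dots> \<le> ?I"
    proof (rule nn_integral_mono)
      fix x :: "real^'n"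
      show "ennreal (norm (?G x)) \<le> ennreal (fact CARD('n) * (q x * e x * d x ^ (CARD('n) - 1))) * indicator (ball 0 1) x"
      proof (cases "norm x < 1")
        case True
        have 0: "0 \<le> e x" "0 \<le> q x" "0 \<le> d x"
          using e[OF True] q[OF True] d(1)[OF True] abs_ge_zero order_trans by blast+
        have "\<bar>jac ((c S)(k := \<xi>)) x\<bar> \<le> fact CARD('n) * (\<Prod>l\<in>UNIV. if l = k then e x else d x)"
          by (rule jac_bound) (use e d True in \<open>auto simp: c_def\<close>)
        also have "(\<Prod>l\<in>UNIV. if l = k then e x else d x) = e x * d x ^ (CARD('n) - 1)"
          by (simp add: prod.remove[of UNIV k] card_Diff_singleton)
        finally have jb: "\<bar>jac ((c S)(k := \<xi>)) x\<bar> \<le> fact CARD('n) * (e x * d x ^ (CARD('n) - 1))" .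
        have "\<bar>a k x - b k x\<bar> * \<bar>jac ((c S)(k := \<xi>)) x\<bar> \<le> q x * (fact CARD('n) * (e x * d x ^ (CARD('n) - 1)))"
          using q[OF True, of k] 0 by (intro mult_mono jb) auto
        with True show ?thesis by (auto simp: abs_mult mult_ac intro!: ennreal_leI)
      next
        case False
        have "jac ((c S)(k := \<xi>)) x = 0"
        proof (rule jac_zero_row[of _ k])
          show "pd \<alpha> (((c S)(k := \<xi>)) k) x = 0" for \<alpha>
            using False \<xi>(2,3) by (auto intro!: pd_eq_0[of "- cball 0 r"])
        qed
        then show ?thesis by simp
      qed
    qed
    finally show ?thesis .
  qed
  have "ennreal \<bar>(LINT x|lborel. \<xi> x * jac (c S) x) - (LINT x|lborel. \<xi> x * jac (c {}) x)\<bar> \<le> of_nat (card S) * ?I" for S :: "'n set"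
  proof (induction S rule: infinite_finite_induct)
    case (insert k S)
    let ?J = "\<lambda>S. LINT x|lborel. \<xi> x * jac (c S) x"
    have "ennreal \<bar>?J (insert k S) - ?J {}\<bar> \<le> ennreal (\<bar>?J (insert k S) - ?J S\<bar> + \<bar>?J S - ?J {}\<bar>)"
      by (rule ennreal_leI) linarith
    also have "\<dots> = ennreal \<bar>?J (insert k S) - ?J S\<bar> + ennreal \<bar>?J S - ?J {}\<bar>"
      by (rule ennreal_plus) auto
    also have "\<dots> \<le> ?I + of_nat (card S) * ?I"
      by (intro add_mono step insert)
    also have "\<dots> = of_nat (card (insert k S)) * ?I" using insert by (simp add: distrib_right)
    finally show ?case .
  qed auto
  from this[of UNIV] show ?thesis by (simp add: c_def[abs_def])
qed

section \<open>The degree of a map close to the identity on the sphere\<close>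

lemma close_near_sphere:
  fixes u :: "'a::euclidean_space \<Rightarrow> real"
  assumes u: "continuous_on UNIV u" and "\<And>x. norm x = 1 ==> \<bar>u x\<bar> \<le> \<delta>" and "\<delta> > 0"
  shows "\<exists>r>0. \<forall>x. 1 - r \<le> norm x --> norm x \<le> 1 --> \<bar>u x\<bar> \<le> 2 * \<delta>"
proof -
  have "uniformly_continuous_on (cball 0 1) u"
    by (intro compact_uniformly_continuous continuous_on_subset[OF u]) auto
  then obtain d where d: "d > 0" "\<And>x y. x \<in> cball 0 1 ==> y \<in> cball 0 1 ==> dist y x < d ==> dist (u y) (u x) < \<delta>"
    unfolding uniformly_continuous_on_def using \<open>\<delta> > 0\<close> by metis
  have "\<bar>u x\<bar> \<le> 2 * \<delta>" if x: "1 - min (d/2) (1/2) \<le> norm x" "norm x \<le> 1" for x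
  proof -
    have "norm x \<noteq> 0" using x(1) by (auto simp: min_def split: if_splits)
    then have s: "norm (sgn x) = 1" by (simp add: norm_sgn)
    have "x = norm x *\<^sub>R sgn x" using \<open>norm x \<noteq> 0\<close> by (simp add: sgn_div_norm)
    then have "dist x (sgn x) = norm ((norm x - 1) *\<^sub>R sgn x)"
      by (metis dist_norm scaleR_left_diff_distrib scaleR_one)
    also have "\<dots> = 1 - norm x" using s x(2) by simp
    also have "\<dots> < d" using x(1) d(1) by (auto simp: min_def split: if_splits)
    finally have "dist (u x) (u (sgn x)) < \<delta>" using s x(2) by (intro d(2)) auto
    then show ?thesis using assms(2)[OF s] by (simp add: dist_real_def)
  qed
  then show ?thesis using d(1) by (intro exI[of _ "min (d/2) (1/2)"]) auto
qed

text \<open>The integral below is that of the pullback of the form \<open>\<Prod>\<eta>(y\<^sub>k) dy\<close>. Since \<open>Y\<close> is a primitive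
  of \<open>\<eta>\<close>, the effect of exchanging one component of the map is the integral of a Jacobian with a
  compactly supported entry: near the sphere the two exchanged components lie on the same side of
  the support of \<open>\<eta>\<close> unless one of the remaining factors vanishes.\<close>

lemma degree_exchange_component:
  fixes c :: "'n::finite \<Rightarrow> real^'n \<Rightarrow> real"
  defines "\<delta> \<equiv> 1 / (8 * real CARD('n))"
  assumes Y: "\<And>t. (Y has_real_derivative \<eta> t) (at t)" "\<And>t. (\<eta> has_real_derivative \<eta>' t) (at t)"
    "continuous_on UNIV \<eta>'" "\<And>t. \<bar>t\<bar> \<ge> \<delta> ==> \<eta> t = 0" "\<And>t. t \<le> -\<delta> ==> Y t = 0" "\<And>t. t \<ge> \<delta> ==> Y t = 1"
  assumes c: "\<And>l. C1 (c l)" "\<And>l x. norm x = 1 ==> \<bar>c l x - x $ l\<bar> \<le> \<delta>"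
    and f: "C1 f" "\<And>x. norm x = 1 ==> \<bar>f x - x $ k\<bar> \<le> \<delta>"
    and h: "C1 h" "\<And>x. norm x = 1 ==> \<bar>h x - x $ k\<bar> \<le> \<delta>"
  shows "(LINT x|lborel. indicator (ball 0 1) x * ((\<Prod>l\<in>UNIV. \<eta> ((c(k := f)) l x)) * jac (c(k := f)) x))
       = (LINT x|lborel. indicator (ball 0 1) x * ((\<Prod>l\<in>UNIV. \<eta> ((c(k := h)) l x)) * jac (c(k := h)) x))"
proof -
  let ?n = "real CARD('n)"
  have n1: "?n \<ge> 1" by (simp add: Suc_leI)
  have \<delta>: "\<delta> > 0" "\<delta> \<le> 1/8" using n1 by (auto simp: \<delta>_def field_simps)
  have c\<eta>: "continuous_on UNIV \<eta>" using Y(2) by (meson DERIV_continuous continuous_at_imp_continuous_on)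
  have CY: "C1 Y" "C1 \<eta>" using C1_real[OF Y(1) c\<eta>] C1_real[OF Y(2,3)] by auto
  have Cx: "C1 (\<lambda>x::real^'n. x $ l)" for l by (intro C1_linear bounded_linear_vec_nth)
  have Cu: "continuous_on UNIV (\<lambda>x. u x - x $ l)" if "C1 u" for u :: "real^'n \<Rightarrow> real" and l
    using C1_continuous[OF C1_diff[OF that Cx]] .
  have near: "\<exists>r>0. \<forall>x. 1 - r \<le> norm x --> norm x \<le> 1 --> \<bar>u x - x $ l\<bar> \<le> 2 * \<delta>"
    if "C1 u" "\<And>x. norm x = 1 ==> \<bar>u x - x $ l\<bar> \<le> \<delta>" for u :: "real^'n \<Rightarrow> real" and l
    by (rule close_near_sphere[OF Cu[OF that(1)] that(2) \<delta>(1)])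
  obtain rf where rf: "rf > 0" "\<And>x. 1 - rf \<le> norm x ==> norm x \<le> 1 ==> \<bar>f x - x $ k\<bar> \<le> 2 * \<delta>"
    using near[OF f] by blast
  obtain rh where rh: "rh > 0" "\<And>x. 1 - rh \<le> norm x ==> norm x \<le> 1 ==> \<bar>h x - x $ k\<bar> \<le> 2 * \<delta>"
    using near[OF h] by blast
  have "\<forall>l. \<exists>r>0. \<forall>x. 1 - r \<le> norm x --> norm x \<le> 1 --> \<bar>c l x - x $ l\<bar> \<le> 2 * \<delta>"
    using near[OF c(1) c(2)] by blast
  then obtain rc where rc: "\<And>l. rc l > 0" "\<And>l x. 1 - rc l \<le> norm x ==> norm x \<le> 1 ==> \<bar>c l x - x $ l\<bar> \<le> 2 * \<delta>"
    by metis
  define r where "r = Min (insert (1/4) (insert rf (insert rh (range rc))))"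
  have r0: "r > 0" unfolding r_def using rf(1) rh(1) rc(1) by (subst Min_gr_iff) auto
  have r: "r \<le> 1/4" "r \<le> rf" "r \<le> rh" "\<And>l. r \<le> rc l" unfolding r_def by (rule Min_le, simp, simp)+
  \<comment> \<open>With \<open>G\<close> as its entry in row \<open>k\<close> the Jacobian is the difference of the two integrands, and \<open>G\<close>
    vanishes near the sphere.\<close>
  define G where "G x = (Y (f x) - Y (h x)) * (\<Prod>l\<in>UNIV - {k}. \<eta> (c l x))" for x
  have G0: "G x = 0" if x: "1 - r \<le> norm x" "norm x \<le> 1" for x
  proof (cases "\<exists>l\<in>UNIV - {k}. \<eta> (c l x) = 0")
    case True
    then have "(\<Prod>l\<in>UNIV - {k}. \<eta> (c l x)) = 0" by (subst prod_zero_iff) auto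
    then show ?thesis by (simp add: G_def)
  next
    case False
    have xl: "(x $ l)^2 \<le> (3 * \<delta>)^2" if "l \<noteq> k" for l
    proof -
      have "\<bar>c l x\<bar> < \<delta>" using False that Y(4)[of "c l x"] by force
      moreover have "\<bar>c l x - x $ l\<bar> \<le> 2 * \<delta>" using x r(4)[of l] by (intro rc(2)) auto
      ultimately have "\<bar>x $ l\<bar> \<le> 3 * \<delta>" by linarith
      then show ?thesis using abs_le_square_iff[of "x $ l" "3 * \<delta>"] \<delta>(1) by simp
    qed
    have "(norm x)^2 = (\<Sum>l\<in>UNIV. (x $ l)^2)"
      by (simp add: norm_vec_def L2_set_def sum_nonneg)
    also have "\<dots> = (x $ k)^2 + (\<Sum>l\<in>UNIV - {k}. (x $ l)^2)" by (simp add: sum.remove[of UNIV k])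
    also have "(\<Sum>l\<in>UNIV - {k}. (x $ l)^2) \<le> (\<Sum>l\<in>UNIV - {k}. (3 * \<delta>)^2)"
      by (intro sum_mono xl) auto
    also have "\<dots> \<le> ?n * (3 * \<delta>)^2"
      by (simp add: card_Diff_singleton mult_right_mono)
    also have "\<dots> = 9 / (64 * ?n)" using n1 by (simp add: \<delta>_def power2_eq_square field_simps)
    also have "\<dots> \<le> 9 / 64" using n1 by (simp add: field_simps)
    finally have "(norm x)^2 \<le> (x $ k)^2 + 9/64" by simp
    moreover have "(3/4)^2 \<le> (norm x)^2" using x r(1) by (intro power_mono) auto
    ultimately have "(1/2)^2 \<le> (x $ k)^2" by (simp add: power2_eq_square)
    then have xk: "1/2 \<le> \<bar>x $ k\<bar>" using abs_le_square_iff[of "1/2" "x $ k"] by simp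
    have fh: "\<bar>f x - x $ k\<bar> \<le> 2 * \<delta>" "\<bar>h x - x $ k\<bar> \<le> 2 * \<delta>"
      using x r by (auto intro!: rf(2) rh(2))
    have "Y (f x) = Y (h x)"
    proof (cases "x $ k \<ge> 0")
      case True
      then have "f x \<ge> \<delta>" "h x \<ge> \<delta>" using xk fh \<delta> by linarith+
      then show ?thesis by (simp add: Y(6))
    next
      case False
      then have "f x \<le> -\<delta>" "h x \<le> -\<delta>" using xk fh \<delta> by linarith+
      then show ?thesis by (simp add: Y(5))
    qed
    then show ?thesis by (simp add: G_def)
  qed
  let ?U = "\<lambda>x. Y (f x) - Y (h x)" and ?V = "\<lambda>x. \<Prod>l\<in>UNIV - {k}. \<eta> (c l x)"
  have CYf: "C1 (\<lambda>x. Y (f x))" "C1 (\<lambda>x. Y (h x))" using C1_compose CY f(1) h(1) by blast+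
  have CU: "C1 ?U" by (intro C1_diff CYf)
  have Ce: "C1 (\<lambda>x. \<eta> (c l x))" for l using C1_compose[OF c(1) CY(2)] .
  have CV: "C1 ?V" by (intro C1_prod Ce)
  have CG: "C1 G" unfolding G_def[abs_def] by (rule C1_mult[OF CU CV])
  define \<Phi> where "\<Phi> u x = (\<Prod>l\<in>UNIV. \<eta> ((c(k := u)) l x)) * jac (c(k := u)) x" for u x
  have jacG: "jac (c(k := G)) x = \<Phi> f x - \<Phi> h x" for x
  proof -
    have pr: "(\<Prod>l\<in>UNIV. \<eta> ((c(k := u)) l x)) = \<eta> (u x) * ?V x" for u
      by (simp add: prod.remove[of UNIV k])
    have V0: "jac (c(k := ?V)) x = 0"
    proof (rule jac_upd_dependent)
      show "pd \<alpha> ?V x = (\<Sum>l\<in>UNIV - {k}. (\<eta>' (c l x) * (\<Prod>j\<in>UNIV - {k} - {l}. \<eta> (c j x))) * pd \<alpha> (c l) x)" for \<alpha>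
      proof -
        have "(?V has_derivative (\<lambda>v. \<Sum>l\<in>UNIV - {k}. frechet_derivative (\<lambda>x. \<eta> (c l x)) (at x) v * (\<Prod>j\<in>UNIV - {k} - {l}. \<eta> (c j x)))) (at x)"
          by (intro has_derivative_prod C1_has_derivative Ce)
        from pd_eqI[OF this, of \<alpha>] show ?thesis
          by (simp add: pd_compose_real[OF c(1) Y(2)] mult_ac)
      qed
    qed auto
    have U: "jac (c(k := ?U)) x = \<eta> (f x) * jac (c(k := f)) x - \<eta> (h x) * jac (c(k := h)) x"
      using jac_upd_linear[of ?U x "\<eta> (f x)" f "- \<eta> (h x)" h c k]
      by (simp add: pd_diff[OF CYf] pd_compose_real[OF f(1) Y(1)] pd_compose_real[OF h(1) Y(1)])
    have "jac (c(k := G)) x = ?U x * jac (c(k := ?V)) x + ?V x * jac (c(k := ?U)) x"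
      unfolding G_def[abs_def] by (rule jac_upd_mult[OF CU CV])
    then show ?thesis unfolding V0 U \<Phi>_def pr by (simp add: algebra_simps)
  qed
  obtain w :: "real^'n \<Rightarrow> real" where w: "C1 w" "\<And>x. norm x \<le> 1 - r ==> w x = 1" "\<And>x. norm x \<ge> 1 - r / 2 ==> w x = 0"
  proof (rule cutoff_exists[of "1 - r" "1 - r / 2"])
    show "0 \<le> 1 - r" "1 - r < 1 - r / 2" using r r0 by auto
  qed auto
  have Cw: "C1 (\<lambda>x. w x * G x)" by (intro C1_mult w CG)
  have wG: "w x * G x = G x" if "norm x < 1" for x
    using G0[of x] w(2)[of x] that by (cases "norm x \<le> 1 - r") auto
  have "indicator (ball 0 1) x * \<Phi> f x - indicator (ball 0 1) x * \<Phi> h x = jac (c(k := \<lambda>x. w x * G x)) x" for x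
  proof (cases "norm x < 1")
    case True
    have "frechet_derivative (\<lambda>x. w x * G x) (at x) = frechet_derivative G (at x)"
      by (rule pd_cong_open[of "ball 0 1"]) (use True in \<open>auto simp: wG\<close>)
    then have "jac (c(k := \<lambda>x. w x * G x)) x = jac (c(k := G)) x" by (intro jac_cong) simp
    then show ?thesis using True by (simp add: jacG)
  next
    case False
    have "jac (c(k := \<lambda>x. w x * G x)) x = 0"
    proof (rule jac_zero_row[of _ k])
      show "pd \<alpha> ((c(k := \<lambda>x. w x * G x)) k) x = 0" for \<alpha>
        using False w(3) r0 by (auto intro!: pd_eq_0[of "- cball 0 (1 - r / 2)"])
    qed
    then show ?thesis using False by simp
  qed
  moreover have "(LINT x|lborel. jac (c(k := \<lambda>x. w x * G x)) x) = 0"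
    by (rule integral_jac_zero[where K = k and R = "1 - r / 2"]) (use c(1) Cw w(3) in auto)
  ultimately have eq: "(LINT x|lborel. indicator (ball 0 1) x * \<Phi> f x - indicator (ball 0 1) x * \<Phi> h x) = 0" by simp
  have int: "integrable lborel (\<lambda>x. indicator (ball 0 1) x * \<Phi> u x)" if "C1 u" for u
  proof -
    have "continuous_on UNIV (\<Phi> u)"
      unfolding \<Phi>_def[abs_def]
      by (intro continuous_on_mult continuous_on_prod jac_continuous continuous_on_compose2[OF c\<eta>] C1_continuous) (use that c(1) in auto)
    then have "integrable lborel (\<lambda>x. indicator (ball 0 1) x *\<^sub>R (indicator (cball 0 1) x *\<^sub>R \<Phi> u x))"
      by (intro integrable_mult_indicator borel_integrable_compact) (auto intro: continuous_on_subset)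
    also have "(\<lambda>x. indicator (ball 0 1) x *\<^sub>R (indicator (cball 0 1) x *\<^sub>R \<Phi> u x)) = (\<lambda>x. indicator (ball 0 1) x * \<Phi> u x)"
      by (auto simp: indicator_def fun_eq_iff)
    finally show ?thesis .
  qed
  show ?thesis
    using eq Bochner_Integration.integral_diff[OF int[OF f(1)] int[OF h(1)]] unfolding \<Phi>_def by linarith
qed

text \<open>Exchanging the components one at a time turns \<open>W\<close> into the identity. The threshold
  \<open>1 / (8 n)\<close> guarantees that a point where all components are small lies well inside the ball.\<close>

theorem degree_integral_pos:
  fixes W :: "'n::finite \<Rightarrow> real^'n \<Rightarrow> real"
  defines "\<delta> \<equiv> 1 / (8 * real CARD('n))"
  assumes Y: "\<And>t. (Y has_real_derivative \<eta> t) (at t)" "\<And>t. (\<eta> has_real_derivative \<eta>' t) (at t)"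
    "continuous_on UNIV \<eta>'" "\<And>t. \<bar>t\<bar> \<ge> \<delta> ==> \<eta> t = 0" "\<And>t. t \<le> -\<delta> ==> Y t = 0" "\<And>t. t \<ge> \<delta> ==> Y t = 1"
    "\<And>t. \<eta> t \<ge> 0" "\<eta> 0 > 0"
  assumes W: "\<And>l. C1 (W l)" "\<And>l x. norm x = 1 ==> \<bar>W l x - x $ l\<bar> \<le> \<delta>"
  shows "(LINT x|lborel. indicator (ball 0 1) x * ((\<Prod>l\<in>UNIV. \<eta> (W l x)) * jac W x))
       = (LINT x|lborel. (\<Prod>l\<in>UNIV. \<eta> ((x::real^'n) $ l)))"
    and "(LINT x|lborel. (\<Prod>l\<in>UNIV. \<eta> ((x::real^'n) $ l))) > 0"
proof -
  let ?n = "real CARD('n)"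
  have n1: "?n \<ge> 1" by (simp add: Suc_leI)
  have \<delta>: "\<delta> > 0" "\<delta> \<le> 1/8" using n1 by (auto simp: \<delta>_def field_simps)
  have Cx: "C1 (\<lambda>x::real^'n. x $ l)" for l by (intro C1_linear bounded_linear_vec_nth)
  define c where "c S k = (if k \<in> S then W k else (\<lambda>x. x $ k))" for S k
  define I where "I c = (LINT x|lborel. indicator (ball 0 1) x * ((\<Prod>l\<in>UNIV. \<eta> (c l x)) * jac c x))" for c :: "'n \<Rightarrow> real^'n \<Rightarrow> real"
  have "I (c S) = I (c {})" for S :: "'n set"
  proof (induction S rule: infinite_finite_induct)
    case (insert k S)
    have eq: "c (insert k S) = (c S)(k := W k)" "c S = (c S)(k := (\<lambda>x. x $ k))" using insert by (auto simp: c_def)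
    have "I ((c S)(k := W k)) = I ((c S)(k := (\<lambda>x. x $ k)))"
      unfolding I_def
      by (rule degree_exchange_component[where c = "c S" and k = k and f = "W k" and h = "\<lambda>x. x $ k" and Y = Y and \<eta> = \<eta> and \<eta>' = \<eta>'])
         (use Y W Cx \<delta>(1) in \<open>auto simp: c_def \<delta>_def[symmetric]\<close>)
    then have "I (c (insert k S)) = I (c S)" by (simp only: eq(1) eq(2)[symmetric])
    then show ?case using insert.IH by simp
  qed auto
  from this[of UNIV] have "I W = I (\<lambda>k x. x $ k)" by (simp add: c_def[abs_def])
  moreover have "jac (\<lambda>k x. x $ k) x = 1" for x :: "real^'n"
  proof -
    have pdx: "pd \<alpha> (\<lambda>x::real^'n. x $ k) x = axis \<alpha> 1 $ k" for \<alpha> k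
      by (rule pd_eqI) (intro bounded_linear_imp_has_derivative bounded_linear_vec_nth)
    have "(\<chi> k \<alpha>. pd \<alpha> (\<lambda>x::real^'n. x $ k) x) = mat 1"
      unfolding pdx by (simp add: vec_eq_iff mat_def axis_def)
    then show ?thesis by (simp add: jac_def)
  qed
  moreover have supp: "(\<Prod>l\<in>UNIV. \<eta> (x $ l)) = 0" if "norm x \<ge> 1" for x :: "real^'n"
  proof (rule ccontr)
    assume "(\<Prod>l\<in>UNIV. \<eta> (x $ l)) \<noteq> 0"
    then have "\<bar>x $ l\<bar> \<le> \<delta>" for l using Y(4)[of "x $ l"] by (auto simp: prod_zero_iff) (meson linear)
    then have "norm x \<le> (\<Sum>l\<in>(UNIV::'n set). \<delta>)"
      by (intro order_trans[OF norm_le_l1_cart] sum_mono) auto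
    also have "\<dots> < 1" using n1 by (simp add: \<delta>_def)
    finally show False using that by simp
  qed
  have "indicator (ball 0 1) x * (\<Prod>l\<in>UNIV. \<eta> (x $ l)) = (\<Prod>l\<in>UNIV. \<eta> (x $ l))" for x :: "real^'n"
    using supp[of x] by (cases "norm x < 1") auto
  ultimately show "(LINT x|lborel. indicator (ball 0 1) x * ((\<Prod>l\<in>UNIV. \<eta> (W l x)) * jac W x))
       = (LINT x|lborel. (\<Prod>l\<in>UNIV. \<eta> ((x::real^'n) $ l)))"
    by (simp add: I_def)
  have c\<eta>: "continuous_on UNIV \<eta>" using Y(2) by (meson DERIV_continuous continuous_at_imp_continuous_on)
  have c: "continuous_on UNIV (\<lambda>x::real^'n. \<Prod>l\<in>UNIV. \<eta> (x $ l))"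
    by (intro continuous_on_prod continuous_on_compose2[OF c\<eta>] C1_continuous Cx) auto
  show "(LINT x|lborel. (\<Prod>l\<in>UNIV. \<eta> ((x::real^'n) $ l))) > 0"
    by (rule integral_pos_continuous[OF c integrable_lborel_compact_support[OF c, of 1], of 0])
       (use supp Y(7,8) in \<open>auto intro!: prod_nonneg prod_pos\<close>)
qed

section \<open>Averages at a fixed scale\<close>

lemma continuous_bounded_on_cball:
  fixes f :: "'a::euclidean_space \<Rightarrow> 'b::real_normed_vector"
  assumes "continuous_on UNIV f"
  obtains M where "M > 0" "\<And>x. norm x \<le> R ==> norm (f x) \<le> M"
proof -
  have "bounded (f ` cball 0 R)"
    by (intro compact_imp_bounded compact_continuous_image continuous_on_subset[OF assms]) auto
  then obtain M where "M > 0" "\<forall>x\<in>f ` cball 0 R. norm x \<le> M" unfolding bounded_pos by blast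
  then show thesis by (intro that[of M]) auto
qed

definition mol :: "'a::euclidean_space \<Rightarrow> real" where
  "mol = (SOME \<rho>. smooth_on UNIV \<rho> \<and> (\<forall>x. \<rho> x \<ge> 0) \<and> (\<forall>x. norm x \<ge> 1/2 --> \<rho> x = 0) \<and>
     (LINT x|lborel. \<rho> x) = 1)"

lemma mol:
  shows "smooth_on UNIV (mol :: 'a::euclidean_space \<Rightarrow> real)" "mol (x::'a) \<ge> 0"
    "norm (x::'a) \<ge> 1/2 ==> mol x = 0" "(LINT x|lborel. mol (x::'a)) = 1"
proof -
  have "\<exists>\<rho> :: 'a \<Rightarrow> real. smooth_on UNIV \<rho> \<and> (\<forall>x. \<rho> x \<ge> 0) \<and> (\<forall>x. norm x \<ge> 1/2 --> \<rho> x = 0) \<and> (LINT x|lborel. \<rho> x) = 1"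
    using mollifier_exists[of "1/2", where 'a = 'a] by (metis half_gt_zero zero_less_one)
  from someI_ex[OF this, folded mol_def]
  show "smooth_on UNIV (mol :: 'a \<Rightarrow> real)" "mol (x::'a) \<ge> 0"
    "norm (x::'a) \<ge> 1/2 ==> mol x = 0" "(LINT x|lborel. mol (x::'a)) = 1" by auto
qed

lemma mol_C1: "C1 (mol :: 'a::euclidean_space \<Rightarrow> real)"
  using mol(1)[where 'a = 'a] Ck_Suc_C1[of 0 "mol :: 'a \<Rightarrow> real"] by (simp add: smooth_on_def del: Ck_on.simps)

lemma mol_support: "\<forall>z::'a::euclidean_space. norm z > 1 --> mol z = 0"
  by (intro allI impI mol(3)) simp

lemma mol_bound:
  obtains C where "C > 0" "\<And>z. \<bar>mol (z::real^'n)\<bar> \<le> C * indicator (ball 0 1) z"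
    "\<And>z \<alpha>. \<bar>pd \<alpha> mol (z::real^'n)\<bar> \<le> C * indicator (ball 0 1) z"
proof -
  obtain M where M: "M > 0" "\<And>\<alpha> x. norm (x::real^'n) \<le> 1 ==> \<bar>pd \<alpha> mol x\<bar> \<le> M"
    using C1_pd_bounded[OF mol_C1, of 1] by metis
  obtain K where K: "\<And>z. norm (z::real^'n) \<le> 1 ==> norm (mol z) \<le> K"
    by (rule continuous_bounded_on_cball[OF C1_continuous[OF mol_C1], of 1]) auto
  show thesis
  proof (rule that[of "max M K"])
    show "\<bar>mol (z::real^'n)\<bar> \<le> max M K * indicator (ball 0 1) z" for z
      using K[of z] mol(3)[of z] by (cases "norm z < 1") (auto simp: max_def)
    show "\<bar>pd \<alpha> mol (z::real^'n)\<bar> \<le> max M K * indicator (ball 0 1) z" for z \<alpha>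
    proof (cases "norm z < 1")
      case False
      then have "pd \<alpha> mol z = 0" by (intro pd_eq_0[of "- cball 0 (1/2)"]) (auto simp: mol(3))
      then show ?thesis using False by simp
    qed (use M(2)[of z \<alpha>] in \<open>auto simp: max_def\<close>)
  qed (use M in auto)
qed

text \<open>The averages are taken over balls shifted towards the origin, so they are defined on the
  whole closed unit ball, and the average at scale 0 is the function itself.\<close>

definition avg :: "real \<Rightarrow> (real^'n \<Rightarrow> 'b::euclidean_space) \<Rightarrow> real^'n \<Rightarrow> 'b" where
  "avg s v x = (LINT z|lborel. mol z *\<^sub>R v ((1 - 2 * s) *\<^sub>R x + s *\<^sub>R z))"

lemma avg_C1: "C1 v ==> C1 (avg s v)"
  unfolding avg_def[abs_def] by (rule averaging_C1[OF C1_continuous[OF mol_C1] mol_support])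

lemma avg_pd:
  "C1 v ==> pd \<alpha> (avg s v) x = (LINT z|lborel. mol z *\<^sub>R ((1 - 2 * s) *\<^sub>R pd \<alpha> v ((1 - 2 * s) *\<^sub>R x + s *\<^sub>R z)))"
  unfolding avg_def[abs_def]
  by (rule pd_eqI[OF averaging_has_derivative[OF C1_continuous[OF mol_C1] mol_support]])

lemma integrable_mol:
  fixes g :: "real^'n \<Rightarrow> 'b::euclidean_space"
  assumes "continuous_on UNIV g"
  shows "integrable lborel (\<lambda>z. mol z *\<^sub>R g ((1 - 2 * s) *\<^sub>R x + s *\<^sub>R z))"
  by (rule integrable_lborel_compact_support[of _ 1])
     (use mol_support in \<open>auto intro!: continuous_intros C1_continuous[OF mol_C1] continuous_on_compose2[OF assms]\<close>)

lemma avg_component: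
  fixes v :: "real^'n \<Rightarrow> real^'m"
  assumes "C1 v"
  shows "avg s v x $ i = avg s (\<lambda>y. v y $ i) x"
  unfolding avg_def
  using integral_bounded_linear[OF bounded_linear_vec_nth[of i] integrable_mol[OF C1_continuous[OF assms], of s x]]
  by simp

lemma avg_minus_const:
  fixes u :: "real^'n \<Rightarrow> real"
  assumes "continuous_on UNIV u"
  shows "avg s u x - c = (LINT z|lborel. mol z * (u ((1 - 2 * s) *\<^sub>R x + s *\<^sub>R z) - c))"
proof -
  have i: "integrable lborel (mol :: real^'n \<Rightarrow> real)"
    using integrable_mol[of "\<lambda>_. 1 :: real" 0 0] by simp
  show ?thesis
    using integrable_mol[OF assms, of s x] i mol(4)[where 'a = "real^'n"]
    by (simp add: avg_def algebra_simps)
qed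

text \<open>With the derivative on the kernel a constant may be subtracted, so the scaled gradient of an
  average is controlled by the oscillation of the function.\<close>

lemma avg_pd_kernel:
  fixes u :: "real^'n \<Rightarrow> real"
  assumes u: "C1 u"
  shows "s * pd \<alpha> (avg s u) x = - (1 - 2 * s) * (LINT z|lborel. pd \<alpha> mol z * (u ((1 - 2 * s) *\<^sub>R x + s *\<^sub>R z) - c))"
proof -
  define m where "m = (1 - 2 * s) *\<^sub>R x"
  define g where "g z = u (m + s *\<^sub>R z) - c" for z
  have Ca: "C1 (\<lambda>z::real^'n. m + s *\<^sub>R z)"
    by (intro C1_add C1_const C1_linear bounded_linear_scaleR_right)
  have Cg: "C1 g" unfolding g_def[abs_def] by (intro C1_diff C1_compose[OF Ca u] C1_const)
  have "((\<lambda>z. m + s *\<^sub>R z) has_derivative (\<lambda>h. s *\<^sub>R h)) (at z)" for z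
    by (auto intro!: derivative_eq_intros)
  from has_derivative_compose[OF this C1_has_derivative[OF u]]
  have "(g has_derivative (\<lambda>h. frechet_derivative u (at (m + s *\<^sub>R z)) (s *\<^sub>R h) - 0)) (at z)" for z
    unfolding g_def[abs_def] by (intro has_derivative_diff has_derivative_const) simp
  then have pdg: "pd \<alpha> g z = s * pd \<alpha> u (m + s *\<^sub>R z)" for z
    using linear_cmul[OF bounded_linear.linear[OF has_derivative_bounded_linear[OF C1_has_derivative[OF u]]]]
    by (subst pd_eqI) auto
  have zero: "pd \<alpha> mol z = 0" if "norm z > 1" for z :: "real^'n"
    using that by (intro pd_eq_0[of "- cball 0 1" z mol 0]) (auto simp: mol(3))
  have i1: "integrable lborel (\<lambda>z. mol z * pd \<alpha> g z)"
    by (rule integrable_lborel_compact_support[of _ 1])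
       (use mol_support in \<open>auto intro!: continuous_on_mult C1_continuous[OF mol_C1] C1_deriv_continuous[OF Cg]\<close>)
  have i2: "integrable lborel (\<lambda>z. pd \<alpha> mol z * g z)"
    by (rule integrable_lborel_compact_support[of _ 1])
       (use zero in \<open>auto intro!: continuous_on_mult C1_continuous[OF Cg] C1_deriv_continuous[OF mol_C1]\<close>)
  have "0 = (LINT z|lborel. pd \<alpha> (\<lambda>z. mol z * g z) z)"
    by (rule integral_pd_compact_support[where R = 1, symmetric, OF C1_mult[OF mol_C1 Cg]]) (simp add: mol(3))
  also have "\<dots> = (LINT z|lborel. mol z * pd \<alpha> g z) + (LINT z|lborel. pd \<alpha> mol z * g z)"
    unfolding pd_mult[OF mol_C1 Cg] by (rule Bochner_Integration.integral_add[OF i1 i2])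
  also have "(LINT z|lborel. mol z * pd \<alpha> g z) = s * (LINT z|lborel. mol z * pd \<alpha> u (m + s *\<^sub>R z))"
    by (simp add: pdg mult.left_commute)
  finally have A: "s * (LINT z|lborel. mol z * pd \<alpha> u (m + s *\<^sub>R z)) = - (LINT z|lborel. pd \<alpha> mol z * g z)" by linarith
  have B: "pd \<alpha> (avg s u) x = (1 - 2 * s) * (LINT z|lborel. mol z * pd \<alpha> u (m + s *\<^sub>R z))"
    by (simp only: avg_pd[OF u] m_def real_scaleR_def mult.left_commute[of "mol _" "1 - 2 * s"] integral_mult_right_zero)
  have "s * pd \<alpha> (avg s u) x = (1 - 2 * s) * (- (LINT z|lborel. pd \<alpha> mol z * g z))"
    unfolding B A[symmetric] by (rule mult.left_commute)
  then show ?thesis unfolding g_def m_def by (simp only: mult_minus_left mult_minus_right)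
qed

text \<open>A weak form of Hoelder's inequality suffices throughout; it follows from the pointwise bound
  \<open>g \<le> \<kappa> + \<kappa>\<^sup>1\<^sup>-\<^sup>p g\<^sup>p\<close> for all \<open>\<kappa> > 0\<close>.\<close>

lemma young_powr:
  fixes g \<kappa> p :: real
  assumes "\<kappa> > 0" "g \<ge> 0" "p \<ge> 1"
  shows "g \<le> \<kappa> + \<kappa> powr (1 - p) * g powr p"
proof (cases "g \<le> \<kappa>")
  case False
  then have "g = g powr (1 - p) * g powr p" using assms by (simp add: powr_add[symmetric])
  also have "\<dots> \<le> \<kappa> powr (1 - p) * g powr p"
    using False assms by (intro mult_right_mono powr_mono2') auto
  finally show ?thesis using assms by linarith
qed (use assms in \<open>simp add: add_increasing2\<close>)

lemma nn_integral_power_mean: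
  fixes g :: "'a \<Rightarrow> real"
  assumes A: "A \<in> sets M" "emeasure M A = ennreal \<mu>" "\<mu> > 0" and g: "g \<in> borel_measurable M" "\<And>x. g x \<ge> 0"
    and p: "p \<ge> 1" and I: "(\<integral>\<^sup>+x\<in>A. ennreal (g x powr p) \<partial>M) \<le> ennreal I" "I \<ge> 0"
  shows "(\<integral>\<^sup>+x\<in>A. ennreal (g x) \<partial>M) \<le> ennreal (2 * \<mu> * (I / \<mu>) powr (1 / p))"
proof (cases "I = 0")
  case True
  with I have "(\<integral>\<^sup>+x\<in>A. ennreal (g x powr p) \<partial>M) = 0" by simp
  then have "AE x in M. ennreal (g x powr p) * indicator A x = 0"
    using A g by (subst (asm) nn_integral_0_iff_AE) auto
  then have "AE x in M. ennreal (g x) * indicator A x = 0"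
    by eventually_elim (use g(2) in \<open>auto simp: indicator_def ennreal_eq_0_iff split: if_splits\<close>)
  then have "(\<integral>\<^sup>+x\<in>A. ennreal (g x) \<partial>M) = (\<integral>\<^sup>+x. 0 \<partial>M)" by (rule nn_integral_cong_AE)
  then show ?thesis by simp
next
  case False
  with I have I0: "I > 0" by simp
  define \<kappa> where "\<kappa> = (I / \<mu>) powr (1 / p)"
  have \<kappa>: "\<kappa> > 0" using I0 A(3) by (simp add: \<kappa>_def)
  have "(\<integral>\<^sup>+x\<in>A. ennreal (g x) \<partial>M) \<le> (\<integral>\<^sup>+x. ennreal \<kappa> * indicator A x + ennreal (\<kappa> powr (1 - p)) * (ennreal (g x powr p) * indicator A x) \<partial>M)"
  proof (rule nn_integral_mono)
    fix x
    have "ennreal (g x) \<le> ennreal (\<kappa> + \<kappa> powr (1 - p) * g x powr p)"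
      by (rule ennreal_leI[OF young_powr[OF \<kappa> g(2) p]])
    also have "\<dots> = ennreal \<kappa> + ennreal (\<kappa> powr (1 - p)) * ennreal (g x powr p)"
      using \<kappa> by (simp add: ennreal_plus ennreal_mult)
    finally show "ennreal (g x) * indicator A x \<le> ennreal \<kappa> * indicator A x + ennreal (\<kappa> powr (1 - p)) * (ennreal (g x powr p) * indicator A x)"
      by (auto simp: indicator_def)
  qed
  also have "\<dots> = ennreal \<kappa> * ennreal \<mu> + ennreal (\<kappa> powr (1 - p)) * (\<integral>\<^sup>+x\<in>A. ennreal (g x powr p) \<partial>M)"
    using A g(1) by (simp add: nn_integral_add nn_integral_cmult)
  also have "\<dots> \<le> ennreal \<kappa> * ennreal \<mu> + ennreal (\<kappa> powr (1 - p)) * ennreal I"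
    by (intro add_mono mult_left_mono I order_refl) auto
  also have "\<dots> = ennreal (\<kappa> * \<mu> + \<kappa> powr (1 - p) * I)"
    using \<kappa> A(3) I0 by (simp add: ennreal_mult ennreal_plus)
  also have "\<kappa> powr (1 - p) * I = \<kappa> * \<mu>"
  proof -
    have "\<kappa> powr p = I / \<mu>" using I0 A(3) p by (simp add: \<kappa>_def powr_powr)
    then have "I = \<kappa> powr p * \<mu>" using A(3) by simp
    then have "\<kappa> powr (1 - p) * I = (\<kappa> powr (1 - p) * \<kappa> powr p) * \<mu>" by simp
    also have "\<kappa> powr (1 - p) * \<kappa> powr p = \<kappa>" using \<kappa> by (simp add: powr_add[symmetric])
    finally show ?thesis .
  qed
  finally show ?thesis by (simp add: \<kappa>_def algebra_simps)
qed


subsection \<open>Oscillation integrals\<close>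

text \<open>The radius \<open>6 t\<close> leaves room for the averaging balls at scales \<open>t\<close> and \<open>t / 2\<close> around a point
  and for their shift towards the origin.\<close>

definition osc :: "real \<Rightarrow> real \<Rightarrow> (real^'n \<Rightarrow> 'b::euclidean_space) \<Rightarrow> real^'n \<Rightarrow> ennreal" where
  "osc p t v y = (\<integral>\<^sup>+y'\<in>ball 0 1 \<inter> ball y (6 * t). ennreal (norm (v y - v y') powr p) \<partial>lborel)"

lemma ball_borel[measurable]: "ball (a::'a::euclidean_space) r \<in> sets borel"
  by simp

lemma osc_measurable[measurable]:
  assumes "continuous_on UNIV v" shows "osc p t v \<in> borel_measurable borel"
proof -
  have [measurable]: "v \<in> borel_measurable borel" by (rule borel_measurable_continuous_onI[OF assms])
  have *: "(\<lambda>(y, y'). ennreal (norm (v y - v y') powr p) * indicator (ball 0 1 \<inter> ball y (6 * t)) y')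
      = (\<lambda>x. ennreal (norm (v (fst x) - v (snd x)) powr p) * (indicator (ball 0 1) (snd x) * indicator {x. dist (fst x) (snd x) < 6 * t} x))"
    by (auto simp: fun_eq_iff indicator_def)
  have "(\<lambda>(y, y'). ennreal (norm (v y - v y') powr p) * indicator (ball 0 1 \<inter> ball y (6 * t)) y')
      \<in> borel_measurable (borel \<Otimes>\<^sub>M borel)"
  proof -
    have [measurable]: "{x :: (real^'n) \<times> (real^'n). dist (fst x) (snd x) < 6 * t} \<in> sets (borel \<Otimes>\<^sub>M borel)"
      unfolding borel_prod by (intro borel_open open_Collect_less continuous_intros)
    show ?thesis unfolding * by measurable
  qed
  also have "borel_measurable (borel \<Otimes>\<^sub>M borel) = borel_measurable (lborel \<Otimes>\<^sub>M lborel)"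
    by (rule measurable_cong_sets) (simp_all cong: sets_pair_measure_cong)
  finally show ?thesis
    unfolding osc_def[abs_def]
    using sigma_finite_measure.borel_measurable_nn_integral[OF sigma_finite_lborel, of "\<lambda>y y'. ennreal (norm (v y - v y') powr p) * indicator (ball 0 1 \<inter> ball y (6 * t)) y'" lborel]
    by simp
qed

lemma osc_finite:
  fixes v :: "real^'n \<Rightarrow> 'b::euclidean_space"
  assumes "continuous_on UNIV v" "p > 0" shows "osc p t v y < \<infinity>"
proof -
  obtain M where M: "\<And>x. norm x \<le> 1 ==> norm (v x) \<le> M"
    by (rule continuous_bounded_on_cball[OF assms(1), of 1]) auto
  have "osc p t v y \<le> (\<integral>\<^sup>+y'. ennreal ((norm (v y) + \<bar>M\<bar>) powr p) * indicator (ball 0 1) (y'::real^'n) \<partial>lborel)"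
    unfolding osc_def
  proof (rule nn_integral_mono)
    fix x :: "real^'n"
    have "norm (v y - v x) \<le> norm (v y) + \<bar>M\<bar>" if "norm x < 1"
      using norm_triangle_ineq4[of "v y" "v x"] M[of x] that by linarith
    then show "ennreal (norm (v y - v x) powr p) * indicator (ball 0 1 \<inter> ball y (6 * t)) x
        \<le> ennreal ((norm (v y) + \<bar>M\<bar>) powr p) * indicator (ball 0 1) x"
      using assms(2) by (auto simp: indicator_def intro!: ennreal_leI powr_mono2)
  qed
  also have "\<dots> = ennreal ((norm (v y) + \<bar>M\<bar>) powr p) * emeasure lborel (ball (0::real^'n) 1)"
    by (simp add: nn_integral_cmult)
  also have "\<dots> < \<infinity>"
    using emeasure_lborel_ball_finite[of "0::real^'n" 1] by (simp add: ennreal_mult_less_top)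
  finally show ?thesis .
qed

lemma nn_integral_ball_rescale:
  fixes f :: "real^'n \<Rightarrow> ennreal"
  assumes "s > 0" "f \<in> borel_measurable borel"
  shows "(\<integral>\<^sup>+z\<in>ball 0 1. f (m + s *\<^sub>R z) \<partial>lborel) = ennreal (1 / s ^ CARD('n)) * (\<integral>\<^sup>+y\<in>ball m s. f y \<partial>lborel)"
proof -
  have "(\<integral>\<^sup>+y\<in>ball m s. f y \<partial>lborel) = ennreal (s ^ CARD('n)) * (\<integral>\<^sup>+z. f (m + s *\<^sub>R z) * indicator (ball m s) (m + s *\<^sub>R z) \<partial>lborel)"
  proof -
    have [measurable]: "f \<in> borel_measurable borel" by fact
    have "(\<lambda>y. f y * indicator (ball m s) y) \<in> borel_measurable borel" by measurable
    from nn_integral_affine[OF _ this, of s m] show ?thesis using assms(1) by simp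
  qed
  also have "(\<lambda>z. f (m + s *\<^sub>R z) * indicator (ball m s) (m + s *\<^sub>R z)) = (\<lambda>z. f (m + s *\<^sub>R z) * indicator (ball 0 1) z)"
    using assms(1) by (auto simp: fun_eq_iff indicator_def dist_norm)
  finally have *: "(\<integral>\<^sup>+y\<in>ball m s. f y \<partial>lborel) = ennreal (s ^ CARD('n)) * (\<integral>\<^sup>+z\<in>ball 0 1. f (m + s *\<^sub>R z) \<partial>lborel)" .
  show ?thesis unfolding * mult.assoc[symmetric]
    using assms(1) by (simp add: ennreal_mult[symmetric])
qed

text \<open>The centre \<open>y\<close> of the oscillation is independent of the point \<open>x\<close> of the average, so the right
  side can be integrated over \<open>y\<close> in a ball.\<close>

lemma avg_osc_bound:
  assumes p: "p \<ge> 1"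
  obtains C where "C > 0" "\<And>(v :: real^'n \<Rightarrow> real^'m) s t x y i \<alpha>. C1 v ==> 0 < s ==> s \<le> t ==> t \<le> 2 * s ==> s \<le> 1/4 ==>
      ball ((1 - 2 * s) *\<^sub>R x) s \<subseteq> ball 0 1 \<inter> ball y (6 * t) ==>
      s * \<bar>pd \<alpha> (avg s (\<lambda>y. v y $ i)) x\<bar> \<le> C * (enn2real (osc p t v y) / t ^ CARD('n)) powr (1 / p)"
    "\<And>(v :: real^'n \<Rightarrow> real^'m) s t x y i. C1 v ==> 0 < s ==> s \<le> t ==> t \<le> 2 * s ==> s \<le> 1/4 ==>
      ball ((1 - 2 * s) *\<^sub>R x) s \<subseteq> ball 0 1 \<inter> ball y (6 * t) ==>
      \<bar>avg s (\<lambda>y. v y $ i) x - v y $ i\<bar> \<le> C * (enn2real (osc p t v y) / t ^ CARD('n)) powr (1 / p)"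
proof -
  let ?n = "CARD('n)"
  obtain B where B: "B > 0" "\<And>z. \<bar>mol (z::real^'n)\<bar> \<le> B * indicator (ball 0 1) z"
    "\<And>z \<alpha>. \<bar>pd \<alpha> mol (z::real^'n)\<bar> \<le> B * indicator (ball 0 1) z" using mol_bound by metis
  define \<mu> where "\<mu> = measure lborel (ball (0::real^'n) 1)"
  have \<mu>: "\<mu> > 0" unfolding \<mu>_def by (rule content_ball_pos) simp
  have e\<mu>: "emeasure lborel (ball (0::real^'n) 1) = ennreal \<mu>"
    unfolding \<mu>_def using emeasure_lborel_ball_finite[of "0::real^'n" 1] by (intro emeasure_eq_ennreal_measure) auto
  define C where "C = B * (2 * \<mu> * (2 ^ ?n / \<mu>) powr (1 / p))"
  have C: "C > 0" using B(1) \<mu> by (simp add: C_def)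
  have key: "\<bar>LINT z|lborel. w z * (v ((1 - 2 * s) *\<^sub>R x + s *\<^sub>R z) $ i - v y $ i)\<bar> \<le> C * (enn2real (osc p t v y) / t ^ ?n) powr (1 / p)"
    if v: "C1 v" and s: "0 < s" "s \<le> t" "t \<le> 2 * s" and sub: "ball ((1 - 2 * s) *\<^sub>R x) s \<subseteq> ball 0 1 \<inter> ball y (6 * t)"
      and w: "continuous_on UNIV w" "\<And>z. \<bar>w z\<bar> \<le> B * indicator (ball 0 1) z"
    for w and v :: "real^'n \<Rightarrow> real^'m" and s t :: real and x y :: "real^'n" and i :: 'm
  proof -
    define m where "m = (1 - 2 * s) *\<^sub>R x"
    note [continuous_intros] = continuous_on_compose2[OF C1_continuous[OF v, of UNIV]]
    define g where "g z = norm (v y - v (m + s *\<^sub>R z))" for z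
    define c0 where "c0 = enn2real (osc p t v y)"
    have c0: "osc p t v y = ennreal c0"
      unfolding c0_def using osc_finite[OF C1_continuous[OF v], of p t y] p by simp
    have c0_nonneg: "c0 \<ge> 0" by (simp add: c0_def)
    have gm: "g \<in> borel_measurable lborel"
      unfolding g_def[abs_def] measurable_lborel2 by (intro borel_measurable_continuous_onI continuous_intros) auto
    have "(\<integral>\<^sup>+z\<in>ball 0 1. ennreal (g z powr p) \<partial>lborel)
        = ennreal (1 / s ^ ?n) * (\<integral>\<^sup>+y'\<in>ball m s. ennreal (norm (v y - v y') powr p) \<partial>lborel)"
      unfolding g_def
      by (rule nn_integral_ball_rescale[OF s(1), of "\<lambda>y'. ennreal (norm (v y - v y') powr p)"])
         (use borel_measurable_continuous_onI[OF C1_continuous[OF v]] in measurable)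
    also have "\<dots> \<le> ennreal (1 / s ^ ?n) * osc p t v y"
      unfolding osc_def using sub m_def
      by (intro mult_left_mono nn_integral_mono) (auto simp: indicator_def)
    also have "\<dots> = ennreal (c0 / s ^ ?n)" using s c0_nonneg by (simp add: c0 ennreal_mult[symmetric])
    finally have "(\<integral>\<^sup>+z\<in>ball 0 1. ennreal (g z) \<partial>lborel) \<le> ennreal (2 * \<mu> * ((c0 / s ^ ?n) / \<mu>) powr (1 / p))"
      by (intro nn_integral_power_mean[OF _ e\<mu> \<mu> gm _ p]) (use c0_nonneg s in \<open>auto simp: g_def\<close>)
    also have "\<dots> \<le> ennreal (2 * \<mu> * ((2 ^ ?n / \<mu>) * (c0 / t ^ ?n)) powr (1 / p))"
    proof (intro ennreal_leI mult_left_mono powr_mono2)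
      have "t ^ ?n \<le> (2 * s) ^ ?n" using s by (intro power_mono) auto
      then have "1 / s ^ ?n \<le> 2 ^ ?n / t ^ ?n" using s by (simp add: field_simps power_mult_distrib)
      then have "(c0 / \<mu>) * (1 / s ^ ?n) \<le> (c0 / \<mu>) * (2 ^ ?n / t ^ ?n)"
        using c0_nonneg \<mu> by (intro mult_left_mono) auto
      then show "c0 / s ^ ?n / \<mu> \<le> 2 ^ ?n / \<mu> * (c0 / t ^ ?n)" by (simp add: mult_ac)
    qed (use c0_nonneg s \<mu> p in auto)
    finally have G: "(\<integral>\<^sup>+z\<in>ball 0 1. ennreal (g z) \<partial>lborel) \<le> ennreal (2 * \<mu> * ((2 ^ ?n / \<mu>) * (c0 / t ^ ?n)) powr (1 / p))" .
    let ?h = "\<lambda>z. w z * (v (m + s *\<^sub>R z) $ i - v y $ i)"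
    have w0: "w z = 0" if "norm z > 1" for z using w(2)[of z] that by simp
    have int: "integrable lborel ?h"
      by (rule integrable_lborel_compact_support[of _ 1])
         (auto intro!: continuous_intros w(1) simp: w0)
    have "ennreal (norm (LINT z|lborel. ?h z)) \<le> (\<integral>\<^sup>+z. norm (?h z) \<partial>lborel)"
      by (rule integral_norm_bound_ennreal[OF int])
    also have "\<dots> \<le> (\<integral>\<^sup>+z. ennreal B * (ennreal (g z) * indicator (ball 0 1) z) \<partial>lborel)"
    proof (rule nn_integral_mono)
      fix z
      have "norm (?h z) \<le> (B * indicator (ball 0 1) z) * g z"
        unfolding real_norm_def abs_mult
      proof (intro mult_mono w(2))
        show "\<bar>v (m + s *\<^sub>R z) $ i - v y $ i\<bar> \<le> g z"
          using component_le_norm_cart[of "v y - v (m + s *\<^sub>R z)" i] by (simp add: g_def abs_minus_commute)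
      qed (use B(1) in auto)
      then have "ennreal (norm (?h z)) \<le> ennreal ((B * indicator (ball 0 1) z) * g z)" by (rule ennreal_leI)
      also have "\<dots> = ennreal B * (ennreal (g z) * indicator (ball 0 1) z)"
        using B(1) by (auto simp: indicator_def ennreal_mult g_def)
      finally show "ennreal (norm (?h z)) \<le> ennreal B * (ennreal (g z) * indicator (ball 0 1) z)" .
    qed
    also have "\<dots> = ennreal B * (\<integral>\<^sup>+z\<in>ball 0 1. ennreal (g z) \<partial>lborel)"
      using gm by (intro nn_integral_cmult) auto
    also have "\<dots> \<le> ennreal B * ennreal (2 * \<mu> * ((2 ^ ?n / \<mu>) * (c0 / t ^ ?n)) powr (1 / p))"
      by (intro mult_left_mono G) auto
    also have "\<dots> = ennreal (C * (c0 / t ^ ?n) powr (1 / p))"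
    proof -
      have pm: "((2 ^ ?n / \<mu>) * (c0 / t ^ ?n)) powr (1 / p) = (2 ^ ?n / \<mu>) powr (1 / p) * (c0 / t ^ ?n) powr (1 / p)"
        by (rule powr_mult)
      show ?thesis unfolding pm C_def using B(1) \<mu> by (simp add: ennreal_mult[symmetric] mult_ac)
    qed
    finally show ?thesis
      using C by (simp add: c0_def m_def)
  qed
  show thesis
  proof (rule that[OF C])
    fix v :: "real^'n \<Rightarrow> real^'m" and s t :: real and x y :: "real^'n" and i :: 'm
    assume a: "C1 v" "0 < s" "s \<le> t" "t \<le> 2 * s" "s \<le> 1/4" "ball ((1 - 2 * s) *\<^sub>R x) s \<subseteq> ball 0 1 \<inter> ball y (6 * t)"
    have u: "C1 (\<lambda>y. v y $ i)" by (rule C1_component[OF a(1)])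
    show "\<bar>avg s (\<lambda>y. v y $ i) x - v y $ i\<bar> \<le> C * (enn2real (osc p t v y) / t ^ ?n) powr (1 / p)"
      using key[OF a(1-4,6) C1_continuous[OF mol_C1] B(2)] by (simp add: avg_minus_const[OF C1_continuous[OF u]])
    fix \<alpha>
    let ?L = "LINT z|lborel. pd \<alpha> mol z * (v ((1 - 2 * s) *\<^sub>R x + s *\<^sub>R z) $ i - v y $ i)"
    have "s * \<bar>pd \<alpha> (avg s (\<lambda>y. v y $ i)) x\<bar> = \<bar>s * pd \<alpha> (avg s (\<lambda>y. v y $ i)) x\<bar>" using a by (simp add: abs_mult)
    also have "\<dots> = \<bar>1 - 2 * s\<bar> * \<bar>?L\<bar>"
      unfolding avg_pd_kernel[OF u, where s = s and \<alpha> = \<alpha> and x = x and c = "v y $ i"] by (simp only: abs_mult abs_minus_cancel)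
    also have "\<dots> \<le> 1 * \<bar>?L\<bar>" using a by (intro mult_right_mono) auto
    also have "\<dots> \<le> C * (enn2real (osc p t v y) / t ^ ?n) powr (1 / p)"
      using key[OF a(1-4,6) C1_deriv_continuous[OF mol_C1] B(3)] by simp
    finally show "s * \<bar>pd \<alpha> (avg s (\<lambda>y. v y $ i)) x\<bar> \<le> C * (enn2real (osc p t v y) / t ^ ?n) powr (1 / p)" .
  qed
qed

definition Osc :: "real \<Rightarrow> real \<Rightarrow> (real^'n \<Rightarrow> 'b::euclidean_space) \<Rightarrow> (real^'n) set \<Rightarrow> ennreal" where
  "Osc p t v A = (\<integral>\<^sup>+y\<in>A. osc p t v y \<partial>lborel)"

lemma shifted_ball_subset:
  fixes x :: "'a::euclidean_space"
  assumes "norm x \<le> 1" "0 < s" "s \<le> t" "s \<le> 1/4"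
  shows "ball ((1 - 2 * s) *\<^sub>R x) s \<subseteq> ball 0 1 \<inter> ball x (6 * t)"
    and "y \<in> ball ((1 - 2 * t) *\<^sub>R x) t ==> ball ((1 - 2 * s) *\<^sub>R x) s \<subseteq> ball 0 1 \<inter> ball y (6 * t)"
proof -
  have *: "norm z < 1 \<and> norm (z - x) < 3 * s" if "z \<in> ball ((1 - 2 * s) *\<^sub>R x) s" for z
  proof -
    have d: "norm (z - (1 - 2 * s) *\<^sub>R x) < s" using that by (simp add: dist_norm norm_minus_commute)
    have "norm ((1 - 2 * s) *\<^sub>R x) \<le> 1 - 2 * s"
      using assms by (simp add: mult_left_le)
    then have 1: "norm z < 1" using norm_triangle_sub[of z "(1 - 2 * s) *\<^sub>R x"] d assms by linarith
    have "z - x = (z - (1 - 2 * s) *\<^sub>R x) - (2 * s) *\<^sub>R x" by (simp add: algebra_simps)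
    then have "norm (z - x) \<le> norm (z - (1 - 2 * s) *\<^sub>R x) + norm ((2 * s) *\<^sub>R x)"
      using norm_triangle_ineq4 by metis
    also have "norm ((2 * s) *\<^sub>R x) \<le> 2 * s" using assms by (simp add: mult_left_le)
    finally show ?thesis using 1 d by linarith
  qed
  show "ball ((1 - 2 * s) *\<^sub>R x) s \<subseteq> ball 0 1 \<inter> ball x (6 * t)"
  proof
    fix z assume "z \<in> ball ((1 - 2 * s) *\<^sub>R x) s"
    from *[OF this] show "z \<in> ball 0 1 \<inter> ball x (6 * t)" using assms by (simp add: dist_norm norm_minus_commute)
  qed
  assume y: "y \<in> ball ((1 - 2 * t) *\<^sub>R x) t"
  have d: "norm (y - (1 - 2 * t) *\<^sub>R x) < t" using y by (simp add: dist_norm norm_minus_commute)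
  have "y - x = (y - (1 - 2 * t) *\<^sub>R x) - (2 * t) *\<^sub>R x" by (simp add: algebra_simps)
  then have "norm (y - x) \<le> norm (y - (1 - 2 * t) *\<^sub>R x) + norm ((2 * t) *\<^sub>R x)"
    using norm_triangle_ineq4 by metis
  also have "norm ((2 * t) *\<^sub>R x) \<le> 2 * t" using assms by (simp add: mult_left_le)
  finally have yx: "norm (y - x) < 3 * t" using d by linarith
  show "ball ((1 - 2 * s) *\<^sub>R x) s \<subseteq> ball 0 1 \<inter> ball y (6 * t)"
  proof
    fix z assume "z \<in> ball ((1 - 2 * s) *\<^sub>R x) s"
    from *[OF this] have "norm z < 1" "norm (y - z) < 6 * t"
      using yx norm_triangle_ineq4[of "y - x" "z - x"] assms by (auto simp: norm_minus_commute)
    then show "z \<in> ball 0 1 \<inter> ball y (6 * t)" by (simp add: dist_norm)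
  qed
qed

lemma nn_integral_osc_powr:
  fixes v :: "real^'n \<Rightarrow> 'b::euclidean_space"
  assumes v: "continuous_on UNIV v" and p: "p \<ge> 1" and t: "t > 0" and A: "A \<in> sets borel"
  shows "(\<integral>\<^sup>+x\<in>A. ennreal (((enn2real (osc p t v x) / t ^ CARD('n)) powr (1 / p)) powr p) \<partial>lborel)
    = ennreal (1 / t ^ CARD('n)) * Osc p t v A"
proof -
  have "ennreal (((enn2real (osc p t v x) / t ^ CARD('n)) powr (1 / p)) powr p) = ennreal (1 / t ^ CARD('n)) * osc p t v x" for x
  proof -
    obtain r where "osc p t v x = ennreal r" "r \<ge> 0"
      using osc_finite[OF v, of p t x] p by (cases "osc p t v x") auto
    then show ?thesis using p t by (simp add: powr_powr ennreal_mult[symmetric])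
  qed
  then show ?thesis
    unfolding Osc_def using osc_measurable[OF v, of p t] A
    by (simp add: mult.assoc nn_integral_cmult)
qed

text \<open>If the oscillation over a ball at the scale of the ball is small, then so is the scaled
  gradient of the average over it.\<close>

lemma avg_pd_bound:
  assumes p: "p \<ge> 1"
  obtains C where "C > 0" "\<And>(v :: real^'n \<Rightarrow> real^'m) t x i \<alpha> \<delta>. C1 v ==> 0 < t ==> t \<le> 1/4 ==> norm x \<le> 1 ==> \<delta> \<ge> 0 ==>
      Osc p t v (ball ((1 - 2 * t) *\<^sub>R x) t) \<le> ennreal (\<delta> * t ^ (2 * CARD('n))) ==>
      t * \<bar>pd \<alpha> (avg t (\<lambda>y. v y $ i)) x\<bar> \<le> C * \<delta> powr (1 / p)"
proof -
  let ?n = "CARD('n)"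
  obtain C where C: "C > 0" "\<And>(v :: real^'n \<Rightarrow> real^'m) s t x y i \<alpha>. C1 v ==> 0 < s ==> s \<le> t ==> t \<le> 2 * s ==> s \<le> 1/4 ==>
      ball ((1 - 2 * s) *\<^sub>R x) s \<subseteq> ball 0 1 \<inter> ball y (6 * t) ==>
      s * \<bar>pd \<alpha> (avg s (\<lambda>y. v y $ i)) x\<bar> \<le> C * (enn2real (osc p t v y) / t ^ CARD('n)) powr (1 / p)"
  proof (rule avg_osc_bound[OF p, where 'n = 'n and 'm = 'm], goal_cases)
    case (1 C) then show ?thesis by (intro that[of C]) auto
  qed
  define \<mu> where "\<mu> = unit_ball_vol (real DIM(real^'n))"
  have \<mu>: "\<mu> > 0" by (simp add: \<mu>_def)
  show thesis
  proof (rule that[of "C * (1 / \<mu>) powr (1 / p)"])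
    fix v :: "real^'n \<Rightarrow> real^'m" and t x i \<alpha> \<delta>
    assume a: "C1 v" "0 < t" "t \<le> 1/4" "norm x \<le> 1" "\<delta> \<ge> 0"
      and O: "Osc p t v (ball ((1 - 2 * t) *\<^sub>R x) t) \<le> ennreal (\<delta> * t ^ (2 * ?n))"
    define L where "L = t * \<bar>pd \<alpha> (avg t (\<lambda>y. v y $ i)) x\<bar> / C"
    let ?A = "ball ((1 - 2 * t) *\<^sub>R x) t"
    have L0: "L \<ge> 0" using a C(1) by (simp add: L_def)
    have L: "L \<le> (enn2real (osc p t v y) / t ^ ?n) powr (1 / p)" if "y \<in> ?A" for y
      using C(2)[OF a(1,2) order_refl _ a(3) shifted_ball_subset(2)[OF a(4,2) order_refl a(3) that], where \<alpha> = \<alpha> and i = i] a C(1)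
      by (simp add: L_def field_simps)
    have "ennreal (L powr p) * ennreal (\<mu> * t ^ ?n) = ennreal (L powr p) * emeasure lborel ?A"
      using a by (simp add: emeasure_ball \<mu>_def)
    also have "\<dots> = (\<integral>\<^sup>+y\<in>?A. ennreal (L powr p) \<partial>lborel)" by (simp add: nn_integral_cmult)
    also have "\<dots> \<le> (\<integral>\<^sup>+y\<in>?A. ennreal (((enn2real (osc p t v y) / t ^ ?n) powr (1 / p)) powr p) \<partial>lborel)"
      by (rule nn_integral_mono) (use L L0 p in \<open>auto simp: indicator_def intro!: ennreal_leI powr_mono2\<close>)
    also have "\<dots> = ennreal (1 / t ^ ?n) * Osc p t v ?A"
      by (rule nn_integral_osc_powr[OF C1_continuous[OF a(1)] p a(2)]) simp
    also have "\<dots> \<le> ennreal (1 / t ^ ?n) * ennreal (\<delta> * t ^ (2 * ?n))"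
      by (intro mult_left_mono O) auto
    also have "\<dots> = ennreal (\<delta> * t ^ ?n)"
      using a by (simp add: ennreal_mult[symmetric] mult_2 power_add)
    finally have "L powr p * (\<mu> * t ^ ?n) \<le> \<delta> * t ^ ?n"
      using a \<mu> by (simp add: ennreal_mult[symmetric])
    then have "L powr p \<le> \<delta> / \<mu>" using a \<mu> by (simp add: field_simps)
    then have "(L powr p) powr (1 / p) \<le> (\<delta> / \<mu>) powr (1 / p)" using p by (intro powr_mono2) auto
    then have "L \<le> (\<delta> / \<mu>) powr (1 / p)" using p L0 by (simp add: powr_powr)
    also have "\<dots> = (1 / \<mu>) powr (1 / p) * \<delta> powr (1 / p)" using a \<mu> by (simp add: powr_mult[symmetric])
    finally show "t * \<bar>pd \<alpha> (avg t (\<lambda>y. v y $ i)) x\<bar> \<le> C * (1 / \<mu>) powr (1 / p) * \<delta> powr (1 / p)"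
      using C(1) by (simp add: L_def field_simps)
  qed (use C(1) \<mu> in simp)
qed

lemma avg_close:
  fixes u :: "real^'n \<Rightarrow> real"
  assumes u: "continuous_on UNIV u" and e: "e > 0"
  obtains s0 where "s0 > 0" "\<And>s x. 0 \<le> s ==> s \<le> s0 ==> norm x \<le> 1 ==> \<bar>avg s u x - u x\<bar> \<le> e"
proof -
  have "uniformly_continuous_on (cball 0 4) u"
    by (intro compact_uniformly_continuous continuous_on_subset[OF u]) auto
  then obtain d where d: "d > 0" "\<And>x y. x \<in> cball 0 4 ==> y \<in> cball 0 4 ==> dist y x < d ==> dist (u y) (u x) < e"
    unfolding uniformly_continuous_on_def using e by metis
  show thesis
  proof (rule that[of "min 1 (d / 4)"])
    fix s and x :: "real^'n" assume s: "0 \<le> s" "s \<le> min 1 (d / 4)" and x: "norm x \<le> 1"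
    let ?h = "\<lambda>z. mol z * (u ((1 - 2 * s) *\<^sub>R x + s *\<^sub>R z) - u x)"
    have b: "\<bar>?h z\<bar> \<le> mol z * e" for z
    proof (cases "norm z < 1")
      case True
      have "(1 - 2 * s) *\<^sub>R x + s *\<^sub>R z - x = s *\<^sub>R (z - 2 *\<^sub>R x)" by (simp add: algebra_simps)
      moreover have "norm (z - 2 *\<^sub>R x) \<le> 3" using norm_triangle_ineq4[of z "2 *\<^sub>R x"] True x by simp
      ultimately have "dist ((1 - 2 * s) *\<^sub>R x + s *\<^sub>R z) x \<le> s * 3"
        using s(1) by (simp add: dist_norm mult_left_mono)
      then have d1: "dist ((1 - 2 * s) *\<^sub>R x + s *\<^sub>R z) x < d" "dist ((1 - 2 * s) *\<^sub>R x + s *\<^sub>R z) x \<le> 3"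
        using s d(1) by (auto simp: min_def split: if_splits)
      then have "norm ((1 - 2 * s) *\<^sub>R x + s *\<^sub>R z) \<le> 4"
        using norm_triangle_sub[of "(1 - 2 * s) *\<^sub>R x + s *\<^sub>R z" x] x by (simp add: dist_norm)
      then have "dist (u ((1 - 2 * s) *\<^sub>R x + s *\<^sub>R z)) (u x) < e" using x d1 by (intro d(2)) auto
      then show ?thesis using mol(2)[of z] by (auto simp: dist_real_def abs_mult intro!: mult_left_mono)
    next
      case False
      then show ?thesis by (simp add: mol(3))
    qed
    have im: "integrable lborel (mol :: real^'n \<Rightarrow> real)"
      using integrable_mol[of "\<lambda>_. 1 :: real" 0 0] by simp
    have ih: "integrable lborel ?h"
      using integrable_mol[OF u, of s x] im by (simp add: algebra_simps)
    have "\<bar>avg s u x - u x\<bar> \<le> (LINT z|lborel. \<bar>?h z\<bar>)"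
      unfolding avg_minus_const[OF u] by (rule integral_abs_bound)
    also have "\<dots> \<le> (LINT z|lborel. mol (z::real^'n) * e)"
      by (intro integral_mono b) (use ih im in auto)
    also have "\<dots> = e" using mol(4)[where 'a = "real^'n"] by simp
    finally show "\<bar>avg s u x - u x\<bar> \<le> e" .
  qed (use d(1) in auto)
qed

lemma avg_pd_eq:
  fixes u :: "real^'n \<Rightarrow> real"
  assumes "C1 u" shows "pd \<alpha> (avg s u) x = (1 - 2 * s) * avg s (pd \<alpha> u) x"
  unfolding avg_pd[OF assms] avg_def
  by (simp only: real_scaleR_def mult.left_commute[of "mol _" "1 - 2 * s"] integral_mult_right_zero)

section \<open>Boundary values of averages\<close>

lemma sgn_borel[measurable]: "(sgn :: 'a::euclidean_space \<Rightarrow> 'a) \<in> borel_measurable borel"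
  unfolding sgn_div_norm[abs_def] by measurable

lemma cball_borel[measurable]: "cball (a::'a::euclidean_space) r \<in> sets borel"
  by simp

text \<open>The cone over a spherical cap of radius \<open>t\<close> is covered by about \<open>1/t\<close> balls of radius
  comparable to \<open>t\<close>, and contains about \<open>1/t\<close> disjoint ones.\<close>

lemma cap_volume_upper:
  obtains C where "C > 0" "\<And>t (y::real^'n). 0 < t ==> t \<le> 1/4 ==>
    emeasure lborel {x \<in> ball 0 1 - {0}. norm (y - (1 - 2 * t) *\<^sub>R sgn x) < t} \<le> ennreal (C * t ^ (CARD('n) - 1))"
proof -
  let ?n = "CARD('n)"
  define \<mu> where "\<mu> = unit_ball_vol (real DIM(real^'n))"
  have \<mu>: "\<mu> > 0" by (simp add: \<mu>_def)
  show thesis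
  proof (rule that[of "2 * 5 ^ ?n * \<mu>"])
    fix t :: real and y :: "real^'n" assume t: "0 < t" "t \<le> 1/4"
    let ?S = "{x \<in> ball 0 1 - {0}. norm (y - (1 - 2 * t) *\<^sub>R sgn x) < t}"
    show "emeasure lborel ?S \<le> ennreal (2 * 5 ^ ?n * \<mu> * t ^ (?n - 1))"
    proof (cases "?S = {}")
      case False
      then obtain x1 where x1: "x1 \<in> ?S" by blast
      define e where "e = sgn x1"
      have e: "norm e = 1" using x1 by (simp add: e_def norm_sgn)
      define N where "N = nat \<lfloor>1 / t\<rfloor>"
      have sub: "?S \<subseteq> (\<Union>i\<in>{..N}. cball ((real i * t) *\<^sub>R e) (5 * t))"
      proof
        fix x assume x: "x \<in> ?S"
        define i where "i = nat \<lfloor>norm x / t\<rfloor>"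
        have "norm x / t \<le> 1 / t" using x t by (simp add: divide_right_mono)
        then have iN: "i \<le> N" unfolding i_def N_def by (intro nat_mono floor_mono)
        have "real i = of_int \<lfloor>norm x / t\<rfloor>" unfolding i_def using t by simp
        then have "real i \<le> norm x / t" "norm x / t < real i + 1" by linarith+
        then have i: "\<bar>norm x - real i * t\<bar> \<le> t" using t by (simp add: field_simps)
        have "norm ((1 - 2 * t) *\<^sub>R (sgn x - e)) = norm ((y - (1 - 2 * t) *\<^sub>R sgn x1) - (y - (1 - 2 * t) *\<^sub>R sgn x))"
          by (simp add: e_def scaleR_diff_right)
        also have "\<dots> \<le> norm (y - (1 - 2 * t) *\<^sub>R sgn x1) + norm (y - (1 - 2 * t) *\<^sub>R sgn x)" by (rule norm_triangle_ineq4)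
        also have "\<dots> < 2 * t" using x x1 by simp
        finally have "(1 - 2 * t) * norm (sgn x - e) < 2 * t" using t by simp
        moreover have "(1/2) * norm (sgn x - e) \<le> (1 - 2 * t) * norm (sgn x - e)"
          using t by (intro mult_right_mono) auto
        ultimately have se: "norm (sgn x - e) \<le> 4 * t" by linarith
        have "x - (real i * t) *\<^sub>R e = norm x *\<^sub>R (sgn x - e) + (norm x - real i * t) *\<^sub>R e"
          using x by (simp add: sgn_div_norm algebra_simps)
        then have "norm (x - (real i * t) *\<^sub>R e) \<le> norm (norm x *\<^sub>R (sgn x - e)) + norm ((norm x - real i * t) *\<^sub>R e)"
          by (metis norm_triangle_ineq)
        also have "\<dots> = norm x * norm (sgn x - e) + \<bar>norm x - real i * t\<bar>" by (simp add: e)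
        also have "\<dots> \<le> 1 * (4 * t) + t" using x se i by (intro add_mono mult_mono) auto
        finally have "x \<in> cball ((real i * t) *\<^sub>R e) (5 * t)" by (simp add: dist_norm norm_minus_commute)
        then show "x \<in> (\<Union>i\<in>{..N}. cball ((real i * t) *\<^sub>R e) (5 * t))" using iN by blast
      qed
      have "emeasure lborel ?S \<le> emeasure lborel (\<Union>i\<in>{..N}. cball ((real i * t) *\<^sub>R e) (5 * t))"
        by (rule emeasure_mono[OF sub]) auto
      also have "\<dots> \<le> (\<Sum>i\<in>{..N}. emeasure lborel (cball ((real i * t) *\<^sub>R e) (5 * t)))"
        by (rule emeasure_subadditive_finite) auto
      also have "\<dots> = ennreal (real (N + 1) * (\<mu> * (5 * t) ^ ?n))"
        using t \<mu> by (simp add: emeasure_cball \<mu>_def ennreal_of_nat_eq_real_of_nat ennreal_mult[symmetric] del: of_nat_Suc)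
      also have "\<dots> \<le> ennreal ((2 / t) * (\<mu> * (5 * t) ^ ?n))"
      proof (intro ennreal_leI mult_right_mono)
        have "real N \<le> 1 / t" unfolding N_def using t by simp
        moreover have "1 \<le> 1 / t" using t by simp
        ultimately show "real (N + 1) \<le> 2 / t" by simp
      qed (use t \<mu> in auto)
      also have "(2 / t) * (\<mu> * (5 * t) ^ ?n) = 2 * 5 ^ ?n * \<mu> * t ^ (?n - 1)"
        using t by (cases ?n) (auto simp: power_mult_distrib)
      finally show ?thesis .
    next
      case True
      then show ?thesis by (simp only: emeasure_empty) simp
    qed
  qed (use \<mu> in auto)
qed

lemma cap_volume_lower:
  obtains c where "c > 0" "\<And>t (\<theta>::real^'n). 0 < t ==> t \<le> 1/4 ==> norm \<theta> = 1 ==>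
    ennreal (c * t ^ (CARD('n) - 1)) \<le> emeasure lborel {x \<in> ball 0 1 - {0}. norm (sgn x - \<theta>) < 4 * t}"
proof -
  let ?n = "CARD('n)"
  define \<mu> where "\<mu> = unit_ball_vol (real DIM(real^'n))"
  have \<mu>: "\<mu> > 0" by (simp add: \<mu>_def)
  show thesis
  proof (rule that[of "\<mu> / (4 * 2 ^ ?n)"])
    fix t :: real and \<theta> :: "real^'n" assume t: "0 < t" "t \<le> 1/4" and \<theta>: "norm \<theta> = 1"
    let ?S = "{x \<in> ball 0 1 - {0}. norm (sgn x - \<theta>) < 4 * t}"
    define N where "N = nat \<lfloor>1 / (2 * t)\<rfloor>"
    define r where "r i = 1/2 + t / 2 + real i * t" for i :: nat
    have N: "real N \<le> 1 / (2 * t)" "1 / (4 * t) \<le> real N"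
    proof -
      show "real N \<le> 1 / (2 * t)" unfolding N_def using t by simp
      have "real N \<ge> 1 / (2 * t) - 1" unfolding N_def by linarith
      moreover have "1 / (2 * t) - 1 / (4 * t) = 1 / (4 * t)" using t by (simp add: field_simps)
      moreover have "1 / (4 * t) \<ge> 1" using t by simp
      ultimately show "1 / (4 * t) \<le> real N" by linarith
    qed
    have r: "1/2 + t/2 \<le> r i" "r i + t / 2 \<le> 1" if "i < N" for i
    proof -
      show "1/2 + t/2 \<le> r i" using t by (simp add: r_def)
      have "(real i + 1) * t \<le> real N * t" using that t by (intro mult_right_mono) auto
      also have "\<dots> \<le> 1 / (2 * t) * t" using N t by (intro mult_right_mono) auto
      also have "\<dots> = 1/2" using t by simp
      finally show "r i + t / 2 \<le> 1" by (simp add: r_def algebra_simps)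
    qed
    have sub: "(\<Union>i\<in>{..<N}. ball (r i *\<^sub>R \<theta>) (t / 2)) \<subseteq> ?S"
    proof
      fix x assume "x \<in> (\<Union>i\<in>{..<N}. ball (r i *\<^sub>R \<theta>) (t / 2))"
      then obtain i where i: "i < N" "norm (x - r i *\<^sub>R \<theta>) < t / 2" by (auto simp: dist_norm norm_minus_commute)
      have nr: "norm (r i *\<^sub>R \<theta>) = r i" using r(1)[OF i(1)] t \<theta> by simp
      have x: "norm x < 1" "norm x > 1/2" "\<bar>r i - norm x\<bar> < t / 2"
        using norm_triangle_ineq3[of x "r i *\<^sub>R \<theta>"] i(2) r[OF i(1)] nr by linarith+
      have "norm x *\<^sub>R (sgn x - \<theta>) = (x - r i *\<^sub>R \<theta>) + (r i - norm x) *\<^sub>R \<theta>"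
      proof -
        have "x \<noteq> 0" using x by auto
        then show ?thesis by (simp add: sgn_div_norm algebra_simps)
      qed
      then have "norm (norm x *\<^sub>R (sgn x - \<theta>)) \<le> norm (x - r i *\<^sub>R \<theta>) + norm ((r i - norm x) *\<^sub>R \<theta>)"
        by (metis norm_triangle_ineq)
      also have "\<dots> < t" using i x \<theta> by simp
      finally have "norm x * norm (sgn x - \<theta>) < t" by simp
      moreover have "(1/2) * norm (sgn x - \<theta>) \<le> norm x * norm (sgn x - \<theta>)"
        using x by (intro mult_right_mono) auto
      ultimately have "norm (sgn x - \<theta>) < 4 * t" using t by linarith
      then show "x \<in> ?S" using x by auto
    qed
    have disj: "disjoint_family_on (\<lambda>i. ball (r i *\<^sub>R \<theta>) (t / 2)) {..<N}"
      unfolding disjoint_family_on_def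
    proof (intro ballI impI)
      fix i j :: nat assume "i \<noteq> j"
      then have "1 \<le> \<bar>real i - real j\<bar>" by linarith
      then have "t \<le> \<bar>real i - real j\<bar> * t" using t by simp
      also have "\<dots> = dist (r i *\<^sub>R \<theta>) (r j *\<^sub>R \<theta>)"
        using t \<theta> by (simp add: dist_norm scaleR_diff_left[symmetric] r_def left_diff_distrib[symmetric] abs_mult)
      finally have "t \<le> dist (r i *\<^sub>R \<theta>) (r j *\<^sub>R \<theta>)" .
      moreover have "dist (r i *\<^sub>R \<theta>) (r j *\<^sub>R \<theta>) < t" if "z \<in> ball (r i *\<^sub>R \<theta>) (t / 2)" "z \<in> ball (r j *\<^sub>R \<theta>) (t / 2)" for z
        using that dist_triangle2[of "r i *\<^sub>R \<theta>" "r j *\<^sub>R \<theta>" z] by simp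
      ultimately show "ball (r i *\<^sub>R \<theta>) (t / 2) \<inter> ball (r j *\<^sub>R \<theta>) (t / 2) = {}" by force
    qed
    have "\<mu> / (4 * 2 ^ ?n) * t ^ (?n - 1) = (1 / (4 * t)) * (\<mu> * (t / 2) ^ ?n)"
      using t by (cases ?n) (auto simp: power_divide field_simps)
    also have "\<dots> \<le> real N * (\<mu> * (t / 2) ^ ?n)" using N t \<mu> by (intro mult_right_mono) auto
    finally have "ennreal (\<mu> / (4 * 2 ^ ?n) * t ^ (?n - 1)) \<le> ennreal (real N * (\<mu> * (t / 2) ^ ?n))"
      by (rule ennreal_leI)
    also have "\<dots> = (\<Sum>i\<in>{..<N}. emeasure lborel (ball (r i *\<^sub>R \<theta>) (t / 2)))"
      using t \<mu> by (simp add: emeasure_ball \<mu>_def ennreal_of_nat_eq_real_of_nat ennreal_mult[symmetric])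
    also have "\<dots> = emeasure lborel (\<Union>i\<in>{..<N}. ball (r i *\<^sub>R \<theta>) (t / 2))"
      by (rule sum_emeasure[OF _ disj]) auto
    also have "\<dots> \<le> emeasure lborel ?S"
    proof (rule emeasure_mono[OF sub])
      have "Measurable.pred borel (\<lambda>x. norm (sgn x - \<theta>) < 4 * t)" by measurable
      then have [measurable]: "{x. norm (sgn x - \<theta>) < 4 * t} \<in> sets borel" by (simp add: pred_def)
      have "?S = (ball 0 1 - {0}) \<inter> {x. norm (sgn x - \<theta>) < 4 * t}" by auto
      then show "?S \<in> sets lborel" by (simp only: sets_lborel) measurable
    qed
    finally show "ennreal (\<mu> / (4 * 2 ^ ?n) * t ^ (?n - 1)) \<le> emeasure lborel ?S" .
  qed (use \<mu> in auto)
qed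

text \<open>The oscillation is averaged over the balls of radius \<open>t\<close> around \<open>(1 - 2 t) \<theta>\<close>, which lie in the
  boundary layer of width \<open>3 t\<close>. Each point of the layer belongs to the balls of a cap of directions of
  size about \<open>t\<^sup>n\<^sup>-\<^sup>1\<close>, and this produces the power of \<open>t\<close> on the right.\<close>

lemma avg_step_on_sphere:
  assumes p: "p \<ge> 1"
  obtains C where "C > 0" "\<And>(v :: real^'n \<Rightarrow> real^'m) t i \<delta>. C1 v ==> 0 < t ==> t \<le> 1/4 ==> \<delta> \<ge> 0 ==>
      Osc p t v (ball 0 1 - cball 0 (1 - 3 * t)) \<le> ennreal (\<delta> * t ^ (2 * CARD('n))) ==>
      (\<integral>\<^sup>+x\<in>ball 0 1 - {0}. ennreal (\<bar>avg t (\<lambda>y. v y $ i) (sgn x) - avg (t/2) (\<lambda>y. v y $ i) (sgn x)\<bar> powr p) \<partial>lborel)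
        \<le> ennreal (C * \<delta> * t ^ (CARD('n) - 1))"
proof -
  let ?n = "CARD('n)"
  obtain C1' where C1': "C1' > 0" "\<And>(v :: real^'n \<Rightarrow> real^'m) s t x y i. C1 v ==> 0 < s ==> s \<le> t ==> t \<le> 2 * s ==> s \<le> 1/4 ==>
      ball ((1 - 2 * s) *\<^sub>R x) s \<subseteq> ball 0 1 \<inter> ball y (6 * t) ==>
      \<bar>avg s (\<lambda>y. v y $ i) x - v y $ i\<bar> \<le> C1' * (enn2real (osc p t v y) / t ^ CARD('n)) powr (1 / p)"
  proof (rule avg_osc_bound[OF p, where 'n = 'n and 'm = 'm], goal_cases)
    case (1 C) then show ?thesis by (intro that[of C]) auto
  qed
  obtain C2 where C2: "C2 > 0" "\<And>t (y::real^'n). 0 < t ==> t \<le> 1/4 ==>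
    emeasure lborel {x \<in> ball 0 1 - {0}. norm (y - (1 - 2 * t) *\<^sub>R sgn x) < t} \<le> ennreal (C2 * t ^ (CARD('n) - 1))"
  proof (rule cap_volume_upper[where 'n = 'n], goal_cases)
    case (1 C) then show ?thesis by (intro that[of C]) auto
  qed
  define \<mu> where "\<mu> = unit_ball_vol (real DIM(real^'n))"
  have \<mu>: "\<mu> > 0" by (simp add: \<mu>_def)
  define K where "K = (2 * C1') powr p"
  have K: "K > 0" using C1' by (simp add: K_def)
  show thesis
  proof (rule that[of "K * C2 / \<mu>"])
    fix v :: "real^'n \<Rightarrow> real^'m" and t \<delta> :: real and i :: 'm
    assume a: "C1 v" "0 < t" "t \<le> 1/4" "\<delta> \<ge> 0"
      and O: "Osc p t v (ball 0 1 - cball 0 (1 - 3 * t)) \<le> ennreal (\<delta> * t ^ (2 * ?n))"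
    let ?L = "ball 0 1 - cball (0::real^'n) (1 - 3 * t)"
    let ?B = "ball 0 1 - {0::real^'n}"
    define D where "D \<theta> = \<bar>avg t (\<lambda>y. v y $ i) \<theta> - avg (t/2) (\<lambda>y. v y $ i) \<theta>\<bar>" for \<theta>
    define P where "P x y \<longleftrightarrow> norm (y - (1 - 2 * t) *\<^sub>R sgn x) < t" for x y :: "real^'n"
    have om[measurable]: "osc p t v \<in> borel_measurable borel" by (rule osc_measurable[OF C1_continuous[OF a(1)]])
    have [measurable]: "{x. P (fst x) (snd x)} \<in> sets (borel \<Otimes>\<^sub>M borel)"
      "{y. P x y} \<in> sets borel" "{x. P x y} \<in> sets borel" for x y
    proof -
      have "Measurable.pred (borel \<Otimes>\<^sub>M borel) (\<lambda>x. P (fst x) (snd x))"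
        "Measurable.pred borel (\<lambda>y. P x y)" "Measurable.pred borel (\<lambda>x. P x y)"
        unfolding P_def by measurable
      then show "{x. P (fst x) (snd x)} \<in> sets (borel \<Otimes>\<^sub>M borel)"
        "{y. P x y} \<in> sets borel" "{x. P x y} \<in> sets borel"
        by (simp_all add: pred_def space_pair_measure)
    qed
    have Dm[measurable]: "(\<lambda>x. D (sgn x)) \<in> borel_measurable borel"
    proof -
      have "D \<in> borel_measurable borel" unfolding D_def[abs_def]
        by (intro borel_measurable_continuous_onI continuous_intros C1_continuous avg_C1 C1_component a(1))
      then show ?thesis by measurable
    qed
    have D: "ennreal (D \<theta> powr p) \<le> ennreal (K / t ^ ?n) * osc p t v y" if "norm \<theta> = 1" "y \<in> ball ((1 - 2 * t) *\<^sub>R \<theta>) t" for \<theta> y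
    proof -
      let ?Q = "(enn2real (osc p t v y) / t ^ ?n) powr (1 / p)"
      have "\<bar>avg t (\<lambda>y. v y $ i) \<theta> - v y $ i\<bar> \<le> C1' * ?Q"
        using a that by (intro C1'(2) shifted_ball_subset(2)) auto
      moreover have "\<bar>avg (t/2) (\<lambda>y. v y $ i) \<theta> - v y $ i\<bar> \<le> C1' * ?Q"
        using a that by (intro C1'(2) shifted_ball_subset(2)) auto
      ultimately have "D \<theta> \<le> (2 * C1') * ?Q" unfolding D_def by linarith
      then have "D \<theta> powr p \<le> ((2 * C1') * ?Q) powr p" using p by (intro powr_mono2) (auto simp: D_def)
      also have "\<dots> = K * (enn2real (osc p t v y) / t ^ ?n)"
        using p C1'(1) a by (simp add: powr_mult powr_powr K_def)
      finally have "ennreal (D \<theta> powr p) \<le> ennreal (K * (enn2real (osc p t v y) / t ^ ?n))" by (rule ennreal_leI)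
      moreover obtain r where "osc p t v y = ennreal r" "r \<ge> 0"
        using osc_finite[OF C1_continuous[OF a(1)], of p t y] p by (cases "osc p t v y") auto
      ultimately show ?thesis using K a by (simp add: ennreal_mult[symmetric])
    qed
    have S: "{x \<in> ?B. P x y} = {x \<in> ball 0 1 - {0}. norm (y - (1 - 2 * t) *\<^sub>R sgn x) < t}" for y by (simp add: P_def)
    have cap: "(\<integral>\<^sup>+x. indicator ?B x * indicator {x. P x y} x \<partial>lborel) \<le> ennreal (C2 * t ^ (?n - 1)) * indicator ?L y" for y
    proof -
      have "(\<integral>\<^sup>+x. indicator ?B x * indicator {x. P x y} x \<partial>lborel) = (\<integral>\<^sup>+x. indicator {x \<in> ?B. P x y} x \<partial>lborel)"
        by (intro nn_integral_cong) (auto simp: indicator_def)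
      also have "\<dots> = emeasure lborel {x \<in> ?B. P x y}"
      proof (rule nn_integral_indicator)
        have "{x \<in> ?B. P x y} = ?B \<inter> {x. P x y}" by auto
        then show "{x \<in> ?B. P x y} \<in> sets lborel" by (simp only: sets_lborel) measurable
      qed
      also have "\<dots> \<le> ennreal (C2 * t ^ (?n - 1)) * indicator ?L y"
      proof (cases "y \<in> ?L")
        case True
        then show ?thesis unfolding S using C2(2)[OF a(2,3), of y] by simp
      next
        case False
        have "\<not> P x y" if "x \<in> ?B" for x
        proof
          assume "P x y"
          then have d: "norm (y - (1 - 2 * t) *\<^sub>R sgn x) < t" by (simp add: P_def)
          have "norm ((1 - 2 * t) *\<^sub>R sgn x) = 1 - 2 * t" using that a by (simp add: norm_sgn)
          then have "norm y < 1" "norm y > 1 - 3 * t"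
            using d norm_triangle_ineq3[of y "(1 - 2 * t) *\<^sub>R sgn x"] a by linarith+
          then show False using False by simp
        qed
        then have "{x \<in> ?B. P x y} = {}" by blast
        then show ?thesis by (simp only: emeasure_empty) simp
      qed
      finally show ?thesis .
    qed
    have vol: "emeasure lborel {y. P x y} = ennreal (\<mu> * t ^ ?n)" for x
    proof -
      have "{y. P x y} = ball ((1 - 2 * t) *\<^sub>R sgn x) t" by (auto simp: P_def dist_norm norm_minus_commute)
      then show ?thesis using a by (simp add: emeasure_ball \<mu>_def)
    qed
    let ?I = "\<integral>\<^sup>+x\<in>?B. ennreal (D (sgn x) powr p) \<partial>lborel"
    have "?I * ennreal (\<mu> * t ^ ?n) = (\<integral>\<^sup>+x. (ennreal (D (sgn x) powr p) * indicator ?B x) * ennreal (\<mu> * t ^ ?n) \<partial>lborel)"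
      by (intro nn_integral_multc[symmetric]) (unfold measurable_lborel2, measurable)
    also have "\<dots> \<le> (\<integral>\<^sup>+x. (\<integral>\<^sup>+y. (indicator ?B x * indicator {x. P (fst x) (snd x)} (x, y)) * (ennreal (K / t ^ ?n) * osc p t v y) \<partial>lborel) \<partial>lborel)"
    proof (rule nn_integral_mono)
      fix x
      have "(ennreal (D (sgn x) powr p) * indicator ?B x) * ennreal (\<mu> * t ^ ?n)
          = (\<integral>\<^sup>+y. (ennreal (D (sgn x) powr p) * indicator ?B x) * indicator {y. P x y} y \<partial>lborel)"
        unfolding vol[of x, symmetric] by (rule nn_integral_cmult_indicator[symmetric]) (unfold sets_lborel, measurable)
      also have "\<dots> \<le> (\<integral>\<^sup>+y. (indicator ?B x * indicator {x. P (fst x) (snd x)} (x, y)) * (ennreal (K / t ^ ?n) * osc p t v y) \<partial>lborel)"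
      proof (rule nn_integral_mono)
        fix y
        show "(ennreal (D (sgn x) powr p) * indicator ?B x) * indicator {y. P x y} y
           \<le> (indicator ?B x * indicator {x. P (fst x) (snd x)} (x, y)) * (ennreal (K / t ^ ?n) * osc p t v y)"
          using D[of "sgn x" y] by (auto simp: indicator_def norm_sgn P_def dist_norm norm_minus_commute)
      qed
      finally show "(ennreal (D (sgn x) powr p) * indicator ?B x) * ennreal (\<mu> * t ^ ?n)
          \<le> (\<integral>\<^sup>+y. (indicator ?B x * indicator {x. P (fst x) (snd x)} (x, y)) * (ennreal (K / t ^ ?n) * osc p t v y) \<partial>lborel)" .
    qed
    also have "\<dots> = (\<integral>\<^sup>+y. (\<integral>\<^sup>+x. (indicator ?B x * indicator {x. P (fst x) (snd x)} (x, y)) * (ennreal (K / t ^ ?n) * osc p t v y) \<partial>lborel) \<partial>lborel)"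
    proof (rule lborel_pair.Fubini'[symmetric])
      have "(\<lambda>z::(real^'n) \<times> (real^'n). (indicator ?B (fst z) * indicator {x. P (fst x) (snd x)} z) * (ennreal (K / t ^ ?n) * osc p t v (snd z)))
         \<in> borel_measurable (borel \<Otimes>\<^sub>M borel)" by measurable
      also have "borel_measurable (borel \<Otimes>\<^sub>M borel) = borel_measurable (lborel \<Otimes>\<^sub>M lborel)"
        by (rule measurable_cong_sets) (simp_all cong: sets_pair_measure_cong)
      finally show "(\<lambda>(x, y). (indicator ?B x * indicator {x. P (fst x) (snd x)} (x, y)) * (ennreal (K / t ^ ?n) * osc p t v y))
         \<in> borel_measurable (lborel \<Otimes>\<^sub>M lborel)" by (simp add: split_beta)
    qed
    also have "\<dots> \<le> (\<integral>\<^sup>+y. (ennreal (K / t ^ ?n) * ennreal (C2 * t ^ (?n - 1))) * (osc p t v y * indicator ?L y) \<partial>lborel)"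
    proof (rule nn_integral_mono)
      fix y
      have "(\<integral>\<^sup>+x. (indicator ?B x * indicator {x. P (fst x) (snd x)} (x, y)) * (ennreal (K / t ^ ?n) * osc p t v y) \<partial>lborel)
         = (\<integral>\<^sup>+x. (indicator ?B x * indicator {x. P x y} x) * (ennreal (K / t ^ ?n) * osc p t v y) \<partial>lborel)"
        by (intro nn_integral_cong) (auto simp: indicator_def)
      also have "\<dots> = (\<integral>\<^sup>+x. indicator ?B x * indicator {x. P x y} x \<partial>lborel) * (ennreal (K / t ^ ?n) * osc p t v y)"
        by (rule nn_integral_multc) (unfold measurable_lborel2, measurable)
      also have "\<dots> \<le> (ennreal (C2 * t ^ (?n - 1)) * indicator ?L y) * (ennreal (K / t ^ ?n) * osc p t v y)"
        by (intro mult_right_mono cap) auto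
      finally show "(\<integral>\<^sup>+x. (indicator ?B x * indicator {x. P (fst x) (snd x)} (x, y)) * (ennreal (K / t ^ ?n) * osc p t v y) \<partial>lborel)
         \<le> (ennreal (K / t ^ ?n) * ennreal (C2 * t ^ (?n - 1))) * (osc p t v y * indicator ?L y)"
        by (simp add: mult_ac)
    qed
    also have "\<dots> = (ennreal (K / t ^ ?n) * ennreal (C2 * t ^ (?n - 1))) * Osc p t v ?L"
      unfolding Osc_def by (rule nn_integral_cmult) (unfold measurable_lborel2, measurable)
    also have "\<dots> \<le> (ennreal (K / t ^ ?n) * ennreal (C2 * t ^ (?n - 1))) * ennreal (\<delta> * t ^ (2 * ?n))"
      by (intro mult_left_mono O) auto
    also have "\<dots> = ennreal ((K * C2 * \<delta> * t ^ (?n - 1)) * t ^ ?n)"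
    proof -
      have e: "t ^ (2 * ?n) = t ^ ?n * t ^ ?n" by (simp add: mult_2 power_add)
      show ?thesis unfolding e using a K C2(1) by (simp add: ennreal_mult[symmetric] mult_ac)
    qed
    finally have *: "?I * ennreal (\<mu> * t ^ ?n) \<le> ennreal ((K * C2 * \<delta> * t ^ (?n - 1)) * t ^ ?n)" .
    have "?I = ?I * ennreal (\<mu> * t ^ ?n) * ennreal (1 / (\<mu> * t ^ ?n))"
      using \<mu> a by (simp add: mult.assoc ennreal_mult[symmetric])
    also have "\<dots> \<le> ennreal ((K * C2 * \<delta> * t ^ (?n - 1)) * t ^ ?n) * ennreal (1 / (\<mu> * t ^ ?n))"
      by (intro mult_right_mono *) auto
    also have "\<dots> = ennreal (K * C2 / \<mu> * \<delta> * t ^ (?n - 1))"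
      using \<mu> a K C2(1) by (simp add: ennreal_mult[symmetric])
    finally show "(\<integral>\<^sup>+x\<in>?B. ennreal (\<bar>avg t (\<lambda>y. v y $ i) (sgn x) - avg (t/2) (\<lambda>y. v y $ i) (sgn x)\<bar> powr p) \<partial>lborel)
        \<le> ennreal (K * C2 / \<mu> * \<delta> * t ^ (?n - 1))" unfolding D_def .
  qed (use K C2 \<mu> in auto)
qed

lemma C1_lipschitz:
  fixes u :: "real^'n \<Rightarrow> real"
  assumes u: "C1 u" and S: "convex S" and M: "\<And>\<alpha> x. x \<in> S ==> \<bar>pd \<alpha> u x\<bar> \<le> M" and xy: "x \<in> S" "y \<in> S"
  shows "\<bar>u x - u y\<bar> \<le> real CARD('n) * M * norm (x - y)"
proof -
  have "norm (u x - u y) \<le> (real CARD('n) * M) * norm (x - y)"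
  proof (rule differentiable_bound[OF S, of u "\<lambda>x. frechet_derivative u (at x)"])
    show "(u has_derivative frechet_derivative u (at z)) (at z within S)" for z
      by (rule has_derivative_at_withinI[OF C1_has_derivative[OF u]])
    fix z :: "real^'n" assume z: "z \<in> S"
    show "onorm (frechet_derivative u (at z)) \<le> real CARD('n) * M"
    proof (rule onorm_le)
      fix h
      have "norm (frechet_derivative u (at z) h) \<le> (\<Sum>\<alpha>\<in>UNIV. \<bar>h $ \<alpha> * pd \<alpha> u z\<bar>)"
        unfolding frechet_derivative_expand[OF u, of z h] by (simp add: sum_abs)
      also have "\<dots> \<le> (\<Sum>\<alpha>\<in>(UNIV::'n set). M * norm h)"
      proof (rule sum_mono)
        fix \<alpha>
        have "\<bar>h $ \<alpha>\<bar> * \<bar>pd \<alpha> u z\<bar> \<le> norm h * M"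
          using M[OF z, of \<alpha>] component_le_norm_cart[of h \<alpha>] by (intro mult_mono) auto
        then show "\<bar>h $ \<alpha> * pd \<alpha> u z\<bar> \<le> M * norm h" by (simp add: abs_mult mult.commute)
      qed
      finally show "norm (frechet_derivative u (at z) h) \<le> real CARD('n) * M * norm h" by simp
    qed
  qed (use xy in auto)
  then show ?thesis by simp
qed

lemma geometric_sum_bound:
  fixes q :: real
  assumes "0 \<le> q" "q < 1" shows "(\<Sum>j<J. q ^ j) \<le> 1 / (1 - q)"
proof -
  have "(\<Sum>j<J. q ^ j) \<le> (\<Sum>j. q ^ j)"
    using assms by (intro sum_le_suminf) auto
  then show ?thesis using assms by (simp add: suminf_geometric)
qed

text \<open>At the scale \<open>t\<close> the averages on the sphere are close to the boundary values: by telescoping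
  over dyadic scales, their distance to the trace is small in the mean over caps of radius
  comparable to \<open>t\<close>, and by the gradient bound the averages vary little over such caps.\<close>

theorem avg_close_to_trace:
  assumes p: "p \<ge> 1" and n2: "CARD('n) \<ge> 2"
  obtains C where "C > 0" "\<And>(v :: real^'n \<Rightarrow> real^'m) t i \<delta> e g \<theta>. C1 v ==> 0 < t ==> t \<le> 1/4 ==> \<delta> \<ge> 0 ==> e > 0 ==>
      (\<And>j. Osc p (t / 2 ^ j) v (ball 0 1 - cball 0 (1 - 3 * (t / 2 ^ j))) \<le> ennreal (\<delta> * (t / 2 ^ j) ^ (2 * CARD('n)))) ==>
      (\<And>x. norm x \<le> 1 ==> Osc p t v (ball ((1 - 2 * t) *\<^sub>R x) t) \<le> ennreal (\<delta> * t ^ (2 * CARD('n)))) ==>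
      norm \<theta> = 1 ==> (\<And>x. norm x = 1 ==> norm (x - \<theta>) < 4 * t ==> \<bar>g x - g \<theta>\<bar> \<le> e) ==>
      (\<lambda>x. g (sgn x)) \<in> borel_measurable borel ==>
      (\<integral>\<^sup>+x\<in>ball 0 1 - {0}. ennreal \<bar>v (sgn x) $ i - g (sgn x)\<bar> \<partial>lborel) \<le> ennreal (e * t ^ (CARD('n) - 1)) ==>
      \<bar>avg t (\<lambda>y. v y $ i) \<theta> - g \<theta>\<bar> \<le> C * (\<delta> powr (1 / p) + e)"
proof -
  let ?n = "CARD('n)"
  let ?B = "ball 0 1 - {0::real^'n}"
  obtain C2 where C2: "C2 > 0" "\<And>(v :: real^'n \<Rightarrow> real^'m) t x i \<alpha> \<delta>. C1 v ==> 0 < t ==> t \<le> 1/4 ==> norm x \<le> 1 ==> \<delta> \<ge> 0 ==>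
      Osc p t v (ball ((1 - 2 * t) *\<^sub>R x) t) \<le> ennreal (\<delta> * t ^ (2 * CARD('n))) ==>
      t * \<bar>pd \<alpha> (avg t (\<lambda>y. v y $ i)) x\<bar> \<le> C2 * \<delta> powr (1 / p)"
  proof (rule avg_pd_bound[OF p, where 'n = 'n and 'm = 'm], goal_cases)
    case (1 C) then show ?thesis by (intro that[of C]) auto
  qed
  obtain C3 where C3: "C3 > 0" "\<And>(v :: real^'n \<Rightarrow> real^'m) t i \<delta>. C1 v ==> 0 < t ==> t \<le> 1/4 ==> \<delta> \<ge> 0 ==>
      Osc p t v (ball 0 1 - cball 0 (1 - 3 * t)) \<le> ennreal (\<delta> * t ^ (2 * CARD('n))) ==>
      (\<integral>\<^sup>+x\<in>ball 0 1 - {0}. ennreal (\<bar>avg t (\<lambda>y. v y $ i) (sgn x) - avg (t/2) (\<lambda>y. v y $ i) (sgn x)\<bar> powr p) \<partial>lborel)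
        \<le> ennreal (C3 * \<delta> * t ^ (CARD('n) - 1))"
  proof (rule avg_step_on_sphere[OF p, where 'n = 'n and 'm = 'm], goal_cases)
    case (1 C) then show ?thesis by (intro that[of C]) auto
  qed
  obtain c where c: "c > 0" "\<And>t (\<theta>::real^'n). 0 < t ==> t \<le> 1/4 ==> norm \<theta> = 1 ==>
    ennreal (c * t ^ (CARD('n) - 1)) \<le> emeasure lborel {x \<in> ball 0 1 - {0}. norm (sgn x - \<theta>) < 4 * t}"
  proof (rule cap_volume_lower[where 'n = 'n], goal_cases)
    case (1 C) then show ?thesis by (intro that[of C]) auto
  qed
  \<comment> \<open>The gain from one dyadic scale to the next.\<close>
  define q where "q = (1 / 2 ^ (?n - 1)) powr (1 / p)"
  have q: "0 \<le> q" "q < 1"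
  proof -
    have "(2::real) ^ (?n - 1) > 1" using n2 by (intro one_less_power) auto
    then have "(1 / 2 ^ (?n - 1)) powr (1 / p) < 1 powr (1 / p)"
      using p by (intro powr_less_mono2) auto
    then show "q < 1" by (simp add: q_def)
  qed (simp add: q_def)
  define A where "A = 2 * (C3 / c) powr (1 / p) / (1 - q)"
  have A: "A > 0" using C3(1) c(1) q by (simp add: A_def)
  define C where "C = 4 * real ?n * C2 + A + 2 + 1 / c"
  have C: "C > 0" using C2(1) A c(1) by (simp add: C_def add_pos_pos)
  show thesis
  proof (rule that[OF C])
    fix v :: "real^'n \<Rightarrow> real^'m" and t \<delta> e :: real and i :: 'm and g :: "real^'n \<Rightarrow> real" and \<theta> :: "real^'n"
    assume a: "C1 v" "0 < t" "t \<le> 1/4" "\<delta> \<ge> 0" "e > 0"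
      and lay: "\<And>j. Osc p (t / 2 ^ j) v (ball 0 1 - cball 0 (1 - 3 * (t / 2 ^ j))) \<le> ennreal (\<delta> * (t / 2 ^ j) ^ (2 * CARD('n)))"
      and bal: "\<And>x. norm x \<le> 1 ==> Osc p t v (ball ((1 - 2 * t) *\<^sub>R x) t) \<le> ennreal (\<delta> * t ^ (2 * CARD('n)))"
      and \<theta>: "norm \<theta> = 1" and g: "\<And>x. norm x = 1 ==> norm (x - \<theta>) < 4 * t ==> \<bar>g x - g \<theta>\<bar> \<le> e"
      and gm[measurable]: "(\<lambda>x. g (sgn x)) \<in> borel_measurable borel"
      and vg: "(\<integral>\<^sup>+x\<in>?B. ennreal \<bar>v (sgn x) $ i - g (sgn x)\<bar> \<partial>lborel) \<le> ennreal (e * t ^ (?n - 1))"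
    define u where "u = (\<lambda>y. v y $ i)"
    have Cu: "C1 u" unfolding u_def by (rule C1_component[OF a(1)])
    define r where "r j = t / 2 ^ j" for j :: nat
    have r: "0 < r j" "r j \<le> 1/4" "r j \<le> t" "r (Suc j) = r j / 2" for j
    proof -
      show "0 < r j" "r (Suc j) = r j / 2" using a by (auto simp: r_def)
      have "t / 2 ^ j \<le> t / 1" using a by (intro divide_left_mono) auto
      then show "r j \<le> t" by (simp add: r_def)
      then show "r j \<le> 1/4" using a by simp
    qed
    \<comment> \<open>The cone over the cap of radius \<open>4 t\<close> around \<open>\<theta>\<close>; the estimate holds in the mean over it.\<close>
    define K where "K = {x \<in> ?B. norm (sgn x - \<theta>) < 4 * t}"
    have Km[measurable]: "K \<in> sets borel"
    proof -
      have "Measurable.pred borel (\<lambda>x. norm (sgn x - \<theta>) < 4 * t)" by measurable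
      then have [measurable]: "{x. norm (sgn x - \<theta>) < 4 * t} \<in> sets borel" by (simp add: pred_def)
      have "K = ?B \<inter> {x. norm (sgn x - \<theta>) < 4 * t}" by (auto simp: K_def)
      then show ?thesis by simp
    qed
    have KB: "K \<subseteq> ?B" by (auto simp: K_def)
    define \<mu> where "\<mu> = measure lborel K"
    have fin: "emeasure lborel K \<noteq> \<infinity>"
    proof -
      have "emeasure lborel K \<le> emeasure lborel (ball (0::real^'n) 1)" by (rule emeasure_mono) (use KB in auto)
      also have "\<dots> < \<infinity>" using emeasure_lborel_ball_finite[of "0::real^'n" 1] by simp
      finally show ?thesis by simp
    qed
    have e\<mu>: "emeasure lborel K = ennreal \<mu>" unfolding \<mu>_def by (rule emeasure_eq_ennreal_measure) (use fin in simp)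
    have "ennreal (c * t ^ (?n - 1)) \<le> ennreal \<mu>"
      using c(2)[OF a(2,3) \<theta>] e\<mu> by (simp add: K_def)
    then have \<mu>c: "c * t ^ (?n - 1) \<le> \<mu>" by (subst (asm) ennreal_le_iff) (auto simp: \<mu>_def)
    moreover have "c * t ^ (?n - 1) > 0" using c(1) a by simp
    ultimately have \<mu>: "\<mu> > 0" by linarith
    have am: "(\<lambda>x. avg s u (sgn x)) \<in> borel_measurable borel" for s
    proof -
      have [measurable]: "avg s u \<in> borel_measurable borel"
        by (intro borel_measurable_continuous_onI C1_continuous avg_C1 Cu)
      show ?thesis by measurable
    qed
    have um[measurable]: "(\<lambda>x. u (sgn x)) \<in> borel_measurable borel"
    proof -
      have [measurable]: "u \<in> borel_measurable borel"
        by (intro borel_measurable_continuous_onI C1_continuous Cu)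
      show ?thesis by measurable
    qed
    note [measurable] = am
    let ?d = "\<delta> powr (1 / p)"
    have step: "(\<integral>\<^sup>+x\<in>K. ennreal \<bar>avg (r j) u (sgn x) - avg (r (Suc j)) u (sgn x)\<bar> \<partial>lborel)
        \<le> ennreal (\<mu> * (2 * (C3 / c) powr (1 / p) * ?d * q ^ j))" for j
    proof -
      let ?g = "\<lambda>x. \<bar>avg (r j) u (sgn x) - avg (r j / 2) u (sgn x)\<bar>"
      have I: "(\<integral>\<^sup>+x\<in>K. ennreal (?g x powr p) \<partial>lborel) \<le> ennreal (C3 * \<delta> * r j ^ (?n - 1))"
      proof -
        have "(\<integral>\<^sup>+x\<in>K. ennreal (?g x powr p) \<partial>lborel) \<le> (\<integral>\<^sup>+x\<in>?B. ennreal (?g x powr p) \<partial>lborel)"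
          using KB by (intro nn_integral_mono) (auto simp: indicator_def)
        also have "\<dots> \<le> ennreal (C3 * \<delta> * r j ^ (?n - 1))"
          unfolding u_def by (rule C3(2)[OF a(1) r(1,2) a(4)]) (use lay[of j] in \<open>simp add: r_def\<close>)
        finally show ?thesis .
      qed
      have "(\<integral>\<^sup>+x\<in>K. ennreal (?g x) \<partial>lborel) \<le> ennreal (2 * \<mu> * (C3 * \<delta> * r j ^ (?n - 1) / \<mu>) powr (1 / p))"
        by (rule nn_integral_power_mean[OF _ e\<mu> \<mu> _ _ p I]) (use C3(1) a r(1)[of j] in \<open>auto simp: less_imp_le\<close>)
      also have "\<dots> \<le> ennreal (\<mu> * (2 * (C3 / c) powr (1 / p) * ?d * q ^ j))"
      proof (rule ennreal_leI)
        have "C3 * \<delta> * r j ^ (?n - 1) / \<mu> \<le> C3 * \<delta> * r j ^ (?n - 1) / (c * t ^ (?n - 1))"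
          using \<mu>c \<mu> c(1) a C3(1) r(1)[of j] by (intro divide_left_mono mult_pos_pos mult_nonneg_nonneg) (auto simp: less_imp_le)
        also have "\<dots> = (C3 / c) * \<delta> * (1 / 2 ^ (?n - 1)) ^ j"
          using a by (simp add: r_def power_divide power_mult[symmetric] mult.commute)
        finally have "(C3 * \<delta> * r j ^ (?n - 1) / \<mu>) powr (1 / p) \<le> ((C3 / c) * \<delta> * (1 / 2 ^ (?n - 1)) ^ j) powr (1 / p)"
          using \<mu> a C3(1) r(1)[of j] p by (intro powr_mono2) (auto simp: less_imp_le)
        also have "\<dots> = (C3 / c) powr (1 / p) * ?d * q ^ j"
        proof -
          have "((1 / 2 ^ (?n - 1)) ^ j) powr (1 / p) = q ^ j"
            unfolding q_def by (simp add: powr_power powr_realpow[symmetric] powr_powr mult.commute)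
          moreover have "((C3 / c) * \<delta> * (1 / 2 ^ (?n - 1)) ^ j) powr (1 / p)
              = (C3 / c) powr (1 / p) * \<delta> powr (1 / p) * ((1 / 2 ^ (?n - 1)) ^ j) powr (1 / p)"
            by (simp only: powr_mult)
          ultimately show ?thesis by simp
        qed
        finally have "2 * \<mu> * (C3 * \<delta> * r j ^ (?n - 1) / \<mu>) powr (1 / p) \<le> 2 * \<mu> * ((C3 / c) powr (1 / p) * ?d * q ^ j)"
          using \<mu> by (intro mult_left_mono) auto
        then show "2 * \<mu> * (C3 * \<delta> * r j ^ (?n - 1) / \<mu>) powr (1 / p) \<le> \<mu> * (2 * (C3 / c) powr (1 / p) * ?d * q ^ j)"
          by (simp add: mult_ac)
      qed
      finally show ?thesis unfolding r(4) .
    qed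
    have tel: "(\<integral>\<^sup>+x\<in>K. ennreal \<bar>avg t u (sgn x) - avg (r J) u (sgn x)\<bar> \<partial>lborel)
        \<le> ennreal (\<mu> * (2 * (C3 / c) powr (1 / p) * ?d * (\<Sum>j<J. q ^ j)))" for J
    proof (induction J)
      case 0 then show ?case by (simp add: r_def)
    next
      case (Suc J)
      have "(\<integral>\<^sup>+x\<in>K. ennreal \<bar>avg t u (sgn x) - avg (r (Suc J)) u (sgn x)\<bar> \<partial>lborel)
          \<le> (\<integral>\<^sup>+x. ennreal \<bar>avg t u (sgn x) - avg (r J) u (sgn x)\<bar> * indicator K x
             + ennreal \<bar>avg (r J) u (sgn x) - avg (r (Suc J)) u (sgn x)\<bar> * indicator K x \<partial>lborel)"
        by (rule nn_integral_mono) (auto simp: indicator_def ennreal_plus[symmetric] simp del: ennreal_plus intro!: ennreal_leI)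
      also have "\<dots> = (\<integral>\<^sup>+x\<in>K. ennreal \<bar>avg t u (sgn x) - avg (r J) u (sgn x)\<bar> \<partial>lborel)
          + (\<integral>\<^sup>+x\<in>K. ennreal \<bar>avg (r J) u (sgn x) - avg (r (Suc J)) u (sgn x)\<bar> \<partial>lborel)"
        by (rule nn_integral_add) (unfold measurable_lborel2, measurable)
      also have "\<dots> \<le> ennreal (\<mu> * (2 * (C3 / c) powr (1 / p) * ?d * (\<Sum>j<J. q ^ j))) + ennreal (\<mu> * (2 * (C3 / c) powr (1 / p) * ?d * q ^ J))"
        by (intro add_mono Suc step)
      also have "\<dots> = ennreal (\<mu> * (2 * (C3 / c) powr (1 / p) * ?d * (\<Sum>j<Suc J. q ^ j)))"
        using \<mu> q by (subst ennreal_plus[symmetric]) (auto simp: algebra_simps intro!: mult_nonneg_nonneg sum_nonneg)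
      finally show ?case .
    qed
    obtain s0 where s0: "s0 > 0" "\<And>s x. 0 \<le> s ==> s \<le> s0 ==> norm x \<le> 1 ==> \<bar>avg s u x - u x\<bar> \<le> e"
      using avg_close[OF C1_continuous[OF Cu] a(5)] by blast
    obtain J :: nat where "(1/2)^J < s0 / t" using real_arch_pow_inv[of "s0 / t" "1/2"] s0(1) a(2) by auto
    then have J: "r J \<le> s0" using a by (simp add: r_def power_one_over field_simps)
    define X where "X = \<bar>avg t u \<theta> - g \<theta>\<bar>"
    define a1 where "a1 = 4 * real ?n * C2 * ?d + 2 * e"
    have a1: "a1 \<ge> 0" using C2(1) a by (simp add: a1_def)
    have pt: "X \<le> a1 + \<bar>avg t u (sgn x) - avg (r J) u (sgn x)\<bar> + \<bar>u (sgn x) - g (sgn x)\<bar>" if x: "x \<in> K" for x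
    proof -
      have s1: "norm (sgn x) = 1" "norm (sgn x - \<theta>) < 4 * t" using x by (auto simp: K_def norm_sgn)
      have M: "\<bar>pd \<alpha> (avg t u) z\<bar> \<le> C2 * ?d / t" if "norm z \<le> 1" for \<alpha> z
        using C2(2)[OF a(1,2,3) that a(4) bal[OF that], where \<alpha> = \<alpha> and i = i] a(2) unfolding u_def
        by (simp add: field_simps)
      have "\<bar>avg t u \<theta> - avg t u (sgn x)\<bar> \<le> real ?n * (C2 * ?d / t) * norm (\<theta> - sgn x)"
        by (rule C1_lipschitz[OF avg_C1[OF Cu] convex_cball[of 0 1]]) (use \<theta> s1 M in auto)
      also have "\<dots> \<le> real ?n * (C2 * ?d / t) * (4 * t)"
        using s1 C2(1) a by (intro mult_left_mono) (auto simp: norm_minus_commute)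
      also have "\<dots> = 4 * real ?n * C2 * ?d" using a by simp
      finally have 1: "\<bar>avg t u \<theta> - avg t u (sgn x)\<bar> \<le> 4 * real ?n * C2 * ?d" .
      have 2: "\<bar>avg (r J) u (sgn x) - u (sgn x)\<bar> \<le> e" using s0(2)[of "r J" "sgn x"] J r(1)[of J] s1 by simp
      have 3: "\<bar>g (sgn x) - g \<theta>\<bar> \<le> e" by (rule g[OF s1])
      show ?thesis using 1 2 3 unfolding X_def a1_def by linarith
    qed
    have "ennreal (X * \<mu>) = (\<integral>\<^sup>+x\<in>K. ennreal X \<partial>lborel)"
      using \<mu> by (simp add: nn_integral_cmult_indicator e\<mu> ennreal_mult X_def)
    also have "\<dots> \<le> (\<integral>\<^sup>+x. (ennreal a1 * indicator K x + ennreal \<bar>avg t u (sgn x) - avg (r J) u (sgn x)\<bar> * indicator K x)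
        + ennreal \<bar>u (sgn x) - g (sgn x)\<bar> * indicator K x \<partial>lborel)"
      by (rule nn_integral_mono)
         (use pt a1 in \<open>auto simp: indicator_def ennreal_plus[symmetric] simp del: ennreal_plus intro!: ennreal_leI\<close>)
    also have "\<dots> = ((\<integral>\<^sup>+x. ennreal a1 * indicator K x \<partial>lborel)
        + (\<integral>\<^sup>+x\<in>K. ennreal \<bar>avg t u (sgn x) - avg (r J) u (sgn x)\<bar> \<partial>lborel))
        + (\<integral>\<^sup>+x\<in>K. ennreal \<bar>u (sgn x) - g (sgn x)\<bar> \<partial>lborel)"
    proof -
      have "(\<lambda>x. ennreal a1 * indicator K x) \<in> borel_measurable lborel"
        "(\<lambda>x. ennreal \<bar>avg t u (sgn x) - avg (r J) u (sgn x)\<bar> * indicator K x) \<in> borel_measurable lborel"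
        "(\<lambda>x. ennreal \<bar>u (sgn x) - g (sgn x)\<bar> * indicator K x) \<in> borel_measurable lborel"
        unfolding measurable_lborel2 by measurable
      then show ?thesis by (subst nn_integral_add, simp, simp)+ simp
    qed
    also have "\<dots> \<le> (ennreal (a1 * \<mu>) + ennreal (\<mu> * (A * ?d))) + ennreal (\<mu> * (e / c))"
    proof (intro add_mono)
      show "(\<integral>\<^sup>+x. ennreal a1 * indicator K x \<partial>lborel) \<le> ennreal (a1 * \<mu>)"
        using \<mu> a1 by (simp add: nn_integral_cmult_indicator e\<mu> ennreal_mult)
      have "2 * (C3 / c) powr (1 / p) * ?d * (\<Sum>j<J. q ^ j) \<le> 2 * (C3 / c) powr (1 / p) * ?d * (1 / (1 - q))"
        by (intro mult_left_mono geometric_sum_bound q) auto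
      also have "\<dots> = A * ?d" by (simp add: A_def)
      finally show "(\<integral>\<^sup>+x\<in>K. ennreal \<bar>avg t u (sgn x) - avg (r J) u (sgn x)\<bar> \<partial>lborel) \<le> ennreal (\<mu> * (A * ?d))"
        using \<mu> by (intro order_trans[OF tel] ennreal_leI mult_left_mono) auto
      have "(\<integral>\<^sup>+x\<in>K. ennreal \<bar>u (sgn x) - g (sgn x)\<bar> \<partial>lborel) \<le> (\<integral>\<^sup>+x\<in>?B. ennreal \<bar>v (sgn x) $ i - g (sgn x)\<bar> \<partial>lborel)"
        using KB unfolding u_def by (intro nn_integral_mono) (auto simp: indicator_def)
      also have "\<dots> \<le> ennreal (e * t ^ (?n - 1))" by (rule vg)
      also have "\<dots> \<le> ennreal (\<mu> * (e / c))"
        using mult_right_mono[OF \<mu>c, of "e / c"] a c(1) by (intro ennreal_leI) (simp add: field_simps)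
      finally show "(\<integral>\<^sup>+x\<in>K. ennreal \<bar>u (sgn x) - g (sgn x)\<bar> \<partial>lborel) \<le> ennreal (\<mu> * (e / c))" .
    qed
    also have "\<dots> = ennreal ((a1 + A * ?d + e / c) * \<mu>)"
      using \<mu> a1 A a c(1) by (subst ennreal_plus[symmetric], simp, simp)+ (simp add: algebra_simps)
    finally have "X * \<mu> \<le> (a1 + A * ?d + e / c) * \<mu>"
      using \<mu> a1 A a c(1) by (subst (asm) ennreal_le_iff) auto
    then have "X \<le> a1 + A * ?d + e / c" using \<mu> by simp
    also have "\<dots> = (4 * real ?n * C2 + A) * ?d + (2 + 1 / c) * e" by (simp add: a1_def algebra_simps)
    also have "\<dots> \<le> C * ?d + C * e"
    proof (intro add_mono mult_right_mono)
      show "4 * real ?n * C2 + A \<le> C" using c(1) by (simp add: C_def)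
      have "0 \<le> 4 * real ?n * C2" using C2(1) by simp
      then show "2 + 1 / c \<le> C" using A unfolding C_def by linarith
    qed (use a in auto)
    finally show "\<bar>avg t (\<lambda>y. v y $ i) \<theta> - g \<theta>\<bar> \<le> C * (?d + e)"
      unfolding X_def u_def by (simp add: distrib_left)
  qed
qed

section \<open>Passing from a function to its averages\<close>

lemma weighted_geometric_mean_le:
  fixes X Y a :: real
  assumes "X \<ge> 0" "Y \<ge> 0" "0 \<le> a" "a \<le> 1"
  shows "X powr a * Y powr (1 - a) \<le> X + Y"
proof -
  define m where "m = max X Y"
  have "X powr a * Y powr (1 - a) \<le> m powr a * m powr (1 - a)"
    using assms by (intro mult_mono powr_mono2) (auto simp: m_def)
  also have "\<dots> = m powr 1" by (simp add: powr_add[symmetric])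
  also have "\<dots> \<le> X + Y" using assms by (auto simp: m_def)
  finally show ?thesis .
qed

text \<open>The powers of the two scales balance because \<open>b\<^sup>p\<^sup>-\<^sup>n Q\<^sup>n\<close> is homogeneous of degree \<open>p\<close>; the
  remaining factor is geometric in the ratio of the scales, with the exponent below positive
  exactly because \<open>p < n\<^sup>2 / (n - 1)\<close>.\<close>

lemma scale_balance:
  fixes b Q \<beta> r t p :: real and n :: nat
  defines "\<kappa> \<equiv> 1 - real n + real n * real n / p"
  assumes n: "n \<ge> 1" and p: "real n \<le> p" "p \<le> real n + 1" and b: "0 \<le> b" "b \<le> \<beta>" and \<beta>: "\<beta> > 0" and Q: "0 \<le> Q" and r: "0 < r" and t: "0 < t"
  shows "(Q * (b / t) * (Q / r) ^ (n - 1)) \<le> \<beta> powr (real n + 1 - p) * (r / t) powr \<kappa> * (b powr p / t ^ n + Q powr p / r ^ n)"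
proof (cases "b = 0 \<or> Q = 0")
  case True
  then have "Q * (b / t) * (Q / r) ^ (n - 1) = 0" by auto
  moreover have "0 \<le> \<beta> powr (real n + 1 - p) * (r / t) powr \<kappa> * (b powr p / t ^ n + Q powr p / r ^ n)"
    using r t by (intro mult_nonneg_nonneg add_nonneg_nonneg divide_nonneg_nonneg) auto
  ultimately show ?thesis by linarith
next
  case False
  then have b0: "b > 0" and Q0: "Q > 0" using b Q by auto
  have p0: "p > 0" using n p by linarith
  \<comment> \<open>The exponents of the geometric mean are those for which \<open>b\<close> enters with the power \<open>p - n\<close> and \<open>Q\<close>
    with the power \<open>n\<close>; the remaining \<open>b\<^sup>n\<^sup>+\<^sup>1\<^sup>-\<^sup>p\<close> is at most \<open>\<beta>\<^sup>n\<^sup>+\<^sup>1\<^sup>-\<^sup>p\<close>.\<close>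
  define a where "a = (p - real n) / p"
  have a: "0 \<le> a" "a \<le> 1" "1 - a = real n / p" using p p0 by (auto simp: a_def field_simps)
  define X where "X = b powr p / t ^ n"
  define Y where "Y = Q powr p / r ^ n"
  have X0: "X \<ge> 0" and Y0: "Y \<ge> 0" using r t by (auto simp: X_def Y_def)
  have X: "X powr a = b powr (p - real n) * t powr (- real n * a)"
  proof -
    have "X = b powr p * t powr (- real n)" using t by (simp add: X_def powr_minus powr_realpow divide_inverse)
    then have "X powr a = (b powr p) powr a * (t powr (- real n)) powr a" by (simp add: powr_mult)
    also have "\<dots> = b powr (p * a) * t powr (- real n * a)" by (simp add: powr_powr)
    also have "p * a = p - real n" using p0 by (simp add: a_def)
    finally show ?thesis .
  qed
  have Y: "Y powr (1 - a) = Q powr real n * r powr (- real n * (1 - a))"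
  proof -
    have "Y = Q powr p * r powr (- real n)" using r by (simp add: Y_def powr_minus powr_realpow divide_inverse)
    then have "Y powr (1 - a) = (Q powr p) powr (1 - a) * (r powr (- real n)) powr (1 - a)" by (simp add: powr_mult)
    also have "\<dots> = Q powr (p * (1 - a)) * r powr (- real n * (1 - a))" by (simp add: powr_powr)
    also have "p * (1 - a) = real n" using p0 a(3) by simp
    finally show ?thesis .
  qed
  have \<kappa>: "\<kappa> = 1 - real n + real n * (1 - a)" "- \<kappa> = real n * a - 1"
    unfolding \<kappa>_def a(3) using p0 by (auto simp: a_def field_simps)
  have "Q * (b / t) * (Q / r) ^ (n - 1) = b * (Q * Q ^ (n - 1)) * (1 / t) * (1 / r ^ (n - 1))"
    by (simp add: power_divide)
  also have "Q * Q ^ (n - 1) = Q powr real n"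
    using n Q0 by (simp add: powr_realpow power_Suc[symmetric] del: power_Suc)
  also have "1 / t = t powr (-1)" using t by (simp add: powr_minus divide_inverse)
  also have "1 / r ^ (n - 1) = r powr (1 - real n)"
  proof -
    have "r powr (1 - real n) = r powr (- real (n - 1))" using n by (simp add: of_nat_diff)
    then show ?thesis using r by (simp add: powr_minus powr_realpow divide_inverse del: of_nat_diff)
  qed
  also have "b * Q powr real n * t powr (-1) * r powr (1 - real n)
      \<le> (\<beta> powr (real n + 1 - p) * b powr (p - real n)) * Q powr real n * t powr (-1) * r powr (1 - real n)"
  proof (intro mult_right_mono)
    have "b = b powr (real n + 1 - p) * b powr (p - real n)" using b0 by (simp add: powr_add[symmetric])
    also have "\<dots> \<le> \<beta> powr (real n + 1 - p) * b powr (p - real n)"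
      using b p by (intro mult_right_mono powr_mono2) auto
    finally show "b \<le> \<beta> powr (real n + 1 - p) * b powr (p - real n)" .
  qed auto
  also have "\<dots> = \<beta> powr (real n + 1 - p) * (r / t) powr \<kappa> * (X powr a * Y powr (1 - a))"
  proof -
    have "(r / t) powr \<kappa> = r powr (1 - real n) * r powr (real n * (1 - a)) * t powr (- \<kappa>)"
    proof -
      have "(r / t) powr \<kappa> = r powr \<kappa> * t powr (- \<kappa>)"
      proof -
        have "(r / t) powr \<kappa> = r powr \<kappa> / t powr \<kappa>" using r t by (simp add: powr_divide)
        then show ?thesis by (simp add: powr_minus divide_inverse)
      qed
      also have "r powr \<kappa> = r powr (1 - real n) * r powr (real n * (1 - a))"
        unfolding \<kappa>(1) by (rule powr_add)
      finally show ?thesis .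
    qed
    also have "t powr (- \<kappa>) = t powr (real n * a) * t powr (-1)"
      unfolding \<kappa>(2) by (simp only: diff_conv_add_uminus powr_add)
    finally have "(r / t) powr \<kappa> * (X powr a * Y powr (1 - a))
       = b powr (p - real n) * Q powr real n * t powr (-1) * r powr (1 - real n)
         * (t powr (real n * a) * t powr (- real n * a)) * (r powr (real n * (1 - a)) * r powr (- real n * (1 - a)))"
      unfolding X Y by (simp only: mult_ac)
    also have "t powr (real n * a) * t powr (- real n * a) = 1" using t by (simp add: powr_add[symmetric])
    also have "r powr (real n * (1 - a)) * r powr (- real n * (1 - a)) = 1" using r by (simp add: powr_add[symmetric])
    finally show ?thesis by (simp add: mult.assoc)
  qed
  also have "\<dots> \<le> \<beta> powr (real n + 1 - p) * (r / t) powr \<kappa> * (X + Y)"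
    by (intro mult_left_mono weighted_geometric_mean_le X0 Y0 a) auto
  finally show ?thesis by (simp add: X_def Y_def)
qed

text \<open>The averages of a C1 map converge to it uniformly with their derivatives, so the dyadic
  telescoping may start from scale zero.\<close>

lemma integral_jac_avg_tendsto:
  fixes u :: "'n::finite \<Rightarrow> real^'n \<Rightarrow> real"
  assumes u: "\<And>k. C1 (u k)" and \<xi>: "C1 \<xi>" "\<forall>x. norm x \<ge> 1 --> \<xi> x = 0"
    and s: "s \<longlonglongrightarrow> 0" "\<And>j. 0 \<le> s j" "\<And>j. s j \<le> 1/4"
  shows "(\<lambda>j. LINT x|lborel. \<xi> x * jac (\<lambda>k. avg (s j) (u k)) x) \<longlonglongrightarrow> (LINT x|lborel. \<xi> x * jac u x)"
proof -
  have "\<exists>M. M > 0 \<and> (\<forall>\<alpha> x. norm x \<le> 1 --> \<bar>pd \<alpha> (u k) x\<bar> \<le> M)" for k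
    using C1_pd_bounded[OF u, of 1] by metis
  then obtain M where M: "\<And>k. M k > 0" "\<And>k \<alpha> x. norm x \<le> 1 ==> \<bar>pd \<alpha> (u k) x\<bar> \<le> M k" by metis
  have cp: "continuous_on UNIV (pd \<alpha> (u k))" for \<alpha> k using C1_deriv_continuous[OF u] .
  have im: "integrable lborel (mol :: real^'n \<Rightarrow> real)"
    using integrable_mol[of "\<lambda>_. 1 :: real" 0 0] by simp
  have b: "\<bar>pd \<alpha> (avg (s j) (u k)) x\<bar> \<le> M k" if x: "norm x \<le> 1" for \<alpha> k j x
  proof -
    let ?h = "\<lambda>z. mol z * pd \<alpha> (u k) ((1 - 2 * s j) *\<^sub>R x + s j *\<^sub>R z)"
    have h: "\<bar>?h z\<bar> \<le> mol z * M k" for z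
    proof (cases "norm z < 1")
      case True
      have "norm ((1 - 2 * s j) *\<^sub>R x + s j *\<^sub>R z) \<le> norm ((1 - 2 * s j) *\<^sub>R x) + norm (s j *\<^sub>R z)" by (rule norm_triangle_ineq)
      also have "\<dots> = (1 - 2 * s j) * norm x + s j * norm z" using s(2,3)[of j] by simp
      also have "\<dots> \<le> (1 - 2 * s j) * 1 + s j * 1" using x True s(2,3)[of j] by (intro add_mono mult_left_mono) auto
      also have "\<dots> \<le> 1" using s(2)[of j] by simp
      finally show ?thesis using M(2)[where \<alpha> = \<alpha> and k = k] mol(2)[of z] by (auto simp: abs_mult intro!: mult_left_mono)
    qed (simp add: mol(3))
    have "\<bar>avg (s j) (pd \<alpha> (u k)) x\<bar> \<le> (LINT z|lborel. \<bar>?h z\<bar>)"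
      unfolding avg_def real_scaleR_def by (rule integral_abs_bound)
    also have "\<dots> \<le> (LINT z|lborel. mol (z::real^'n) * M k)"
      using integrable_mol[OF cp[where \<alpha> = \<alpha> and k = k], where s = "s j" and x = x] im by (intro integral_mono h) auto
    also have "\<dots> = M k" using mol(4)[where 'a = "real^'n"] by simp
    finally have "\<bar>1 - 2 * s j\<bar> * \<bar>avg (s j) (pd \<alpha> (u k)) x\<bar> \<le> 1 * M k"
      using s(2,3)[of j] by (intro mult_mono) auto
    then show ?thesis by (simp add: avg_pd_eq[OF u] abs_mult)
  qed
  have lim: "(\<lambda>j. pd \<alpha> (avg (s j) (u k)) x) \<longlonglongrightarrow> pd \<alpha> (u k) x" if x: "norm x \<le> 1" for \<alpha> k x
  proof -
    have "(\<lambda>j. avg (s j) (pd \<alpha> (u k)) x) \<longlonglongrightarrow> pd \<alpha> (u k) x"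
    proof (rule LIMSEQ_I)
      fix e :: real assume "e > 0"
      then have "e / 2 > 0" by simp
      obtain s0 where s0: "s0 > 0" "\<And>s x. 0 \<le> s ==> s \<le> s0 ==> norm x \<le> 1 ==> \<bar>avg s (pd \<alpha> (u k)) x - pd \<alpha> (u k) x\<bar> \<le> e / 2"
        using avg_close[OF cp \<open>e / 2 > 0\<close>] by blast
      obtain j0 where j0: "\<forall>j\<ge>j0. norm (s j - 0) < s0" using LIMSEQ_D[OF s(1) s0(1)] by blast
      show "\<exists>j0. \<forall>j\<ge>j0. norm (avg (s j) (pd \<alpha> (u k)) x - pd \<alpha> (u k) x) < e"
      proof (intro exI[of _ j0] allI impI)
        fix j assume "j \<ge> j0"
        with j0 have "norm (s j - 0) < s0" by blast
        then have "s j \<le> s0" by simp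
        from s0(2)[OF s(2) this x] show "norm (avg (s j) (pd \<alpha> (u k)) x - pd \<alpha> (u k) x) < e"
          using \<open>e > 0\<close> by simp
      qed
    qed
    then have "(\<lambda>j. (1 - 2 * s j) * avg (s j) (pd \<alpha> (u k)) x) \<longlonglongrightarrow> (1 - 2 * 0) * pd \<alpha> (u k) x"
      by (intro tendsto_intros s(1))
    then show ?thesis by (simp add: avg_pd_eq[OF u])
  qed
  obtain L where L: "L > 0" "\<And>x. norm x \<le> 1 ==> norm (\<xi> x) \<le> L"
    by (rule continuous_bounded_on_cball[OF C1_continuous[OF \<xi>(1)], of 1]) auto
  define B where "B = L * (fact CARD('n) * (\<Prod>k\<in>UNIV. M k))"
  show ?thesis
  proof (rule integral_dominated_convergence[where w = "\<lambda>x. indicator (cball 0 1) x * B"])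
    show "integrable lborel (\<lambda>x. indicator (cball (0::real^'n) 1) x * B)"
      using emeasure_lborel_cball_finite[of "0::real^'n" 1] by simp
    show "(\<lambda>x. \<xi> x * jac u x) \<in> borel_measurable lborel"
      unfolding measurable_lborel2
      by (intro borel_measurable_continuous_onI continuous_on_mult C1_continuous \<xi>(1) jac_continuous u)
    show "(\<lambda>x. \<xi> x * jac (\<lambda>k. avg (s j) (u k)) x) \<in> borel_measurable lborel" for j
      unfolding measurable_lborel2
      by (intro borel_measurable_continuous_onI continuous_on_mult C1_continuous \<xi>(1) jac_continuous avg_C1 u)
    show "AE x in lborel. (\<lambda>j. \<xi> x * jac (\<lambda>k. avg (s j) (u k)) x) \<longlonglongrightarrow> \<xi> x * jac u x"
    proof (rule AE_I2)
      fix x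
      show "(\<lambda>j. \<xi> x * jac (\<lambda>k. avg (s j) (u k)) x) \<longlonglongrightarrow> \<xi> x * jac u x"
      proof (cases "norm x < 1")
        case True
        then show ?thesis by (intro tendsto_intros jac_tendsto lim) simp
      qed (use \<xi>(2) in simp)
    qed
    show "AE x in lborel. norm (\<xi> x * jac (\<lambda>k. avg (s j) (u k)) x) \<le> indicator (cball 0 1) x * B" for j
    proof (rule AE_I2)
      fix x
      show "norm (\<xi> x * jac (\<lambda>k. avg (s j) (u k)) x) \<le> indicator (cball 0 1) x * B"
      proof (cases "norm x < 1")
        case True
        have "\<bar>\<xi> x\<bar> * \<bar>jac (\<lambda>k. avg (s j) (u k)) x\<bar> \<le> B"
          unfolding B_def using L(2)[of x] True L(1)
          by (intro mult_mono jac_bound b) (auto intro!: prod_nonneg less_imp_le[OF M(1)])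
        then show ?thesis using True by (simp add: abs_mult)
      next
        case False
        have "0 \<le> B" unfolding B_def
          by (intro mult_nonneg_nonneg prod_nonneg less_imp_le[OF M(1)] less_imp_le[OF L(1)]) auto
        then show ?thesis using False \<xi>(2) by simp
      qed
    qed
  qed
qed

text \<open>The weight is allowed to have a gradient as large as that of an average at scale \<open>t\<close>. The
  estimate compares consecutive dyadic scales and sums up.\<close>

theorem integral_jac_avg_comparison:
  assumes n2: "CARD('n) \<ge> 2" and p: "real CARD('n) \<le> p" "p \<le> real CARD('n) + 1"
  obtains C where "C > 0" "\<And>(v :: real^'n \<Rightarrow> real^'m) (g :: 'n \<Rightarrow> 'm) t \<xi> r b \<beta> B Q. C1 v ==> 0 < t ==> t \<le> 1/4 ==>
      C1 \<xi> ==> \<forall>x. norm x \<ge> r --> \<xi> x = 0 ==> r < 1 ==> b \<in> borel_measurable borel ==>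
      (\<And>x \<alpha>. norm x < 1 ==> \<bar>pd \<alpha> \<xi> x\<bar> \<le> b x / t) ==> (\<And>x. 0 \<le> b x) ==> (\<And>x. norm x < 1 ==> b x \<le> \<beta>) ==> \<beta> > 0 ==> B \<ge> 0 ==> Q \<ge> 0 ==>
      (\<integral>\<^sup>+x\<in>ball 0 1. ennreal (b x powr p) \<partial>lborel) \<le> ennreal (B * t ^ CARD('n)) ==>
      (\<And>j. Osc p (t / 2 ^ j) v (ball 0 1) \<le> ennreal (Q * (t / 2 ^ j) ^ (2 * CARD('n)))) ==>
      \<bar>(LINT x|lborel. \<xi> x * jac (\<lambda>k. avg t (\<lambda>y. v y $ g k)) x) - (LINT x|lborel. \<xi> x * jac (\<lambda>k y. v y $ g k) x)\<bar>
        \<le> C * \<beta> powr (real CARD('n) + 1 - p) * (B + Q)"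
proof -
  let ?n = "CARD('n)"
  have p1: "p \<ge> 1" using n2 p by linarith
  obtain C1' where C1': "C1' > 0" "\<And>(v :: real^'n \<Rightarrow> real^'m) s t x y i \<alpha>. C1 v ==> 0 < s ==> s \<le> t ==> t \<le> 2 * s ==> s \<le> 1/4 ==>
      ball ((1 - 2 * s) *\<^sub>R x) s \<subseteq> ball 0 1 \<inter> ball y (6 * t) ==>
      s * \<bar>pd \<alpha> (avg s (\<lambda>y. v y $ i)) x\<bar> \<le> C1' * (enn2real (osc p t v y) / t ^ CARD('n)) powr (1 / p)"
    "\<And>(v :: real^'n \<Rightarrow> real^'m) s t x y i. C1 v ==> 0 < s ==> s \<le> t ==> t \<le> 2 * s ==> s \<le> 1/4 ==>
      ball ((1 - 2 * s) *\<^sub>R x) s \<subseteq> ball 0 1 \<inter> ball y (6 * t) ==>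
      \<bar>avg s (\<lambda>y. v y $ i) x - v y $ i\<bar> \<le> C1' * (enn2real (osc p t v y) / t ^ CARD('n)) powr (1 / p)"
  proof (rule avg_osc_bound[OF p1, where 'n = 'n and 'm = 'm], goal_cases)
    case (1 C) then show ?thesis by (intro that[of C]) auto
  qed
  define \<kappa> where "\<kappa> = 1 - real ?n + real ?n * real ?n / p"
  have \<kappa>: "\<kappa> > 0"
  proof -
    \<comment> \<open>The sum over the dyadic scales converges because \<open>n\<^sup>2 / (n + 1) > n - 1\<close>.\<close>
    have "real ?n * real ?n / p \<ge> real ?n * real ?n / (real ?n + 1)" using p p1 by (intro divide_left_mono) auto
    moreover have "real ?n * real ?n / (real ?n + 1) > real ?n - 1" by (simp add: field_simps)
    ultimately show ?thesis unfolding \<kappa>_def by linarith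
  qed
  define q :: real where "q = (1 / 2) powr \<kappa>"
  have q: "0 \<le> q" "q < 1"
  proof -
    have "(1 / 2 :: real) powr \<kappa> < 1 powr \<kappa>" using \<kappa> by (intro powr_less_mono2) auto
    then show "q < 1" by (simp add: q_def)
  qed (simp add: q_def)
  define H where "H = real ?n * (fact ?n * (2 * C1') ^ ?n)"
  have H: "H > 0" using C1'(1) n2 by (simp add: H_def)
  show thesis
  proof (rule that[of "H / (1 - q)"])
    fix v :: "real^'n \<Rightarrow> real^'m" and g :: "'n \<Rightarrow> 'm" and t r \<beta> B Q :: real and \<xi> b :: "real^'n \<Rightarrow> real"
    assume v: "C1 v" and t: "0 < t" "t \<le> 1/4" and \<xi>: "C1 \<xi>" "\<forall>x. norm x \<ge> r --> \<xi> x = 0" "r < 1"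
      and bm[measurable]: "b \<in> borel_measurable borel" and b: "\<And>x \<alpha>. norm x < 1 ==> \<bar>pd \<alpha> \<xi> x\<bar> \<le> b x / t"
      "\<And>x. 0 \<le> b x" "\<And>x. norm x < 1 ==> b x \<le> \<beta>" and \<beta>: "\<beta> > 0" and BQ: "B \<ge> 0" "Q \<ge> 0"
      and bB: "(\<integral>\<^sup>+x\<in>ball 0 1. ennreal (b x powr p) \<partial>lborel) \<le> ennreal (B * t ^ ?n)"
      and oQ: "\<And>j. Osc p (t / 2 ^ j) v (ball 0 1) \<le> ennreal (Q * (t / 2 ^ j) ^ (2 * ?n))"
    define s where "s j = t / 2 ^ j" for j :: nat
    have s: "0 < s j" "s j \<le> 1/4" "s j \<le> t" "s (Suc j) = s j / 2" for j
    proof -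
      show "0 < s j" "s (Suc j) = s j / 2" using t by (auto simp: s_def)
      have "t / 2 ^ j \<le> t / 1" using t by (intro divide_left_mono) auto
      then show "s j \<le> t" by (simp add: s_def)
      then show "s j \<le> 1/4" using t by simp
    qed
    define T where "T j = (LINT x|lborel. \<xi> x * jac (\<lambda>k. avg (s j) (\<lambda>y. v y $ g k)) x)" for j
    define G where "G = H * \<beta> powr (real ?n + 1 - p) * (B + Q)"
    have G: "G \<ge> 0" using H BQ by (simp add: G_def)
    have Ca: "C1 (avg x (\<lambda>y. v y $ i))" for x i by (intro avg_C1 C1_component v)
    have step: "\<bar>T j - T (Suc j)\<bar> \<le> G * q ^ j" for j
    proof -
      define Qj where "Qj x = (enn2real (osc p (s j) v x) / s j ^ ?n) powr (1 / p)" for x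
      have Qj0: "Qj x \<ge> 0" for x by (simp add: Qj_def)
      have sub: "ball ((1 - 2 * s j) *\<^sub>R x) (s j) \<subseteq> ball 0 1 \<inter> ball x (6 * s j)"
        "ball ((1 - 2 * s (Suc j)) *\<^sub>R x) (s (Suc j)) \<subseteq> ball 0 1 \<inter> ball x (6 * s j)" if "norm x < 1" for x :: "real^'n"
      proof -
        show "ball ((1 - 2 * s j) *\<^sub>R x) (s j) \<subseteq> ball 0 1 \<inter> ball x (6 * s j)"
          using that s(1)[of j] s(2)[of j] by (intro shifted_ball_subset(1)) auto
        show "ball ((1 - 2 * s (Suc j)) *\<^sub>R x) (s (Suc j)) \<subseteq> ball 0 1 \<inter> ball x (6 * s j)"
          using that s(1)[of j] s(2)[of j] s(4)[of j] by (intro shifted_ball_subset(1)) auto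
      qed
      let ?e = "\<lambda>x. b x / t" and ?q = "\<lambda>x. 2 * C1' * Qj x" and ?d = "\<lambda>x. 2 * C1' * Qj x / s j"
      have "ennreal \<bar>T j - T (Suc j)\<bar>
         \<le> of_nat ?n * (\<integral>\<^sup>+x\<in>ball 0 1. ennreal (fact ?n * (?q x * ?e x * ?d x ^ (?n - 1))) \<partial>lborel)"
        unfolding T_def
      proof (rule integral_jac_comparison[where q = ?q and e = ?e and d = ?d, OF Ca Ca \<xi>])
        fix k and x :: "real^'n" assume x: "norm x < 1"
        have "\<bar>avg (s j) (\<lambda>y. v y $ g k) x - v x $ g k\<bar> \<le> C1' * Qj x"
          unfolding Qj_def using s[of j] by (intro C1'(3) v sub(1) x) auto
        moreover have "\<bar>avg (s (Suc j)) (\<lambda>y. v y $ g k) x - v x $ g k\<bar> \<le> C1' * Qj x"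
          unfolding Qj_def using s[of j] by (intro C1'(3) v sub(2) x) (auto simp: s(4))
        ultimately show "\<bar>avg (s j) (\<lambda>y. v y $ g k) x - avg (s (Suc j)) (\<lambda>y. v y $ g k) x\<bar> \<le> 2 * C1' * Qj x"
          by linarith
        fix \<alpha>
        have 1: "s j * \<bar>pd \<alpha> (avg (s j) (\<lambda>y. v y $ g k)) x\<bar> \<le> C1' * Qj x"
          unfolding Qj_def using s[of j] by (intro C1'(2) v sub(1) x) auto
        have 2: "s (Suc j) * \<bar>pd \<alpha> (avg (s (Suc j)) (\<lambda>y. v y $ g k)) x\<bar> \<le> C1' * Qj x"
          unfolding Qj_def using s[of j] by (intro C1'(2) v sub(2) x) (auto simp: s(4))
        have "C1' * Qj x \<le> 2 * C1' * Qj x" using C1'(1) Qj0[of x] by simp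
        then show "\<bar>pd \<alpha> (avg (s j) (\<lambda>y. v y $ g k)) x\<bar> \<le> ?d x"
          using 1 s(1)[of j] by (simp add: pos_le_divide_eq mult_ac)
        show "\<bar>pd \<alpha> (avg (s (Suc j)) (\<lambda>y. v y $ g k)) x\<bar> \<le> ?d x"
        proof -
          have e: "s j = 2 * s (Suc j)" using s(4)[of j] by simp
          have "s j * \<bar>pd \<alpha> (avg (s (Suc j)) (\<lambda>y. v y $ g k)) x\<bar> = 2 * (s (Suc j) * \<bar>pd \<alpha> (avg (s (Suc j)) (\<lambda>y. v y $ g k)) x\<bar>)"
            by (subst e) simp
          also have "\<dots> \<le> 2 * C1' * Qj x" using 2 by simp
          finally show ?thesis by (subst pos_le_divide_eq[OF s(1)]) (simp only: mult.commute)
        qed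
      qed (use b(1) in auto)
      also have "\<dots> \<le> of_nat ?n * (\<integral>\<^sup>+x. ennreal (fact ?n * (2 * C1') ^ ?n * \<beta> powr (real ?n + 1 - p) * q ^ j) *
          (ennreal (1 / t ^ ?n) * (ennreal (b x powr p) * indicator (ball 0 1) x) + ennreal (1 / s j ^ ?n) * (ennreal (Qj x powr p) * indicator (ball 0 1) x)) \<partial>lborel)"
      proof (intro mult_left_mono nn_integral_mono)
        fix x :: "real^'n"
        show "ennreal (fact ?n * (?q x * ?e x * ?d x ^ (?n - 1))) * indicator (ball 0 1) x
          \<le> ennreal (fact ?n * (2 * C1') ^ ?n * \<beta> powr (real ?n + 1 - p) * q ^ j) *
          (ennreal (1 / t ^ ?n) * (ennreal (b x powr p) * indicator (ball 0 1) x) + ennreal (1 / s j ^ ?n) * (ennreal (Qj x powr p) * indicator (ball 0 1) x))"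
        proof (cases "norm x < 1")
          case True
          have st: "(s j / t) powr \<kappa> = q ^ j"
          proof -
            have "s j / t = (1 / 2) ^ j" using t by (simp add: s_def power_one_over)
            then show ?thesis unfolding q_def by (simp add: powr_realpow[symmetric] powr_powr mult.commute)
          qed
          have "?q x * ?e x * ?d x ^ (?n - 1) = ((2 * C1') * (2 * C1') ^ (?n - 1)) * (Qj x * (b x / t) * (Qj x / s j) ^ (?n - 1))"
            by (simp add: power_mult_distrib power_divide mult_ac)
          also have "(2 * C1') * (2 * C1') ^ (?n - 1) = (2 * C1') ^ ?n"
            using power_Suc[of "2 * C1'" "?n - 1"] n2 by (simp only: Suc_diff_1 zero_less_card_finite)
          also have "(2 * C1') ^ ?n * (Qj x * (b x / t) * (Qj x / s j) ^ (?n - 1))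
             \<le> (2 * C1') ^ ?n * (\<beta> powr (real ?n + 1 - p) * (s j / t) powr \<kappa> * (b x powr p / t ^ ?n + Qj x powr p / s j ^ ?n))"
            unfolding \<kappa>_def using n2 p b(2,3) True \<beta> Qj0 s(1) t C1'(1)
            by (intro mult_left_mono scale_balance) auto
          finally have "fact ?n * (?q x * ?e x * ?d x ^ (?n - 1))
             \<le> fact ?n * ((2 * C1') ^ ?n * (\<beta> powr (real ?n + 1 - p) * q ^ j * (b x powr p / t ^ ?n + Qj x powr p / s j ^ ?n)))"
            unfolding st by (intro mult_left_mono) auto
          also have "\<dots> = (fact ?n * (2 * C1') ^ ?n * \<beta> powr (real ?n + 1 - p) * q ^ j) * ((1 / t ^ ?n) * b x powr p + (1 / s j ^ ?n) * Qj x powr p)"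
            by (simp add: mult_ac)
          finally have "ennreal (fact ?n * (?q x * ?e x * ?d x ^ (?n - 1)))
             \<le> ennreal ((fact ?n * (2 * C1') ^ ?n * \<beta> powr (real ?n + 1 - p) * q ^ j) * ((1 / t ^ ?n) * b x powr p + (1 / s j ^ ?n) * Qj x powr p))"
            by (rule ennreal_leI)
          also have "\<dots> = ennreal (fact ?n * (2 * C1') ^ ?n * \<beta> powr (real ?n + 1 - p) * q ^ j) *
             (ennreal (1 / t ^ ?n) * ennreal (b x powr p) + ennreal (1 / s j ^ ?n) * ennreal (Qj x powr p))"
          proof -
            have aux: "ennreal (K * (a * b + c * d)) = ennreal K * (ennreal a * ennreal b + ennreal c * ennreal d)"
              if "0 \<le> K" "0 \<le> a" "0 \<le> b" "0 \<le> c" "0 \<le> d" for K a b c d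
              using that by (simp add: ennreal_mult ennreal_plus)
            show ?thesis using t s(1)[of j] q C1'(1) by (intro aux) auto
          qed
          finally show ?thesis using True by simp
        qed simp
      qed auto
      also have "\<dots> = of_nat ?n * (ennreal (fact ?n * (2 * C1') ^ ?n * \<beta> powr (real ?n + 1 - p) * q ^ j) *
          (ennreal (1 / t ^ ?n) * (\<integral>\<^sup>+x\<in>ball 0 1. ennreal (b x powr p) \<partial>lborel) + ennreal (1 / s j ^ ?n) * (\<integral>\<^sup>+x\<in>ball 0 1. ennreal (Qj x powr p) \<partial>lborel)))"
      proof -
        have [measurable]: "osc p (s j) v \<in> borel_measurable borel" by (rule osc_measurable[OF C1_continuous[OF v]])
        have "(\<lambda>x. ennreal (b x powr p) * indicator (ball 0 1) x) \<in> borel_measurable lborel"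
          "(\<lambda>x. ennreal (Qj x powr p) * indicator (ball 0 1) x) \<in> borel_measurable lborel"
          unfolding measurable_lborel2 Qj_def by measurable
        then show ?thesis by (simp add: nn_integral_cmult nn_integral_add)
      qed
      also have "\<dots> \<le> of_nat ?n * (ennreal (fact ?n * (2 * C1') ^ ?n * \<beta> powr (real ?n + 1 - p) * q ^ j) *
          (ennreal (1 / t ^ ?n) * ennreal (B * t ^ ?n) + ennreal (1 / s j ^ ?n) * ennreal (Q * s j ^ ?n)))"
      proof (intro mult_left_mono add_mono bB)
        have "(\<integral>\<^sup>+x\<in>ball 0 1. ennreal (Qj x powr p) \<partial>lborel) = ennreal (1 / s j ^ ?n) * Osc p (s j) v (ball 0 1)"
          unfolding Qj_def by (rule nn_integral_osc_powr[OF C1_continuous[OF v] p1 s(1)]) simp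
        also have "\<dots> \<le> ennreal (1 / s j ^ ?n) * ennreal (Q * s j ^ (2 * ?n))"
          using oQ[of j] by (intro mult_left_mono) (auto simp: s_def)
        also have "\<dots> = ennreal (Q * s j ^ ?n)"
          using s(1)[of j] BQ by (simp add: ennreal_mult[symmetric] mult_2 power_add)
        finally show "(\<integral>\<^sup>+x\<in>ball 0 1. ennreal (Qj x powr p) \<partial>lborel) \<le> ennreal (Q * s j ^ ?n)" .
      qed auto
      also have "\<dots> = ennreal (real ?n * ((fact ?n * (2 * C1') ^ ?n * \<beta> powr (real ?n + 1 - p) * q ^ j) * (B + Q)))"
        using t s(1)[of j] BQ q C1'(1) by (simp add: ennreal_mult[symmetric] ennreal_plus[symmetric] ennreal_of_nat_eq_real_of_nat del: ennreal_plus)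
      also have "\<dots> = ennreal (G * q ^ j)" by (simp add: G_def H_def mult_ac)
      finally show ?thesis using G q by simp
    qed
    have tel: "\<bar>T 0 - T J\<bar> \<le> G * (\<Sum>j<J. q ^ j)" for J
    proof (induction J)
      case (Suc J)
      have "\<bar>T 0 - T (Suc J)\<bar> \<le> \<bar>T 0 - T J\<bar> + \<bar>T J - T (Suc J)\<bar>" by linarith
      also have "\<dots> \<le> G * (\<Sum>j<J. q ^ j) + G * q ^ J" by (intro add_mono Suc step)
      finally show ?case by (simp add: algebra_simps)
    qed simp
    have s0: "s \<longlonglongrightarrow> 0"
    proof -
      have "(\<lambda>j. t * (1 / 2) ^ j) \<longlonglongrightarrow> t * 0" by (intro tendsto_mult tendsto_const LIMSEQ_power_zero) simp
      moreover have "s = (\<lambda>j. t * (1 / 2) ^ j)" by (simp add: fun_eq_iff s_def power_divide)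
      ultimately show ?thesis by simp
    qed
    have "T \<longlonglongrightarrow> (LINT x|lborel. \<xi> x * jac (\<lambda>k y. v y $ g k) x)"
      unfolding T_def
      by (rule integral_jac_avg_tendsto[OF _ \<xi>(1) _ s0]) (use \<xi> s in \<open>auto intro: C1_component[OF v] less_imp_le\<close>)
    then have "(\<lambda>J. \<bar>T 0 - T J\<bar>) \<longlonglongrightarrow> \<bar>T 0 - (LINT x|lborel. \<xi> x * jac (\<lambda>k y. v y $ g k) x)\<bar>"
      by (intro tendsto_intros)
    moreover have "\<bar>T 0 - T J\<bar> \<le> G * (1 / (1 - q))" for J
      using mult_left_mono[OF geometric_sum_bound[OF q, of J] G] tel[of J] by linarith
    ultimately have "\<bar>T 0 - (LINT x|lborel. \<xi> x * jac (\<lambda>k y. v y $ g k) x)\<bar> \<le> G * (1 / (1 - q))"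
      by (intro LIMSEQ_le_const2) auto
    then show "\<bar>(LINT x|lborel. \<xi> x * jac (\<lambda>k. avg t (\<lambda>y. v y $ g k)) x) - (LINT x|lborel. \<xi> x * jac (\<lambda>k y. v y $ g k) x)\<bar>
        \<le> H / (1 - q) * \<beta> powr (real ?n + 1 - p) * (B + Q)"
      by (simp add: T_def s_def G_def)
  qed (use H q in simp)
qed

section \<open>Vanishing of the Jacobians in the limit\<close>

text \<open>The scale invariant form of small oscillation. Smallness on the whole ball, as opposed to
  boundedness, fails at the exponent \<open>p = n\<close>, where gradients in \<open>L\<^sup>n\<close> are compatible with
  oscillations of constant scaled size; smallness survives on boundary layers and small balls.\<close>

definition osc_decay :: "real \<Rightarrow> (nat \<Rightarrow> real^'n \<Rightarrow> real^'m) \<Rightarrow> bool" where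
  "osc_decay p v \<longleftrightarrow> (\<exists>M>0. \<forall>\<delta>>0. \<exists>\<eta>>0. \<eta> \<le> 1/4 \<and> (\<exists>K. \<forall>k\<ge>K. \<forall>t. 0 < t \<and> t \<le> \<eta> -->
     Osc p t (v k) (ball 0 1) \<le> ennreal (M * t ^ (2 * CARD('n))) \<and>
     (p \<noteq> real CARD('n) --> Osc p t (v k) (ball 0 1) \<le> ennreal (\<delta> * t ^ (2 * CARD('n)))) \<and>
     Osc p t (v k) (ball 0 1 - cball 0 (1 - 3 * t)) \<le> ennreal (\<delta> * t ^ (2 * CARD('n))) \<and>
     (\<forall>x. norm x \<le> 1 --> Osc p t (v k) (ball ((1 - 2 * t) *\<^sub>R x) t) \<le> ennreal (\<delta> * t ^ (2 * CARD('n))))))"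

lemma integrable_mult_jac:
  assumes "\<And>k. C1 (a k)" "continuous_on UNIV \<xi>" "\<forall>x. norm x \<ge> r --> \<xi> x = 0"
  shows "integrable lborel (\<lambda>x. \<xi> x * jac a x)"
  by (rule integrable_lborel_compact_support[of _ r])
     (use assms in \<open>auto intro!: continuous_on_mult jac_continuous\<close>)

lemma integral_mult_jac_bound:
  fixes a :: "'n::finite \<Rightarrow> real^'n \<Rightarrow> real"
  assumes a: "\<And>k. C1 (a k)" and \<xi>: "continuous_on UNIV \<xi>" "\<forall>x. norm x \<ge> 1 --> \<xi> x = 0" "\<And>x. \<bar>\<xi> x\<bar> \<le> d"
    and D: "\<And>k \<alpha> x. norm x < 1 ==> \<bar>pd \<alpha> (a k) x\<bar> \<le> D"
  shows "\<bar>LINT x|lborel. \<xi> x * jac a x\<bar> \<le> measure lborel (ball (0::real^'n) 1) * (d * (fact CARD('n) * D ^ CARD('n)))"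
proof -
  let ?B = "d * (fact CARD('n) * D ^ CARD('n))"
  have "\<bar>LINT x|lborel. \<xi> x * jac a x\<bar> \<le> (LINT x|lborel. \<bar>\<xi> x * jac a x\<bar>)" by (rule integral_abs_bound)
  also have "\<dots> \<le> (LINT x|lborel. indicator (ball (0::real^'n) 1) x * ?B)"
  proof (rule integral_mono)
    show "integrable lborel (\<lambda>x. \<bar>\<xi> x * jac a x\<bar>)"
      by (intro integrable_abs integrable_mult_jac[OF a \<xi>(1,2)])
    show "integrable lborel (\<lambda>x. indicator (ball (0::real^'n) 1) x * ?B)"
      using emeasure_lborel_ball_finite[of "0::real^'n" 1] by simp
    fix x
    show "\<bar>\<xi> x * jac a x\<bar> \<le> indicator (ball 0 1) x * ?B"
    proof (cases "norm x < 1")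
      case True
      have "\<bar>jac a x\<bar> \<le> fact CARD('n) * (\<Prod>k\<in>(UNIV::'n set). D)"
        by (rule jac_bound) (rule D[OF True])
      then have "\<bar>\<xi> x\<bar> * \<bar>jac a x\<bar> \<le> ?B"
        using \<xi>(3)[of x] abs_ge_zero[of "\<xi> x"] by (intro mult_mono) auto
      then show ?thesis using True by (simp add: abs_mult)
    qed (use \<xi>(2) in simp)
  qed
  also have "\<dots> = measure lborel (ball (0::real^'n) 1) * ?B" by simp
  finally show ?thesis .
qed

lemma mollified_is_test_function:
  fixes \<phi> :: "'a::euclidean_space \<Rightarrow> real"
  assumes "smooth_on UNIV \<phi>" "\<And>x. norm x \<ge> R ==> \<phi> x = 0" "R < 1"
  shows "test_function (ball 0 1) \<phi>"
proof -
  have "{x. \<phi> x \<noteq> 0} \<subseteq> cball 0 R" using assms(2) by (force simp: not_le)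
  then have "closure {x. \<phi> x \<noteq> 0} \<subseteq> cball 0 R" by (rule closure_minimal) simp
  then show ?thesis
    unfolding test_function_def compact_closure using assms(1,3) \<open>{x. \<phi> x \<noteq> 0} \<subseteq> cball 0 R\<close>
    by (auto intro: bounded_subset[OF bounded_cball])
qed

text \<open>The comparison with the averages at a fixed scale bounds the Jacobian integral by the C1
  norm of the weight, uniformly along the sequence. So smooth weights may be replaced by C1 ones.\<close>

theorem integral_jac_tendsto_0:
  fixes v :: "nat \<Rightarrow> real^'n \<Rightarrow> real^'m" and g :: "'n \<Rightarrow> 'm"
  assumes n2: "CARD('n) \<ge> 2" and p: "real CARD('n) \<le> p" "p \<le> real CARD('n) + 1"
    and v: "\<And>k. C1 (v k)" and dec: "osc_decay p v"
    and test: "\<And>\<phi>. test_function (ball 0 1) \<phi> ==> (\<lambda>k. LINT x|lborel. \<phi> x * jac (\<lambda>l y. v k y $ g l) x) \<longlonglongrightarrow> 0"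
    and \<xi>: "C1 \<xi>" "\<forall>x. norm x \<ge> r --> \<xi> x = 0" "r < 1"
  shows "(\<lambda>k. LINT x|lborel. \<xi> x * jac (\<lambda>l y. v k y $ g l) x) \<longlonglongrightarrow> 0"
proof -
  let ?n = "CARD('n)"
  have p1: "p \<ge> 1" using n2 p by linarith
  obtain C2 where C2: "C2 > 0" "\<And>(v :: real^'n \<Rightarrow> real^'m) t x i \<alpha> \<delta>. C1 v ==> 0 < t ==> t \<le> 1/4 ==> norm x \<le> 1 ==> \<delta> \<ge> 0 ==>
      Osc p t v (ball ((1 - 2 * t) *\<^sub>R x) t) \<le> ennreal (\<delta> * t ^ (2 * CARD('n))) ==>
      t * \<bar>pd \<alpha> (avg t (\<lambda>y. v y $ i)) x\<bar> \<le> C2 * \<delta> powr (1 / p)"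
  proof (rule avg_pd_bound[OF p1, where 'n = 'n and 'm = 'm], goal_cases)
    case (1 C) then show ?thesis by (intro that[of C]) auto
  qed
  obtain CE where CE: "CE > 0" "\<And>(v :: real^'n \<Rightarrow> real^'m) (g :: 'n \<Rightarrow> 'm) t \<xi> r b \<beta> B Q. C1 v ==> 0 < t ==> t \<le> 1/4 ==>
      C1 \<xi> ==> \<forall>x. norm x \<ge> r --> \<xi> x = 0 ==> r < 1 ==> b \<in> borel_measurable borel ==>
      (\<And>x \<alpha>. norm x < 1 ==> \<bar>pd \<alpha> \<xi> x\<bar> \<le> b x / t) ==> (\<And>x. 0 \<le> b x) ==> (\<And>x. norm x < 1 ==> b x \<le> \<beta>) ==> \<beta> > 0 ==> B \<ge> 0 ==> Q \<ge> 0 ==>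
      (\<integral>\<^sup>+x\<in>ball 0 1. ennreal (b x powr p) \<partial>lborel) \<le> ennreal (B * t ^ CARD('n)) ==>
      (\<And>j. Osc p (t / 2 ^ j) v (ball 0 1) \<le> ennreal (Q * (t / 2 ^ j) ^ (2 * CARD('n)))) ==>
      \<bar>(LINT x|lborel. \<xi> x * jac (\<lambda>k. avg t (\<lambda>y. v y $ g k)) x) - (LINT x|lborel. \<xi> x * jac (\<lambda>k y. v y $ g k) x)\<bar>
        \<le> CE * \<beta> powr (real CARD('n) + 1 - p) * (B + Q)"
  proof (rule integral_jac_avg_comparison[OF n2 p, where 'm = 'm], goal_cases)
    case (1 C) show ?thesis by (rule that[OF 1(2)]) (rule 1(3))
  qed
  obtain M where M: "M > 0" and dec': "\<And>\<delta>. \<delta> > 0 ==> \<exists>\<eta>>0. \<eta> \<le> 1/4 \<and> (\<exists>K. \<forall>k\<ge>K. \<forall>t. 0 < t \<and> t \<le> \<eta> -->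
     Osc p t (v k) (ball 0 1) \<le> ennreal (M * t ^ (2 * CARD('n))) \<and>
     (p \<noteq> real CARD('n) --> Osc p t (v k) (ball 0 1) \<le> ennreal (\<delta> * t ^ (2 * CARD('n)))) \<and>
     Osc p t (v k) (ball 0 1 - cball 0 (1 - 3 * t)) \<le> ennreal (\<delta> * t ^ (2 * CARD('n))) \<and>
     (\<forall>x. norm x \<le> 1 --> Osc p t (v k) (ball ((1 - 2 * t) *\<^sub>R x) t) \<le> ennreal (\<delta> * t ^ (2 * CARD('n)))))"
    using dec unfolding osc_decay_def by blast
  from dec'[OF zero_less_one] obtain t K where t: "0 < t" "t \<le> 1/4"
    and K: "\<And>k s. k \<ge> K ==> 0 < s ==> s \<le> t ==> Osc p s (v k) (ball 0 1) \<le> ennreal (M * s ^ (2 * ?n))"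
      "\<And>k x. k \<ge> K ==> norm x \<le> 1 ==> Osc p t (v k) (ball ((1 - 2 * t) *\<^sub>R x) t) \<le> ennreal (1 * t ^ (2 * ?n))"
    by blast
  define \<mu> where "\<mu> = measure lborel (ball (0::real^'n) 1)"
  have \<mu>: "\<mu> > 0" unfolding \<mu>_def by (rule content_ball_pos) simp
  have e\<mu>: "emeasure lborel (ball (0::real^'n) 1) = ennreal \<mu>"
    unfolding \<mu>_def using emeasure_lborel_ball_finite[of "0::real^'n" 1] by (intro emeasure_eq_ennreal_measure) auto
  define B where "B = t powr p * \<mu> / t ^ ?n"
  have B: "B \<ge> 0" using \<mu> t by (simp add: B_def)
  define D where "D = \<mu> * (fact ?n * (C2 / t) ^ ?n) + CE * t powr (real ?n + 1 - p) * (B + M)"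
  have D: "D \<ge> 0" unfolding D_def using \<mu> t C2(1) CE(1) B M by (intro add_nonneg_nonneg mult_nonneg_nonneg) auto
  have bound: "\<bar>LINT x|lborel. \<zeta> x * jac (\<lambda>l y. v k y $ g l) x\<bar> \<le> d * D"
    if \<zeta>: "C1 \<zeta>" "\<forall>x. norm x \<ge> r --> \<zeta> x = 0" "r < 1" "\<And>x. \<bar>\<zeta> x\<bar> \<le> d" "\<And>\<alpha> x. \<bar>pd \<alpha> \<zeta> x\<bar> \<le> d" and d: "d > 0" and k: "k \<ge> K"
    for \<zeta> r d k
  proof -
    let ?J = "\<lambda>\<zeta>. LINT x|lborel. \<zeta> x * jac (\<lambda>l y. v k y $ g l) x"
    let ?A = "\<lambda>\<zeta>. LINT x|lborel. \<zeta> x * jac (\<lambda>l. avg t (\<lambda>y. v k y $ g l)) x"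
    have "\<bar>?A \<zeta>\<bar> \<le> \<mu> * (d * (fact ?n * (C2 / t) ^ ?n))"
      unfolding \<mu>_def
    proof (rule integral_mult_jac_bound)
      show "C1 (avg t (\<lambda>y. v k y $ g l))" for l by (intro avg_C1 C1_component v)
      show "\<bar>pd \<alpha> (avg t (\<lambda>y. v k y $ g l)) x\<bar> \<le> C2 / t" if "norm x < 1" for \<alpha> l x
      proof -
        have "t * \<bar>pd \<alpha> (avg t (\<lambda>y. v k y $ g l)) x\<bar> \<le> C2 * 1 powr (1 / p)"
          by (rule C2(2)[OF v t _ _ K(2)[OF k]]) (use that in auto)
        then show ?thesis using t by (simp add: pos_le_divide_eq mult.commute)
      qed
    qed (use \<zeta> C1_continuous in auto)
    moreover have "\<bar>?A \<zeta> - ?J \<zeta>\<bar> \<le> d * (CE * t powr (real ?n + 1 - p) * (B + M))"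
    proof -
      let ?z = "\<lambda>x. (1 / d) * \<zeta> x"
      have Cz: "C1 ?z" by (intro C1_mult C1_const \<zeta>(1))
      have "\<bar>?A ?z - ?J ?z\<bar> \<le> CE * t powr (real ?n + 1 - p) * (B + M)"
      proof (rule CE(2)[where b = "\<lambda>_. t" and r = r])
        show "\<bar>pd \<alpha> ?z x\<bar> \<le> t / t" for \<alpha> x
        proof -
          have "pd \<alpha> ?z x = (1 / d) * pd \<alpha> \<zeta> x"
            unfolding pd_mult[OF C1_const \<zeta>(1)] by (simp add: frechet_derivative_const)
          then show ?thesis using \<zeta>(5)[where \<alpha> = \<alpha> and x = x] d t by (simp only: abs_mult) simp
        qed
        have "(\<integral>\<^sup>+x\<in>ball (0::real^'n) 1. ennreal (t powr p) \<partial>lborel) = ennreal (t powr p * \<mu>)"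
          using \<mu> by (simp add: nn_integral_cmult e\<mu> ennreal_mult)
        then show "(\<integral>\<^sup>+x\<in>ball (0::real^'n) 1. ennreal (t powr p) \<partial>lborel) \<le> ennreal (B * t ^ ?n)"
          using t by (simp add: B_def)
        show "Osc p (t / 2 ^ j) (v k) (ball 0 1) \<le> ennreal (M * (t / 2 ^ j) ^ (2 * CARD('n)))" for j
        proof (rule K(1)[OF k])
          have "t / 2 ^ j \<le> t / 1" using t by (intro divide_left_mono) auto
          then show "t / 2 ^ j \<le> t" by simp
        qed (use t in simp)
      qed (use v t Cz \<zeta> B M in auto)
      moreover have "?A ?z - ?J ?z = (1 / d) * (?A \<zeta> - ?J \<zeta>)"
        by (simp only: mult.assoc integral_mult_right_zero right_diff_distrib)
      ultimately have "(1 / d) * \<bar>?A \<zeta> - ?J \<zeta>\<bar> \<le> CE * t powr (real ?n + 1 - p) * (B + M)"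
        using d by (simp add: abs_mult)
      then show ?thesis using d by (simp add: field_simps)
    qed
    ultimately have "\<bar>?J \<zeta>\<bar> \<le> \<mu> * (d * (fact ?n * (C2 / t) ^ ?n)) + d * (CE * t powr (real ?n + 1 - p) * (B + M))" by linarith
    also have "\<dots> = d * D" by (simp add: D_def algebra_simps)
    finally show ?thesis .
  qed
  show ?thesis
  proof (rule LIMSEQ_I)
    fix e :: real assume e: "e > 0"
    define d where "d = min (e / (2 * (D + 1))) ((1 - r) / 2)"
    have d: "d > 0" "d \<le> (1 - r) / 2" "d * D < e / 2 + 0"
    proof -
      show "d > 0" using e D \<xi>(3) by (auto simp: d_def)
      show "d \<le> (1 - r) / 2" unfolding d_def by (rule min.cobounded2)
      have "d * D \<le> e / (2 * (D + 1)) * D" using D by (intro mult_right_mono) (auto simp: d_def)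
      also have "\<dots> < e / 2" using D e by (simp add: field_simps)
      finally show "d * D < e / 2 + 0" by simp
    qed
    obtain \<phi> where \<phi>: "smooth_on UNIV \<phi>" "\<And>x. norm x \<ge> r + d ==> \<phi> x = 0" "\<And>x. \<bar>\<phi> x - \<xi> x\<bar> \<le> d"
      "\<And>\<alpha> x. C1 \<xi> ==> \<bar>pd \<alpha> \<phi> x - pd \<alpha> \<xi> x\<bar> \<le> d"
    proof (rule mollification_exists[where \<xi> = \<xi> and R = r, OF C1_continuous[OF \<xi>(1)] _ d(1)], goal_cases)
      case (2 \<phi>) then show ?case by (intro that[of \<phi>]) auto
    qed (use \<xi>(2) in auto)
    have r1: "r + d < 1" using d \<xi>(3) by (simp add: field_simps)
    have C\<phi>: "C1 \<phi>" using \<phi>(1) Ck_Suc_C1[of 0 \<phi>] by (simp add: smooth_on_def del: Ck_on.simps)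
    from LIMSEQ_D[OF test[OF mollified_is_test_function[OF \<phi>(1,2) r1]], of "e / 2"] e
    obtain K1 where K1: "\<And>k. k \<ge> K1 ==> \<bar>LINT x|lborel. \<phi> x * jac (\<lambda>l y. v k y $ g l) x\<bar> < e / 2" by auto
    show "\<exists>no. \<forall>k\<ge>no. norm ((LINT x|lborel. \<xi> x * jac (\<lambda>l y. v k y $ g l) x) - 0) < e"
    proof (intro exI[of _ "max K K1"] allI impI)
      fix k assume k: "max K K1 \<le> k"
      let ?J = "\<lambda>\<zeta>. LINT x|lborel. \<zeta> x * jac (\<lambda>l y. v k y $ g l) x"
      have i: "integrable lborel (\<lambda>x. \<xi> x * jac (\<lambda>l y. v k y $ g l) x)"
        "integrable lborel (\<lambda>x. \<phi> x * jac (\<lambda>l y. v k y $ g l) x)"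
      proof -
        have Cv: "C1 (\<lambda>y. v k y $ g l)" for l by (rule C1_component[OF v])
        have \<phi>r: "\<forall>x. norm x \<ge> r + d --> \<phi> x = 0" using \<phi>(2) by blast
        show "integrable lborel (\<lambda>x. \<xi> x * jac (\<lambda>l y. v k y $ g l) x)"
          by (rule integrable_mult_jac[OF Cv C1_continuous[OF \<xi>(1)] \<xi>(2)])
        show "integrable lborel (\<lambda>x. \<phi> x * jac (\<lambda>l y. v k y $ g l) x)"
          by (rule integrable_mult_jac[OF Cv C1_continuous[OF C\<phi>] \<phi>r])
      qed
      have "\<bar>?J (\<lambda>x. \<xi> x - \<phi> x)\<bar> \<le> d * D"
      proof (rule bound[where r = "r + d"])
        show "C1 (\<lambda>x. \<xi> x - \<phi> x)" by (intro C1_diff \<xi>(1) C\<phi>)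
        show "\<forall>x. norm x \<ge> r + d --> \<xi> x - \<phi> x = 0" using \<phi>(2) \<xi>(2) d(1) by auto
        show "\<bar>\<xi> x - \<phi> x\<bar> \<le> d" for x using \<phi>(3)[of x] by linarith
        show "\<bar>pd \<alpha> (\<lambda>x. \<xi> x - \<phi> x) x\<bar> \<le> d" for \<alpha> x
          using \<phi>(4)[OF \<xi>(1), where \<alpha> = \<alpha> and x = x] by (simp add: pd_diff[OF \<xi>(1) C\<phi>] abs_minus_commute)
      qed (use r1 d k in auto)
      moreover have "?J (\<lambda>x. \<xi> x - \<phi> x) = ?J \<xi> - ?J \<phi>"
        unfolding left_diff_distrib by (rule Bochner_Integration.integral_diff[OF i])
      ultimately show "norm (?J \<xi> - 0) < e" using K1[of k] k d(3) by simp
    qed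
  qed
qed


subsection \<open>Multi-indices\<close>

lemma jac_permute:
  assumes "\<sigma> permutes UNIV" shows "jac (\<lambda>k. a (\<sigma> k)) x = of_int (sign \<sigma>) * jac a x"
  using det_permute_rows[OF assms, of "\<chi> k \<alpha>. pd \<alpha> (a k) x"] by (simp add: jac_def)

lemma injective_sort:
  fixes g :: "'n::{finite,linorder} \<Rightarrow> 'm::{finite,linorder}"
  assumes "inj g" obtains \<sigma> where "\<sigma> permutes UNIV" "strict_mono (\<lambda>k. g (\<sigma> k))"
proof -
  define xs where "xs = sorted_list_of_set (UNIV :: 'n set)"
  define ys where "ys = sorted_list_of_set (range g)"
  have xs: "sorted_wrt (<) xs" "set xs = UNIV" "distinct xs" and ys: "sorted_wrt (<) ys" "set ys = range g"
    unfolding xs_def ys_def by auto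
  have len: "length xs = length ys" unfolding xs_def ys_def using card_image[OF assms] by simp
  have "\<exists>i. i < length xs \<and> xs ! i = k" for k using xs(2) by (metis UNIV_I in_set_conv_nth)
  then obtain pos where pos: "\<And>k. pos k < length xs" "\<And>k. xs ! pos k = k" by metis
  define h where "h k = ys ! pos k" for k
  have h: "strict_mono h"
  proof (rule strict_monoI)
    fix j k :: 'n assume "j < k"
    have "pos j < pos k"
    proof (rule ccontr)
      assume "\<not> pos j < pos k"
      then consider "pos j = pos k" | "pos k < pos j" by linarith
      then show False
      proof cases
        case 1
        then have "xs ! pos j = xs ! pos k" by (rule arg_cong)
        then have "j = k" by (simp only: pos(2))
        then show False using \<open>j < k\<close> by simp
      next
        case 2
        then have "xs ! pos k < xs ! pos j" using xs(1) pos(1)[of j] by (simp add: sorted_wrt_iff_nth_less)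
        then have "k < j" by (simp only: pos(2))
        then show False using \<open>j < k\<close> by simp
      qed
    qed
    then show "h j < h k" unfolding h_def using ys(1) pos(1)[of k] len by (simp add: sorted_wrt_iff_nth_less)
  qed
  have "h k \<in> range g" for k unfolding h_def ys(2)[symmetric] using pos(1)[of k] len by simp
  then have hg: "g (inv g (h k)) = h k" for k by (simp add: f_inv_into_f)
  define \<sigma> where "\<sigma> k = inv g (h k)" for k
  have "inj \<sigma>"
  proof (rule injI)
    fix j k assume "\<sigma> j = \<sigma> k"
    then have "h j = h k" using hg by (metis \<sigma>_def)
    then show "j = k" using strict_mono_eq[OF h] by simp
  qed
  then have "\<sigma> permutes UNIV" by (intro bij_imp_permutes) (auto simp: bij_def finite_UNIV_inj_surj) 
  then show thesis using that[of \<sigma>] h hg by (simp add: \<sigma>_def)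
qed

text \<open>An injective index map is a permutation of an increasing one, which only changes the sign of
  the Jacobian; for the others two rows coincide.\<close>

lemma integral_jac_tendsto_0_all_indices:
  fixes v :: "nat \<Rightarrow> real^'n::{finite,linorder} \<Rightarrow> real^'m::{finite,linorder}"
  assumes v: "\<And>k. C1 (v k)"
    and mono: "\<And>g. strict_mono g ==> (\<lambda>k. LINT x|lborel. \<phi> x * jac (\<lambda>l y. v k y $ g l) x) \<longlonglongrightarrow> 0"
  shows "(\<lambda>k. LINT x|lborel. \<phi> x * jac (\<lambda>l y. v k y $ g l) x) \<longlonglongrightarrow> 0"
proof (cases "inj g")
  case True
  then obtain \<sigma> where \<sigma>: "\<sigma> permutes UNIV" "strict_mono (\<lambda>k. g (\<sigma> k))" by (rule injective_sort)
  have s: "of_int (sign \<sigma>) * (of_int (sign \<sigma>) :: real) = 1" by (simp add: sign_def)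
  have "jac (\<lambda>l y. v k y $ g l) x = of_int (sign \<sigma>) * jac (\<lambda>l y. v k y $ g (\<sigma> l)) x" for k x
    using jac_permute[OF \<sigma>(1), of "\<lambda>l y. v k y $ g l" x] s by (simp add: mult.assoc[symmetric])
  then have "(LINT x|lborel. \<phi> x * jac (\<lambda>l y. v k y $ g l) x)
     = of_int (sign \<sigma>) * (LINT x|lborel. \<phi> x * jac (\<lambda>l y. v k y $ g (\<sigma> l)) x)" for k
    by (simp only: mult.left_commute[of "\<phi> _"] integral_mult_right_zero)
  then show ?thesis using tendsto_mult_left[OF mono[OF \<sigma>(2)], of "of_int (sign \<sigma>)"] by simp
next
  case False
  then obtain i j where ij: "i \<noteq> j" "g i = g j" by (auto simp: inj_def)
  have "jac (\<lambda>l y. v k y $ g l) x = 0" for k x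
    unfolding jac_def by (rule det_identical_rows[OF ij(1)]) (simp add: row_def ij(2))
  then show ?thesis by simp
qed

text \<open>The chain rule for Jacobians, expanded in the rows instead of by the Cauchy-Binet formula:
  all maps between the index types occur, not only the increasing ones.\<close>

lemma jac_compose:
  fixes \<Phi> :: "'n::finite \<Rightarrow> real^'m \<Rightarrow> real" and F :: "real^'n \<Rightarrow> real^'m"
  assumes F: "C1 F" and \<Phi>: "\<And>k. C1 (\<Phi> k)"
  shows "jac (\<lambda>k x. \<Phi> k (F x)) x = (\<Sum>g\<in>UNIV. (\<Prod>k\<in>UNIV. pd (g k) (\<Phi> k) (F x)) * jac (\<lambda>k y. F y $ g k) x)"
proof -
  define row where "row k i = pd i (\<Phi> k) (F x) *s (\<chi> \<alpha>. pd \<alpha> (\<lambda>y. F y $ i) x)" for k i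
  have "jac (\<lambda>k x. \<Phi> k (F x)) x = det (\<chi> k. \<Sum>i\<in>UNIV. row k i)"
    unfolding jac_def
    by (rule arg_cong[where f = det])
       (simp add: vec_eq_iff row_def pd_compose[OF F \<Phi>] pd_component[OF F] sum_component mult.commute)
  also have "\<dots> = (\<Sum>g\<in>UNIV. det (\<chi> k. row k (g k)))"
  proof -
    have "(\<Prod>k\<in>UNIV. (\<Sum>i\<in>UNIV. row k i) $ q k) = (\<Sum>g\<in>UNIV. \<Prod>k\<in>UNIV. row k (g k) $ q k)" for q
      using prod_sum_PiE[of UNIV "\<lambda>_. UNIV" "\<lambda>k i. row k i $ q k"] by (simp add: sum_component)
    then have "det (\<chi> k. \<Sum>i\<in>UNIV. row k i) = (\<Sum>q | q permutes UNIV. \<Sum>g\<in>UNIV. of_int (sign q) * (\<Prod>k\<in>UNIV. row k (g k) $ q k))"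
      by (simp add: det_def sum_distrib_left)
    also have "\<dots> = (\<Sum>g\<in>UNIV. det (\<chi> k. row k (g k)))"
      by (subst sum.swap) (simp add: det_def)
    finally show ?thesis .
  qed
  also have "\<dots> = (\<Sum>g\<in>UNIV. (\<Prod>k\<in>UNIV. pd (g k) (\<Phi> k) (F x)) * jac (\<lambda>k y. F y $ g k) x)"
  proof (rule sum.cong[OF refl])
    fix g :: "'n \<Rightarrow> 'm"
    show "det (\<chi> k. row k (g k)) = (\<Prod>k\<in>UNIV. pd (g k) (\<Phi> k) (F x)) * jac (\<lambda>k y. F y $ g k) x"
      unfolding row_def jac_def
      using det_rows_mul[of "\<lambda>k. pd (g k) (\<Phi> k) (F x)" "\<lambda>k. \<chi> \<alpha>. pd \<alpha> (\<lambda>y. F y $ g k) x"] by simp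
  qed
  finally show ?thesis .
qed

section \<open>The topological contradiction\<close>

text \<open>The inverse of the boundary homeomorphism is approximated by polynomials times a bump
  function, so that the approximation has bounded derivatives on the whole space.\<close>

lemma approximate_inverse:
  fixes f :: "real^'n \<Rightarrow> real^'m" and h :: "real^'m \<Rightarrow> real^'n"
  assumes f: "continuous_on (sphere 0 1) f" and h: "continuous_on (f ` sphere 0 1) h"
    "\<And>x. norm x = 1 ==> h (f x) = x" and \<delta>: "\<delta> > 0"
  obtains \<Phi> :: "'n \<Rightarrow> real^'m \<Rightarrow> real" and R where "\<And>k. smooth_on UNIV (\<Phi> k)" "\<And>k y. norm y \<ge> R ==> \<Phi> k y = 0"
    "\<And>k x. norm x = 1 ==> \<bar>\<Phi> k (f x) - x $ k\<bar> \<le> \<delta>" "R > 0" "\<And>x. norm x = 1 ==> norm (f x) < R"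
proof -
  have cS: "compact (f ` sphere 0 1)" by (rule compact_continuous_image[OF f]) simp
  then obtain R where R: "R > 0" "\<And>x. norm x = 1 ==> norm (f x) < R"
    using compact_imp_bounded[OF cS] unfolding bounded_pos_less by auto
  define b where "b y = flat_exp 0 (R\<^sup>2 - y \<bullet> y)" for y :: "real^'m"
  have bpos: "b y > 0" if "y \<in> f ` sphere 0 1" for y
  proof -
    have "norm y < R" using that R(2) by auto
    then have "y \<bullet> y < R\<^sup>2" by (simp add: dot_square_norm power_strict_mono)
    then show ?thesis by (simp add: b_def flat_exp_def)
  qed
  have b1: "0 \<le> b y" "b y \<le> 1" for y by (auto simp: b_def flat_exp_def)
  have b0: "b y = 0" if "norm y \<ge> R" for y
  proof -
    have "R\<^sup>2 \<le> y \<bullet> y" using that R(1) by (simp add: dot_square_norm power_mono)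
    then show ?thesis by (simp add: b_def flat_exp_def)
  qed
  have sm: "smooth_on UNIV (\<lambda>y. P y * b y)" if "real_polynomial_function P" for P
    unfolding b_def by (rule smooth_polynomial_bump[OF that])
  have cb: "continuous_on UNIV b"
    using sm[of "\<lambda>_. 1"] C1_continuous[OF Ck_Suc_C1[of 0 b], of UNIV]
    by (simp add: smooth_on_def real_polynomial_function.intros(2) del: Ck_on.simps)
  have "\<exists>P. real_polynomial_function P \<and> (\<forall>y\<in>f ` sphere 0 1. \<bar>h y $ k / b y - P y\<bar> < \<delta>)" for k
  proof -
    have "continuous_on (f ` sphere 0 1) (\<lambda>y. h y $ k / b y)"
      using bpos by (intro continuous_on_divide continuous_on_component h(1) continuous_on_subset[OF cb]) force+
    from Stone_Weierstrass_real_polynomial_function[OF cS this \<delta>] show ?thesis by metis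
  qed
  then obtain P where P: "\<And>k. real_polynomial_function (P k)" "\<And>k y. y \<in> f ` sphere 0 1 ==> \<bar>h y $ k / b y - P k y\<bar> < \<delta>"
    by metis
  show thesis
  proof (rule that[of "\<lambda>k y. P k y * b y" R])
    fix k and x :: "real^'n" assume x: "norm x = 1"
    then have y: "f x \<in> f ` sphere 0 1" by simp
    have "\<bar>P k (f x) * b (f x) - x $ k\<bar> = b (f x) * \<bar>h (f x) $ k / b (f x) - P k (f x)\<bar>"
    proof -
      have "P k (f x) * b (f x) - x $ k = - (b (f x) * (h (f x) $ k / b (f x) - P k (f x)))"
        using bpos[OF y] h(2)[OF x] by (simp add: algebra_simps)
      then show ?thesis using bpos[OF y] by (simp add: abs_mult)
    qed
    also have "\<dots> \<le> 1 * \<delta>" using b1 P(2)[OF y, of k] by (intro mult_mono) auto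
    finally show "\<bar>P k (f x) * b (f x) - x $ k\<bar> \<le> \<delta>" by simp
  qed (use sm P(1) b0 R in auto)
qed

text \<open>At a fixed scale convergence in \<open>L\<^sup>1\<close> implies uniform convergence of the averages. Thus the
  average of one map of the sequence can stand for that of all later ones.\<close>

lemma avg_diff_bound:
  obtains C where "C > 0" "\<And>(v :: real^'n \<Rightarrow> real^'m) w t x i e. C1 v ==> C1 w ==> 0 < t ==> t \<le> 1/4 ==> norm x \<le> 1 ==> e \<ge> 0 ==>
    (\<integral>\<^sup>+y\<in>ball 0 1. ennreal (norm (v y - w y)) \<partial>lborel) \<le> ennreal e ==>
    \<bar>avg t (\<lambda>y. v y $ i) x - avg t (\<lambda>y. w y $ i) x\<bar> \<le> C / t ^ CARD('n) * e"
proof -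
  let ?n = "CARD('n)"
  obtain B where B: "B > 0" "\<And>z. \<bar>mol (z::real^'n)\<bar> \<le> B * indicator (ball 0 1) z"
    "\<And>z \<alpha>. \<bar>pd \<alpha> mol (z::real^'n)\<bar> \<le> B * indicator (ball 0 1) z" using mol_bound by metis
  show thesis
  proof (rule that[OF B(1)])
    fix v w :: "real^'n \<Rightarrow> real^'m" and t e :: real and x :: "real^'n" and i :: 'm
    assume a: "C1 v" "C1 w" "0 < t" "t \<le> 1/4" "norm x \<le> 1" "e \<ge> 0"
      and I: "(\<integral>\<^sup>+y\<in>ball 0 1. ennreal (norm (v y - w y)) \<partial>lborel) \<le> ennreal e"
    define m where "m = (1 - 2 * t) *\<^sub>R x"
    note cv = C1_continuous[OF a(1), of UNIV] C1_continuous[OF a(2), of UNIV]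
    have [measurable]: "v \<in> borel_measurable borel" "w \<in> borel_measurable borel"
      by (intro borel_measurable_continuous_onI cv)+
    let ?h = "\<lambda>z. mol z * (v (m + t *\<^sub>R z) $ i - w (m + t *\<^sub>R z) $ i)"
    have cvi: "continuous_on UNIV (\<lambda>y. v y $ i)" "continuous_on UNIV (\<lambda>y. w y $ i)"
      by (intro C1_continuous C1_component a)+
    have int: "integrable lborel ?h" "avg t (\<lambda>y. v y $ i) x - avg t (\<lambda>y. w y $ i) x = (LINT z|lborel. ?h z)"
      using integrable_mol[OF cvi(1), of t x] integrable_mol[OF cvi(2), of t x]
      by (auto simp: avg_def m_def right_diff_distrib)
    have sub: "ball m t \<subseteq> ball 0 1" unfolding m_def using shifted_ball_subset(1)[OF a(5,3) order_refl a(4)] by blast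
    have "ennreal \<bar>avg t (\<lambda>y. v y $ i) x - avg t (\<lambda>y. w y $ i) x\<bar> \<le> (\<integral>\<^sup>+z. norm (?h z) \<partial>lborel)"
      unfolding int(2) using integral_norm_bound_ennreal[OF int(1)] by simp
    also have "\<dots> \<le> (\<integral>\<^sup>+z. ennreal B * (ennreal (norm (v (m + t *\<^sub>R z) - w (m + t *\<^sub>R z))) * indicator (ball 0 1) z) \<partial>lborel)"
    proof (rule nn_integral_mono)
      fix z
      let ?g = "norm (v (m + t *\<^sub>R z) - w (m + t *\<^sub>R z))"
      have "norm (?h z) \<le> (B * indicator (ball 0 1) z) * ?g"
        unfolding real_norm_def abs_mult
      proof (intro mult_mono B(2))
        show "\<bar>v (m + t *\<^sub>R z) $ i - w (m + t *\<^sub>R z) $ i\<bar> \<le> ?g"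
          using component_le_norm_cart[of "v (m + t *\<^sub>R z) - w (m + t *\<^sub>R z)" i] by simp
      qed (use B(1) in auto)
      then have "ennreal (norm (?h z)) \<le> ennreal ((B * indicator (ball 0 1) z) * ?g)" by (rule ennreal_leI)
      also have "\<dots> = ennreal B * (ennreal ?g * indicator (ball 0 1) z)"
        using B(1) by (auto simp: indicator_def ennreal_mult)
      finally show "ennreal (norm (?h z)) \<le> ennreal B * (ennreal ?g * indicator (ball 0 1) z)" .
    qed
    also have "\<dots> = ennreal B * (\<integral>\<^sup>+z\<in>ball 0 1. ennreal (norm (v (m + t *\<^sub>R z) - w (m + t *\<^sub>R z))) \<partial>lborel)"
      by (rule nn_integral_cmult) (unfold measurable_lborel2, measurable)
    also have "(\<integral>\<^sup>+z\<in>ball 0 1. ennreal (norm (v (m + t *\<^sub>R z) - w (m + t *\<^sub>R z))) \<partial>lborel)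
       = ennreal (1 / t ^ ?n) * (\<integral>\<^sup>+y\<in>ball m t. ennreal (norm (v y - w y)) \<partial>lborel)"
      by (rule nn_integral_ball_rescale[OF a(3), of "\<lambda>y. ennreal (norm (v y - w y))"]) measurable
    also have "(\<integral>\<^sup>+y\<in>ball m t. ennreal (norm (v y - w y)) \<partial>lborel) \<le> (\<integral>\<^sup>+y\<in>ball 0 1. ennreal (norm (v y - w y)) \<partial>lborel)"
      using sub by (intro nn_integral_mono) (auto simp: indicator_def)
    also note I
    finally have "ennreal \<bar>avg t (\<lambda>y. v y $ i) x - avg t (\<lambda>y. w y $ i) x\<bar> \<le> ennreal B * (ennreal (1 / t ^ ?n) * ennreal e)"
      by (simp add: mult_left_mono)
    also have "\<dots> = ennreal (B / t ^ ?n * e)"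
      using B(1) a by (simp add: ennreal_mult[symmetric])
    finally show "\<bar>avg t (\<lambda>y. v y $ i) x - avg t (\<lambda>y. w y $ i) x\<bar> \<le> B / t ^ ?n * e"
      using B(1) a by simp
  qed
qed

lemma pd_compose_bound:
  fixes F :: "real^'n \<Rightarrow> real^'m"
  assumes F: "C1 F" and \<psi>: "C1 \<psi>" "\<And>i y. \<bar>pd i \<psi> y\<bar> \<le> L" and D: "\<And>i. \<bar>pd \<alpha> (\<lambda>y. F y $ i) x\<bar> \<le> D"
  shows "\<bar>pd \<alpha> (\<lambda>x. \<psi> (F x)) x\<bar> \<le> real CARD('m) * L * D"
proof -
  have "\<bar>pd \<alpha> (\<lambda>x. \<psi> (F x)) x\<bar> \<le> (\<Sum>i\<in>(UNIV::'m set). \<bar>pd \<alpha> F x $ i * pd i \<psi> (F x)\<bar>)"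
    unfolding pd_compose[OF F \<psi>(1)] by (simp add: sum_abs)
  also have "\<dots> \<le> (\<Sum>i\<in>(UNIV::'m set). D * L)"
  proof (rule sum_mono)
    fix i :: 'm
    have "\<bar>pd \<alpha> F x $ i\<bar> \<le> D" using D[of i] by (simp add: pd_component[OF F])
    then show "\<bar>pd \<alpha> F x $ i * pd i \<psi> (F x)\<bar> \<le> D * L"
      unfolding abs_mult using \<psi>(2) by (intro mult_mono) (auto intro: order_trans[OF abs_ge_zero])
  qed
  finally show ?thesis by (simp add: mult_ac)
qed

lemma C1_compact_support_pd_bounded:
  fixes \<psi> :: "real^'m \<Rightarrow> real"
  assumes "C1 \<psi>" "\<And>y. norm y \<ge> R ==> \<psi> y = 0"
  shows "\<exists>L>0. \<forall>i y. \<bar>pd i \<psi> y\<bar> \<le> L"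
proof -
  obtain L where L: "L > 0" "\<And>i y. norm y \<le> R ==> \<bar>pd i \<psi> y\<bar> \<le> L" using C1_pd_bounded[OF assms(1), of R] by metis
  have "\<bar>pd i \<psi> y\<bar> \<le> L" for i y
  proof (cases "norm y \<le> R")
    case False
    then have "pd i \<psi> y = 0" by (intro pd_eq_0[of "- cball 0 R"]) (auto simp: assms(2))
    then show ?thesis using L(1) by simp
  qed (rule L(2))
  then show ?thesis using L(1) by blast
qed

text \<open>The order of choices is what makes the argument work. All constants depend on \<open>f\<close> and the
  exponents alone; the smallness \<open>d\<close> of the scaled gradients is chosen from them, then the scale \<open>t\<close>,
  then the index \<open>k0\<close> that fixes the weights, and only then does the index of the sequence tend to
  infinity.\<close>

theorem no_rank_deficient_approximation:
  fixes v :: "nat \<Rightarrow> real^'n \<Rightarrow> real^'m"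
  assumes n2: "CARD('n) \<ge> 2" and p: "real CARD('n) \<le> p" "p \<le> real CARD('n) + 1"
    and v: "\<And>k. C1 (v k)" and dec: "osc_decay p v"
    and cauchy: "\<And>e. e > 0 ==> \<exists>K. \<forall>k\<ge>K. \<forall>l\<ge>K. (\<integral>\<^sup>+x\<in>ball 0 1. ennreal (norm (v k x - v l x)) \<partial>lborel) \<le> ennreal e"
    and trace: "\<And>i e. e > 0 ==> \<exists>K. \<forall>k\<ge>K. (\<integral>\<^sup>+x\<in>ball 0 1 - {0}. ennreal \<bar>v k (sgn x) $ i - f (sgn x) $ i\<bar> \<partial>lborel) \<le> ennreal e"
    and rank: "\<And>g \<phi>. test_function (ball 0 1) \<phi> ==> (\<lambda>k. LINT x|lborel. \<phi> x * jac (\<lambda>l y. v k y $ g l) x) \<longlonglongrightarrow> 0"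
    and f: "continuous_on (sphere 0 1) f" "(\<lambda>x. f (sgn x)) \<in> borel_measurable borel"
    and h: "continuous_on (f ` sphere 0 1) h" "\<And>x. norm x = 1 ==> h (f x) = x"
  shows False
proof -
  let ?n = "CARD('n)" and ?m = "real CARD('m)"
  have p1: "p \<ge> 1" using n2 p by linarith
  have m1: "?m \<ge> 1" by (simp add: Suc_leI)
  obtain C1' where C1': "C1' > 0" "\<And>(v :: real^'n \<Rightarrow> real^'m) s t x y i \<alpha>. C1 v ==> 0 < s ==> s \<le> t ==> t \<le> 2 * s ==> s \<le> 1/4 ==>
      ball ((1 - 2 * s) *\<^sub>R x) s \<subseteq> ball 0 1 \<inter> ball y (6 * t) ==>
      s * \<bar>pd \<alpha> (avg s (\<lambda>y. v y $ i)) x\<bar> \<le> C1' * (enn2real (osc p t v y) / t ^ CARD('n)) powr (1 / p)"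
  proof (rule avg_osc_bound[OF p1, where 'n = 'n and 'm = 'm], goal_cases)
    case (1 C) then show ?thesis by (intro that[of C]) auto
  qed
  obtain C2 where C2: "C2 > 0" "\<And>(v :: real^'n \<Rightarrow> real^'m) t x i \<alpha> \<delta>. C1 v ==> 0 < t ==> t \<le> 1/4 ==> norm x \<le> 1 ==> \<delta> \<ge> 0 ==>
      Osc p t v (ball ((1 - 2 * t) *\<^sub>R x) t) \<le> ennreal (\<delta> * t ^ (2 * CARD('n))) ==>
      t * \<bar>pd \<alpha> (avg t (\<lambda>y. v y $ i)) x\<bar> \<le> C2 * \<delta> powr (1 / p)"
  proof (rule avg_pd_bound[OF p1, where 'n = 'n and 'm = 'm], goal_cases)
    case (1 C) then show ?thesis by (intro that[of C]) auto
  qed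
  obtain CE where CE: "CE > 0" "\<And>(v :: real^'n \<Rightarrow> real^'m) (g :: 'n \<Rightarrow> 'm) t \<xi> r b \<beta> B Q. C1 v ==> 0 < t ==> t \<le> 1/4 ==>
      C1 \<xi> ==> \<forall>x. norm x \<ge> r --> \<xi> x = 0 ==> r < 1 ==> b \<in> borel_measurable borel ==>
      (\<And>x \<alpha>. norm x < 1 ==> \<bar>pd \<alpha> \<xi> x\<bar> \<le> b x / t) ==> (\<And>x. 0 \<le> b x) ==> (\<And>x. norm x < 1 ==> b x \<le> \<beta>) ==> \<beta> > 0 ==> B \<ge> 0 ==> Q \<ge> 0 ==>
      (\<integral>\<^sup>+x\<in>ball 0 1. ennreal (b x powr p) \<partial>lborel) \<le> ennreal (B * t ^ CARD('n)) ==>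
      (\<And>j. Osc p (t / 2 ^ j) v (ball 0 1) \<le> ennreal (Q * (t / 2 ^ j) ^ (2 * CARD('n)))) ==>
      \<bar>(LINT x|lborel. \<xi> x * jac (\<lambda>k. avg t (\<lambda>y. v y $ g k)) x) - (LINT x|lborel. \<xi> x * jac (\<lambda>k y. v y $ g k) x)\<bar>
        \<le> CE * \<beta> powr (real CARD('n) + 1 - p) * (B + Q)"
  proof (rule integral_jac_avg_comparison[OF n2 p, where 'm = 'm], goal_cases)
    case (1 C) show ?thesis by (rule that[OF 1(2)]) (rule 1(3))
  qed
  obtain C4 where C4: "C4 > 0" "\<And>(v :: real^'n \<Rightarrow> real^'m) t i \<delta> e g \<theta>. C1 v ==> 0 < t ==> t \<le> 1/4 ==> \<delta> \<ge> 0 ==> e > 0 ==>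
      (\<And>j. Osc p (t / 2 ^ j) v (ball 0 1 - cball 0 (1 - 3 * (t / 2 ^ j))) \<le> ennreal (\<delta> * (t / 2 ^ j) ^ (2 * CARD('n)))) ==>
      (\<And>x. norm x \<le> 1 ==> Osc p t v (ball ((1 - 2 * t) *\<^sub>R x) t) \<le> ennreal (\<delta> * t ^ (2 * CARD('n)))) ==>
      norm \<theta> = 1 ==> (\<And>x. norm x = 1 ==> norm (x - \<theta>) < 4 * t ==> \<bar>g x - g \<theta>\<bar> \<le> e) ==>
      (\<lambda>x. g (sgn x)) \<in> borel_measurable borel ==>
      (\<integral>\<^sup>+x\<in>ball 0 1 - {0}. ennreal \<bar>v (sgn x) $ i - g (sgn x)\<bar> \<partial>lborel) \<le> ennreal (e * t ^ (CARD('n) - 1)) ==>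
      \<bar>avg t (\<lambda>y. v y $ i) \<theta> - g \<theta>\<bar> \<le> C4 * (\<delta> powr (1 / p) + e)"
  proof (rule avg_close_to_trace[OF p1 n2, where 'm = 'm], goal_cases)
    case (1 C) show ?thesis by (rule that[OF 1(2)]) (rule 1(3))
  qed
  obtain C6 where C6: "C6 > 0" "\<And>(v :: real^'n \<Rightarrow> real^'m) w t x i e. C1 v ==> C1 w ==> 0 < t ==> t \<le> 1/4 ==> norm x \<le> 1 ==> e \<ge> 0 ==>
    (\<integral>\<^sup>+y\<in>ball 0 1. ennreal (norm (v y - w y)) \<partial>lborel) \<le> ennreal e ==>
    \<bar>avg t (\<lambda>y. v y $ i) x - avg t (\<lambda>y. w y $ i) x\<bar> \<le> C6 / t ^ CARD('n) * e"
  proof (rule avg_diff_bound[where 'n = 'n and 'm = 'm], goal_cases)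
    case (1 C) then show ?thesis by (intro that[of C]) auto
  qed
  define \<mu> where "\<mu> = measure lborel (ball (0::real^'n) 1)"
  have \<mu>: "\<mu> > 0" unfolding \<mu>_def by (rule content_ball_pos) simp
  have e\<mu>: "emeasure lborel (ball (0::real^'n) 1) = ennreal \<mu>"
    unfolding \<mu>_def using emeasure_lborel_ball_finite[of "0::real^'n" 1] by (intro emeasure_eq_ennreal_measure) auto

  \<comment> \<open>The closed form on the target: the pullback of a bump form by an approximate inverse of the
    boundary map.\<close>
  define \<delta>0 where "\<delta>0 = 1 / (8 * real ?n)"
  have \<delta>0: "\<delta>0 > 0" using n2 by (simp add: \<delta>0_def)
  obtain Y \<eta> \<eta>' :: "real \<Rightarrow> real" where Y:
    "\<And>t. (Y has_real_derivative \<eta> t) (at t)" "\<And>t. (\<eta> has_real_derivative \<eta>' t) (at t)"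
    "continuous_on UNIV \<eta>'" "\<And>t. \<bar>t\<bar> \<ge> \<delta>0 ==> \<eta> t = 0" "\<And>t. t \<le> -\<delta>0 ==> Y t = 0" "\<And>t. t \<ge> \<delta>0 ==> Y t = 1"
    "\<And>t. \<eta> t \<ge> 0" "\<eta> 0 > 0"
    by (rule step_bump_exists[OF \<delta>0]) blast
  have C\<eta>: "C1 \<eta>" by (rule C1_real[OF Y(2,3)])
  have \<delta>02: "\<delta>0 / 2 > 0" using \<delta>0 by simp
  obtain \<Phi> :: "'n \<Rightarrow> real^'m \<Rightarrow> real" and R where \<Phi>: "\<And>k. smooth_on UNIV (\<Phi> k)" "\<And>k y. norm y \<ge> R ==> \<Phi> k y = 0"
    "\<And>k x. norm x = 1 ==> \<bar>\<Phi> k (f x) - x $ k\<bar> \<le> \<delta>0 / 2" "R > 0"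
    using approximate_inverse[OF f(1) h \<delta>02] by metis
  have C\<Phi>: "C1 (\<Phi> k)" "C1 (pd i (\<Phi> k))" for k i
  proof -
    have *: "Ck_on (Suc (Suc 0)) UNIV (\<Phi> k)" using \<Phi>(1)[of k] by (simp only: smooth_on_def)
    show "C1 (\<Phi> k)" by (rule Ck_Suc_C1[OF *])
    have "Ck_on (Suc 0) UNIV (pd i (\<Phi> k))" using * Ck_on.simps(2)[of "Suc 0"] by blast
    then show "C1 (pd i (\<Phi> k))" by (rule Ck_Suc_C1)
  qed
  have "\<exists>L>0. \<forall>i y. \<bar>pd i (\<Phi> k) y\<bar> \<le> L" for k
    by (rule C1_compact_support_pd_bounded[OF C\<Phi>(1) \<Phi>(2)])
  then obtain L\<Phi>' where L\<Phi>': "\<And>k. L\<Phi>' k > 0" "\<And>k i y. \<bar>pd i (\<Phi> k) y\<bar> \<le> L\<Phi>' k" by metis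
  define L\<Phi> where "L\<Phi> = (\<Sum>k\<in>UNIV. L\<Phi>' k)"
  have L\<Phi>: "L\<Phi> > 0" "L\<Phi>' k \<le> L\<Phi>" for k
  proof -
    show "L\<Phi> > 0" unfolding L\<Phi>_def using L\<Phi>'(1) by (intro sum_pos) auto
    show "L\<Phi>' k \<le> L\<Phi>" unfolding L\<Phi>_def using L\<Phi>'(1) by (intro member_le_sum) (auto simp: less_imp_le)
  qed
  have Lip: "\<bar>\<Phi> k y - \<Phi> k z\<bar> \<le> ?m * L\<Phi> * norm (y - z)" for k y z
    by (rule C1_lipschitz[OF C\<Phi>(1) convex_UNIV]) (use L\<Phi>'(2) L\<Phi>(2) order_trans in \<open>blast+\<close>)
  define \<psi> where "\<psi> g y = (\<Prod>k\<in>UNIV. \<eta> (\<Phi> k y)) * (\<Prod>k\<in>UNIV. pd (g k) (\<Phi> k) y)" for g y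
  have C\<psi>: "C1 (\<psi> g)" for g
    unfolding \<psi>_def[abs_def] by (intro C1_mult C1_prod C1_compose[OF C\<Phi>(1) C\<eta>] C\<Phi>(2))
  have "\<psi> g y = 0" if "norm y \<ge> R + 1" for g y
  proof -
    have "pd i (\<Phi> k) y = 0" for i k
      by (rule pd_eq_0[of "- cball 0 R"]) (use that \<Phi>(2) in auto)
    then show ?thesis by (simp add: \<psi>_def)
  qed
  then have "\<exists>L>0. \<forall>i y. \<bar>pd i (\<psi> g) y\<bar> \<le> L" for g
    by (intro C1_compact_support_pd_bounded[OF C\<psi>, of "R + 1"])
  then obtain L' where L': "\<And>g. L' g > 0" "\<And>g i y. \<bar>pd i (\<psi> g) y\<bar> \<le> L' g" by metis
  define L where "L = (\<Sum>g\<in>UNIV. L' g)"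
  have L: "L > 0" "\<bar>pd i (\<psi> g) y\<bar> \<le> L" for g i y
  proof -
    show "L > 0" unfolding L_def using L'(1) by (intro sum_pos) auto
    have "L' g \<le> L" unfolding L_def using L'(1) by (intro member_le_sum) (auto simp: less_imp_le)
    then show "\<bar>pd i (\<psi> g) y\<bar> \<le> L" using L'(2)[where g = g and i = i and y = y] by linarith
  qed

  \<comment> \<open>All constants are fixed before the scale \<open>t\<close> and the index \<open>k0\<close> are chosen.\<close>
  define c0 where "c0 = (LINT x|lborel. (\<Prod>l\<in>UNIV. \<eta> ((x::real^'n) $ l)))"
  have Wid: "C1 (\<lambda>x::real^'n. x $ l)" for l by (intro C1_linear bounded_linear_vec_nth)
  have c0: "c0 > 0" unfolding c0_def
    by (rule degree_integral_pos(2)[where W = "\<lambda>l x. x $ l" and Y = Y and \<eta>' = \<eta>'])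
       (use Y Wid \<delta>0 in \<open>auto simp: \<delta>0_def[symmetric]\<close>)
  define Ng where "Ng = real (card (UNIV :: ('n \<Rightarrow> 'm) set))"
  have Ng: "Ng \<ge> 1" by (simp add: Ng_def Suc_leI card_gt_0_iff)
  define \<epsilon> where "\<epsilon> = c0 / (4 * Ng)"
  have \<epsilon>: "\<epsilon> > 0" using c0 Ng by (simp add: \<epsilon>_def)
  obtain M where M: "M > 0" and dec': "\<And>\<delta>. \<delta> > 0 ==> \<exists>\<eta>>0. \<eta> \<le> 1/4 \<and> (\<exists>K. \<forall>k\<ge>K. \<forall>t. 0 < t \<and> t \<le> \<eta> -->
     Osc p t (v k) (ball 0 1) \<le> ennreal (M * t ^ (2 * CARD('n))) \<and>
     (p \<noteq> real CARD('n) --> Osc p t (v k) (ball 0 1) \<le> ennreal (\<delta> * t ^ (2 * CARD('n)))) \<and>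
     Osc p t (v k) (ball 0 1 - cball 0 (1 - 3 * t)) \<le> ennreal (\<delta> * t ^ (2 * CARD('n))) \<and>
     (\<forall>x. norm x \<le> 1 --> Osc p t (v k) (ball ((1 - 2 * t) *\<^sub>R x) t) \<le> ennreal (\<delta> * t ^ (2 * CARD('n)))))"
    using dec unfolding osc_decay_def by blast
  define A1 where "A1 = (?m * L * C1') powr p"
  have A1: "A1 > 0" using m1 L(1) C1'(1) by (simp add: A1_def)
  define A2 where "A2 = ?m * L * C2"
  have A2: "A2 > 0" using m1 L(1) C2(1) by (simp add: A2_def)
  define d where "d = min 1 (min (\<delta>0 / (4 * ?m * ?m * L\<Phi> * C4)) (\<epsilon> / (CE * (A1 + 1) * (A2 + 1) * (M + 1))))"
  have d: "d > 0" "d \<le> 1" "d \<le> \<delta>0 / (4 * ?m * ?m * L\<Phi> * C4)" "d \<le> \<epsilon> / (CE * (A1 + 1) * (A2 + 1) * (M + 1))"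
    unfolding d_def using \<delta>0 m1 L\<Phi>(1) C4(1) \<epsilon> CE(1) A1 A2 M by (auto intro!: divide_pos_pos mult_pos_pos add_pos_pos)
  define \<delta> where "\<delta> = d powr p"
  have \<delta>: "\<delta> > 0" "\<delta> powr (1 / p) = d" "\<delta> \<le> d"
  proof -
    show "\<delta> > 0" "\<delta> powr (1 / p) = d" using d(1) p1 by (auto simp: \<delta>_def powr_powr)
    have "d powr p \<le> d powr 1" using d(1,2) p1 by (intro powr_mono') auto
    then show "\<delta> \<le> d" using d(1) by (simp add: \<delta>_def)
  qed
  define \<beta> where "\<beta> = A2 * d"
  have \<beta>: "\<beta> > 0" using A2 d(1) by (simp add: \<beta>_def)
  define \<Omega> where "\<Omega> = (if p = real ?n then M else \<delta>)"
  have \<Omega>: "\<Omega> > 0" using M \<delta>(1) by (simp add: \<Omega>_def)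
  have small: "CE * \<beta> powr (real ?n + 1 - p) * (A1 * \<Omega> + \<Omega>) \<le> \<epsilon>"
  proof -
    have "\<beta> powr (real ?n + 1 - p) * \<Omega> \<le> (A2 + 1) * (M + 1) * d"
    proof (cases "p = real ?n")
      case True
      then have "\<beta> powr (real ?n + 1 - p) * \<Omega> = A2 * M * d" using \<beta> by (simp add: \<Omega>_def \<beta>_def)
      also have "\<dots> \<le> (A2 + 1) * (M + 1) * d" using A2 M d(1) by (intro mult_right_mono mult_mono) auto
      finally show ?thesis .
    next
      case False
      have "\<beta> \<le> A2 * 1" unfolding \<beta>_def using A2 d by (intro mult_left_mono) auto
      then have "\<beta> powr (real ?n + 1 - p) \<le> (A2 + 1) powr (real ?n + 1 - p)" using \<beta> p by (intro powr_mono2) auto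
      also have "\<dots> \<le> (A2 + 1) powr 1" using A2 p by (intro powr_mono) auto
      also have "\<dots> = A2 + 1" using A2 by simp
      finally have "\<beta> powr (real ?n + 1 - p) * \<Omega> \<le> (A2 + 1) * d"
        using False \<delta> \<Omega> A2 d(1) by (intro mult_mono) (auto simp: \<Omega>_def)
      also have "\<dots> \<le> (A2 + 1) * (M + 1) * d"
        using A2 M d(1) by (intro mult_right_mono) (auto simp: distrib_left)
      finally show ?thesis .
    qed
    then have "(CE * (A1 + 1)) * (\<beta> powr (real ?n + 1 - p) * \<Omega>) \<le> (CE * (A1 + 1)) * ((A2 + 1) * (M + 1) * d)"
      using CE(1) A1 by (intro mult_left_mono) auto
    also have "\<dots> = (CE * (A1 + 1) * (A2 + 1) * (M + 1)) * d" by (simp add: mult_ac)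
    also have "\<dots> \<le> \<epsilon>"
    proof -
      have "CE * (A1 + 1) * (A2 + 1) * (M + 1) > 0" using CE(1) A1 A2 M by (intro mult_pos_pos add_pos_pos) auto
      then show ?thesis using d(4) by (simp add: pos_le_divide_eq mult.commute)
    qed
    finally show ?thesis by (simp add: algebra_simps)
  qed
  from dec'[OF \<delta>(1)] obtain t1 K1 where t1: "t1 > 0" "t1 \<le> 1/4" and K1': "\<forall>k\<ge>K1. \<forall>t. 0 < t \<and> t \<le> t1 -->
     Osc p t (v k) (ball 0 1) \<le> ennreal (M * t ^ (2 * CARD('n))) \<and>
     (p \<noteq> real CARD('n) --> Osc p t (v k) (ball 0 1) \<le> ennreal (\<delta> * t ^ (2 * CARD('n)))) \<and>
     Osc p t (v k) (ball 0 1 - cball 0 (1 - 3 * t)) \<le> ennreal (\<delta> * t ^ (2 * CARD('n))) \<and>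
     (\<forall>x. norm x \<le> 1 --> Osc p t (v k) (ball ((1 - 2 * t) *\<^sub>R x) t) \<le> ennreal (\<delta> * t ^ (2 * CARD('n))))"
    by blast
  have K1: "Osc p t (v k) (ball 0 1) \<le> ennreal (M * t ^ (2 * ?n))"
    "p \<noteq> real ?n ==> Osc p t (v k) (ball 0 1) \<le> ennreal (\<delta> * t ^ (2 * ?n))"
    "Osc p t (v k) (ball 0 1 - cball 0 (1 - 3 * t)) \<le> ennreal (\<delta> * t ^ (2 * ?n))"
    "norm x \<le> 1 ==> Osc p t (v k) (ball ((1 - 2 * t) *\<^sub>R x) t) \<le> ennreal (\<delta> * t ^ (2 * ?n))"
    if k: "k \<ge> K1" and t: "0 < t" "t \<le> t1" for k t x
  proof -
    note * = mp[OF spec[OF mp[OF spec[OF K1'] k]] conjI[OF t]]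
    show "Osc p t (v k) (ball 0 1) \<le> ennreal (M * t ^ (2 * ?n))" by (rule conjunct1[OF *])
    show "Osc p t (v k) (ball 0 1) \<le> ennreal (\<delta> * t ^ (2 * ?n))" if "p \<noteq> real ?n"
      by (rule mp[OF conjunct1[OF conjunct2[OF *]] that])
    show "Osc p t (v k) (ball 0 1 - cball 0 (1 - 3 * t)) \<le> ennreal (\<delta> * t ^ (2 * ?n))"
      by (rule conjunct1[OF conjunct2[OF conjunct2[OF *]]])
    show "Osc p t (v k) (ball ((1 - 2 * t) *\<^sub>R x) t) \<le> ennreal (\<delta> * t ^ (2 * ?n))" if "norm x \<le> 1"
      by (rule mp[OF spec[OF conjunct2[OF conjunct2[OF conjunct2[OF *]]]] that])
  qed
  have "uniformly_continuous_on (sphere 0 1) f" by (rule compact_uniformly_continuous[OF f(1)]) simp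
  then obtain \<tau> where \<tau>: "\<tau> > 0" "\<And>x y. x \<in> sphere 0 1 ==> y \<in> sphere 0 1 ==> dist y x < \<tau> ==> dist (f y) (f x) < d"
    unfolding uniformly_continuous_on_def using d(1) by meson
  define t where "t = min t1 (\<tau> / 4)"
  have t: "0 < t" "t \<le> 1/4" "t \<le> t1" "4 * t \<le> \<tau>" using t1 \<tau>(1) by (auto simp: t_def)
  have tj: "0 < t / 2 ^ j" "t / 2 ^ j \<le> t1" for j :: nat
  proof -
    have "t / 2 ^ j \<le> t / 1" using t by (intro divide_left_mono) auto
    then show "t / 2 ^ j \<le> t1" using t by simp
  qed (use t in simp)
  define H where "H = real ?n * (fact ?n * (C6 / t ^ ?n * (\<beta> / t) * (C2 * d / t) ^ (?n - 1)) * \<mu>)"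
  have H: "H \<ge> 0" unfolding H_def using C6(1) t \<beta> C2(1) d(1) \<mu> by auto
  define e1 where "e1 = \<epsilon> / (H + 1)"
  have e1: "e1 > 0" "H * e1 \<le> \<epsilon>"
  proof -
    show "e1 > 0" using \<epsilon> H by (simp add: e1_def)
    have "H * e1 \<le> (H + 1) * e1" using \<open>e1 > 0\<close> by (intro mult_right_mono) auto
    also have "\<dots> = \<epsilon>" using H by (simp add: e1_def)
    finally show "H * e1 \<le> \<epsilon>" .
  qed
  obtain K3 where K3: "\<And>k l. k \<ge> K3 ==> l \<ge> K3 ==> (\<integral>\<^sup>+x\<in>ball 0 1. ennreal (norm (v k x - v l x)) \<partial>lborel) \<le> ennreal e1"
    using cauchy[OF e1(1)] by blast
  have "d * t ^ (?n - 1) > 0" using d(1) t by simp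
  then have "\<forall>i. \<exists>K. \<forall>k\<ge>K. (\<integral>\<^sup>+x\<in>ball 0 1 - {0}. ennreal \<bar>v k (sgn x) $ i - f (sgn x) $ i\<bar> \<partial>lborel) \<le> ennreal (d * t ^ (?n - 1))"
    by (intro allI trace)
  from choice[OF this] obtain K2' where K2'': "\<forall>i. \<forall>k\<ge>K2' i.
    (\<integral>\<^sup>+x\<in>ball 0 1 - {0}. ennreal \<bar>v k (sgn x) $ i - f (sgn x) $ i\<bar> \<partial>lborel) \<le> ennreal (d * t ^ (?n - 1))" ..
  note K2' = mp[OF spec[OF spec[OF K2'']]]
  define k0 where "k0 = max K1 (max K3 (Max (range K2')))"
  have k0: "k0 \<ge> K1" "k0 \<ge> K3" "k0 \<ge> K2' i" for i by (auto simp: k0_def max.coboundedI2)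

  \<comment> \<open>The averaged map and its degree.\<close>
  define F where "F = avg t (v k0)"
  have CF: "C1 F" unfolding F_def by (rule avg_C1[OF v])
  have Fi: "F x $ i = avg t (\<lambda>y. v k0 y $ i) x" for x i unfolding F_def by (rule avg_component[OF v])
  have close: "\<bar>\<Phi> l (F \<theta>) - \<theta> $ l\<bar> \<le> \<delta>0" if \<theta>: "norm \<theta> = 1" for l \<theta>
  proof -
    have "\<bar>F \<theta> $ i - f \<theta> $ i\<bar> \<le> C4 * (d + d)" for i
    proof -
      have "\<bar>avg t (\<lambda>y. v k0 y $ i) \<theta> - (\<lambda>x. f x $ i) \<theta>\<bar> \<le> C4 * (\<delta> powr (1 / p) + d)"
      proof (rule C4(2)[OF v t(1,2) less_imp_le[OF \<delta>(1)] d(1) K1(3)[OF k0(1) tj] K1(4)[OF k0(1) t(1,3)] \<theta>])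
        show "\<bar>f x $ i - f \<theta> $ i\<bar> \<le> d" if "norm x = 1" "norm (x - \<theta>) < 4 * t" for x
        proof -
          have "dist (f x) (f \<theta>) < d" by (rule \<tau>(2)) (use that \<theta> t(4) in \<open>auto simp: dist_norm\<close>)
          then show ?thesis using component_le_norm_cart[of "f x - f \<theta>" i] by (simp add: dist_norm)
        qed
        show "(\<lambda>x. f (sgn x) $ i) \<in> borel_measurable borel"
          by (rule measurable_compose[OF f(2)]) (intro borel_measurable_continuous_onI continuous_intros)
      qed (use K2'[OF k0(3)] in auto)
      then show ?thesis by (simp add: Fi \<delta>(2))
    qed
    then have "norm (F \<theta> - f \<theta>) \<le> (\<Sum>i\<in>(UNIV::'m set). C4 * (d + d))"
      by (intro order_trans[OF norm_le_l1_cart] sum_mono) auto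
    also have "\<dots> = ?m * C4 * 2 * d" by simp
    finally have "?m * L\<Phi> * norm (F \<theta> - f \<theta>) \<le> ?m * L\<Phi> * (?m * C4 * 2 * d)"
      using m1 L\<Phi>(1) by (intro mult_left_mono) auto
    also have "\<dots> \<le> \<delta>0 / 2"
    proof -
      have "4 * ?m * ?m * L\<Phi> * C4 > 0" using m1 L\<Phi>(1) C4(1) by (intro mult_pos_pos) auto
      then have "d * (4 * ?m * ?m * L\<Phi> * C4) \<le> \<delta>0" using d(3) by (simp add: pos_le_divide_eq)
      then show ?thesis by (simp add: mult_ac)
    qed
    finally have "\<bar>\<Phi> l (F \<theta>) - \<Phi> l (f \<theta>)\<bar> \<le> \<delta>0 / 2" using Lip[of l "F \<theta>" "f \<theta>"] by linarith
    then show ?thesis using \<Phi>(3)[OF \<theta>, of l] by linarith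
  qed
  have CW: "C1 (\<lambda>x. \<Phi> l (F x))" for l by (rule C1_compose[OF CF C\<Phi>(1)])
  have deg: "(LINT x|lborel. indicator (ball 0 1) x * ((\<Prod>l\<in>UNIV. \<eta> (\<Phi> l (F x))) * jac (\<lambda>l x. \<Phi> l (F x)) x)) = c0"
    unfolding c0_def
    by (rule degree_integral_pos(1)[where W = "\<lambda>l x. \<Phi> l (F x)" and Y = Y and \<eta>' = \<eta>'])
       (use Y CW close in \<open>auto simp: \<delta>0_def[symmetric]\<close>)

  \<comment> \<open>Near the sphere the pulled back form vanishes, so its coefficients are admissible weights.\<close>
  have Cdiff: "continuous_on UNIV (\<lambda>x. \<Phi> l (F x) - x $ l)" for l
    by (intro C1_continuous C1_diff CW Wid)
  have "\<forall>l. \<exists>r>0. \<forall>x. 1 - r \<le> norm x --> norm x \<le> 1 --> \<bar>\<Phi> l (F x) - x $ l\<bar> \<le> 2 * \<delta>0"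
    using close_near_sphere[OF Cdiff close \<delta>0] by blast
  then obtain rc where rc: "\<And>l. rc l > 0" "\<And>l x. 1 - rc l \<le> norm x ==> norm x \<le> 1 ==> \<bar>\<Phi> l (F x) - x $ l\<bar> \<le> 2 * \<delta>0"
    by metis
  define r where "r = Min (insert (1/2) (range rc))"
  have r0: "r > 0" unfolding r_def using rc(1) by (subst Min_gr_iff) auto
  have r: "r \<le> 1/2" "\<And>l. r \<le> rc l" unfolding r_def by (rule Min_le, simp, simp)+
  have \<psi>0: "\<psi> g (F x) = 0" if x: "1 - r \<le> norm x" "norm x \<le> 1" for g x
  proof (rule ccontr)
    assume "\<psi> g (F x) \<noteq> 0"
    then have "\<eta> (\<Phi> l (F x)) \<noteq> 0" for l by (auto simp: \<psi>_def prod_zero_iff)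
    then have a: "\<bar>\<Phi> l (F x)\<bar> < \<delta>0" for l using Y(4)[of "\<Phi> l (F x)"] by (meson linorder_not_le)
    have b: "\<bar>\<Phi> l (F x) - x $ l\<bar> \<le> 2 * \<delta>0" for l using x r(2)[of l] by (intro rc(2)) auto
    have xl: "\<bar>x $ l\<bar> \<le> 3 * \<delta>0" for l using a[of l] b[of l] by arith
    have "norm x \<le> (\<Sum>l\<in>(UNIV::'n set). 3 * \<delta>0)"
      by (intro order_trans[OF norm_le_l1_cart] sum_mono xl)
    also have "\<dots> = 3 / 8" using n2 by (simp add: \<delta>0_def)
    finally show False using x r(1) by simp
  qed
  obtain w :: "real^'n \<Rightarrow> real" where w: "C1 w" "\<And>x. norm x \<le> 1 - r ==> w x = 1" "\<And>x. norm x \<ge> 1 - r / 2 ==> w x = 0"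
  proof (rule cutoff_exists[of "1 - r" "1 - r / 2"])
    show "0 \<le> 1 - r" "1 - r < 1 - r / 2" using r r0 by auto
  qed auto
  define \<xi> where "\<xi> g x = w x * \<psi> g (F x)" for g x
  have C\<xi>: "C1 (\<xi> g)" for g unfolding \<xi>_def[abs_def] by (intro C1_mult w C1_compose[OF CF C\<psi>])
  have \<xi>0: "\<forall>x. norm x \<ge> 1 - r / 2 --> \<xi> g x = 0" for g by (simp add: \<xi>_def w(3))
  have \<xi>in: "\<xi> g x = \<psi> g (F x)" if "norm x < 1" for g x
    using \<psi>0[of x g] w(2)[of x] that by (cases "norm x \<le> 1 - r") (auto simp: \<xi>_def)
  have pd\<xi>: "pd \<alpha> (\<xi> g) x = pd \<alpha> (\<lambda>x. \<psi> g (F x)) x" if "norm x < 1" for \<alpha> g x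
    by (subst pd_cong_open[of "ball 0 1" x "\<xi> g" "\<lambda>x. \<psi> g (F x)"]) (use that \<xi>in in auto)
  define J where "J g G = (LINT x|lborel. \<xi> g x * jac (\<lambda>l y. G y $ g l) x)" for g and G :: "real^'n \<Rightarrow> real^'m"
  have sumJ: "c0 = (\<Sum>g\<in>UNIV. J g F)"
  proof -
    have "indicator (ball 0 1) x * ((\<Prod>l\<in>UNIV. \<eta> (\<Phi> l (F x))) * jac (\<lambda>l x. \<Phi> l (F x)) x) = (\<Sum>g\<in>UNIV. \<xi> g x * jac (\<lambda>l y. F y $ g l) x)" for x
    proof (cases "norm x < 1")
      case True
      then show ?thesis
        by (simp add: jac_compose[OF CF C\<Phi>(1)] \<xi>in \<psi>_def sum_distrib_left mult.assoc)
    next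
      case False
      then show ?thesis using \<xi>0 r0 by (simp add: sum.neutral)
    qed
    then have "c0 = (LINT x|lborel. (\<Sum>g\<in>UNIV. \<xi> g x * jac (\<lambda>l y. F y $ g l) x))" using deg by simp
    also have "\<dots> = (\<Sum>g\<in>UNIV. J g F)" unfolding J_def
      by (rule Bochner_Integration.integral_sum)
         (rule integrable_mult_jac[OF C1_component[OF CF] C1_continuous[OF C\<xi>] \<xi>0])
    finally show ?thesis .
  qed

  \<comment> \<open>Gradient bounds for the averages and the weights.\<close>
  have gradA: "\<bar>pd \<alpha> (avg t (\<lambda>y. v k y $ i)) x\<bar> \<le> C2 * d / t" if "k \<ge> k0" "norm x \<le> 1" for \<alpha> k i x
  proof -
    have "t * \<bar>pd \<alpha> (avg t (\<lambda>y. v k y $ i)) x\<bar> \<le> C2 * \<delta> powr (1 / p)"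
      by (rule C2(2)[OF v t(1,2) that(2) less_imp_le[OF \<delta>(1)] K1(4)[OF _ t(1,3) that(2)]]) (use that k0(1) in simp)
    then show ?thesis using t(1) by (simp add: \<delta>(2) pos_le_divide_eq mult.commute)
  qed
  have Fi': "(\<lambda>y. F y $ i) = avg t (\<lambda>y. v k0 y $ i)" for i by (rule ext) (rule Fi)
  define Qt where "Qt x = (enn2real (osc p t (v k0) x) / t ^ ?n) powr (1 / p)" for x
  have Qt0: "Qt x \<ge> 0" for x by (simp add: Qt_def)
  define b where "b x = min (?m * L * (C1' * Qt x)) \<beta>" for x
  have b0: "0 \<le> b x" "b x \<le> \<beta>" for x using m1 L(1) C1'(1) Qt0[of x] \<beta> by (auto simp: b_def)
  have b: "\<bar>pd \<alpha> (\<xi> g) x\<bar> \<le> b x / t" if x: "norm x < 1" for \<alpha> g x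
  proof -
    have "ball ((1 - 2 * t) *\<^sub>R x) t \<subseteq> ball 0 1 \<inter> ball x (6 * t)"
      by (rule shifted_ball_subset(1)) (use x t in auto)
    then have D1: "\<bar>pd \<alpha> (\<lambda>y. F y $ i) x\<bar> \<le> C1' * Qt x / t" for i
      using C1'(2)[where v = "v k0" and s = t and t = t and x = x and y = x and \<alpha> = \<alpha> and i = i, OF v] t(1,2)
      unfolding Fi' Qt_def by (simp add: pos_le_divide_eq mult.commute)
    have D2: "\<bar>pd \<alpha> (\<lambda>y. F y $ i) x\<bar> \<le> C2 * d / t" for i
      unfolding Fi' by (rule gradA) (use x in auto)
    have "\<bar>pd \<alpha> (\<lambda>x. \<psi> g (F x)) x\<bar> \<le> ?m * L * (C1' * Qt x / t)"
      by (rule pd_compose_bound[OF CF C\<psi> L(2) D1])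
    moreover have "\<bar>pd \<alpha> (\<lambda>x. \<psi> g (F x)) x\<bar> \<le> ?m * L * (C2 * d / t)"
      by (rule pd_compose_bound[OF CF C\<psi> L(2) D2])
    ultimately show ?thesis
      unfolding pd\<xi>[OF x] b_def \<beta>_def A2_def by (auto simp: min_def mult_ac)
  qed
  have [measurable]: "osc p t (v k0) \<in> borel_measurable borel" by (rule osc_measurable[OF C1_continuous[OF v]])
  have bm: "b \<in> borel_measurable borel" unfolding b_def[abs_def] Qt_def by measurable
  have Osc\<Omega>: "Osc p s (v k) (ball 0 1) \<le> ennreal (\<Omega> * s ^ (2 * ?n))" if "k \<ge> k0" "0 < s" "s \<le> t1" for k s
    using K1(1)[of k s] K1(2)[of k s] that k0(1) by (auto simp: \<Omega>_def)
  have bI: "(\<integral>\<^sup>+x\<in>ball 0 1. ennreal (b x powr p) \<partial>lborel) \<le> ennreal ((A1 * \<Omega>) * t ^ ?n)"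
  proof -
    have "(\<integral>\<^sup>+x\<in>ball 0 1. ennreal (b x powr p) \<partial>lborel) \<le> (\<integral>\<^sup>+x. ennreal A1 * (ennreal (Qt x powr p) * indicator (ball 0 1) x) \<partial>lborel)"
    proof (rule nn_integral_mono)
      fix x :: "real^'n"
      have "b x powr p \<le> (?m * L * (C1' * Qt x)) powr p" using b0(1) p1 by (intro powr_mono2) (auto simp: b_def)
      also have "\<dots> = A1 * Qt x powr p"
        unfolding A1_def by (simp only: powr_mult mult.assoc)
      finally have "ennreal (b x powr p) \<le> ennreal A1 * ennreal (Qt x powr p)"
        using A1 by (simp add: ennreal_mult[symmetric] ennreal_leI)
      then show "ennreal (b x powr p) * indicator (ball 0 1) x \<le> ennreal A1 * (ennreal (Qt x powr p) * indicator (ball 0 1) x)"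
        by (auto simp: indicator_def)
    qed
    also have "\<dots> = ennreal A1 * (\<integral>\<^sup>+x\<in>ball 0 1. ennreal (Qt x powr p) \<partial>lborel)"
      unfolding Qt_def by (rule nn_integral_cmult) (unfold measurable_lborel2, measurable)
    also have "(\<integral>\<^sup>+x\<in>ball 0 1. ennreal (Qt x powr p) \<partial>lborel) = ennreal (1 / t ^ ?n) * Osc p t (v k0) (ball 0 1)"
      unfolding Qt_def by (rule nn_integral_osc_powr[OF C1_continuous[OF v] p1 t(1)]) simp
    also have "ennreal A1 * (ennreal (1 / t ^ ?n) * Osc p t (v k0) (ball 0 1)) \<le> ennreal A1 * (ennreal (1 / t ^ ?n) * ennreal (\<Omega> * t ^ (2 * ?n)))"
      by (intro mult_left_mono Osc\<Omega>[OF order_refl t(1,3)]) auto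
    also have "\<dots> = ennreal ((A1 * \<Omega>) * t ^ ?n)"
    proof -
      have e: "t ^ (2 * ?n) = t ^ ?n * t ^ ?n" by (simp add: mult_2 power_add)
      show ?thesis unfolding e using t A1 \<Omega> by (simp add: ennreal_mult[symmetric] mult_ac)
    qed
    finally show ?thesis .
  qed
  have r1: "1 - r / 2 < 1" using r0 by simp
  have cmp1: "\<bar>J g (avg t (v k)) - J g (v k)\<bar> \<le> \<epsilon>" if k: "k \<ge> k0" for g k
  proof -
    have "\<bar>(LINT x|lborel. \<xi> g x * jac (\<lambda>l. avg t (\<lambda>y. v k y $ g l)) x) - (LINT x|lborel. \<xi> g x * jac (\<lambda>l y. v k y $ g l) x)\<bar>
        \<le> CE * \<beta> powr (real ?n + 1 - p) * (A1 * \<Omega> + \<Omega>)"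
      by (rule CE(2)[OF v t(1,2) C\<xi> \<xi>0 r1 bm b b0 \<beta> _ _ bI Osc\<Omega>[OF k tj]]) (use A1 \<Omega> in auto)
    moreover have "(\<lambda>l y. avg t (v k) y $ g l) = (\<lambda>l. avg t (\<lambda>y. v k y $ g l))"
      by (intro ext) (rule avg_component[OF v])
    ultimately show ?thesis using small unfolding J_def by simp
  qed
  have cmp2: "\<bar>J g F - J g (avg t (v k))\<bar> \<le> \<epsilon>" if k: "k \<ge> k0" for g k
  proof -
    let ?q = "C6 / t ^ ?n * e1" and ?e = "\<beta> / t" and ?d = "C2 * d / t"
    have "ennreal \<bar>J g F - J g (avg t (v k))\<bar>
      \<le> of_nat ?n * (\<integral>\<^sup>+x\<in>ball (0::real^'n) 1. ennreal (fact ?n * (?q * ?e * ?d ^ (?n - 1))) \<partial>lborel)"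
      unfolding J_def Fi' avg_component[OF v]
    proof (rule integral_jac_comparison[where r = "1 - r / 2"])
      fix l and x :: "real^'n" assume x: "norm x < 1"
      show "\<bar>avg t (\<lambda>y. v k0 y $ g l) x - avg t (\<lambda>y. v k y $ g l) x\<bar> \<le> ?q"
        by (rule C6(2)[OF v v t(1,2)]) (use x e1 K3[OF k0(2)] k0(2) k in auto)
      fix \<alpha>
      show "\<bar>pd \<alpha> (avg t (\<lambda>y. v k0 y $ g l)) x\<bar> \<le> ?d" "\<bar>pd \<alpha> (avg t (\<lambda>y. v k y $ g l)) x\<bar> \<le> ?d"
        using x k by (auto intro!: gradA)
    next
      fix \<alpha> and x :: "real^'n" assume x: "norm x < 1"
      have "b x / t \<le> \<beta> / t" using b0(2) t(1) by (intro divide_right_mono) auto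
      then show "\<bar>pd \<alpha> (\<xi> g) x\<bar> \<le> ?e" using b[OF x, where \<alpha> = \<alpha> and g = g] by linarith
    qed (use C\<xi> \<xi>0 r1 in \<open>auto intro!: avg_C1 C1_component v\<close>)
    also have "\<dots> = ennreal (real ?n * (fact ?n * (?q * ?e * ?d ^ (?n - 1)) * \<mu>))"
    proof -
      define E where "E = fact ?n * (?q * ?e * ?d ^ (?n - 1))"
      have "0 \<le> E" unfolding E_def using C6(1) t e1(1) \<beta> C2(1) d(1) by auto
      then show ?thesis using \<mu> unfolding E_def[symmetric]
        by (simp add: nn_integral_cmult_indicator e\<mu> ennreal_mult[symmetric] ennreal_of_nat_eq_real_of_nat)
    qed
    also have "real ?n * (fact ?n * (?q * ?e * ?d ^ (?n - 1)) * \<mu>) = H * e1" by (simp add: H_def)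
    finally have "\<bar>J g F - J g (avg t (v k))\<bar> \<le> H * e1" using H e1(1) by simp
    then show ?thesis using e1(2) by linarith
  qed
  have lim: "(\<lambda>k. J g (v k)) \<longlonglongrightarrow> 0" for g
    unfolding J_def by (rule integral_jac_tendsto_0[OF n2 p v dec rank C\<xi> \<xi>0 r1])
  have "\<forall>g. \<exists>K. \<forall>k\<ge>K. \<bar>J g (v k)\<bar> < \<epsilon>" using LIMSEQ_D[OF lim \<epsilon>] by simp
  then obtain K4 where K4: "\<And>g k. k \<ge> K4 g ==> \<bar>J g (v k)\<bar> < \<epsilon>" by metis
  define k where "k = max k0 (Max (range K4))"
  have k: "k \<ge> k0" "\<And>g. k \<ge> K4 g" by (auto simp: k_def max.coboundedI2)
  have "J g F \<le> 3 * \<epsilon>" for g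
    using cmp1[OF k(1), of g] cmp2[OF k(1), of g] K4[OF k(2), of g] by linarith
  then have "c0 \<le> (\<Sum>g\<in>(UNIV :: ('n \<Rightarrow> 'm) set). 3 * \<epsilon>)" unfolding sumJ by (intro sum_mono)
  also have "\<dots> = Ng * (3 * \<epsilon>)" by (simp add: Ng_def)
  also have "\<dots> = 3 / 4 * c0" using Ng by (simp add: \<epsilon>_def)
  finally show False using c0 by simp
qed

section \<open>Decay of oscillation along Cauchy sequences\<close>

lemma smooth_up_to_boundary_extension:
  fixes v :: "real^'n \<Rightarrow> real^'m"
  assumes "smooth_up_to_boundary (ball 0 1) v"
  obtains w r where "C1 w" "r > 1" "\<And>x. norm x < r ==> w x = v x"
proof -
  obtain U where U: "open U" "cball 0 1 \<subseteq> U" "smooth_on U v"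
    using assms by (auto simp: smooth_up_to_boundary_def)
  have "Ck_on (Suc 0) U v" using U(3) by (simp only: smooth_on_def)
  then have d: "v differentiable_on U" and c: "\<And>h. continuous_on U (\<lambda>x. frechet_derivative v (at x) h)" by auto
  have dv: "(v has_derivative frechet_derivative v (at x)) (at x)" if "x \<in> U" for x
    using d that U(1) by (meson differentiable_on_eq_differentiable_at frechet_derivative_works)
  obtain e where e: "e > 0" "(\<Union>x\<in>cball 0 1. cball x e) \<subseteq> U"
    using compact_subset_open_imp_cball_epsilon_subset[OF compact_cball U(1,2)] by metis
  have inU: "x \<in> U" if "norm x < 1 + e" for x
  proof (cases "norm x \<le> 1")
    case True
    then show ?thesis using U(2) by auto
  next
    case False
    have "norm x *\<^sub>R sgn x = (norm x * inverse (norm x)) *\<^sub>R x" by (simp add: sgn_div_norm)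
    also have "norm x * inverse (norm x) = 1" using False by (intro right_inverse) auto
    finally have "norm x *\<^sub>R sgn x = x" by simp
    then have "dist (sgn x) x = norm (sgn x - norm x *\<^sub>R sgn x)"
      by (simp only: dist_norm)
    also have "sgn x - norm x *\<^sub>R sgn x = (1 - norm x) *\<^sub>R sgn x" by (simp add: scaleR_left_diff_distrib)
    also have "norm \<dots> = norm x - 1"
    proof -
      have "x \<noteq> 0" using False by auto
      then show ?thesis using False by (simp add: norm_sgn)
    qed
    finally have "x \<in> cball (sgn x) e" using that by simp
    moreover have "sgn x \<in> cball 0 1" by (simp add: norm_sgn)
    ultimately show ?thesis using e(2) by blast
  qed
  have e3: "0 \<le> 1 + e / 3" "1 + e / 3 < 1 + 2 * e / 3" using e(1) by auto
  obtain \<zeta> :: "real^'n \<Rightarrow> real" where \<zeta>1: "C1 \<zeta>" "\<And>x. 0 \<le> \<zeta> x" "\<And>x. \<zeta> x \<le> 1"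
    "\<And>x. norm x \<le> 1 + e / 3 ==> \<zeta> x = 1" "\<And>x. norm x \<ge> 1 + 2 * e / 3 ==> \<zeta> x = 0"
    using cutoff_exists[OF e3] by metis
  define w where "w x = \<zeta> x *\<^sub>R v x" for x
  define w' where "w' x h = (if norm x < 1 + e then \<zeta> x *\<^sub>R frechet_derivative v (at x) h + frechet_derivative \<zeta> (at x) h *\<^sub>R v x else 0)" for x h
  have w0: "w x = 0" if "norm x > 1 + 2 * e / 3" for x using \<zeta>1(5)[of x] that by (simp add: w_def)
  have fd0: "frechet_derivative \<zeta> (at x) h = 0" if "norm x > 1 + 2 * e / 3" for x h
    using pd_cong_open[of "- cball 0 (1 + 2 * e / 3)" x \<zeta> "\<lambda>_. 0", OF open_Compl[OF closed_cball]] \<zeta>1(5) that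
    by (simp add: frechet_derivative_const)
  have W': "w' x h = 0" if "norm x > 1 + 2 * e / 3" for x h
    using fd0[OF that] \<zeta>1(5)[of x] that by (simp add: w'_def)
  have "C1 w"
  proof (rule C1I[of w w'])
    fix x
    show "(w has_derivative w' x) (at x)"
    proof (cases "norm x < 1 + e")
      case True
      have "(w has_derivative (\<lambda>h. \<zeta> x *\<^sub>R frechet_derivative v (at x) h + frechet_derivative \<zeta> (at x) h *\<^sub>R v x)) (at x)"
        unfolding w_def[abs_def] by (rule has_derivative_scaleR[OF C1_has_derivative[OF \<zeta>1(1)] dv[OF inU[OF True]]])
      moreover have "w' x = (\<lambda>h. \<zeta> x *\<^sub>R frechet_derivative v (at x) h + frechet_derivative \<zeta> (at x) h *\<^sub>R v x)"
        using True by (simp add: w'_def fun_eq_iff)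
      ultimately show ?thesis by simp
    next
      case False
      then have x: "norm x > 1 + 2 * e / 3" using e(1) by linarith
      have "((\<lambda>_. 0) has_derivative (\<lambda>_. 0)) (at x)" by simp
      then have "(w has_derivative (\<lambda>_. 0)) (at x)"
        by (rule has_derivative_transform_within_open[of _ _ _ _ "- cball 0 (1 + 2 * e / 3)"]) (use x w0 in auto)
      moreover have "w' x = (\<lambda>_. 0)" using W'[OF x] by (simp add: fun_eq_iff)
      ultimately show ?thesis by simp
    qed
  next
    fix h
    have cU: "continuous_on (ball 0 (1 + e)) (\<lambda>x. frechet_derivative v (at x) h)" "continuous_on (ball 0 (1 + e)) v"
      using inU by (auto intro!: continuous_on_subset[OF c] continuous_on_subset[OF differentiable_imp_continuous_on[OF d]])
    have "continuous_on (ball 0 (1 + e)) (\<lambda>x. \<zeta> x *\<^sub>R frechet_derivative v (at x) h + frechet_derivative \<zeta> (at x) h *\<^sub>R v x)"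
      by (intro continuous_intros cU C1_deriv_continuous[OF \<zeta>1(1)] C1_continuous[OF \<zeta>1(1)])
    then have 1: "continuous_on (ball 0 (1 + e)) (\<lambda>x. w' x h)"
      by (rule continuous_on_eq) (simp add: w'_def)
    have 2: "continuous_on (- cball 0 (1 + 2 * e / 3)) (\<lambda>x. w' x h)"
      by (rule continuous_on_eq[OF continuous_on_const[of _ 0]]) (use W' in auto)
    have "continuous_on (ball 0 (1 + e) \<union> - cball 0 (1 + 2 * e / 3)) (\<lambda>x. w' x h)"
      by (rule continuous_on_open_Un[OF _ _ 1 2]) auto
    moreover have "ball 0 (1 + e) \<union> - cball 0 (1 + 2 * e / 3) = (UNIV :: (real^'n) set)" using e(1) by auto
    ultimately show "continuous_on UNIV (\<lambda>x. w' x h)" by simp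
  qed
  then show ?thesis using e(1) \<zeta>1(4) by (intro that[of w "1 + e / 3"]) (auto simp: w_def)
qed

lemma nn_integral_lebesgue_on:
  assumes "\<Omega> \<in> sets borel"
  shows "(\<integral>\<^sup>+x. F x \<partial>lebesgue_on \<Omega>) = (\<integral>\<^sup>+x\<in>\<Omega>. F x \<partial>lborel)"
  using assms by (subst nn_integral_restrict_space) (auto simp: nn_integral_completion)

lemma integral_lebesgue_on:
  fixes F :: "'a::euclidean_space \<Rightarrow> real"
  assumes "\<Omega> \<in> sets borel" "\<And>x. x \<notin> \<Omega> ==> F x = 0" "F \<in> borel_measurable borel"
  shows "(LINT x|lebesgue_on \<Omega>. F x) = (LINT x|lborel. F x)"
proof -
  have "(LINT x|lebesgue_on \<Omega>. F x) = (LINT x|lebesgue. indicat_real \<Omega> x *\<^sub>R F x)"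
    by (rule integral_restrict_space) (use assms in auto)
  also have "\<dots> = (LINT x|lebesgue. F x)"
    by (rule Bochner_Integration.integral_cong) (auto simp: indicator_def assms(2))
  also have "\<dots> = (LINT x|lborel. F x)" by (rule integral_completion) (use assms in simp)
  finally show ?thesis .
qed

lemma ennroot_le_imp_le:
  assumes "ennroot p t \<le> ennreal c" "c \<ge> 0" "p > 0"
  shows "t \<le> ennreal (c powr p)"
proof -
  have t: "t \<noteq> \<infinity>" using assms(1) by (auto simp: ennroot_def top_unique)
  then have "ennreal (enn2real t powr (1 / p)) \<le> ennreal c" using assms(1) by (simp add: ennroot_def)
  then have "enn2real t powr (1 / p) \<le> c" using assms(2) by (simp add: ennreal_le_iff)
  then have "(enn2real t powr (1 / p)) powr p \<le> c powr p" using assms(3) by (intro powr_mono2) auto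
  then have "enn2real t \<le> c powr p" using assms(3) by (simp add: powr_powr)
  moreover have "t = ennreal (enn2real t)" using t by (simp add: less_top)
  ultimately show ?thesis by (metis ennreal_leI)
qed

lemma ennroot_tendsto_0:
  assumes "(\<lambda>k::nat. ennroot p (I k)) \<longlonglongrightarrow> 0" "p > 0" "e > 0"
  shows "\<exists>K. \<forall>k\<ge>K. I k \<le> ennreal e"
proof -
  define c where "c = e powr (1 / p)"
  have c: "c > 0" "c powr p = e" using assms by (auto simp: c_def powr_powr)
  have "eventually (\<lambda>k. ennroot p (I k) < ennreal c) sequentially"
    by (rule order_tendstoD(2)[OF assms(1)]) (use c in simp)
  then obtain K where "\<forall>k\<ge>K. ennroot p (I k) < ennreal c" by (auto simp: eventually_sequentially)
  then have "\<forall>k\<ge>K. I k \<le> ennreal (c powr p)" using ennroot_le_imp_le[of p _ c] c(1) assms(2) by (simp add: less_imp_le)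
  then show ?thesis using c by auto
qed

lemma powr_norm_add_le:
  fixes a b :: "'a::real_normed_vector"
  assumes "p \<ge> 1"
  shows "norm (a + b) powr p \<le> 2 powr p * (norm a powr p + norm b powr p)"
proof -
  have "norm (a + b) powr p \<le> (2 * max (norm a) (norm b)) powr p"
    using norm_triangle_ineq[of a b] assms by (intro powr_mono2) auto
  also have "\<dots> = 2 powr p * max (norm a) (norm b) powr p" by (intro powr_mult)
  also have "\<dots> \<le> 2 powr p * (norm a powr p + norm b powr p)"
    by (intro mult_left_mono) (auto simp: max_def)
  finally show ?thesis .
qed

lemma Osc_add_le:
  fixes a b :: "real^'n \<Rightarrow> real^'m"
  assumes p: "p \<ge> 1" and a: "continuous_on UNIV a" and b: "continuous_on UNIV b" and A: "A \<in> sets borel"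
  shows "Osc p t (\<lambda>x. a x + b x) A \<le> ennreal (2 powr p) * (Osc p t a A + Osc p t b A)"
proof -
  have [measurable]: "a \<in> borel_measurable borel" "b \<in> borel_measurable borel"
    using a b by (auto intro: borel_measurable_continuous_onI)
  have [measurable]: "osc p t a \<in> borel_measurable borel" "osc p t b \<in> borel_measurable borel"
    by (rule osc_measurable[OF a], rule osc_measurable[OF b])
  note A[measurable]
  have pt: "osc p t (\<lambda>x. a x + b x) y \<le> ennreal (2 powr p) * (osc p t a y + osc p t b y)" for y
  proof -
    have "osc p t (\<lambda>x. a x + b x) y \<le> (\<integral>\<^sup>+y'. ennreal (2 powr p) * (ennreal (norm (a y - a y') powr p) * indicator (ball 0 1 \<inter> ball y (6 * t)) y'
        + ennreal (norm (b y - b y') powr p) * indicator (ball 0 1 \<inter> ball y (6 * t)) y') \<partial>lborel)"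
      unfolding osc_def
    proof (rule nn_integral_mono)
      fix y'
      have "norm (a y + b y - (a y' + b y')) powr p \<le> 2 powr p * (norm (a y - a y') powr p + norm (b y - b y') powr p)"
        using powr_norm_add_le[OF p, of "a y - a y'" "b y - b y'"] by (simp add: algebra_simps)
      then have "ennreal (norm (a y + b y - (a y' + b y')) powr p) \<le> ennreal (2 powr p) * (ennreal (norm (a y - a y') powr p) + ennreal (norm (b y - b y') powr p))"
        by (simp add: ennreal_mult[symmetric] ennreal_plus[symmetric] ennreal_leI del: ennreal_plus)
      then show "ennreal (norm (a y + b y - (a y' + b y')) powr p) * indicator (ball 0 1 \<inter> ball y (6 * t)) y' \<le>
         ennreal (2 powr p) * (ennreal (norm (a y - a y') powr p) * indicator (ball 0 1 \<inter> ball y (6 * t)) y'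
        + ennreal (norm (b y - b y') powr p) * indicator (ball 0 1 \<inter> ball y (6 * t)) y')"
        by (auto simp: indicator_def)
    qed
    also have "\<dots> = ennreal (2 powr p) * (osc p t a y + osc p t b y)"
      unfolding osc_def by (subst nn_integral_cmult, measurable, subst nn_integral_add, measurable)
    finally show ?thesis .
  qed
  have "Osc p t (\<lambda>x. a x + b x) A \<le> (\<integral>\<^sup>+y. ennreal (2 powr p) * (osc p t a y * indicator A y + osc p t b y * indicator A y) \<partial>lborel)"
    unfolding Osc_def by (rule nn_integral_mono) (use pt in \<open>auto simp: indicator_def\<close>)
  also have "\<dots> = ennreal (2 powr p) * (Osc p t a A + Osc p t b A)"
    unfolding Osc_def by (subst nn_integral_cmult, measurable, subst nn_integral_add, measurable)
  finally show ?thesis .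
qed

lemma Osc_mono: "A \<subseteq> B ==> Osc p t v A \<le> Osc p t v B"
  unfolding Osc_def by (intro nn_integral_mono mult_left_mono) (auto simp: indicator_def)

lemma Osc_C1_le:
  fixes w :: "real^'n \<Rightarrow> real^'m"
  assumes w: "C1 w" and p: "real CARD('n) \<le> p"
  obtains C where "C > 0" "\<And>t A. 0 < t ==> A \<in> sets borel ==> A \<subseteq> ball 0 1 ==>
     Osc p t w A \<le> ennreal (C * t powr (p - real CARD('n)) * t ^ (2 * CARD('n))) * emeasure lborel A"
proof -
  let ?n = "CARD('n)"
  have p0: "p > 0" using p by (smt (verit) of_nat_0_less_iff zero_less_card_finite)
  obtain N where N: "\<And>i. N i > 0" "\<And>i \<alpha> x. norm x \<le> 1 ==> \<bar>pd \<alpha> (\<lambda>x. w x $ i) x\<bar> \<le> N i"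
  proof -
    have "\<forall>i. \<exists>M>0. \<forall>\<alpha> x. norm x \<le> 1 --> \<bar>pd \<alpha> (\<lambda>x. w x $ i) x\<bar> \<le> M"
    proof
      fix i
      obtain M where "M > 0" "\<And>\<alpha> x. norm x \<le> 1 ==> \<bar>pd \<alpha> (\<lambda>x. w x $ i) x\<bar> \<le> M"
        using C1_pd_bounded[OF C1_component[OF w], of 1 i] by metis
      then show "\<exists>M>0. \<forall>\<alpha> x. norm x \<le> 1 --> \<bar>pd \<alpha> (\<lambda>x. w x $ i) x\<bar> \<le> M" by blast
    qed
    from choice[OF this] show ?thesis using that by metis
  qed
  define L where "L = (\<Sum>i\<in>UNIV. real ?n * N i)"
  have L: "L > 0" unfolding L_def by (intro sum_pos mult_pos_pos) (auto simp: N(1) card_gt_0_iff)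
  have lip: "norm (w x - w y) \<le> L * norm (x - y)" if "norm x < 1" "norm y < 1" for x y
  proof -
    have "norm (w x - w y) \<le> (\<Sum>i\<in>UNIV. \<bar>(w x - w y) $ i\<bar>)" by (rule norm_le_l1_cart)
    also have "\<dots> \<le> (\<Sum>i\<in>UNIV. real ?n * N i * norm (x - y))"
    proof (rule sum_mono)
      fix i
      have "\<bar>w x $ i - w y $ i\<bar> \<le> real ?n * N i * norm (x - y)"
        by (rule C1_lipschitz[OF C1_component[OF w] convex_cball[of 0 1]]) (use N(2) that in auto)
      then show "\<bar>(w x - w y) $ i\<bar> \<le> real ?n * N i * norm (x - y)" by simp
    qed
    finally show ?thesis by (simp add: L_def sum_distrib_right)
  qed
  define \<omega> where "\<omega> = unit_ball_vol (real ?n)"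
  have \<omega>: "\<omega> > 0" unfolding \<omega>_def by (rule unit_ball_vol_pos) simp
  have osc: "osc p t w y \<le> ennreal ((L * (6 * t)) powr p * (\<omega> * (6 * t) ^ ?n))" if t: "t > 0" and y: "norm y < 1" for t y
  proof -
    have "osc p t w y \<le> (\<integral>\<^sup>+y'. ennreal ((L * (6 * t)) powr p) * indicator (ball y (6 * t)) y' \<partial>lborel)"
      unfolding osc_def
    proof (rule nn_integral_mono)
      fix y'
      show "ennreal (norm (w y - w y') powr p) * indicator (ball 0 1 \<inter> ball y (6 * t)) y' \<le> ennreal ((L * (6 * t)) powr p) * indicator (ball y (6 * t)) y'"
      proof (cases "y' \<in> ball 0 1 \<inter> ball y (6 * t)")
        case True
        have "norm (w y - w y') \<le> L * norm (y - y')" by (rule lip) (use y True in auto)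
        also have "\<dots> \<le> L * (6 * t)" using True L by (intro mult_left_mono) (auto simp: dist_norm)
        finally have "norm (w y - w y') powr p \<le> (L * (6 * t)) powr p" using p0 by (intro powr_mono2) auto
        then show ?thesis using True by (simp add: ennreal_leI)
      qed simp
    qed
    also have "\<dots> = ennreal ((L * (6 * t)) powr p) * ennreal (\<omega> * (6 * t) ^ ?n)"
      using t by (subst nn_integral_cmult_indicator) (auto simp: emeasure_ball \<omega>_def)
    finally show ?thesis using t \<omega> by (simp add: ennreal_mult[symmetric])
  qed
  define C where "C = (L * 6) powr p * (\<omega> * 6 ^ ?n)"
  show ?thesis
  proof (rule that[of C])
    show "C > 0" unfolding C_def using L \<omega> by auto
    fix t :: real and A :: "(real^'n) set" assume t: "0 < t" and A: "A \<in> sets borel" "A \<subseteq> ball 0 1"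
    have "(L * (6 * t)) powr p * (\<omega> * (6 * t) ^ ?n) = C * t powr p * t ^ ?n"
      using t L by (simp add: C_def powr_mult power_mult_distrib mult_ac)
    also have "t powr p = t powr (p - real ?n) * t ^ ?n"
      using t by (simp add: powr_add[symmetric] powr_realpow[symmetric])
    finally have e0: "(L * (6 * t)) powr p * (\<omega> * (6 * t) ^ ?n) = C * (t powr (p - real ?n) * t ^ ?n) * t ^ ?n" .
    have e: "(L * (6 * t)) powr p * (\<omega> * (6 * t) ^ ?n) = C * t powr (p - real ?n) * t ^ (2 * ?n)"
    proof -
      have "t ^ (2 * ?n) = t ^ ?n * t ^ ?n" by (simp add: mult_2 power_add)
      then show ?thesis unfolding e0 by (simp only: mult_ac)
    qed
    have "Osc p t w A \<le> (\<integral>\<^sup>+y. ennreal (C * t powr (p - real ?n) * t ^ (2 * ?n)) * indicator A y \<partial>lborel)"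
      unfolding Osc_def by (rule nn_integral_mono) (use osc[OF t] A(2) in \<open>auto simp: indicator_def e[symmetric]\<close>)
    then show "Osc p t w A \<le> ennreal (C * t powr (p - real ?n) * t ^ (2 * ?n)) * emeasure lborel A"
      using A(1) by (simp add: nn_integral_cmult_indicator)
  qed
qed

lemma layer_emeasure_le:
  assumes "0 < t" "t \<le> 1/4"
  shows "emeasure lborel (ball (0::real^'n) 1 - cball 0 (1 - 3 * t)) \<le> ennreal (unit_ball_vol (real CARD('n)) * (3 * real CARD('n) * t))"
proof -
  let ?n = "CARD('n)" and ?\<omega> = "unit_ball_vol (real CARD('n))"
  have "emeasure lborel (ball (0::real^'n) 1 - cball 0 (1 - 3 * t)) = emeasure lborel (ball (0::real^'n) 1) - emeasure lborel (cball (0::real^'n) (1 - 3 * t))"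
    by (rule emeasure_Diff) (use assms in \<open>auto simp: emeasure_cball\<close>)
  also have "\<dots> = ennreal (?\<omega> - ?\<omega> * (1 - 3 * t) ^ ?n)"
    using assms by (simp add: emeasure_ball emeasure_cball ennreal_minus)
  also have "\<dots> \<le> ennreal (?\<omega> * (3 * real ?n * t))"
  proof (rule ennreal_leI)
    have "1 + real ?n * (- 3 * t) \<le> (1 + - 3 * t) ^ ?n" by (rule Bernoulli_inequality) (use assms in auto)
    then have "?\<omega> * (1 - (1 - 3 * t) ^ ?n) \<le> ?\<omega> * (3 * real ?n * t)" by (intro mult_left_mono) auto
    then show "?\<omega> - ?\<omega> * (1 - 3 * t) ^ ?n \<le> ?\<omega> * (3 * real ?n * t)" by (simp add: algebra_simps)
  qed
  finally show ?thesis .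
qed

text \<open>The oscillation of \<open>v k\<close> is compared with that of a fixed \<open>v K\<close>. That one is Lipschitz,
  so its oscillation at scale \<open>t\<close> over a set \<open>A\<close> is at most of order
  \<open>t\<^sup>n\<^sup>+\<^sup>p \<bar>A\<bar>\<close>, which beats \<open>t\<^sup>2\<^sup>n\<close> if \<open>p > n\<close> or if \<open>A\<close> has small volume.\<close>

lemma osc_decay_if_cauchy:
  fixes v :: "nat \<Rightarrow> real^'n \<Rightarrow> real^'m"
  assumes v: "\<And>k. C1 (v k)" and p: "real CARD('n) \<le> p"
    and cauchy: "\<And>e. e > 0 ==> \<exists>K. \<forall>k\<ge>K. \<forall>t. 0 < t \<and> t \<le> 1/4 -->
      Osc p t (\<lambda>x. v k x - v K x) (ball 0 1) \<le> ennreal (e * t ^ (2 * CARD('n)))"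
  shows "osc_decay p v"
proof -
  let ?n = "CARD('n)" and ?\<omega> = "unit_ball_vol (real CARD('n))"
  have n0: "?n > 0" by simp
  have p1: "p \<ge> 1" using p n0 by linarith
  have \<omega>: "?\<omega> > 0" by (rule unit_ball_vol_pos) simp
  then have \<omega>0: "?\<omega> \<noteq> 0" by linarith
  have split: "\<exists>C>0. \<exists>K. \<forall>k\<ge>K. \<forall>t A m. 0 < t \<and> t \<le> 1/4 \<and> A \<in> sets borel \<and> A \<subseteq> ball 0 1 \<and> 0 \<le> m \<and> emeasure lborel A \<le> ennreal m -->
    Osc p t (v k) A \<le> ennreal ((2 powr p * (C * t powr (p - real ?n) * m + e)) * t ^ (2 * ?n))" if e: "e > 0" for e
  proof -
    obtain K where K: "\<forall>k\<ge>K. \<forall>t. 0 < t \<and> t \<le> 1/4 -->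
      Osc p t (\<lambda>x. v k x - v K x) (ball 0 1) \<le> ennreal (e * t ^ (2 * CARD('n)))" using cauchy[OF e] by blast
    obtain C where C: "C > 0" "\<And>t A. 0 < t ==> A \<in> sets borel ==> A \<subseteq> ball 0 1 ==>
     Osc p t (v K) A \<le> ennreal (C * t powr (p - real CARD('n)) * t ^ (2 * CARD('n))) * emeasure lborel A"
      using Osc_C1_le[OF v p, of K] by metis
    show ?thesis
    proof (intro exI[of _ C] conjI exI[of _ K] allI impI)
      fix k and t :: real and A :: "(real^'n) set" and m :: real assume k: "k \<ge> K" and a: "0 < t \<and> t \<le> 1/4 \<and> A \<in> sets borel \<and> A \<subseteq> ball 0 1 \<and> 0 \<le> m \<and> emeasure lborel A \<le> ennreal m"
      have "Osc p t (v k) A = Osc p t (\<lambda>x. v K x + (v k x - v K x)) A" by simp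
      also have "\<dots> \<le> ennreal (2 powr p) * (Osc p t (v K) A + Osc p t (\<lambda>x. v k x - v K x) A)"
        by (rule Osc_add_le[OF p1]) (use a in \<open>auto intro!: C1_continuous C1_diff v\<close>)
      also have "\<dots> \<le> ennreal (2 powr p) * (ennreal (C * t powr (p - real ?n) * t ^ (2 * ?n)) * ennreal m + ennreal (e * t ^ (2 * ?n)))"
      proof (intro mult_left_mono add_mono)
        show "Osc p t (v K) A \<le> ennreal (C * t powr (p - real ?n) * t ^ (2 * ?n)) * ennreal m"
          using C(2)[of t A] a by (meson mult_left_mono order_trans zero_le)
        have "Osc p t (\<lambda>x. v k x - v K x) A \<le> Osc p t (\<lambda>x. v k x - v K x) (ball 0 1)" using a by (intro Osc_mono) auto
        then show "Osc p t (\<lambda>x. v k x - v K x) A \<le> ennreal (e * t ^ (2 * ?n))" using K k a by (meson order_trans)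
      qed simp
      also have "\<dots> = ennreal ((2 powr p * (C * t powr (p - real ?n) * m + e)) * t ^ (2 * ?n))"
      proof -
        have nn: "0 \<le> C * t powr (p - real ?n) * t ^ (2 * ?n)" "0 \<le> e * t ^ (2 * ?n)" "0 \<le> m" using C(1) a e by auto
        have "ennreal (2 powr p) * (ennreal (C * t powr (p - real ?n) * t ^ (2 * ?n)) * ennreal m + ennreal (e * t ^ (2 * ?n)))
          = ennreal (2 powr p * (C * t powr (p - real ?n) * t ^ (2 * ?n) * m + e * t ^ (2 * ?n)))"
          using nn by (simp only: ennreal_mult[symmetric] ennreal_plus[symmetric] mult_nonneg_nonneg add_nonneg_nonneg powr_ge_zero)
        also have "2 powr p * (C * t powr (p - real ?n) * t ^ (2 * ?n) * m + e * t ^ (2 * ?n)) = (2 powr p * (C * t powr (p - real ?n) * m + e)) * t ^ (2 * ?n)"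
          by (simp only: distrib_left distrib_right mult_ac)
        finally show ?thesis .
      qed
      finally show "Osc p t (v k) A \<le> ennreal ((2 powr p * (C * t powr (p - real ?n) * m + e)) * t ^ (2 * ?n))" .
    qed (use C in auto)
  qed
  have tp: "t powr (p - real ?n) \<le> 1" if "0 < t" "t \<le> 1/4" for t :: real
    using that p powr_mono'[of 0 "p - real ?n" t] by simp
  have eB: "emeasure lborel (ball (0::real^'n) 1) \<le> ennreal ?\<omega>" by (simp add: emeasure_ball)
  obtain C1 K1 where C1: "C1 > 0" and K1: "\<forall>k\<ge>K1. \<forall>t A m. 0 < t \<and> t \<le> 1/4 \<and> A \<in> sets borel \<and> A \<subseteq> ball 0 1 \<and> 0 \<le> m \<and> emeasure lborel A \<le> ennreal m -->
    Osc p t (v k) A \<le> ennreal ((2 powr p * (C1 * t powr (p - real ?n) * m + 1)) * t ^ (2 * ?n))"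
    using split[of 1] by auto
  define M where "M = 2 powr p * (C1 * 1 * ?\<omega> + 1)"
  have M: "M > 0" unfolding M_def using C1 \<omega> by (intro mult_pos_pos add_pos_pos) auto
  show ?thesis unfolding osc_decay_def
  proof (rule exI[of _ M], intro conjI allI impI M)
    fix \<delta> :: real assume \<delta>: "\<delta> > 0"
    define e where "e = \<delta> / (2 * 2 powr p)"
    have e: "e > 0" "2 powr p * (e + e) = \<delta>" using \<delta> by (auto simp: e_def)
    obtain C2 K2 where C2: "C2 > 0" and K2: "\<forall>k\<ge>K2. \<forall>t A m. 0 < t \<and> t \<le> 1/4 \<and> A \<in> sets borel \<and> A \<subseteq> ball 0 1 \<and> 0 \<le> m \<and> emeasure lborel A \<le> ennreal m -->
      Osc p t (v k) A \<le> ennreal ((2 powr p * (C2 * t powr (p - real ?n) * m + e)) * t ^ (2 * ?n))"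
      using split[OF e(1)] by auto
    define c where "c = e / (C2 * ?\<omega> * 3 * real ?n)"
    have c: "c > 0" unfolding c_def using e C2 \<omega> \<omega>0 n0 by auto
    define c' where "c' = (if p = real ?n then 1 else (e / (C2 * ?\<omega>)) powr (1 / (p - real ?n)))"
    have c': "c' > 0" unfolding c'_def using e C2 \<omega> \<omega>0 by auto
    define \<eta> where "\<eta> = min (1/4) (min c c')"
    have \<eta>: "\<eta> > 0" "\<eta> \<le> 1/4" "\<eta> \<le> c" "\<eta> \<le> c'" using c c' by (auto simp: \<eta>_def)
    have bd: "Osc p t (v k) A \<le> ennreal (\<delta> * t ^ (2 * ?n))"
      if "k \<ge> K2" "0 < t" "t \<le> 1/4" "A \<in> sets borel" "A \<subseteq> ball 0 1" "0 \<le> m" "emeasure lborel A \<le> ennreal m" "C2 * t powr (p - real ?n) * m \<le> e" for k t A m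
    proof -
      have "Osc p t (v k) A \<le> ennreal ((2 powr p * (C2 * t powr (p - real ?n) * m + e)) * t ^ (2 * ?n))"
        using K2 that by blast
      also have "\<dots> \<le> ennreal ((2 powr p * (e + e)) * t ^ (2 * ?n))"
        using that by (intro ennreal_leI mult_right_mono mult_left_mono add_mono) auto
      finally show ?thesis using e(2) by simp
    qed
    have small: "C2 * t powr (p - real ?n) * (?\<omega> * (3 * real ?n * t)) \<le> e" if "0 < t" "t \<le> \<eta>" for t
    proof -
      have "C2 * t powr (p - real ?n) * (?\<omega> * (3 * real ?n * t)) \<le> C2 * 1 * (?\<omega> * (3 * real ?n * c))"
        using that \<eta> C2 \<omega> \<omega>0 by (intro mult_mono tp) auto
      also have "\<dots> = e" using C2 \<omega> \<omega>0 n0 by (simp add: c_def)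
      finally show ?thesis .
    qed
    show "\<exists>\<eta>>0. \<eta> \<le> 1/4 \<and> (\<exists>K. \<forall>k\<ge>K. \<forall>t. 0 < t \<and> t \<le> \<eta> -->
     Osc p t (v k) (ball 0 1) \<le> ennreal (M * t ^ (2 * CARD('n))) \<and>
     (p \<noteq> real CARD('n) --> Osc p t (v k) (ball 0 1) \<le> ennreal (\<delta> * t ^ (2 * CARD('n)))) \<and>
     Osc p t (v k) (ball 0 1 - cball 0 (1 - 3 * t)) \<le> ennreal (\<delta> * t ^ (2 * CARD('n))) \<and>
     (\<forall>x. norm x \<le> 1 --> Osc p t (v k) (ball ((1 - 2 * t) *\<^sub>R x) t) \<le> ennreal (\<delta> * t ^ (2 * CARD('n)))))"
    proof (intro exI[of _ \<eta>] conjI \<eta> exI[of _ "max K1 K2"] allI impI)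
      fix k t assume k: "k \<ge> max K1 K2" and t: "0 < t \<and> t \<le> \<eta>"
      then have kk: "k \<ge> K1" "k \<ge> K2" and tt: "0 < t" "t \<le> 1/4" "t \<le> \<eta>" using \<eta> by auto
      have "0 < t \<and> t \<le> 1/4 \<and> ball (0::real^'n) 1 \<in> sets borel \<and> ball (0::real^'n) 1 \<subseteq> ball 0 1 \<and> 0 \<le> ?\<omega> \<and> emeasure lborel (ball (0::real^'n) 1) \<le> ennreal ?\<omega>"
        using tt eB \<omega> by auto
      then have "Osc p t (v k) (ball 0 1) \<le> ennreal ((2 powr p * (C1 * t powr (p - real ?n) * ?\<omega> + 1)) * t ^ (2 * ?n))"
        using K1 kk(1) by blast
      also have "\<dots> \<le> ennreal (M * t ^ (2 * ?n))"
        unfolding M_def using tt C1 \<omega> by (intro ennreal_leI mult_right_mono mult_left_mono add_mono tp) auto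
      finally show "Osc p t (v k) (ball 0 1) \<le> ennreal (M * t ^ (2 * ?n))" .
      show "Osc p t (v k) (ball 0 1) \<le> ennreal (\<delta> * t ^ (2 * ?n))" if np: "p \<noteq> real ?n"
      proof (rule bd[OF kk(2) tt(1,2) _ _ _ eB])
        have pn: "p - real ?n > 0" using p np by simp
        have "t powr (p - real ?n) \<le> c' powr (p - real ?n)" using tt \<eta>(4) pn by (intro powr_mono2) auto
        also have "\<dots> = e / (C2 * ?\<omega>)" using np pn e C2 \<omega> \<omega>0 by (simp add: c'_def powr_powr)
        finally have "C2 * t powr (p - real ?n) * ?\<omega> \<le> C2 * (e / (C2 * ?\<omega>)) * ?\<omega>"
          using C2 \<omega> \<omega>0 by (intro mult_right_mono mult_left_mono) auto
        then show "C2 * t powr (p - real ?n) * ?\<omega> \<le> e" using C2 \<omega> \<omega>0 by simp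
      qed (use \<omega> in auto)
      show "Osc p t (v k) (ball 0 1 - cball 0 (1 - 3 * t)) \<le> ennreal (\<delta> * t ^ (2 * ?n))"
        by (rule bd[OF kk(2) tt(1,2) _ _ _ layer_emeasure_le[OF tt(1,2)] small[OF tt(1,3)]]) (use \<omega> tt in auto)
      show "Osc p t (v k) (ball ((1 - 2 * t) *\<^sub>R x) t) \<le> ennreal (\<delta> * t ^ (2 * ?n))" if x: "norm x \<le> 1" for x
      proof (rule bd[OF kk(2) tt(1,2) _ _ _ _ small[OF tt(1,3)]])
        show "ball ((1 - 2 * t) *\<^sub>R x) t \<subseteq> ball 0 1"
        proof
          fix z assume "z \<in> ball ((1 - 2 * t) *\<^sub>R x) t"
          then have "norm (z - (1 - 2 * t) *\<^sub>R x) < t" by (simp add: dist_norm norm_minus_commute)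
          moreover have "norm ((1 - 2 * t) *\<^sub>R x) \<le> 1 - 2 * t"
            using x tt mult_left_mono[of "norm x" 1 "1 - 2 * t"] by simp
          ultimately have "norm z < 1" using norm_triangle_sub[of z "(1 - 2 * t) *\<^sub>R x"] tt(1) by linarith
          then show "z \<in> ball 0 1" by simp
        qed
        have "t ^ ?n \<le> t ^ 1" using tt n0 by (intro power_decreasing) auto
        also have "\<dots> \<le> 3 * real ?n * t"
        proof -
          have "1 \<le> 3 * real ?n" using n0 by linarith
          from mult_right_mono[OF this, of t] show ?thesis using tt(1) by simp
        qed
        finally have "?\<omega> * t ^ ?n \<le> ?\<omega> * (3 * real ?n * t)" using \<omega> by (intro mult_left_mono) auto
        then show "emeasure lborel (ball ((1 - 2 * t) *\<^sub>R x) t) \<le> ennreal (?\<omega> * (3 * real ?n * t))"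
          using tt by (simp add: emeasure_ball ennreal_leI)
      qed (use \<omega> tt in auto)
    qed
  qed
qed

lemma nn_integral_translate:
  fixes f :: "'a::euclidean_space \<Rightarrow> ennreal"
  assumes "f \<in> borel_measurable borel"
  shows "(\<integral>\<^sup>+x. f (t + x) \<partial>lborel) = (\<integral>\<^sup>+x. f x \<partial>lborel)"
  using nn_integral_affine[of 1 f t] assms by simp

lemma norm_derivative_le:
  fixes w :: "real^'n \<Rightarrow> real^'m"
  assumes "C1 w"
  shows "norm (frechet_derivative w (at x) h) \<le> norm h * (\<Sum>\<alpha>\<in>UNIV. norm (pd \<alpha> w x))"
proof -
  have "norm (frechet_derivative w (at x) h) \<le> (\<Sum>\<alpha>\<in>UNIV. norm (h $ \<alpha> *\<^sub>R pd \<alpha> w x))"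
    unfolding frechet_derivative_expand[OF assms, of x h] by (rule norm_sum)
  also have "\<dots> \<le> (\<Sum>\<alpha>\<in>UNIV. norm h * norm (pd \<alpha> w x))"
    by (intro sum_mono) (auto intro!: mult_right_mono component_le_norm_cart)
  finally show ?thesis by (simp add: sum_distrib_left)
qed

subsection \<open>First order spaces\<close>

lemma increment_powr_le:
  fixes w :: "real^'n \<Rightarrow> real^'m"
  assumes w: "C1 w" and p: "p \<ge> 1"
  shows "ennreal (norm (w (y + h) - w y) powr p) \<le>
    ennreal ((2 * norm h) powr p) * (\<integral>\<^sup>+\<tau>\<in>{0..1::real}. ennreal ((\<Sum>\<alpha>\<in>UNIV. norm (pd \<alpha> w (y + \<tau> *\<^sub>R h))) powr p) \<partial>lborel)"
proof -
  define G where "G z = (\<Sum>\<alpha>\<in>UNIV. norm (pd \<alpha> w z))" for z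
  have G0: "G z \<ge> 0" for z by (auto simp: G_def intro: sum_nonneg)
  have cG: "continuous_on UNIV G" unfolding G_def[abs_def] by (intro continuous_intros C1_deriv_continuous[OF w])
  have cl: "continuous_on UNIV (\<lambda>\<tau>::real. y + \<tau> *\<^sub>R h)" by (intro continuous_intros)
  have cGl: "continuous_on UNIV (\<lambda>\<tau>. G (y + \<tau> *\<^sub>R h))"
    by (rule continuous_on_compose2[OF cG cl]) simp
  define \<phi>' where "\<phi>' \<tau> = frechet_derivative w (at (y + \<tau> *\<^sub>R h)) h" for \<tau>
  have c\<phi>: "continuous_on UNIV \<phi>'"
    unfolding \<phi>'_def[abs_def] by (rule continuous_on_compose2[OF C1_deriv_continuous[OF w, of UNIV] cl]) simp
  have d: "((\<lambda>\<tau>. w (y + \<tau> *\<^sub>R h)) has_vector_derivative \<phi>' \<tau>) (at \<tau> within {0..1})" for \<tau>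
  proof -
    have "((\<lambda>\<tau>. y + \<tau> *\<^sub>R h) has_derivative (\<lambda>s. s *\<^sub>R h)) (at \<tau>)"
      by (auto intro!: derivative_eq_intros)
    from has_derivative_compose[OF this C1_has_derivative[OF w]]
    have "((\<lambda>\<tau>. w (y + \<tau> *\<^sub>R h)) has_derivative (\<lambda>s. frechet_derivative w (at (y + \<tau> *\<^sub>R h)) (s *\<^sub>R h))) (at \<tau>)" .
    moreover have "frechet_derivative w (at (y + \<tau> *\<^sub>R h)) (s *\<^sub>R h) = s *\<^sub>R \<phi>' \<tau>" for s
      unfolding \<phi>'_def by (rule linear_scale[OF has_derivative_linear[OF C1_has_derivative[OF w]]])
    ultimately show ?thesis by (auto simp: has_vector_derivative_def intro: has_derivative_at_withinI)
  qed
  have c01: "continuous_on {0..1} \<phi>'" using c\<phi> continuous_on_subset by blast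
  have I: "(LINT \<tau>|lborel. indicator {0..1} \<tau> *\<^sub>R \<phi>' \<tau>) = w (y + h) - w y"
    using integral_FTC_Icc[of 0 1 "\<lambda>\<tau>. w (y + \<tau> *\<^sub>R h)" \<phi>'] d c01 by simp
  have int: "integrable lborel (\<lambda>\<tau>. indicator {0..1} \<tau> *\<^sub>R \<phi>' \<tau>)"
    using borel_integrable_compact[of "{0..1}" \<phi>'] c01 by (simp add: set_integrable_def)
  define P where "P = (\<integral>\<^sup>+\<tau>\<in>{0..1::real}. ennreal (G (y + \<tau> *\<^sub>R h) powr p) \<partial>lborel)"
  have [measurable]: "(\<lambda>\<tau>. G (y + \<tau> *\<^sub>R h)) \<in> borel_measurable borel" by (rule borel_measurable_continuous_onI[OF cGl])
  have "ennreal (norm (w (y + h) - w y)) \<le> (\<integral>\<^sup>+\<tau>. ennreal (norm (indicator {0..1::real} \<tau> *\<^sub>R \<phi>' \<tau>)) \<partial>lborel)"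
    unfolding I[symmetric] by (rule integral_norm_bound_ennreal[OF int])
  also have "\<dots> \<le> (\<integral>\<^sup>+\<tau>. ennreal (norm h) * (ennreal (G (y + \<tau> *\<^sub>R h)) * indicator {0..1::real} \<tau>) \<partial>lborel)"
  proof (rule nn_integral_mono)
    fix \<tau> :: real
    have "ennreal (norm (\<phi>' \<tau>)) \<le> ennreal (norm h) * ennreal (G (y + \<tau> *\<^sub>R h))"
      using norm_derivative_le[OF w, of "y + \<tau> *\<^sub>R h" h] G0 unfolding \<phi>'_def G_def[symmetric]
      by (simp add: ennreal_mult[symmetric] ennreal_leI)
    then show "ennreal (norm (indicator {0..1::real} \<tau> *\<^sub>R \<phi>' \<tau>)) \<le> ennreal (norm h) * (ennreal (G (y + \<tau> *\<^sub>R h)) * indicator {0..1::real} \<tau>)"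
      by (auto simp: indicator_def)
  qed
  also have "\<dots> = ennreal (norm h) * (\<integral>\<^sup>+\<tau>\<in>{0..1::real}. ennreal (G (y + \<tau> *\<^sub>R h)) \<partial>lborel)"
    by (rule nn_integral_cmult) measurable
  finally have 1: "ennreal (norm (w (y + h) - w y)) \<le> ennreal (norm h) * (\<integral>\<^sup>+\<tau>\<in>{0..1::real}. ennreal (G (y + \<tau> *\<^sub>R h)) \<partial>lborel)" .
  have P_fin: "P < \<infinity>"
  proof -
    obtain N where N: "N > 0" "\<And>\<tau>. norm \<tau> \<le> 1 ==> norm (G (y + \<tau> *\<^sub>R h)) \<le> N"
      using continuous_bounded_on_cball[OF cGl, of 1] by metis
    have "P \<le> (\<integral>\<^sup>+\<tau>. ennreal (N powr p) * indicator {0..1::real} \<tau> \<partial>lborel)"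
      unfolding P_def
    proof (rule nn_integral_mono)
      fix \<tau> :: real
      show "ennreal (G (y + \<tau> *\<^sub>R h) powr p) * indicator {0..1} \<tau> \<le> ennreal (N powr p) * indicator {0..1} \<tau>"
        using N(2)[of \<tau>] p G0 by (auto simp: indicator_def intro!: ennreal_leI powr_mono2)
    qed
    also have "\<dots> < \<infinity>" by (simp add: nn_integral_cmult_indicator ennreal_mult_less_top)
    finally show ?thesis .
  qed
  define I' where "I' = enn2real P"
  have PI: "P = ennreal I'" "I' \<ge> 0" using P_fin by (auto simp: I'_def)
  have e01: "emeasure lborel {0..1::real} = ennreal 1" by simp
  have "(\<integral>\<^sup>+\<tau>\<in>{0..1::real}. ennreal (G (y + \<tau> *\<^sub>R h)) \<partial>lborel) \<le> ennreal (2 * 1 * (I' / 1) powr (1 / p))"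
    by (rule nn_integral_power_mean[OF _ e01]) (use p G0 PI in \<open>auto simp: P_def\<close>)
  then have "ennreal (norm (w (y + h) - w y)) \<le> ennreal (norm h) * ennreal (2 * I' powr (1 / p))"
    using order_trans[OF 1 mult_left_mono[OF _ zero_le]] by simp
  then have "norm (w (y + h) - w y) \<le> 2 * norm h * I' powr (1 / p)"
    using PI by (simp add: ennreal_mult[symmetric] ennreal_le_iff mult_ac)
  then have "norm (w (y + h) - w y) powr p \<le> (2 * norm h * I' powr (1 / p)) powr p"
    using p by (intro powr_mono2) auto
  also have "\<dots> = (2 * norm h) powr p * I'" using PI p by (simp add: powr_mult powr_powr)
  finally have "ennreal (norm (w (y + h) - w y) powr p) \<le> ennreal ((2 * norm h) powr p) * P"
    using PI by (simp add: ennreal_mult[symmetric] ennreal_leI)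
  then show ?thesis by (simp add: P_def G_def)
qed

text \<open>With \<open>y' = y + h\<close>, Tonelli's theorem and translation invariance reduce the integral over the
  pairs of points to the volume of the ball of increments times the energy of \<open>w\<close>.\<close>

lemma Osc_le_gradient:
  fixes w :: "real^'n \<Rightarrow> real^'m"
  assumes w: "C1 w" and p: "p \<ge> 1" and t: "t > 0"
  shows "Osc p t w (ball 0 1) \<le> ennreal ((12 * t) powr p * (unit_ball_vol (real CARD('n)) * (6 * t) ^ CARD('n))) *
    (\<integral>\<^sup>+x\<in>ball 0 1. ennreal ((\<Sum>\<alpha>\<in>UNIV. norm (pd \<alpha> w x)) powr p) \<partial>lborel)"
proof -
  define \<Phi> where "\<Phi> z = ennreal ((\<Sum>\<alpha>\<in>UNIV. norm (pd \<alpha> w z)) powr p) * indicator (ball 0 1) z" for z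
  have [measurable]: "(\<lambda>z. \<Sum>\<alpha>\<in>UNIV. norm (pd \<alpha> w z)) \<in> borel_measurable borel"
    by (intro borel_measurable_continuous_onI continuous_intros C1_deriv_continuous[OF w])
  have \<Phi>m[measurable]: "\<Phi> \<in> borel_measurable borel" unfolding \<Phi>_def[abs_def] by measurable
  have [measurable]: "w \<in> borel_measurable borel" by (rule borel_measurable_continuous_onI[OF C1_continuous[OF w]])
  let ?c = "(12 * t) powr p" and ?I = "\<integral>\<^sup>+x. \<Phi> x \<partial>lborel"
  let ?F = "\<lambda>y h. indicator (ball (0::real^'n) (6 * t)) h * (\<integral>\<^sup>+\<tau>. indicator {0..1::real} \<tau> * \<Phi> (y + \<tau> *\<^sub>R h) \<partial>lborel)"
  have osc: "osc p t w y * indicator (ball 0 1) y \<le> ennreal ?c * (\<integral>\<^sup>+h. ?F y h \<partial>lborel)" for y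
  proof (cases "y \<in> ball 0 1")
    case True
    have "osc p t w y = (\<integral>\<^sup>+h. ennreal (norm (w y - w (y + h)) powr p) * indicator (ball 0 1 \<inter> ball y (6 * t)) (y + h) \<partial>lborel)"
      unfolding osc_def by (rule nn_integral_translate[symmetric]) measurable
    also have "\<dots> \<le> (\<integral>\<^sup>+h. ennreal ?c * ?F y h \<partial>lborel)"
    proof (rule nn_integral_mono)
      fix h
      show "ennreal (norm (w y - w (y + h)) powr p) * indicator (ball 0 1 \<inter> ball y (6 * t)) (y + h) \<le> ennreal ?c * ?F y h"
      proof (cases "y + h \<in> ball 0 1 \<inter> ball y (6 * t)")
        case in_ball: True
        then have h: "norm h < 6 * t" by (simp add: dist_norm)
        have seg: "y + \<tau> *\<^sub>R h \<in> ball 0 1" if "\<tau> \<in> {0..1}" for \<tau>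
        proof -
          have "(1 - \<tau>) *\<^sub>R y + \<tau> *\<^sub>R (y + h) \<in> ball 0 1"
            using True in_ball that by (intro convexD[OF convex_ball]) auto
          then show ?thesis by (simp add: algebra_simps)
        qed
        have "ennreal (norm (w y - w (y + h)) powr p) \<le> ennreal ((2 * norm h) powr p) *
          (\<integral>\<^sup>+\<tau>\<in>{0..1::real}. ennreal ((\<Sum>\<alpha>\<in>UNIV. norm (pd \<alpha> w (y + \<tau> *\<^sub>R h))) powr p) \<partial>lborel)"
          using increment_powr_le[OF w p, of y h] by (simp add: norm_minus_commute)
        also have "(\<integral>\<^sup>+\<tau>\<in>{0..1::real}. ennreal ((\<Sum>\<alpha>\<in>UNIV. norm (pd \<alpha> w (y + \<tau> *\<^sub>R h))) powr p) \<partial>lborel)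
          = (\<integral>\<^sup>+\<tau>. indicator {0..1::real} \<tau> * \<Phi> (y + \<tau> *\<^sub>R h) \<partial>lborel)"
          by (rule nn_integral_cong) (use seg in \<open>auto simp: \<Phi>_def indicator_def\<close>)
        also have "ennreal ((2 * norm h) powr p) * \<dots> \<le> ennreal ?c * \<dots>"
          using h p t by (intro mult_right_mono ennreal_leI powr_mono2) auto
        finally show ?thesis using in_ball h by (simp add: indicator_def)
      qed simp
    qed
    also have "\<dots> = ennreal ?c * (\<integral>\<^sup>+h. ?F y h \<partial>lborel)"
      by (rule nn_integral_cmult) measurable
    finally show ?thesis using True by simp
  qed simp
  have tr: "(\<integral>\<^sup>+y. \<Phi> (y + \<tau> *\<^sub>R h) \<partial>lborel) = ?I" for \<tau> :: real and h
    using nn_integral_translate[OF \<Phi>m, of "\<tau> *\<^sub>R h"] by (simp add: add.commute)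
  have "Osc p t w (ball 0 1) \<le> (\<integral>\<^sup>+y. ennreal ?c * (\<integral>\<^sup>+h. ?F y h \<partial>lborel) \<partial>lborel)"
    unfolding Osc_def by (rule nn_integral_mono) (rule osc)
  also have "\<dots> = ennreal ?c * (\<integral>\<^sup>+y. (\<integral>\<^sup>+h. ?F y h \<partial>lborel) \<partial>lborel)"
    by (rule nn_integral_cmult) measurable
  also have "(\<integral>\<^sup>+y. (\<integral>\<^sup>+h. ?F y h \<partial>lborel) \<partial>lborel) = (\<integral>\<^sup>+h. (\<integral>\<^sup>+y. ?F y h \<partial>lborel) \<partial>lborel)"
    by (rule lborel_pair.Fubini'[symmetric]) measurable
  also have "\<dots> = (\<integral>\<^sup>+h. ?I * indicator (ball (0::real^'n) (6 * t)) h \<partial>lborel)"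
  proof (rule nn_integral_cong)
    fix h :: "real^'n"
    have "(\<integral>\<^sup>+y. ?F y h \<partial>lborel) = indicator (ball 0 (6 * t)) h * (\<integral>\<^sup>+y. (\<integral>\<^sup>+\<tau>. indicator {0..1::real} \<tau> * \<Phi> (y + \<tau> *\<^sub>R h) \<partial>lborel) \<partial>lborel)"
      by (rule nn_integral_cmult) measurable
    also have "(\<integral>\<^sup>+y. (\<integral>\<^sup>+\<tau>. indicator {0..1::real} \<tau> * \<Phi> (y + \<tau> *\<^sub>R h) \<partial>lborel) \<partial>lborel) = (\<integral>\<^sup>+\<tau>. (\<integral>\<^sup>+y. indicator {0..1::real} \<tau> * \<Phi> (y + \<tau> *\<^sub>R h) \<partial>lborel) \<partial>lborel)"
      by (rule lborel_pair.Fubini'[symmetric]) measurable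
    also have "\<dots> = (\<integral>\<^sup>+\<tau>. ?I * indicator {0..1::real} \<tau> \<partial>lborel)"
    proof (rule nn_integral_cong)
      fix \<tau> :: real
      have "(\<integral>\<^sup>+y. indicator {0..1::real} \<tau> * \<Phi> (y + \<tau> *\<^sub>R h) \<partial>lborel) = indicator {0..1} \<tau> * (\<integral>\<^sup>+y. \<Phi> (y + \<tau> *\<^sub>R h) \<partial>lborel)"
        by (rule nn_integral_cmult) measurable
      then show "(\<integral>\<^sup>+y. indicator {0..1::real} \<tau> * \<Phi> (y + \<tau> *\<^sub>R h) \<partial>lborel) = ?I * indicator {0..1::real} \<tau>"
        by (simp add: tr mult.commute)
    qed
    also have "\<dots> = ?I" by (simp add: nn_integral_cmult_indicator)
    finally show "(\<integral>\<^sup>+y. ?F y h \<partial>lborel) = ?I * indicator (ball 0 (6 * t)) h" by (simp add: mult.commute)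
  qed
  also have "\<dots> = ?I * ennreal (unit_ball_vol (real CARD('n)) * (6 * t) ^ CARD('n))"
    using t by (simp add: nn_integral_cmult_indicator emeasure_ball)
  finally have "Osc p t w (ball 0 1) \<le> (ennreal ?c * ennreal (unit_ball_vol (real CARD('n)) * (6 * t) ^ CARD('n))) * ?I"
    by (simp only: mult_ac)
  also have "ennreal ?c * ennreal (unit_ball_vol (real CARD('n)) * (6 * t) ^ CARD('n)) = ennreal (?c * (unit_ball_vol (real CARD('n)) * (6 * t) ^ CARD('n)))"
    using t by (simp add: ennreal_mult[symmetric])
  finally show ?thesis by (simp add: \<Phi>_def)
qed

section \<open>Fractional seminorms and integrals over the sphere\<close>

lemma borel_representative:
  fixes u :: "real^'n \<Rightarrow> real^'m"
  assumes u: "u \<in> borel_measurable (lebesgue_on \<Omega>)" and \<Omega>: "\<Omega> \<in> sets borel"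
  obtains u' where "u' \<in> borel_measurable borel" "AE x in lborel. x \<in> \<Omega> --> u x = u' x"
proof -
  have "(\<lambda>x. indicator \<Omega> x *\<^sub>R u x) \<in> borel_measurable lebesgue"
    using u \<Omega> by (subst (asm) borel_measurable_restrict_space_iff) auto
  then have "(\<lambda>x. (indicator \<Omega> x *\<^sub>R u x) $ i) \<in> borel_measurable lebesgue" for i
    by (rule measurable_compose) (intro borel_measurable_continuous_onI continuous_intros)
  then have "\<forall>i. \<exists>g. g \<in> borel_measurable lborel \<and> (AE x in lborel. (indicator \<Omega> x *\<^sub>R u x) $ i = g x)"
    using completion_ex_borel_measurable_real[of _ lborel] by blast
  from choice[OF this] obtain g where g: "\<And>i. g i \<in> borel_measurable lborel" "\<And>i. AE x in lborel. (indicator \<Omega> x *\<^sub>R u x) $ i = g i x"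
    by blast
  have [measurable]: "g i \<in> borel_measurable borel" for i using g(1)[of i] by simp
  define u' where "u' x = (\<chi> i. g i x)" for x
  have "u' \<in> borel_measurable borel"
    by (subst borel_measurable_euclidean_space) (auto simp: Basis_vec_def inner_axis u'_def)
  moreover have "AE x in lborel. \<forall>i\<in>UNIV. (indicator \<Omega> x *\<^sub>R u x) $ i = g i x"
    by (rule AE_finite_allI) (use g(2) in auto)
  then have "AE x in lborel. x \<in> \<Omega> --> u x = u' x" by eventually_elim (auto simp: u'_def vec_eq_iff)
  ultimately show ?thesis by (rule that)
qed

definition gagliardo :: "real \<Rightarrow> real \<Rightarrow> (real^'n \<Rightarrow> real^'m) \<Rightarrow> ennreal" where
  "gagliardo p q f = (\<integral>\<^sup>+x\<in>ball 0 1. (\<integral>\<^sup>+y\<in>ball 0 1. ennreal (norm (f x - f y) powr p / norm (x - y) powr q) \<partial>lborel) \<partial>lborel)"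

lemma gagliardo_seminorm_ball:
  fixes f :: "real^'n \<Rightarrow> real^'m"
  shows "gagliardo_seminorm s p (ball 0 1) f = ennroot p (gagliardo p (real CARD('n) + s * p) f)"
  by (simp add: gagliardo_seminorm_def gagliardo_def nn_integral_lebesgue_on[OF ball_borel])

lemma gagliardo_cong_AE:
  fixes f g :: "real^'n \<Rightarrow> real^'m"
  assumes "AE x in lborel. x \<in> ball 0 1 --> f x = g x"
  shows "gagliardo p q f = gagliardo p q g"
  unfolding gagliardo_def
proof (rule nn_integral_cong_AE, use assms in eventually_elim)
  fix x :: "real^'n" assume x: "x \<in> ball 0 1 --> f x = g x"
  have "(\<integral>\<^sup>+y\<in>ball 0 1. ennreal (norm (f x - f y) powr p / norm (x - y) powr q) \<partial>lborel) =
     (\<integral>\<^sup>+y\<in>ball 0 1. ennreal (norm (f x - g y) powr p / norm (x - y) powr q) \<partial>lborel)"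
    by (rule nn_integral_cong_AE, use assms in eventually_elim) (auto simp: indicator_def)
  then show "(\<integral>\<^sup>+y\<in>ball 0 1. ennreal (norm (f x - f y) powr p / norm (x - y) powr q) \<partial>lborel) * indicator (ball 0 1) x =
     (\<integral>\<^sup>+y\<in>ball 0 1. ennreal (norm (g x - g y) powr p / norm (x - y) powr q) \<partial>lborel) * indicator (ball 0 1) x"
    using x by (cases "x \<in> ball 0 1") auto
qed

lemma gagliardo_diff_le:
  fixes f g :: "real^'n \<Rightarrow> real^'m"
  assumes p: "p \<ge> 1" and [measurable]: "f \<in> borel_measurable borel" "g \<in> borel_measurable borel"
  shows "gagliardo p q (\<lambda>x. f x - g x) \<le> ennreal (2 powr p) * (gagliardo p q f + gagliardo p q g)"
proof -
  let ?k = "\<lambda>f x y. ennreal (norm (f x - f y :: real^'m) powr p / norm (x - y :: real^'n) powr q)"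
  let ?i = "\<lambda>f x. \<integral>\<^sup>+y\<in>ball 0 1. ?k f x y \<partial>lborel"
  have pt: "?k (\<lambda>x. f x - g x) x y \<le> ennreal (2 powr p) * (?k f x y + ?k g x y)" for x y
  proof -
    have "norm ((f x - g x) - (f y - g y)) powr p \<le> 2 powr p * (norm (f x - f y) powr p + norm (g x - g y) powr p)"
      using powr_norm_add_le[OF p, of "f x - f y" "- (g x - g y)"] by (simp add: algebra_simps norm_minus_commute)
    then have "norm ((f x - g x) - (f y - g y)) powr p / norm (x - y) powr q \<le>
        2 powr p * (norm (f x - f y) powr p / norm (x - y) powr q + norm (g x - g y) powr p / norm (x - y) powr q)"
      using divide_right_mono[of _ _ "norm (x - y) powr q"] by (simp add: add_divide_distrib[symmetric])
    then show ?thesis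
      by (simp add: ennreal_mult[symmetric] ennreal_plus[symmetric] ennreal_leI del: ennreal_plus)
  qed
  have im: "?i f \<in> borel_measurable lborel" "?i g \<in> borel_measurable lborel" by measurable
  have in_le: "?i (\<lambda>x. f x - g x) x \<le> ennreal (2 powr p) * (?i f x + ?i g x)" for x
  proof -
    have "?i (\<lambda>x. f x - g x) x \<le> (\<integral>\<^sup>+y. ennreal (2 powr p) * (?k f x y * indicator (ball 0 1) y + ?k g x y * indicator (ball 0 1) y) \<partial>lborel)"
      by (rule nn_integral_mono) (use pt in \<open>auto simp: indicator_def\<close>)
    also have "\<dots> = ennreal (2 powr p) * (?i f x + ?i g x)"
      by (subst nn_integral_cmult, measurable, subst nn_integral_add, measurable)
    finally show ?thesis .
  qed
  have "gagliardo p q (\<lambda>x. f x - g x) \<le> (\<integral>\<^sup>+x. ennreal (2 powr p) * (?i f x * indicator (ball 0 1) x + ?i g x * indicator (ball 0 1) x) \<partial>lborel)"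
    unfolding gagliardo_def by (rule nn_integral_mono) (use in_le in \<open>auto simp: indicator_def\<close>)
  also have "\<dots> = ennreal (2 powr p) * (gagliardo p q f + gagliardo p q g)"
    unfolding gagliardo_def by (subst nn_integral_cmult, measurable, subst nn_integral_add, measurable)
  finally show ?thesis .
qed

text \<open>Where \<open>\<bar>x - y\<bar> < 6 t\<close>, the kernel is at least \<open>(6 t)\<^sup>-\<^sup>q\<close>.\<close>

lemma Osc_le_gagliardo:
  fixes w :: "real^'n \<Rightarrow> real^'m"
  assumes w: "continuous_on UNIV w" and p: "p > 0" and q: "q \<ge> 0" and t: "t > 0"
  shows "Osc p t w (ball 0 1) \<le> ennreal ((6 * t) powr q) * gagliardo p q w"
proof -
  have [measurable]: "w \<in> borel_measurable borel" by (rule borel_measurable_continuous_onI[OF w])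
  let ?k = "\<lambda>x y. ennreal (norm (w x - w y) powr p / norm (x - y) powr q)"
  have "osc p t w x \<le> ennreal ((6 * t) powr q) * (\<integral>\<^sup>+y\<in>ball 0 1. ?k x y \<partial>lborel)" for x
  proof -
    have "osc p t w x \<le> (\<integral>\<^sup>+y. ennreal ((6 * t) powr q) * (?k x y * indicator (ball 0 1) y) \<partial>lborel)"
      unfolding osc_def
    proof (rule nn_integral_mono)
      fix y
      show "ennreal (norm (w x - w y) powr p) * indicator (ball 0 1 \<inter> ball x (6 * t)) y \<le> ennreal ((6 * t) powr q) * (?k x y * indicator (ball 0 1) y)"
      proof (cases "y \<in> ball 0 1 \<inter> ball x (6 * t) \<and> x \<noteq> y")
        case True
        then have d: "norm (x - y) > 0" "norm (x - y) \<le> 6 * t" by (auto simp: dist_norm)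
        have "norm (w x - w y) powr p = norm (x - y) powr q * (norm (w x - w y) powr p / norm (x - y) powr q)"
          using d by simp
        also have "\<dots> \<le> (6 * t) powr q * (norm (w x - w y) powr p / norm (x - y) powr q)"
          using d q by (intro mult_right_mono powr_mono2) auto
        finally show ?thesis using True by (simp add: ennreal_mult[symmetric] ennreal_leI)
      next
        case False
        then show ?thesis using p by (auto simp: indicator_def)
      qed
    qed
    also have "\<dots> = ennreal ((6 * t) powr q) * (\<integral>\<^sup>+y\<in>ball 0 1. ?k x y \<partial>lborel)" by (rule nn_integral_cmult) measurable
    finally show ?thesis .
  qed
  then have "Osc p t w (ball 0 1) \<le> (\<integral>\<^sup>+x. ennreal ((6 * t) powr q) * ((\<integral>\<^sup>+y\<in>ball 0 1. ?k x y \<partial>lborel) * indicator (ball 0 1) x) \<partial>lborel)"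
    unfolding Osc_def by (intro nn_integral_mono) (auto simp: indicator_def)
  also have "\<dots> = ennreal ((6 * t) powr q) * gagliardo p q w"
    unfolding gagliardo_def by (rule nn_integral_cmult) measurable
  finally show ?thesis .
qed

lemma nn_integral_sphere_measure:
  fixes g :: "real^'n \<Rightarrow> real^'m"
  assumes g: "continuous_on (sphere 0 1) g"
  shows "(\<integral>\<^sup>+x. ennreal (norm (g x) powr p) \<partial>sphere_measure) =
    of_nat CARD('n) * (\<integral>\<^sup>+x\<in>ball 0 1 - {0}. ennreal (norm (g (sgn x)) powr p) \<partial>lborel)"
proof -
  let ?N = "restrict_space borel (sphere (0::real^'n) 1)" and ?M = "lebesgue_on (ball (0::real^'n) 1 - {0})"
  have gm: "(\<lambda>x. ennreal (norm (g x) powr p)) \<in> borel_measurable ?N"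
    using borel_measurable_continuous_on_restrict[OF g] by measurable
  have "(sgn :: real^'n \<Rightarrow> real^'n) \<in> lebesgue \<rightarrow>\<^sub>M borel" by (rule measurable_completion) simp
  then have "(sgn :: real^'n \<Rightarrow> real^'n) \<in> ?M \<rightarrow>\<^sub>M borel" by (rule measurable_restrict_space1)
  then have sm: "sgn \<in> ?M \<rightarrow>\<^sub>M ?N"
    by (rule measurable_restrict_space2[rotated]) (auto simp: space_restrict_space norm_sgn)
  have "(\<integral>\<^sup>+x. ennreal (norm (g x) powr p) \<partial>sphere_measure) = of_nat DIM(real^'n) * (\<integral>\<^sup>+x. ennreal (norm (g x) powr p) \<partial>distr ?M ?N sgn)"
    unfolding sphere_measure_def by (rule nn_integral_scale_measure) (use gm in simp)
  also have "(\<integral>\<^sup>+x. ennreal (norm (g x) powr p) \<partial>distr ?M ?N sgn) = (\<integral>\<^sup>+x. ennreal (norm (g (sgn x)) powr p) \<partial>?M)"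
    by (rule nn_integral_distr[OF sm]) (use gm in simp)
  also have "\<dots> = (\<integral>\<^sup>+x\<in>ball 0 1 - {0}. ennreal (norm (g (sgn x)) powr p) \<partial>lborel)"
    by (rule nn_integral_lebesgue_on) auto
  finally show ?thesis by simp
qed

lemma L1_bound_from_Lp:
  fixes A :: "'a::euclidean_space set"
  assumes A: "A \<in> sets borel" "emeasure lborel A = ennreal \<mu>" "\<mu> > 0" and p: "p \<ge> 1" and e: "e > 0"
  obtains e' where "e' > 0" "\<And>g. g \<in> borel_measurable borel ==> (\<And>x. g x \<ge> 0) ==>
    (\<integral>\<^sup>+x\<in>A. ennreal (g x powr p) \<partial>lborel) \<le> ennreal e' ==> (\<integral>\<^sup>+x\<in>A. ennreal (g x) \<partial>lborel) \<le> ennreal e"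
proof -
  define e' where "e' = \<mu> * (e / (2 * \<mu>)) powr p"
  have e': "e' > 0" unfolding e'_def using A(3) e by simp
  show ?thesis
  proof (rule that[OF e'])
    fix g :: "'a \<Rightarrow> real" assume g: "g \<in> borel_measurable borel" "\<And>x. g x \<ge> 0" and I: "(\<integral>\<^sup>+x\<in>A. ennreal (g x powr p) \<partial>lborel) \<le> ennreal e'"
    have "(\<integral>\<^sup>+x\<in>A. ennreal (g x) \<partial>lborel) \<le> ennreal (2 * \<mu> * (e' / \<mu>) powr (1 / p))"
      by (rule nn_integral_power_mean[OF _ A(2,3) _ g(2) p I]) (use A g e' in auto)
    also have "2 * \<mu> * (e' / \<mu>) powr (1 / p) = e" using A(3) e p by (simp add: e'_def powr_powr)
    finally show "(\<integral>\<^sup>+x\<in>A. ennreal (g x) \<partial>lborel) \<le> ennreal e" .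
  qed
qed

section \<open>Weak gradients\<close>

lemma integrable_mult_supported:
  fixes g \<xi> :: "'a::euclidean_space \<Rightarrow> real"
  assumes g: "set_integrable lebesgue K g" and \<xi>: "continuous_on UNIV \<xi>" "\<And>x. x \<notin> K ==> \<xi> x = 0" "\<And>x. \<bar>\<xi> x\<bar> \<le> e"
  shows "integrable lebesgue (\<lambda>x. \<xi> x * g x)"
    and "\<bar>LINT x|lebesgue. \<xi> x * g x\<bar> \<le> e * (LINT x|lebesgue. \<bar>indicator K x * g x\<bar>)"
proof -
  have m: "\<xi> \<in> borel_measurable lebesgue"
    by (rule measurable_completion) (simp add: borel_measurable_continuous_onI[OF \<xi>(1)])
  have eq': "\<xi> x * g x = \<xi> x * (indicator K x * g x)" for x using \<xi>(2)[of x] by (cases "x \<in> K") simp_all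
  then have eq: "(\<lambda>x. \<xi> x * g x) = (\<lambda>x. \<xi> x * (indicator K x * g x))" by (rule ext)
  have gi: "integrable lebesgue (\<lambda>x. indicator K x * g x)" using g by (simp add: set_integrable_def)
  have ei: "integrable lebesgue (\<lambda>x. e * \<bar>indicator K x * g x\<bar>)" using gi by (intro integrable_mult_right integrable_abs)
  have b: "\<bar>\<xi> x * (indicator K x * g x)\<bar> \<le> e * \<bar>indicator K x * g x\<bar>" for x
    unfolding abs_mult by (rule mult_right_mono[OF \<xi>(3)]) simp
  have e0: "e \<ge> 0" using \<xi>(3)[of undefined] by linarith
  show i: "integrable lebesgue (\<lambda>x. \<xi> x * g x)"
    unfolding eq
  proof (rule Bochner_Integration.integrable_bound[OF ei])
    show "(\<lambda>x. \<xi> x * (indicator K x * g x)) \<in> borel_measurable lebesgue"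
      by (rule borel_measurable_times[OF m borel_measurable_integrable[OF gi]])
    show "AE x in lebesgue. norm (\<xi> x * (indicator K x * g x)) \<le> norm (e * \<bar>indicator K x * g x\<bar>)"
      using b e0 by (intro AE_I2) (simp only: real_norm_def abs_mult abs_abs abs_of_nonneg[OF e0])
  qed
  have "\<bar>LINT x|lebesgue. \<xi> x * g x\<bar> \<le> (LINT x|lebesgue. \<bar>\<xi> x * g x\<bar>)" by (rule integral_abs_bound)
  also have "\<dots> \<le> (LINT x|lebesgue. e * \<bar>indicator K x * g x\<bar>)"
  proof (rule integral_mono[OF integrable_abs[OF i] ei])
    show "\<bar>\<xi> x * g x\<bar> \<le> e * \<bar>indicator K x * g x\<bar>" for x unfolding eq'[of x] by (rule b)
  qed
  also have "\<dots> = e * (LINT x|lebesgue. \<bar>indicator K x * g x\<bar>)" by (rule integral_mult_right_zero)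
  finally show "\<bar>LINT x|lebesgue. \<xi> x * g x\<bar> \<le> e * (LINT x|lebesgue. \<bar>indicator K x * g x\<bar>)" .
qed

lemma continuous_compact_support_bounded:
  fixes \<xi> :: "'a::euclidean_space \<Rightarrow> real"
  assumes "continuous_on UNIV \<xi>" "compact K" "\<And>x. x \<notin> K ==> \<xi> x = 0"
  obtains e where "\<And>x. \<bar>\<xi> x\<bar> \<le> e"
proof -
  obtain R where R: "K \<subseteq> cball 0 R" using bounded_subset_ballD[OF compact_imp_bounded[OF assms(2)], of 0] ball_subset_cball by blast
  obtain M where M: "M > 0" "\<And>x. norm x \<le> R ==> norm (\<xi> x) \<le> M" using continuous_bounded_on_cball[OF assms(1), of R] by metis
  have "\<bar>\<xi> x\<bar> \<le> M" for x
  proof (cases "x \<in> K")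
    case True
    then have "norm x \<le> R" using R by auto
    from M(2)[OF this] show ?thesis by simp
  next
    case False
    show ?thesis unfolding assms(3)[OF False] using M(1) by simp
  qed
  then show ?thesis by (rule that)
qed

lemma integral_lebesgue_on_supported:
  fixes F :: "'a::euclidean_space \<Rightarrow> real"
  assumes "\<Omega> \<in> sets borel" "\<And>x. x \<notin> \<Omega> ==> F x = 0"
  shows "(LINT x|lebesgue_on \<Omega>. F x) = (LINT x|lebesgue. F x)"
proof -
  have "(LINT x|lebesgue_on \<Omega>. F x) = (LINT x|lebesgue. indicat_real \<Omega> x *\<^sub>R F x)"
    by (rule integral_restrict_space) (use assms in auto)
  also have "\<dots> = (LINT x|lebesgue. F x)"
    by (rule Bochner_Integration.integral_cong) (auto simp: indicator_def assms(2))
  finally show ?thesis .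
qed

lemma test_functionD:
  fixes \<phi> :: "real^'n \<Rightarrow> real"
  assumes "test_function \<Omega> \<phi>"
  obtains K where "compact K" "K \<subseteq> \<Omega>" "\<And>x. x \<notin> K ==> \<phi> x = 0" "\<And>x j. x \<notin> K ==> pd j \<phi> x = 0" "C1 \<phi>"
proof -
  let ?K = "closure {x. \<phi> x \<noteq> 0}"
  have s: "smooth_on UNIV \<phi>" and K: "compact ?K" "?K \<subseteq> \<Omega>" using assms by (auto simp: test_function_def)
  have "Ck_on (Suc 0) UNIV \<phi>" using s by (simp only: smooth_on_def)
  then have "C1 \<phi>" by (rule Ck_Suc_C1)
  have z: "\<phi> x = 0" if "x \<notin> ?K" for x using that closure_subset[of "{x. \<phi> x \<noteq> 0}"] by auto
  have "pd j \<phi> x = 0" if x: "x \<notin> ?K" for x j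
  proof (rule pd_eq_0[of "- ?K"])
    show "open (- ?K)" by (rule open_Compl[OF closed_closure])
    show "x \<in> - ?K" using x by simp
    show "\<phi> y = 0" if "y \<in> - ?K" for y by (rule z[OF ComplD[OF that]])
  qed
  then show ?thesis by (intro that[OF K z _ \<open>C1 \<phi>\<close>])
qed

lemma set_integrable_component:
  fixes f :: "real^'n \<Rightarrow> 'b::euclidean_space^'m"
  assumes "set_integrable M K f" shows "set_integrable M K (\<lambda>x. f x $ i)"
  using integrable_bounded_linear[OF bounded_linear_vec_nth assms[unfolded set_integrable_def], of i]
  by (simp add: set_integrable_def)

lemma continuous_absolutely_integrable:
  fixes f :: "real^'n \<Rightarrow> 'b::euclidean_space"
  assumes "continuous_on UNIV f" "compact K" shows "f absolutely_integrable_on K"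
proof -
  have "integrable lborel (\<lambda>x. indicator K x *\<^sub>R f x)"
    by (rule borel_integrable_compact[OF assms(2)]) (use assms(1) continuous_on_subset in blast)
  then show ?thesis by (simp add: set_integrable_def integrable_completion borel_measurable_integrable)
qed

lemma integrable_test_products:
  fixes f :: "real^'n \<Rightarrow> real^'m" and G :: "real^'n \<Rightarrow> real^'n^'m"
  assumes f: "\<And>K. compact K ==> K \<subseteq> \<Omega> ==> f absolutely_integrable_on K" 
    and G: "\<And>K. compact K ==> K \<subseteq> \<Omega> ==> G absolutely_integrable_on K" and \<phi>: "test_function \<Omega> \<phi>"
  shows "integrable lebesgue (\<lambda>x. pd j \<phi> x * f x $ i)" "integrable lebesgue (\<lambda>x. \<phi> x * G x $ i $ j)"
proof -
  obtain K where K: "compact K" "K \<subseteq> \<Omega>" "\<And>x. x \<notin> K ==> \<phi> x = 0" "\<And>x j. x \<notin> K ==> pd j \<phi> x = 0" "C1 \<phi>"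
  proof (rule test_functionD[OF \<phi>], goal_cases)
    case (1 K)
    show ?case by (rule 1(1)) (rule 1(2), rule 1(3), rule 1(4), assumption, rule 1(5), assumption, rule 1(6))
  qed
  obtain e where e: "\<And>x. \<bar>\<phi> x\<bar> \<le> e" using continuous_compact_support_bounded[OF C1_continuous[OF K(5)] K(1,3)] by metis
  obtain e' where e': "\<And>x. \<bar>pd j \<phi> x\<bar> \<le> e'"
    using continuous_compact_support_bounded[OF C1_deriv_continuous[OF K(5)] K(1,4)] by metis
  show "integrable lebesgue (\<lambda>x. pd j \<phi> x * f x $ i)"
    by (rule integrable_mult_supported(1)[OF set_integrable_component[OF f[OF K(1,2)]] C1_deriv_continuous[OF K(5)] K(4) e'])
  show "integrable lebesgue (\<lambda>x. \<phi> x * G x $ i $ j)"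
    by (rule integrable_mult_supported(1)[OF set_integrable_component[OF set_integrable_component[OF G[OF K(1,2)]]] C1_continuous[OF K(5)] K(3) e])
qed

lemma has_weak_gradient_iff:
  fixes f :: "real^'n \<Rightarrow> real^'m"
  assumes \<Omega>: "\<Omega> \<in> sets borel"
  shows "has_weak_gradient f G \<Omega> \<longleftrightarrow>
     (\<forall>K. compact K \<and> K \<subseteq> \<Omega> --> f absolutely_integrable_on K \<and> G absolutely_integrable_on K) \<and>
     (\<forall>\<phi>. test_function \<Omega> \<phi> --> (\<forall>i j. (LINT x|lebesgue. pd j \<phi> x * f x $ i) = - (LINT x|lebesgue. \<phi> x * G x $ i $ j)))"
proof -
  have "(LINT x|lebesgue_on \<Omega>. f x $ i * pd j \<phi> x) = (LINT x|lebesgue. pd j \<phi> x * f x $ i)"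
    "(LINT x|lebesgue_on \<Omega>. G x $ i $ j * \<phi> x) = (LINT x|lebesgue. \<phi> x * G x $ i $ j)" if t: "test_function \<Omega> \<phi>" for \<phi> i j
  proof -
    obtain K where K: "compact K" "K \<subseteq> \<Omega>" "\<And>x. x \<notin> K ==> \<phi> x = 0" "\<And>x j. x \<notin> K ==> pd j \<phi> x = 0" "C1 \<phi>"
  proof (rule test_functionD[OF t], goal_cases)
    case (1 K)
    show ?case by (rule 1(1)) (rule 1(2), rule 1(3), rule 1(4), assumption, rule 1(5), assumption, rule 1(6))
  qed
    show "(LINT x|lebesgue_on \<Omega>. f x $ i * pd j \<phi> x) = (LINT x|lebesgue. pd j \<phi> x * f x $ i)"
      by (subst integral_lebesgue_on_supported[OF \<Omega>]) (use K in \<open>auto simp: mult.commute\<close>)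
    show "(LINT x|lebesgue_on \<Omega>. G x $ i $ j * \<phi> x) = (LINT x|lebesgue. \<phi> x * G x $ i $ j)"
      by (subst integral_lebesgue_on_supported[OF \<Omega>]) (use K in \<open>auto simp: mult.commute\<close>)
  qed
  then show ?thesis unfolding has_weak_gradient_def by (simp cong: conj_cong imp_cong)
qed

lemma has_weak_gradient_cong:
  fixes f g :: "real^'n \<Rightarrow> real^'m"
  assumes "\<And>x. x \<in> \<Omega> ==> f x = g x"
  shows "has_weak_gradient f G \<Omega> \<longleftrightarrow> has_weak_gradient g G \<Omega>"
proof -
  have 1: "(f absolutely_integrable_on K) = (g absolutely_integrable_on K)" if "K \<subseteq> \<Omega>" for K
    by (rule set_integrable_cong) (use assms that in auto)
  have 2: "(LINT x|lebesgue_on \<Omega>. f x $ i * pd j \<phi> x) = (LINT x|lebesgue_on \<Omega>. g x $ i * pd j \<phi> x)" for i j \<phi>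
    by (rule Bochner_Integration.integral_cong) (auto simp: space_restrict_space assms)
  show ?thesis unfolding has_weak_gradient_def 2 using 1 by (simp cong: conj_cong)
qed

lemma has_weak_gradient_diff:
  fixes f1 f2 :: "real^'n \<Rightarrow> real^'m"
  assumes \<Omega>: "\<Omega> \<in> sets borel" and 1: "has_weak_gradient f1 G1 \<Omega>" and 2: "has_weak_gradient f2 G2 \<Omega>"
  shows "has_weak_gradient (\<lambda>x. f1 x - f2 x) (\<lambda>x. G1 x - G2 x) \<Omega>"
proof -
  note 1 = 1[unfolded has_weak_gradient_iff[OF \<Omega>]] and 2 = 2[unfolded has_weak_gradient_iff[OF \<Omega>]]
  have i1: "\<And>K. compact K ==> K \<subseteq> \<Omega> ==> f1 absolutely_integrable_on K" "\<And>K. compact K ==> K \<subseteq> \<Omega> ==> G1 absolutely_integrable_on K"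
    using 1 by auto
  have i2: "\<And>K. compact K ==> K \<subseteq> \<Omega> ==> f2 absolutely_integrable_on K" "\<And>K. compact K ==> K \<subseteq> \<Omega> ==> G2 absolutely_integrable_on K"
    using 2 by auto
  show ?thesis unfolding has_weak_gradient_iff[OF \<Omega>]
  proof (intro conjI allI impI)
    fix K assume "compact K \<and> K \<subseteq> \<Omega>"
    then show "(\<lambda>x. f1 x - f2 x) absolutely_integrable_on K" "(\<lambda>x. G1 x - G2 x) absolutely_integrable_on K"
      using i1 i2 by (auto intro!: set_integral_diff(1))
  next
    fix \<phi> i j assume t: "test_function \<Omega> \<phi>"
    note I = integrable_test_products[OF i1 t, where i = i and j = j] integrable_test_products[OF i2 t, where i = i and j = j]
    have "(LINT x|lebesgue. pd j \<phi> x * f1 x $ i) = - (LINT x|lebesgue. \<phi> x * G1 x $ i $ j)"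
      "(LINT x|lebesgue. pd j \<phi> x * f2 x $ i) = - (LINT x|lebesgue. \<phi> x * G2 x $ i $ j)" 
      by (rule mp[OF spec[OF conjunct2[OF 1]] t, THEN spec, THEN spec], rule mp[OF spec[OF conjunct2[OF 2]] t, THEN spec, THEN spec])
    then show "(LINT x|lebesgue. pd j \<phi> x * (f1 x - f2 x) $ i) = - (LINT x|lebesgue. \<phi> x * (G1 x - G2 x) $ i $ j)"
      using I by (simp add: right_diff_distrib)
  qed
qed

lemma has_weak_gradient_C1:
  fixes w :: "real^'n \<Rightarrow> real^'m"
  assumes w: "C1 w" and \<Omega>: "\<Omega> \<in> sets borel"
  shows "has_weak_gradient w (\<lambda>x. \<chi> i j. pd j w x $ i) \<Omega>"
  unfolding has_weak_gradient_iff[OF \<Omega>]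
proof (intro conjI allI impI)
  fix K :: "(real^'n) set" assume K: "compact K \<and> K \<subseteq> \<Omega>"
  show "w absolutely_integrable_on K" by (rule continuous_absolutely_integrable[OF C1_continuous[OF w]]) (use K in simp)
  have "continuous_on UNIV (\<lambda>x. \<chi> i j. pd j w x $ i)"
    by (intro continuous_on_vec_lambda continuous_on_component C1_deriv_continuous[OF w])
  then show "(\<lambda>x. \<chi> i j. pd j w x $ i) absolutely_integrable_on K"
    by (rule continuous_absolutely_integrable) (use K in simp)
next
  fix \<phi> i j assume t: "test_function \<Omega> \<phi>"
  obtain K where K: "compact K" "K \<subseteq> \<Omega>" "\<And>x. x \<notin> K ==> \<phi> x = 0" "\<And>x j. x \<notin> K ==> pd j \<phi> x = 0" "C1 \<phi>"
  proof (rule test_functionD[OF t], goal_cases)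
    case (1 K)
    show ?case by (rule 1(1)) (rule 1(2), rule 1(3), rule 1(4), assumption, rule 1(5), assumption, rule 1(6))
  qed
  obtain R where R: "K \<subseteq> cball 0 R" using bounded_subset_ballD[OF compact_imp_bounded[OF K(1)], of 0] ball_subset_cball by blast
  have Cw: "C1 (\<lambda>x. w x $ i)" by (rule C1_component[OF w])
  have out: "x \<notin> K" if "norm x > R" for x using R that by auto
  have "0 = (LINT x|lborel. pd j (\<lambda>x. \<phi> x * w x $ i) x)"
  proof (rule integral_pd_compact_support[OF C1_mult[OF K(5) Cw], symmetric], intro allI impI)
    show "\<phi> x * w x $ i = 0" if "norm x > R" for x unfolding K(3)[OF out[OF that]] by simp
  qed
  also have "\<dots> = (LINT x|lborel. \<phi> x * pd j w x $ i + pd j \<phi> x * w x $ i)"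
    by (simp only: pd_mult[OF K(5) Cw] pd_component[OF w])
  also have "\<dots> = (LINT x|lborel. \<phi> x * pd j w x $ i) + (LINT x|lborel. pd j \<phi> x * w x $ i)"
  proof (rule Bochner_Integration.integral_add)
    show "integrable lborel (\<lambda>x. \<phi> x * pd j w x $ i)"
    proof (rule integrable_lborel_compact_support[of _ R])
      show "continuous_on UNIV (\<lambda>x. \<phi> x * pd j w x $ i)"
        by (intro continuous_intros C1_continuous[OF K(5)] C1_deriv_continuous[OF w])
      show "\<phi> x * pd j w x $ i = 0" if "norm x > R" for x unfolding K(3)[OF out[OF that]] by simp
    qed
    show "integrable lborel (\<lambda>x. pd j \<phi> x * w x $ i)"
    proof (rule integrable_lborel_compact_support[of _ R])
      show "continuous_on UNIV (\<lambda>x. pd j \<phi> x * w x $ i)"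
        by (intro continuous_intros C1_continuous[OF w] C1_deriv_continuous[OF K(5)])
      show "pd j \<phi> x * w x $ i = 0" if "norm x > R" for x unfolding K(4)[OF out[OF that]] by simp
    qed
  qed
  also have "(LINT x|lborel. \<phi> x * pd j w x $ i) = (LINT x|lebesgue. \<phi> x * pd j w x $ i)"
    by (rule integral_completion[symmetric])
       (simp, intro borel_measurable_continuous_onI continuous_intros C1_continuous[OF K(5)] C1_deriv_continuous[OF w])
  also have "(LINT x|lborel. pd j \<phi> x * w x $ i) = (LINT x|lebesgue. pd j \<phi> x * w x $ i)"
    by (rule integral_completion[symmetric])
       (simp, intro borel_measurable_continuous_onI continuous_intros C1_continuous[OF w] C1_deriv_continuous[OF K(5)])
  finally show "(LINT x|lebesgue. pd j \<phi> x * w x $ i) = - (LINT x|lebesgue. \<phi> x * (\<chi> i j. pd j w x $ i) $ i $ j)" by simp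
qed

text \<open>Continuous weights are limits of test functions supported in a common compact set, uniformly, and a
  locally integrable function pairs continuously with those.\<close>

lemma weak_gradient_zero_pairing:
  fixes G :: "real^'n \<Rightarrow> real^'n^'m"
  assumes G: "has_weak_gradient (\<lambda>_. 0) G (ball 0 1)"
    and \<xi>: "continuous_on UNIV \<xi>" "\<And>x. norm x \<ge> r ==> \<xi> x = 0" and r: "r < 1"
  shows "(LINT x|lebesgue. \<xi> x * G x $ i $ j) = 0"
proof -
  \<comment> \<open>Room for the supports of the mollified weights.\<close>
  define e0 where "e0 = (1 - r) / 2"
  have e0: "e0 > 0" "r + e0 < 1" using r by (auto simp: e0_def field_simps)
  let ?K = "cball (0::real^'n) (r + e0)"
  have G': "\<forall>K. compact K \<and> K \<subseteq> ball 0 1 --> G absolutely_integrable_on K"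
    "\<And>\<phi>. test_function (ball 0 1) \<phi> ==> (LINT x|lebesgue. \<phi> x * G x $ i $ j) = 0"
    using G unfolding has_weak_gradient_iff[OF ball_borel] by auto
  have "compact ?K \<and> ?K \<subseteq> ball 0 1" using e0 by auto
  then have "G absolutely_integrable_on ?K" by (rule mp[OF spec[OF G'(1)]])
  then have h: "set_integrable lebesgue ?K (\<lambda>x. G x $ i $ j)" by (intro set_integrable_component)
  let ?N = "LINT x|lebesgue. \<bar>indicator ?K x * G x $ i $ j\<bar>"
  have N: "?N \<ge> 0" by simp
  have bound: "\<bar>LINT x|lebesgue. \<xi> x * G x $ i $ j\<bar> \<le> e * ?N" if e: "0 < e" "e \<le> e0" for e
  proof -
    obtain \<phi> where \<phi>: "smooth_on UNIV \<phi>" "\<And>x. norm x \<ge> r + e ==> \<phi> x = 0" "\<And>x. \<bar>\<phi> x - \<xi> x\<bar> \<le> e"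
    proof (rule mollification_exists[OF \<xi> e(1)])
      fix \<phi> assume "smooth_on UNIV \<phi>" "\<And>x. norm x \<ge> r + e ==> \<phi> x = 0" "\<And>x. \<bar>\<phi> x - \<xi> x\<bar> \<le> e"
      then show thesis by (rule that)
    qed
    have re: "r + e < 1" using e e0 by linarith
    have t: "test_function (ball 0 1) \<phi>" by (rule mollified_is_test_function[OF \<phi>(1,2) re])
    have C\<phi>: "C1 \<phi>" by (rule test_functionD[OF t]) simp
    have c1: "continuous_on UNIV \<phi>" by (rule C1_continuous[OF C\<phi>])
    have c: "continuous_on UNIV (\<lambda>x. \<xi> x - \<phi> x)" by (intro continuous_intros \<xi>(1) c1)
    have z: "\<phi> x = 0" "\<xi> x = 0" if "x \<notin> ?K" for x using that \<phi>(2)[of x] \<xi>(2)[of x] e e0 by auto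
    obtain b1 where b1: "\<And>x. \<bar>\<phi> x\<bar> \<le> b1" using continuous_compact_support_bounded[OF c1 compact_cball z(1)] by metis
    obtain b2 where b2: "\<And>x. \<bar>\<xi> x\<bar> \<le> b2" using continuous_compact_support_bounded[OF \<xi>(1) compact_cball z(2)] by metis
    have "(LINT x|lebesgue. (\<xi> x - \<phi> x) * G x $ i $ j) = (LINT x|lebesgue. \<xi> x * G x $ i $ j) - (LINT x|lebesgue. \<phi> x * G x $ i $ j)"
      unfolding left_diff_distrib
      by (rule Bochner_Integration.integral_diff[OF integrable_mult_supported(1)[OF h \<xi>(1) z(2) b2] integrable_mult_supported(1)[OF h c1 z(1) b1]])
    moreover have "\<bar>LINT x|lebesgue. (\<xi> x - \<phi> x) * G x $ i $ j\<bar> \<le> e * ?N"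
      by (rule integrable_mult_supported(2)[OF h c]) (use z \<phi>(3) in \<open>auto simp: abs_minus_commute\<close>)
    ultimately show ?thesis using G'(2)[OF t] by simp
  qed
  have le: "\<bar>LINT x|lebesgue. \<xi> x * G x $ i $ j\<bar> \<le> 0 + \<epsilon>" if "\<epsilon> > 0" for \<epsilon>
  proof -
    define e where "e = min e0 (\<epsilon> / (?N + 1))"
    have "0 < \<epsilon> / (?N + 1)" by (rule divide_pos_pos[OF that add_nonneg_pos[OF N zero_less_one]])
    then have e: "0 < e" "e \<le> e0" "e \<le> \<epsilon> / (?N + 1)" using e0 unfolding e_def by linarith+
    have "e * ?N \<le> \<epsilon> / (?N + 1) * (?N + 1)" using e N that by (intro mult_mono) auto
    also have "\<dots> = \<epsilon>"
    proof -
      have "?N + 1 \<noteq> 0" using N by linarith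
      then show ?thesis by simp
    qed
    finally show ?thesis using bound[OF e(1,2)] by linarith
  qed
  have "\<bar>LINT x|lebesgue. \<xi> x * G x $ i $ j\<bar> \<le> 0" by (rule field_le_epsilon[OF le])
  then show ?thesis by simp
qed

lemma mult_power_le:
  fixes a b :: real
  assumes "a \<ge> 0" "b \<ge> 0" "n \<ge> 1"
  shows "a * b ^ (n - 1) \<le> 4 ^ n * a ^ n + b ^ n / 4"
proof (cases "4 * a \<le> b")
  case True
  have "a * b ^ (n - 1) \<le> b / 4 * b ^ (n - 1)" using True assms by (intro mult_right_mono) auto
  also have "\<dots> = b ^ n / 4" using assms by (simp add: power_eq_if)
  finally show ?thesis using assms by (smt (verit) mult_nonneg_nonneg zero_le_power)
next
  case False
  have "a * b ^ (n - 1) \<le> (4 * a) * (4 * a) ^ (n - 1)" using False assms by (intro mult_mono power_mono) auto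
  also have "\<dots> = 4 ^ n * a ^ n" using assms by (simp add: power_eq_if[of _ n] power_mult_distrib)
  finally show ?thesis using assms by (smt (verit) divide_nonneg_nonneg zero_le_power)
qed

lemma ennreal_absorb_half:
  assumes "ennreal x \<le> E + ennreal (x / 2)" "x \<ge> 0"
  shows "ennreal x \<le> 2 * E"
proof (cases E rule: ennreal_cases)
  case (real e)
  then have "x \<le> e + x / 2" using assms by (simp add: ennreal_plus[symmetric] ennreal_le_iff del: ennreal_plus)
  then have "ennreal x \<le> ennreal (2 * e)" by (intro ennreal_leI) simp
  then show ?thesis using real by (simp add: ennreal_mult)
qed (simp add: ennreal_mult_eq_top_iff)

text \<open>The energy of \<open>w\<close> is bounded by duality: its partial derivative \<open>g\<close> is paired with
  \<open>\<zeta> g \<bar>g\<bar>\<^sup>n\<^sup>-\<^sup>2\<close> for a cutoff \<open>\<zeta>\<close>, where it may be replaced by any weak gradient of \<open>w\<close>, and Young's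
  inequality absorbs half of the result. The bound holds for every weak gradient, in particular
  for the one that the Sobolev norm chooses.\<close>

lemma partial_power_le_weak_gradients:
  fixes w f1 f2 :: "real^'n \<Rightarrow> real^'m"
  assumes n2: "CARD('n) \<ge> 2" and w: "C1 w" and eq: "\<And>x. norm x < 1 ==> w x = f1 x - f2 x"
    and G1: "has_weak_gradient f1 G1 (ball 0 1)" and G2: "has_weak_gradient f2 G2 (ball 0 1)"
  shows "(\<integral>\<^sup>+x\<in>ball 0 1. ennreal (\<bar>pd j w x $ i\<bar> ^ CARD('n)) \<partial>lborel) \<le>
    ennreal (2 * 4 ^ CARD('n)) * ((\<integral>\<^sup>+x\<in>ball 0 1. ennreal (norm (G1 x) ^ CARD('n)) \<partial>lborel) + (\<integral>\<^sup>+x\<in>ball 0 1. ennreal (norm (G2 x) ^ CARD('n)) \<partial>lborel))"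
    (is "_ \<le> ennreal ?c * (?I1 + ?I2)")
proof -
  let ?n = "CARD('n)"
  define g where "g x = pd j w x $ i" for x
  have cg: "continuous_on UNIV g" unfolding g_def[abs_def] by (intro continuous_intros C1_deriv_continuous[OF w])
  have [measurable]: "g \<in> borel_measurable borel" by (rule borel_measurable_continuous_onI[OF cg])
  have "has_weak_gradient (\<lambda>x. f1 x - f2 x) (\<lambda>x. G1 x - G2 x) (ball 0 1)" by (rule has_weak_gradient_diff[OF ball_borel G1 G2])
  then have "has_weak_gradient w (\<lambda>x. G1 x - G2 x) (ball 0 1)"
    by (subst has_weak_gradient_cong[of _ w "\<lambda>x. f1 x - f2 x"]) (use eq in auto)
  from has_weak_gradient_diff[OF ball_borel has_weak_gradient_C1[OF w ball_borel] this]
  have z: "has_weak_gradient (\<lambda>_. 0) (\<lambda>x. (\<chi> i j. pd j w x $ i) - (G1 x - G2 x)) (ball 0 1)" by simp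
  have inner: "(\<integral>\<^sup>+x\<in>ball 0 \<rho>. ennreal (\<bar>g x\<bar> ^ ?n) \<partial>lborel) \<le> ennreal ?c * (?I1 + ?I2)" if \<rho>: "0 \<le> \<rho>" "\<rho> < 1" for \<rho>
  proof -
    define r where "r = (1 + \<rho>) / 2"
    have r: "\<rho> < r" "r < 1" using \<rho> by (auto simp: r_def)
    let ?K = "cball (0::real^'n) r"
    obtain \<zeta> :: "real^'n \<Rightarrow> real" where \<zeta>: "C1 \<zeta>" "\<And>x. 0 \<le> \<zeta> x" "\<And>x. \<zeta> x \<le> 1" "\<And>x. norm x \<le> \<rho> ==> \<zeta> x = 1" "\<And>x. norm x \<ge> r ==> \<zeta> x = 0"
       using cutoff_exists[OF \<rho>(1) r(1)] by metis
    have c\<zeta>: "continuous_on UNIV \<zeta>" by (rule C1_continuous[OF \<zeta>(1)])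
    have [measurable]: "\<zeta> \<in> borel_measurable borel" by (rule borel_measurable_continuous_onI[OF c\<zeta>])
    define \<xi> where "\<xi> x = \<zeta> x * (g x * \<bar>g x\<bar> ^ (?n - 2))" for x
    have c\<xi>: "continuous_on UNIV \<xi>" unfolding \<xi>_def[abs_def] by (intro continuous_intros c\<zeta> cg)
    have [measurable]: "\<xi> \<in> borel_measurable borel" by (rule borel_measurable_continuous_onI[OF c\<xi>])
    have \<xi>0: "\<xi> x = 0" if "norm x \<ge> r" for x using \<zeta>(5)[OF that] by (simp add: \<xi>_def)
    have \<xi>K: "\<xi> x = 0" if "x \<notin> ?K" for x using that \<xi>0[of x] by simp
    obtain b where b: "\<And>x. \<bar>\<xi> x\<bar> \<le> b" using continuous_compact_support_bounded[OF c\<xi> compact_cball \<xi>K] by metis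
    have pw: "\<bar>z\<bar> ^ ?n = z * z * \<bar>z\<bar> ^ (?n - 2)" "\<bar>z\<bar> ^ (?n - 1) = \<bar>z\<bar> * \<bar>z\<bar> ^ (?n - 2)" for z :: real
    proof -
      obtain m where m: "?n = Suc (Suc m)" using n2 by (metis add_2_eq_Suc le_Suc_ex)
      show "\<bar>z\<bar> ^ ?n = z * z * \<bar>z\<bar> ^ (?n - 2)" "\<bar>z\<bar> ^ (?n - 1) = \<bar>z\<bar> * \<bar>z\<bar> ^ (?n - 2)" unfolding m by simp_all
    qed
    have \<xi>g: "\<xi> x * g x = \<zeta> x * \<bar>g x\<bar> ^ ?n" for x by (simp add: \<xi>_def pw(1) mult_ac)
    have \<xi>g0: "\<xi> x * g x \<ge> 0" for x unfolding \<xi>g by (intro mult_nonneg_nonneg \<zeta>(2) zero_le_power abs_ge_zero)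
    have \<xi>abs: "\<bar>\<xi> x\<bar> = \<zeta> x * \<bar>g x\<bar> ^ (?n - 1)" for x using \<zeta>(2)[of x] unfolding \<xi>_def pw(2) by (simp add: abs_mult power_abs)
    have Kc: "compact ?K \<and> ?K \<subseteq> ball 0 1" using r by auto
    have ai: "G1 absolutely_integrable_on ?K" "G2 absolutely_integrable_on ?K"
      by (rule conjunct2[OF mp[OF spec[OF conjunct1[OF G1[unfolded has_weak_gradient_def]]] Kc]],
          rule conjunct2[OF mp[OF spec[OF conjunct1[OF G2[unfolded has_weak_gradient_def]]] Kc]])
    have hi: "set_integrable lebesgue ?K (\<lambda>x. G1 x $ i $ j)" "set_integrable lebesgue ?K (\<lambda>x. G2 x $ i $ j)"
      using ai by (auto intro!: set_integrable_component)
    have hg: "set_integrable lebesgue ?K g" by (rule continuous_absolutely_integrable[OF cg compact_cball])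
    have I: "integrable lebesgue (\<lambda>x. \<xi> x * G1 x $ i $ j)" "integrable lebesgue (\<lambda>x. \<xi> x * G2 x $ i $ j)" "integrable lebesgue (\<lambda>x. \<xi> x * g x)"
      by (rule integrable_mult_supported(1)[OF hi(1) c\<xi> \<xi>K b], assumption,
          rule integrable_mult_supported(1)[OF hi(2) c\<xi> \<xi>K b], assumption,
          rule integrable_mult_supported(1)[OF hg c\<xi> \<xi>K b])
    have "(LINT x|lebesgue. \<xi> x * g x) = (LINT x|lebesgue. \<xi> x * G1 x $ i $ j) - (LINT x|lebesgue. \<xi> x * G2 x $ i $ j)"
    proof -
      have "0 = (LINT x|lebesgue. \<xi> x * ((\<chi> i j. pd j w x $ i) - (G1 x - G2 x)) $ i $ j)"
        by (rule weak_gradient_zero_pairing[OF z c\<xi> \<xi>0 r(2), symmetric])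
      also have "\<dots> = (LINT x|lebesgue. \<xi> x * g x - (\<xi> x * G1 x $ i $ j - \<xi> x * G2 x $ i $ j))"
        by (simp add: g_def right_diff_distrib)
      also have "\<dots> = (LINT x|lebesgue. \<xi> x * g x) - ((LINT x|lebesgue. \<xi> x * G1 x $ i $ j) - (LINT x|lebesgue. \<xi> x * G2 x $ i $ j))"
        using I by simp
      finally show ?thesis by simp
    qed
    then have le: "ennreal (LINT x|lebesgue. \<xi> x * g x) \<le> ennreal \<bar>LINT x|lebesgue. \<xi> x * G1 x $ i $ j\<bar> + ennreal \<bar>LINT x|lebesgue. \<xi> x * G2 x $ i $ j\<bar>"
      by (simp add: ennreal_plus[symmetric] ennreal_leI del: ennreal_plus)
    define X where "X = (LINT x|lebesgue. \<xi> x * g x)"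
    have X: "(\<integral>\<^sup>+x. ennreal (\<zeta> x * \<bar>g x\<bar> ^ ?n) \<partial>lborel) = ennreal X" "X \<ge> 0"
    proof -
      have "(\<integral>\<^sup>+x. ennreal (\<xi> x * g x) \<partial>lebesgue) = ennreal X"
        unfolding X_def by (rule nn_integral_eq_integral[OF I(3) AE_I2]) (rule \<xi>g0)
      then show "(\<integral>\<^sup>+x. ennreal (\<zeta> x * \<bar>g x\<bar> ^ ?n) \<partial>lborel) = ennreal X" by (simp add: \<xi>g nn_integral_completion)
      show "X \<ge> 0" unfolding X_def by (rule Bochner_Integration.integral_nonneg) (rule \<xi>g0)
    qed
    have one: "ennreal \<bar>LINT x|lebesgue. \<xi> x * G x $ i $ j\<bar> \<le> ennreal (4 ^ ?n) * (\<integral>\<^sup>+x\<in>ball 0 1. ennreal (norm (G x) ^ ?n) \<partial>lborel) + ennreal (X / 4)"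
      if int: "integrable lebesgue (\<lambda>x. \<xi> x * G x $ i $ j)" and aG: "G absolutely_integrable_on ?K" for G :: "real^'n \<Rightarrow> real^'n^'m"
    proof -
      have "(\<lambda>x. indicator ?K x *\<^sub>R G x) \<in> borel_measurable lebesgue"
        by (rule borel_measurable_integrable) (use aG in \<open>simp add: set_integrable_def\<close>)
      then have Gm: "(\<lambda>x. ennreal (norm (indicator ?K x *\<^sub>R G x) ^ ?n)) \<in> borel_measurable lebesgue" by measurable
      have [measurable]: "(\<lambda>x. ennreal (\<zeta> x * \<bar>g x\<bar> ^ ?n)) \<in> borel_measurable lebesgue"
        by (rule measurable_completion) simp
      have "ennreal \<bar>LINT x|lebesgue. \<xi> x * G x $ i $ j\<bar> \<le> (\<integral>\<^sup>+x. ennreal (norm (\<xi> x * G x $ i $ j)) \<partial>lebesgue)"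
        using integral_norm_bound_ennreal[OF int] by simp
      also have "\<dots> \<le> (\<integral>\<^sup>+x. ennreal (4 ^ ?n) * ennreal (norm (indicator ?K x *\<^sub>R G x) ^ ?n) + ennreal (1 / 4) * ennreal (\<zeta> x * \<bar>g x\<bar> ^ ?n) \<partial>lebesgue)"
      proof (rule nn_integral_mono)
        fix x
        show "ennreal (norm (\<xi> x * G x $ i $ j)) \<le> ennreal (4 ^ ?n) * ennreal (norm (indicator ?K x *\<^sub>R G x) ^ ?n) + ennreal (1 / 4) * ennreal (\<zeta> x * \<bar>g x\<bar> ^ ?n)"
        proof (cases "x \<in> ?K")
          case True
          have "\<bar>G x $ i $ j\<bar> \<le> norm (G x)"
            using component_le_norm_cart[of "G x $ i" j] Finite_Cartesian_Product.norm_nth_le[of "G x" i] by linarith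
          then have "\<bar>\<xi> x\<bar> * \<bar>G x $ i $ j\<bar> \<le> \<bar>\<xi> x\<bar> * norm (G x)" by (intro mult_left_mono) auto
          also have "\<dots> = \<zeta> x * (norm (G x) * \<bar>g x\<bar> ^ (?n - 1))" by (simp add: \<xi>abs)
          also have "\<dots> \<le> \<zeta> x * (4 ^ ?n * norm (G x) ^ ?n + \<bar>g x\<bar> ^ ?n / 4)"
            using \<zeta>(2) n2 by (intro mult_left_mono mult_power_le) auto
          also have "\<dots> \<le> 4 ^ ?n * norm (G x) ^ ?n + 1 / 4 * (\<zeta> x * \<bar>g x\<bar> ^ ?n)"
            using mult_right_mono[OF \<zeta>(3)[of x], of "4 ^ ?n * norm (G x) ^ ?n"] by (simp add: distrib_left)
          finally have "norm (\<xi> x * G x $ i $ j) \<le> 4 ^ ?n * norm (G x) ^ ?n + 1 / 4 * (\<zeta> x * \<bar>g x\<bar> ^ ?n)" by (simp add: abs_mult)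
          then have "ennreal (norm (\<xi> x * G x $ i $ j)) \<le> ennreal (4 ^ ?n * norm (G x) ^ ?n + 1 / 4 * (\<zeta> x * \<bar>g x\<bar> ^ ?n))" by (rule ennreal_leI)
          also have "\<dots> = ennreal (4 ^ ?n * norm (G x) ^ ?n) + ennreal (1 / 4 * (\<zeta> x * \<bar>g x\<bar> ^ ?n))"
            by (rule ennreal_plus) (use \<zeta>(2)[of x] in auto)
          also have "\<dots> = ennreal (4 ^ ?n) * ennreal (norm (G x) ^ ?n) + ennreal (1 / 4) * ennreal (\<zeta> x * \<bar>g x\<bar> ^ ?n)"
            using \<zeta>(2)[of x] by (simp only: ennreal_mult zero_le_power mult_nonneg_nonneg norm_ge_zero abs_ge_zero zero_le_numeral zero_le_divide_1_iff)
          finally show ?thesis using True by simp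
        qed (simp add: \<xi>K)
      qed
      also have "\<dots> = ennreal (4 ^ ?n) * (\<integral>\<^sup>+x. ennreal (norm (indicator ?K x *\<^sub>R G x) ^ ?n) \<partial>lebesgue) + ennreal (1 / 4) * (\<integral>\<^sup>+x. ennreal (\<zeta> x * \<bar>g x\<bar> ^ ?n) \<partial>lebesgue)"
        using Gm by (simp add: nn_integral_add nn_integral_cmult)
      also have "\<dots> \<le> ennreal (4 ^ ?n) * (\<integral>\<^sup>+x\<in>ball 0 1. ennreal (norm (G x) ^ ?n) \<partial>lborel) + ennreal (1 / 4) * ennreal X"
        unfolding nn_integral_completion X(1)
      proof (intro add_mono mult_left_mono nn_integral_mono)
        fix x
        show "ennreal (norm (indicator ?K x *\<^sub>R G x) ^ ?n) \<le> ennreal (norm (G x) ^ ?n) * indicator (ball 0 1) x"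
          using r(2) by (auto simp: indicator_def power_0_left)
      qed auto
      also have "ennreal (1 / 4) * ennreal X = ennreal (X / 4)" using X(2) by (simp add: ennreal_mult[symmetric])
      finally show ?thesis .
    qed
    have XX: "ennreal X \<le> ennreal (4 ^ ?n) * (?I1 + ?I2) + ennreal (X / 2)"
    proof -
      have "ennreal X \<le> (ennreal (4 ^ ?n) * ?I1 + ennreal (X / 4)) + (ennreal (4 ^ ?n) * ?I2 + ennreal (X / 4))"
        using le add_mono[OF one[OF I(1) ai(1)] one[OF I(2) ai(2)]] unfolding X_def by (rule order_trans)
      also have "\<dots> = ennreal (4 ^ ?n) * (?I1 + ?I2) + (ennreal (X / 4) + ennreal (X / 4))" by (simp add: distrib_left add_ac)
      also have "ennreal (X / 4) + ennreal (X / 4) = ennreal (X / 2)" using X(2) by (simp add: ennreal_plus[symmetric] del: ennreal_plus)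
      finally show ?thesis .
    qed
    have "ennreal X \<le> ennreal ?c * (?I1 + ?I2)"
    proof -
      have "ennreal X \<le> 2 * (ennreal (4 ^ ?n) * (?I1 + ?I2))" by (rule ennreal_absorb_half[OF XX X(2)])
      also have "\<dots> = (2 * ennreal (4 ^ ?n)) * (?I1 + ?I2)" by (simp only: mult.assoc)
      also have "2 * ennreal (4 ^ ?n) = ennreal ?c" using ennreal_mult[of 2 "4 ^ ?n"] by simp
      finally show ?thesis .
    qed
    moreover have "(\<integral>\<^sup>+x\<in>ball 0 \<rho>. ennreal (\<bar>g x\<bar> ^ ?n) \<partial>lborel) \<le> (\<integral>\<^sup>+x. ennreal (\<zeta> x * \<bar>g x\<bar> ^ ?n) \<partial>lborel)"
      by (rule nn_integral_mono) (use \<zeta>(4) in \<open>auto simp: indicator_def\<close>)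
    ultimately show ?thesis using X(1) by simp
  qed
  define \<rho> where "\<rho> m = 1 - 1 / real (Suc m)" for m
  have \<rho>: "0 \<le> \<rho> m" "\<rho> m < 1" for m by (auto simp: \<rho>_def field_simps)
  have inc: "\<rho> m \<le> \<rho> m'" if "m \<le> m'" for m m' using that by (auto simp: \<rho>_def field_simps)
  have sup: "(SUP m. indicator (ball 0 (\<rho> m)) x) = (indicator (ball (0::real^'n) 1) x :: ennreal)" for x
  proof (cases "norm x < 1")
    case True
    obtain m where "inverse (real (Suc m)) < 1 - norm x" using reals_Archimedean[of "1 - norm x"] True by auto
    then have xm: "x \<in> ball 0 (\<rho> m)" unfolding \<rho>_def inverse_eq_divide mem_ball_0 by linarith
    have "(indicator (ball 0 (\<rho> m)) x :: ennreal) \<le> (SUP m. indicator (ball 0 (\<rho> m)) x)" by (rule SUP_upper) simp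
    then have "1 \<le> (SUP m. (indicator (ball 0 (\<rho> m)) x :: ennreal))" unfolding indicator_simps(1)[OF xm] .
    moreover have "(SUP m. indicator (ball 0 (\<rho> m)) x) \<le> (1::ennreal)" by (rule SUP_least) (auto simp: indicator_def)
    ultimately have "(SUP m. indicator (ball 0 (\<rho> m)) x) = (1::ennreal)" by (rule antisym[rotated])
    then show ?thesis using True by simp
  next
    case False
    then have "x \<notin> ball 0 (\<rho> m)" for m using \<rho>(2)[of m] by auto
    then show ?thesis using False by simp
  qed
  have "(\<integral>\<^sup>+x\<in>ball 0 1. ennreal (\<bar>g x\<bar> ^ ?n) \<partial>lborel) = (\<integral>\<^sup>+x. (SUP m. ennreal (\<bar>g x\<bar> ^ ?n) * indicator (ball 0 (\<rho> m)) x) \<partial>lborel)"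
    unfolding sup[symmetric] by (simp add: SUP_mult_left_ennreal)
  also have "\<dots> = (SUP m. \<integral>\<^sup>+x. ennreal (\<bar>g x\<bar> ^ ?n) * indicator (ball 0 (\<rho> m)) x \<partial>lborel)"
  proof (rule nn_integral_monotone_convergence_SUP)
    show "incseq (\<lambda>m x. ennreal (\<bar>g x\<bar> ^ ?n) * indicator (ball 0 (\<rho> m)) x)"
      using inc by (auto simp: incseq_def le_fun_def indicator_def intro: order_less_le_trans)
  qed simp
  also have "\<dots> \<le> ennreal ?c * (?I1 + ?I2)" by (rule SUP_least) (rule inner[OF \<rho>])
  finally show ?thesis by (simp add: g_def)
qed

lemma gradient_power_le_weak_gradients:
  fixes w f1 f2 :: "real^'n \<Rightarrow> real^'m"
  assumes n2: "CARD('n) \<ge> 2" and w: "C1 w" and eq: "\<And>x. norm x < 1 ==> w x = f1 x - f2 x"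
    and G1: "has_weak_gradient f1 G1 (ball 0 1)" and G2: "has_weak_gradient f2 G2 (ball 0 1)"
  shows "(\<integral>\<^sup>+x\<in>ball 0 1. ennreal ((\<Sum>\<alpha>\<in>UNIV. norm (pd \<alpha> w x)) powr real CARD('n)) \<partial>lborel) \<le>
    ennreal ((real CARD('n) * real CARD('m)) ^ Suc CARD('n) * (2 * 4 ^ CARD('n))) *
    ((\<integral>\<^sup>+x\<in>ball 0 1. ennreal (norm (G1 x) powr real CARD('n)) \<partial>lborel) + (\<integral>\<^sup>+x\<in>ball 0 1. ennreal (norm (G2 x) powr real CARD('n)) \<partial>lborel))"
proof -
  let ?n = "CARD('n)" and ?N = "real CARD('n) * real CARD('m)"
  let ?S = "UNIV \<times> UNIV :: ('n \<times> 'm) set"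
  have pn: "z powr real ?n = z ^ ?n" if "z \<ge> 0" for z :: real using that by (simp add: powr_realpow')
  have [measurable]: "(\<lambda>x. pd \<alpha> w x $ i) \<in> borel_measurable borel" for \<alpha> i
    by (intro borel_measurable_continuous_onI continuous_intros C1_deriv_continuous[OF w])
  have pt: "(\<Sum>\<alpha>\<in>UNIV. norm (pd \<alpha> w x)) powr real ?n \<le> ?N ^ ?n * (\<Sum>q\<in>?S. \<bar>pd (fst q) w x $ snd q\<bar> ^ ?n)" for x
  proof -
    define a where "a q = \<bar>pd (fst q) w x $ snd q\<bar>" for q
    have "(\<Sum>\<alpha>\<in>UNIV. norm (pd \<alpha> w x)) \<le> (\<Sum>\<alpha>\<in>UNIV. \<Sum>i\<in>UNIV. a (\<alpha>, i))"
      unfolding a_def fst_conv snd_conv by (intro sum_mono norm_le_l1_cart)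
    also have "\<dots> = (\<Sum>q\<in>?S. a q)" by (simp add: sum.cartesian_product)
    also have "\<dots> \<le> (\<Sum>q\<in>?S. Max (a ` ?S))" by (intro sum_mono Max_ge) auto
    also have "\<dots> = ?N * Max (a ` ?S)" by (simp add: card_cartesian_product)
    finally have "(\<Sum>\<alpha>\<in>UNIV. norm (pd \<alpha> w x)) ^ ?n \<le> (?N * Max (a ` ?S)) ^ ?n"
      by (intro power_mono sum_nonneg) auto
    moreover obtain q where q: "q \<in> ?S" "Max (a ` ?S) = a q"
    proof -
      have "Max (a ` ?S) \<in> a ` ?S" by (rule Max_in) auto
      then show thesis using that by (elim imageE)
    qed
    moreover have "a q ^ ?n \<le> (\<Sum>q\<in>?S. a q ^ ?n)" using q by (intro member_le_sum) (auto simp: a_def)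
    ultimately have "(\<Sum>\<alpha>\<in>UNIV. norm (pd \<alpha> w x)) ^ ?n \<le> ?N ^ ?n * (\<Sum>q\<in>?S. a q ^ ?n)"
      by (smt (verit, best) mult_left_mono power_mult_distrib zero_le_power of_nat_0_le_iff mult_nonneg_nonneg)
    then show ?thesis by (subst pn) (auto simp: a_def intro: sum_nonneg)
  qed
  let ?R = "(\<integral>\<^sup>+x\<in>ball 0 1. ennreal (norm (G1 x) ^ ?n) \<partial>lborel) + (\<integral>\<^sup>+x\<in>ball 0 1. ennreal (norm (G2 x) ^ ?n) \<partial>lborel)"
  have "(\<integral>\<^sup>+x\<in>ball 0 1. ennreal ((\<Sum>\<alpha>\<in>UNIV. norm (pd \<alpha> w x)) powr real ?n) \<partial>lborel)
    \<le> (\<integral>\<^sup>+x. ennreal (?N ^ ?n) * (\<Sum>q\<in>?S. ennreal (\<bar>pd (fst q) w x $ snd q\<bar> ^ ?n) * indicator (ball 0 1) x) \<partial>lborel)"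
  proof (rule nn_integral_mono)
    fix x
    have "ennreal ((\<Sum>\<alpha>\<in>UNIV. norm (pd \<alpha> w x)) powr real ?n) \<le> ennreal (?N ^ ?n * (\<Sum>q\<in>?S. \<bar>pd (fst q) w x $ snd q\<bar> ^ ?n))"
      by (rule ennreal_leI[OF pt])
    also have "\<dots> = ennreal (?N ^ ?n) * (\<Sum>q\<in>?S. ennreal (\<bar>pd (fst q) w x $ snd q\<bar> ^ ?n))"
      by (subst ennreal_mult) (auto intro: sum_nonneg simp: sum_ennreal)
    finally show "ennreal ((\<Sum>\<alpha>\<in>UNIV. norm (pd \<alpha> w x)) powr real ?n) * indicator (ball 0 1) x \<le>
      ennreal (?N ^ ?n) * (\<Sum>q\<in>?S. ennreal (\<bar>pd (fst q) w x $ snd q\<bar> ^ ?n) * indicator (ball 0 1) x)"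
      by (auto simp: indicator_def)
  qed
  also have "\<dots> = ennreal (?N ^ ?n) * (\<Sum>q\<in>?S. \<integral>\<^sup>+x\<in>ball 0 1. ennreal (\<bar>pd (fst q) w x $ snd q\<bar> ^ ?n) \<partial>lborel)"
    by (subst nn_integral_cmult, measurable, subst nn_integral_sum, measurable)
  also have "\<dots> \<le> ennreal (?N ^ ?n) * (\<Sum>q\<in>?S. ennreal (2 * 4 ^ ?n) * ?R)"
    by (intro mult_left_mono sum_mono partial_power_le_weak_gradients[OF n2 w eq G1 G2]) auto
  also have "\<dots> = (ennreal (?N ^ ?n) * ennreal ?N * ennreal (2 * 4 ^ ?n)) * ?R"
    by (simp add: card_cartesian_product ennreal_of_nat_eq_real_of_nat ennreal_mult mult_ac)
  also have "ennreal (?N ^ ?n) * ennreal ?N * ennreal (2 * 4 ^ ?n) = ennreal (?N ^ Suc ?n * (2 * 4 ^ ?n))"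
    by (simp add: ennreal_mult[symmetric] mult_ac)
  finally show ?thesis by (simp only: pn norm_ge_zero)
qed

section \<open>From Sobolev convergence to the contradiction\<close>

lemma add_tendsto_0_ennreal:
  fixes a b :: "nat \<Rightarrow> ennreal"
  assumes "(\<lambda>k. a k + b k) \<longlonglongrightarrow> 0"
  shows "a \<longlonglongrightarrow> 0" "b \<longlonglongrightarrow> 0"
  by (rule tendsto_sandwich[OF _ _ tendsto_const assms], simp, simp add: add_increasing2)
     (rule tendsto_sandwich[OF _ _ tendsto_const assms], simp, simp add: add_increasing)

lemma sobolev_limit_cauchy:
  fixes w :: "nat \<Rightarrow> real^'n \<Rightarrow> real^'m"
  assumes n2: "CARD('n) \<ge> 2" and s: "0 < s" "s \<le> 1" "s \<noteq> 1 ==> s * p = real CARD('n)" "s = 1 ==> p = real CARD('n)"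
    and p: "p \<ge> 1" and w: "\<And>k. C1 (w k)" and vw: "\<And>k x. norm x < 1 ==> w k x = v k x"
    and u: "u \<in> sobolev_space s p (ball 0 1)"
    and lim: "(\<lambda>k. sobolev_norm s p (ball 0 1) (\<lambda>x. v k x - u x)) \<longlonglongrightarrow> 0"
  shows "e > 0 ==> \<exists>K. \<forall>k\<ge>K. \<forall>l\<ge>K. (\<integral>\<^sup>+x\<in>ball 0 1. ennreal (norm (w k x - w l x)) \<partial>lborel) \<le> ennreal e"
    and "e > 0 ==> \<exists>K. \<forall>k\<ge>K. \<forall>t. 0 < t \<and> t \<le> 1/4 -->
      Osc p t (\<lambda>x. w k x - w K x) (ball 0 1) \<le> ennreal (e * t ^ (2 * CARD('n)))"
proof -
  let ?n = "CARD('n)" and ?B = "ball (0::real^'n) 1"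
  have um: "u \<in> borel_measurable (lebesgue_on ?B)" using u by (simp add: sobolev_space_def Lp_space_def)
  obtain u' where u': "u' \<in> borel_measurable borel" "AE x in lborel. x \<in> ?B --> u x = u' x"
  proof (rule borel_representative[OF um ball_borel], goal_cases)
    case (1 u')
    show ?case by (rule 1(1)) (rule 1(2), rule 1(3))
  qed
  have wm: "w k \<in> borel_measurable borel" for k by (rule borel_measurable_continuous_onI[OF C1_continuous[OF w]])
  have dm: "(\<lambda>x. w k x - u' x) \<in> borel_measurable borel" for k using wm u'(1) by (intro borel_measurable_diff)
  have p0: "p > 0" using p by simp
  note lims = add_tendsto_0_ennreal[OF lim[unfolded sobolev_norm_def]]
  have Lp: "Lp_norm (lebesgue_on ?B) p (\<lambda>x. v k x - u x) = ennroot p (\<integral>\<^sup>+x\<in>?B. ennreal (norm (w k x - u' x) powr p) \<partial>lborel)" for k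
  proof -
    have "(\<integral>\<^sup>+x\<in>?B. ennreal (norm (v k x - u x) powr p) \<partial>lborel) = (\<integral>\<^sup>+x\<in>?B. ennreal (norm (w k x - u' x) powr p) \<partial>lborel)"
      by (rule nn_integral_cong_AE, use u'(2) in eventually_elim) (auto simp: indicator_def vw)
    then show ?thesis by (simp add: Lp_norm_def nn_integral_lebesgue_on[OF ball_borel])
  qed
  have e\<mu>: "emeasure lborel ?B = ennreal (unit_ball_vol (real ?n))" by (simp add: emeasure_ball)
  have \<mu>: "unit_ball_vol (real ?n) > 0" by (rule unit_ball_vol_pos) simp
  show "\<exists>K. \<forall>k\<ge>K. \<forall>l\<ge>K. (\<integral>\<^sup>+x\<in>?B. ennreal (norm (w k x - w l x)) \<partial>lborel) \<le> ennreal e" if e: "e > 0"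
  proof -
    obtain e' where e': "e' > 0" and L1: "\<And>g. g \<in> borel_measurable borel ==> (\<And>x. g x \<ge> 0) ==>
      (\<integral>\<^sup>+x\<in>?B. ennreal (g x powr p) \<partial>lborel) \<le> ennreal e' ==> (\<integral>\<^sup>+x\<in>?B. ennreal (g x) \<partial>lborel) \<le> ennreal e"
    proof (rule L1_bound_from_Lp[OF ball_borel e\<mu> \<mu> p e], goal_cases)
      case (1 e')
      show ?case by (rule 1(1)[OF 1(2)]) (rule 1(3))
    qed
    define c where "c = e' / (2 * 2 powr p)"
    have c: "c > 0" "2 powr p * (c + c) = e'" using e' by (auto simp: c_def)
    obtain K where K: "\<forall>k\<ge>K. (\<integral>\<^sup>+x\<in>?B. ennreal (norm (w k x - u' x) powr p) \<partial>lborel) \<le> ennreal c"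
      using ennroot_tendsto_0[OF lims(1)[unfolded Lp] p0 c(1)] by blast
    have "(\<integral>\<^sup>+x\<in>?B. ennreal (norm (w k x - w l x)) \<partial>lborel) \<le> ennreal e" if kl: "k \<ge> K" "l \<ge> K" for k l
    proof (rule L1)
      note wm[of k, measurable] wm[of l, measurable]
      show "(\<lambda>x. norm (w k x - w l x)) \<in> borel_measurable borel" by measurable
      have "(\<integral>\<^sup>+x\<in>?B. ennreal (norm (w k x - w l x) powr p) \<partial>lborel) \<le>
        (\<integral>\<^sup>+x. ennreal (2 powr p) * (ennreal (norm (w k x - u' x) powr p) * indicator ?B x + ennreal (norm (w l x - u' x) powr p) * indicator ?B x) \<partial>lborel)"
      proof (rule nn_integral_mono)
        fix x
        have "norm (w k x - w l x) powr p \<le> 2 powr p * (norm (w k x - u' x) powr p + norm (w l x - u' x) powr p)"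
          using powr_norm_add_le[OF p, of "w k x - u' x" "- (w l x - u' x)"] by (simp add: norm_minus_commute)
        then have "ennreal (norm (w k x - w l x) powr p) \<le> ennreal (2 powr p) * (ennreal (norm (w k x - u' x) powr p) + ennreal (norm (w l x - u' x) powr p))"
          by (simp add: ennreal_mult[symmetric] ennreal_plus[symmetric] ennreal_leI del: ennreal_plus)
        then show "ennreal (norm (w k x - w l x) powr p) * indicator ?B x \<le> ennreal (2 powr p) * (ennreal (norm (w k x - u' x) powr p) * indicator ?B x + ennreal (norm (w l x - u' x) powr p) * indicator ?B x)"
          by (auto simp: indicator_def)
      qed
      also have "\<dots> = ennreal (2 powr p) * ((\<integral>\<^sup>+x\<in>?B. ennreal (norm (w k x - u' x) powr p) \<partial>lborel) + (\<integral>\<^sup>+x\<in>?B. ennreal (norm (w l x - u' x) powr p) \<partial>lborel))"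
      proof -
        note dm[of k, measurable] dm[of l, measurable]
        show ?thesis by (subst nn_integral_cmult, measurable, subst nn_integral_add, measurable)
      qed
      also have "\<dots> \<le> ennreal (2 powr p) * (ennreal c + ennreal c)"
        by (intro mult_left_mono add_mono K[rule_format] kl) simp
      also have "\<dots> = ennreal e'" using c by (simp add: ennreal_mult[symmetric] ennreal_plus[symmetric] del: ennreal_plus)
      finally show "(\<integral>\<^sup>+x\<in>?B. ennreal (norm (w k x - w l x) powr p) \<partial>lborel) \<le> ennreal e'" .
    qed simp
    then show ?thesis by blast
  qed
  show "\<exists>K. \<forall>k\<ge>K. \<forall>t. 0 < t \<and> t \<le> 1/4 -->
      Osc p t (\<lambda>x. w k x - w K x) ?B \<le> ennreal (e * t ^ (2 * ?n))" if e: "e > 0"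
  proof (cases "s = 1")
    case False
    have sp: "s * p = real ?n" by (rule s(3)[OF False])
    have pow: "(6 * t) powr (real ?n + s * p) = 6 ^ (2 * ?n) * t ^ (2 * ?n)" if "t > 0" for t :: real
    proof -
      have "(6 * t) powr (real ?n + s * p) = (6 * t) powr real (2 * ?n)" by (simp add: sp)
      also have "\<dots> = (6 * t) ^ (2 * ?n)" using that by (subst powr_realpow) auto
      finally show ?thesis by (simp add: power_mult_distrib)
    qed
    have G: "gagliardo_seminorm s p ?B (\<lambda>x. v k x - u x) = ennroot p (gagliardo p (real ?n + s * p) (\<lambda>x. w k x - u' x))" for k
    proof -
      have "AE x in lborel. x \<in> ?B --> v k x - u x = w k x - u' x" using u'(2) by eventually_elim (simp add: vw)
      then show ?thesis unfolding gagliardo_seminorm_ball by (intro arg_cong[where f = "ennroot p"] gagliardo_cong_AE)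
    qed
    define c where "c = e / (2 * 2 powr p * 6 ^ (2 * ?n))"
    have c: "c > 0" "6 ^ (2 * ?n) * (2 powr p * (c + c)) = e" using e by (auto simp: c_def)
    obtain K where K: "\<forall>k\<ge>K. gagliardo p (real ?n + s * p) (\<lambda>x. w k x - u' x) \<le> ennreal c"
      using ennroot_tendsto_0[OF lims(2)[unfolded if_not_P[OF False] G] p0 c(1)] by blast
    have "Osc p t (\<lambda>x. w k x - w K x) ?B \<le> ennreal (e * t ^ (2 * ?n))" if k: "k \<ge> K" and t: "0 < t" for k t
    proof -
      have "Osc p t (\<lambda>x. w k x - w K x) ?B \<le> ennreal ((6 * t) powr (real ?n + s * p)) * gagliardo p (real ?n + s * p) (\<lambda>x. w k x - w K x)"
        by (rule Osc_le_gagliardo[OF C1_continuous[OF C1_diff[OF w w]] p0 _ t]) (simp add: sp)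
      also have "gagliardo p (real ?n + s * p) (\<lambda>x. w k x - w K x) = gagliardo p (real ?n + s * p) (\<lambda>x. (w k x - u' x) - (w K x - u' x))" by simp
      also have "\<dots> \<le> ennreal (2 powr p) * (gagliardo p (real ?n + s * p) (\<lambda>x. w k x - u' x) + gagliardo p (real ?n + s * p) (\<lambda>x. w K x - u' x))"
        by (rule gagliardo_diff_le[OF p dm dm])
      also have "\<dots> \<le> ennreal (2 powr p) * (ennreal c + ennreal c)"
        by (intro mult_left_mono add_mono K[rule_format] k) auto
      also have "\<dots> = ennreal (2 powr p * (c + c))" using c(1) by (simp add: ennreal_mult[symmetric] ennreal_plus[symmetric] del: ennreal_plus)
      finally have "Osc p t (\<lambda>x. w k x - w K x) ?B \<le> ennreal ((6 * t) powr (real ?n + s * p)) * ennreal (2 powr p * (c + c))"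
        by (simp add: mult_left_mono)
      also have "\<dots> = ennreal ((6 ^ (2 * ?n) * (2 powr p * (c + c))) * t ^ (2 * ?n))"
        unfolding pow[OF t] using c(1) t by (simp add: ennreal_mult[symmetric] mult_ac)
      finally show ?thesis unfolding c(2) .
    qed
    then show ?thesis by blast
  next
    case True
    have pn: "p = real ?n" by (rule s(4)[OF True])
    obtain G where G: "has_weak_gradient u G ?B" using u True by (auto simp: sobolev_space_def)
    define H where "H k = weak_gradient (\<lambda>x. v k x - u x) ?B" for k
    have H: "has_weak_gradient (\<lambda>x. v k x - u x) (H k) ?B" for k
    proof -
      have "has_weak_gradient (\<lambda>x. w k x - u x) (\<lambda>x. (\<chi> i j. pd j (w k) x $ i) - G x) ?B"
        by (rule has_weak_gradient_diff[OF ball_borel has_weak_gradient_C1[OF w ball_borel] G])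
      then have "has_weak_gradient (\<lambda>x. v k x - u x) (\<lambda>x. (\<chi> i j. pd j (w k) x $ i) - G x) ?B"
        by (subst has_weak_gradient_cong[of _ "\<lambda>x. v k x - u x" "\<lambda>x. w k x - u x"]) (auto simp: vw)
      then show ?thesis unfolding H_def weak_gradient_def
        by (rule someI[of "\<lambda>G. has_weak_gradient (\<lambda>x. v k x - u x) G ?B"])
    qed
    have LpH: "Lp_norm (lebesgue_on ?B) p (weak_gradient (\<lambda>x. v k x - u x) ?B) = ennroot p (\<integral>\<^sup>+x\<in>?B. ennreal (norm (H k x) powr p) \<partial>lborel)" for k
      by (simp add: Lp_norm_def nn_integral_lebesgue_on[OF ball_borel] H_def)
    define c1 where "c1 = (real ?n * real CARD('m)) ^ Suc ?n * (2 * 4 ^ ?n)"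
    have "c1 > 0" unfolding c1_def by (intro mult_pos_pos zero_less_power) (auto simp: card_gt_0_iff)
    define c2 where "c2 = 12 ^ ?n * (unit_ball_vol (real ?n) * 6 ^ ?n)"
    have "c2 > 0" unfolding c2_def using \<mu> by (intro mult_pos_pos) auto
    define c where "c = e / (2 * c1 * c2)"
    have c: "c > 0" "c2 * (c1 * (c + c)) = e" using e \<open>c1 > 0\<close> \<open>c2 > 0\<close> by (auto simp: c_def)
    have pow: "(12 * t) powr p * (unit_ball_vol (real ?n) * (6 * t) ^ ?n) = c2 * t ^ (2 * ?n)" if "t > 0" for t :: real
    proof -
      have "(12 * t) powr p = (12 * t) ^ ?n" unfolding pn using that by (subst powr_realpow) auto
      moreover have "t ^ (2 * ?n) = t ^ ?n * t ^ ?n" by (simp add: mult_2 power_add)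
      ultimately show ?thesis by (simp only: c2_def power_mult_distrib mult_ac)
    qed
    obtain K where K: "\<forall>k\<ge>K. (\<integral>\<^sup>+x\<in>?B. ennreal (norm (H k x) powr p) \<partial>lborel) \<le> ennreal c"
      using ennroot_tendsto_0[OF lims(2)[unfolded if_P[OF True] LpH] p0 c(1)] by blast
    have "Osc p t (\<lambda>x. w k x - w K x) ?B \<le> ennreal (e * t ^ (2 * ?n))" if k: "k \<ge> K" and t: "0 < t" for k t
    proof -
      have "Osc p t (\<lambda>x. w k x - w K x) ?B \<le> ennreal ((12 * t) powr p * (unit_ball_vol (real ?n) * (6 * t) ^ ?n)) *
        (\<integral>\<^sup>+x\<in>?B. ennreal ((\<Sum>\<alpha>\<in>UNIV. norm (pd \<alpha> (\<lambda>x. w k x - w K x) x)) powr p) \<partial>lborel)"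
        by (rule Osc_le_gradient[OF C1_diff[OF w w] p t])
      also have "(\<integral>\<^sup>+x\<in>?B. ennreal ((\<Sum>\<alpha>\<in>UNIV. norm (pd \<alpha> (\<lambda>x. w k x - w K x) x)) powr p) \<partial>lborel) \<le>
        ennreal c1 * ((\<integral>\<^sup>+x\<in>?B. ennreal (norm (H k x) powr p) \<partial>lborel) + (\<integral>\<^sup>+x\<in>?B. ennreal (norm (H K x) powr p) \<partial>lborel))"
        unfolding pn c1_def
        by (rule gradient_power_le_weak_gradients[OF n2 C1_diff[OF w w] _ H H]) (simp add: vw)
      also have "\<dots> \<le> ennreal c1 * (ennreal c + ennreal c)"
        by (intro mult_left_mono add_mono K[rule_format] k) auto
      also have "\<dots> = ennreal (c1 * (c + c))" using c(1) \<open>c1 > 0\<close> by (simp add: ennreal_mult[symmetric] ennreal_plus[symmetric] del: ennreal_plus)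
      finally have "Osc p t (\<lambda>x. w k x - w K x) ?B \<le> ennreal ((12 * t) powr p * (unit_ball_vol (real ?n) * (6 * t) ^ ?n)) * ennreal (c1 * (c + c))"
        by (simp add: mult_left_mono)
      also have "\<dots> = ennreal ((c2 * (c1 * (c + c))) * t ^ (2 * ?n))"
        unfolding pow[OF t] using c(1) \<open>c1 > 0\<close> \<open>c2 > 0\<close> t by (simp add: ennreal_mult[symmetric] mult_ac)
      finally show ?thesis unfolding c(2) .
    qed
    then show ?thesis by blast
  qed
qed

lemma trace_limit:
  fixes v :: "nat \<Rightarrow> real^'n \<Rightarrow> real^'m"
  assumes v: "\<And>k. continuous_on (sphere 0 1) (v k)" and f: "continuous_on (sphere 0 1) f"
    and vm: "\<And>k. (\<lambda>x. v k (sgn x)) \<in> borel_measurable borel" and fm: "(\<lambda>x. f (sgn x)) \<in> borel_measurable borel"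
    and p: "p \<ge> 1" and lim: "(\<lambda>k. Lp_norm sphere_measure p (\<lambda>x. v k x - f x)) \<longlonglongrightarrow> 0" and e: "e > 0"
  shows "\<exists>K. \<forall>k\<ge>K. (\<integral>\<^sup>+x\<in>ball 0 1 - {0}. ennreal \<bar>v k (sgn x) $ i - f (sgn x) $ i\<bar> \<partial>lborel) \<le> ennreal e"
proof -
  let ?n = "CARD('n)" and ?A = "ball (0::real^'n) 1 - {0}"
  have eA: "emeasure lborel ?A = ennreal (unit_ball_vol (real ?n))"
    by (subst emeasure_Diff) (auto simp: emeasure_ball)
  have \<mu>: "unit_ball_vol (real ?n) > 0" by (rule unit_ball_vol_pos) simp
  have Am: "?A \<in> sets borel" by simp
  obtain e' where e': "e' > 0" and L1: "\<And>g. g \<in> borel_measurable borel ==> (\<And>x. g x \<ge> 0) ==>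
      (\<integral>\<^sup>+x\<in>?A. ennreal (g x powr p) \<partial>lborel) \<le> ennreal e' ==> (\<integral>\<^sup>+x\<in>?A. ennreal (g x) \<partial>lborel) \<le> ennreal e"
  proof (rule L1_bound_from_Lp[OF Am eA \<mu> p e], goal_cases)
    case (1 e')
    show ?case by (rule 1(1)[OF 1(2)]) (rule 1(3))
  qed
  have p0: "p > 0" using p by simp
  obtain K where K: "\<forall>k\<ge>K. (\<integral>\<^sup>+x. ennreal (norm (v k x - f x) powr p) \<partial>sphere_measure) \<le> ennreal e'"
    using ennroot_tendsto_0[OF lim[unfolded Lp_norm_def] p0 e'] by blast
  have "(\<integral>\<^sup>+x\<in>?A. ennreal \<bar>v k (sgn x) $ i - f (sgn x) $ i\<bar> \<partial>lborel) \<le> ennreal e" if k: "k \<ge> K" for k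
  proof -
    let ?J = "\<integral>\<^sup>+x\<in>?A. ennreal (norm (v k (sgn x) - f (sgn x)) powr p) \<partial>lborel"
    have "1 * ?J \<le> of_nat ?n * ?J"
    proof (rule mult_right_mono)
      have "(1::ennreal) = of_nat 1" by simp
      also have "\<dots> \<le> of_nat ?n" by (rule of_nat_mono) (simp add: Suc_leI)
      finally show "(1::ennreal) \<le> of_nat ?n" .
    qed simp
    also have "\<dots> = (\<integral>\<^sup>+x. ennreal (norm (v k x - f x) powr p) \<partial>sphere_measure)"
      by (rule nn_integral_sphere_measure[symmetric]) (intro continuous_intros v f)
    also have "\<dots> \<le> ennreal e'" using K k by blast
    finally have "?J \<le> ennreal e'" by simp
    moreover note vm[of k, measurable] fm[measurable]
    have "(\<lambda>x. norm (v k (sgn x) - f (sgn x))) \<in> borel_measurable borel" by measurable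
    ultimately have "(\<integral>\<^sup>+x\<in>?A. ennreal (norm (v k (sgn x) - f (sgn x))) \<partial>lborel) \<le> ennreal e"
      by (intro L1) auto
    moreover have "(\<integral>\<^sup>+x\<in>?A. ennreal \<bar>v k (sgn x) $ i - f (sgn x) $ i\<bar> \<partial>lborel) \<le> (\<integral>\<^sup>+x\<in>?A. ennreal (norm (v k (sgn x) - f (sgn x))) \<partial>lborel)"
    proof (intro nn_integral_mono mult_right_mono ennreal_leI)
      show "\<bar>v k (sgn x) $ i - f (sgn x) $ i\<bar> \<le> norm (v k (sgn x) - f (sgn x))" for x
        using component_le_norm_cart[of "v k (sgn x) - f (sgn x)" i] by simp
    qed simp
    ultimately show ?thesis by (rule order_trans[rotated])
  qed
  then show ?thesis by blast
qed

lemma radial_extension_measurable: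
  fixes f :: "'a::euclidean_space \<Rightarrow> 'b::euclidean_space"
  assumes "continuous_on (sphere 0 1) f"
  shows "(\<lambda>x. f (sgn x)) \<in> borel_measurable borel"
proof (rule borel_measurable_continuous_countable_exceptions)
  show "countable {0::'a}" by simp
  have "continuous_on (- {0}) (sgn :: 'a \<Rightarrow> 'a)" by (auto intro!: continuous_intros)
  then show "continuous_on (- {0}) (\<lambda>x. f (sgn x))"
    by (rule continuous_on_compose2[OF assms]) (auto simp: norm_sgn split: if_splits)
qed

text \<open>The rank condition speaks of families indexed by \<open>\<epsilon> > 0\<close>. A sequence becomes such a family by
  taking its member of index \<open>\<lceil>1/\<epsilon>\<rceil>\<close>, and is recovered along \<open>\<epsilon> = 1 / k\<close>.\<close>

lemma rank_limit_along_sequence: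
  assumes rank: "distributional_rank_less s p u" and g: "strict_mono g" and \<phi>: "test_function (ball 0 1) \<phi>"
    and v: "\<And>k::nat. smooth_up_to_boundary (ball 0 1) (v k)"
    and lim: "(\<lambda>k. sobolev_norm s p (ball 0 1) (\<lambda>x. v k x - u x)) \<longlonglongrightarrow> 0"
  shows "(\<lambda>k. LINT x|lebesgue_on (ball 0 1). pullback_coeff (v k) g x * \<phi> x) \<longlonglongrightarrow> 0"
proof -
  define j where "j \<epsilon> = nat \<lceil>1 / \<epsilon>\<rceil>" for \<epsilon> :: real
  have j: "filterlim j sequentially (at_right 0)"
    unfolding filterlim_at_top
  proof
    fix Z :: nat
    have "0 < 1 / (real Z + 1)" by simp
    then have "eventually (\<lambda>\<epsilon>. \<epsilon> \<in> {0<..<1 / (real Z + 1)}) (at_right 0)" by (rule eventually_at_right_real)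
    then show "eventually (\<lambda>\<epsilon>. Z \<le> j \<epsilon>) (at_right 0)"
    proof eventually_elim
      case (elim \<epsilon>)
      then have "real Z + 1 \<le> 1 / \<epsilon>" by (simp add: field_simps)
      then have "int Z \<le> \<lceil>1 / \<epsilon>\<rceil>" by linarith
      then show ?case by (simp add: j_def le_nat_iff)
    qed
  qed
  have "((\<lambda>\<epsilon>. LINT x|lebesgue_on (ball 0 1). pullback_coeff (v (j \<epsilon>)) g x * \<phi> x) \<longlongrightarrow> 0) (at_right 0)"
    using rank[unfolded distributional_rank_less_def, rule_format, OF g, of \<phi> "\<lambda>\<epsilon>. v (j \<epsilon>)"]
      \<phi> v filterlim_compose[OF lim j] by simp
  moreover have "filterlim (\<lambda>k. inverse (real (Suc k))) (at_right 0) sequentially"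
    unfolding filterlim_at using LIMSEQ_inverse_real_of_nat by simp
  ultimately have "(\<lambda>k. LINT x|lebesgue_on (ball 0 1). pullback_coeff (v (j (inverse (real (Suc k))))) g x * \<phi> x) \<longlonglongrightarrow> 0"
    by (rule filterlim_compose)
  moreover have "j (inverse (real (Suc k))) = Suc k" for k
  proof -
    have "1 / inverse (real (Suc k)) = of_int (int (Suc k))" by (simp add: field_simps)
    then show ?thesis unfolding j_def by (simp only: ceiling_of_int nat_int)
  qed
  ultimately show ?thesis by (simp add: filterlim_sequentially_Suc[of "\<lambda>k. LINT x|lebesgue_on (ball 0 1). pullback_coeff (v k) g x * \<phi> x"])
qed

lemma integral_pullback_coeff:
  fixes v w :: "real^'n \<Rightarrow> real^'m"
  assumes w: "C1 w" and vw: "\<And>x. norm x < 1 ==> w x = v x" and \<phi>: "test_function (ball 0 1) \<phi>"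
  shows "(LINT x|lebesgue_on (ball 0 1). pullback_coeff v g x * \<phi> x) = (LINT x|lborel. \<phi> x * jac (\<lambda>l y. w y $ g l) x)"
proof -
  have supp: "\<phi> x = 0" if "x \<notin> ball 0 1" for x
  proof -
    have "closure {x. \<phi> x \<noteq> 0} \<subseteq> ball 0 1" using \<phi> unfolding test_function_def by (elim conjE)
    then have "{x. \<phi> x \<noteq> 0} \<subseteq> ball 0 1" by (rule order_trans[OF closure_subset])
    then show ?thesis using that by auto
  qed
  have "Ck_on (Suc 0) UNIV \<phi>" using conjunct1[OF \<phi>[unfolded test_function_def]] by (simp only: smooth_on_def)
  then have c\<phi>: "continuous_on UNIV \<phi>" by (intro C1_continuous[OF Ck_Suc_C1])
  have eq: "pullback_coeff v g x * \<phi> x = \<phi> x * jac (\<lambda>l y. w y $ g l) x" for x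
  proof (cases "x \<in> ball 0 1")
    case True
    have "frechet_derivative v (at x) = frechet_derivative w (at x)"
      by (rule pd_cong_open[of "ball 0 1"]) (use True vw in auto)
    then show ?thesis by (simp add: pullback_coeff_def jac_def pd_component[OF w])
  qed (simp add: supp)
  have m: "(\<lambda>x. jac (\<lambda>l y. w y $ g l) x) \<in> borel_measurable borel"
    unfolding jac_def det_def
    by (intro borel_measurable_continuous_onI continuous_intros)
       (auto intro!: continuous_intros C1_deriv_continuous C1_component w)
  have "(\<lambda>x. \<phi> x * jac (\<lambda>l y. w y $ g l) x) \<in> borel_measurable borel"
    by (rule borel_measurable_times[OF borel_measurable_continuous_onI[OF c\<phi>] m])
  then show ?thesis unfolding eq by (intro integral_lebesgue_on ball_borel) (auto simp: supp)
qed

theorem theorem1p2: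
  fixes f :: "real^'n::{finite,linorder} \<Rightarrow> real^'m::{finite,linorder}"
    and s :: real
  assumes "CARD('n) \<ge> 2"
    and "\<exists>g. homeomorphism (sphere 0 1) (f ` sphere 0 1) f g"
    and "0 < s" and "s \<le> 1"
    and "s \<ge> real CARD('n) / (real CARD('n) + 1)"
  shows "\<not> (\<exists>u.
             u \<in> sobolev_space s (real CARD('n) / s) (ball 0 1) \<and>
             distributional_rank_less s (real CARD('n) / s) u \<and>
             has_trace s (real CARD('n) / s) u f)"
proof
  let ?n = "CARD('n)"
  define p where "p = real ?n / s"
  assume "\<exists>u. u \<in> sobolev_space s (real ?n / s) (ball 0 1) \<and>
             distributional_rank_less s (real ?n / s) u \<and> has_trace s (real ?n / s) u f"
  then obtain u where u: "u \<in> sobolev_space s p (ball 0 1)" and rank: "distributional_rank_less s p u"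
    and trace: "has_trace s p u f" unfolding p_def by blast
  have n0: "real ?n > 0" using assms(1) by linarith
  have pl: "real ?n \<le> p" using assms(3,4) n0 by (simp add: p_def field_simps)
  have pu: "p \<le> real ?n + 1"
    using assms(3,5) n0 by (simp add: p_def pos_divide_le_eq mult.commute)
  have p1: "p \<ge> 1" using pl assms(1) by linarith
  have sp: "s * p = real ?n" using assms(3) by (simp add: p_def)
  have s1: "s = 1 \<Longrightarrow> p = real ?n" by (simp add: p_def)
  obtain h where h: "homeomorphism (sphere 0 1) (f ` sphere 0 1) f h" using assms(2) by blast
  have f: "continuous_on (sphere 0 1) f" by (rule homeomorphism_cont1[OF h])
  obtain v where v: "\<And>k. smooth_up_to_boundary (ball 0 1) (v k)"
    and lim: "(\<lambda>k. sobolev_norm s p (ball 0 1) (\<lambda>x. v k x - u x)) \<longlonglongrightarrow> 0"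
    and tr: "(\<lambda>k. Lp_norm sphere_measure p (\<lambda>x. v k x - f x)) \<longlonglongrightarrow> 0"
    using trace unfolding has_trace_def by blast
  have "\<exists>w. C1 w \<and> (\<forall>x. norm x \<le> 1 \<longrightarrow> w x = v k x)" for k
  proof -
    show ?thesis
    proof (rule smooth_up_to_boundary_extension[OF v[of k]], goal_cases)
      case (1 w r)
      show ?case by (intro exI[of _ w] conjI allI impI 1(1) 1(3)) (use 1(2) in linarith)
    qed
  qed
  then obtain w where w: "\<And>k. C1 (w k)" and wv: "\<And>k x. norm x \<le> 1 \<Longrightarrow> w k x = v k x" by metis
  have wv': "w k x = v k x" if "norm x < 1" for k x by (rule wv) (use that in simp)
  note cau = sobolev_limit_cauchy[OF assms(1,3,4) sp s1 p1 w wv' u lim]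
  have dec: "osc_decay p w" by (rule osc_decay_if_cauchy[OF w pl cau(2)])
  have cv: "continuous_on (sphere 0 1) (v k)" for k
    by (rule continuous_on_eq[OF C1_continuous[OF w[of k]]]) (simp add: wv)
  have trl: "\<exists>K. \<forall>k\<ge>K. (\<integral>\<^sup>+x\<in>ball 0 1 - {0}. ennreal \<bar>w k (sgn x) $ i - f (sgn x) $ i\<bar> \<partial>lborel) \<le> ennreal e" if e: "e > 0" for i e
  proof -
    have "w k (sgn x) = v k (sgn x)" for k x by (rule wv) (simp add: norm_sgn)
    then show ?thesis
      using trace_limit[OF cv f radial_extension_measurable[OF cv] radial_extension_measurable[OF f] p1 tr e, of i] by simp
  qed
  have rk: "(\<lambda>k. LINT x|lborel. \<phi> x * jac (\<lambda>l y. w k y $ g l) x) \<longlonglongrightarrow> 0" if \<phi>: "test_function (ball 0 1) \<phi>" for g \<phi>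
  proof (rule integral_jac_tendsto_0_all_indices[OF w])
    fix g' :: "'n \<Rightarrow> 'm" assume g': "strict_mono g'"
    show "(\<lambda>k. LINT x|lborel. \<phi> x * jac (\<lambda>l y. w k y $ g' l) x) \<longlonglongrightarrow> 0"
      using rank_limit_along_sequence[OF rank g' \<phi> v lim] integral_pullback_coeff[OF w wv' \<phi>] by simp
  qed
  show False
  proof (rule no_rank_deficient_approximation[OF assms(1) pl pu w dec cau(1) trl rk f radial_extension_measurable[OF f]
        homeomorphism_cont2[OF h]])
    show "h (f x) = x" if "norm x = 1" for x by (rule homeomorphism_apply1[OF h]) (use that in simp)
  qed
qed

end
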